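(* Let $f\in\mathcal{B}$. (i) If $\gamma$ is a fixed ray of $f$ such that $f\colon\overline{\gamma}\to\overline{\gamma}$ is a homeomorphism and the accumulation set of $\gamma$ does not contain any critical points of $f$, then $\gamma$ lands at a repelling or parabolic fixed point of $f$. (ii) Similarly, if $S(f)\subset J(f)$ and $\gamma$ is a fixed ray of $f$ whose accumulation set does not intersect $S(f)$, then $\gamma$ lands at a repelling or parabolic fixed point of $f$.
   Context: All closures are taken in $\mathbb{C}$. For an entire function $f$, $J(f)$ denotes the Julia set; $\operatorname{sing}(f^{-1})$ consists of all finite critical values and finite asymptotic values of $f$, and $S(f):=\overline{\operatorname{sing}(f^{-1})}$ is the set of singular values. The Eremenko-Lyubich class $\mathcal{B}$ is the set of all transcendental entire functions $f\colon\mathbb{C}\to\mathbb{C}$ for which $S(f)$ is bounded. A fixed ray of $f$ is a (continuous) curve $\gamma\colon(-\infty,\infty)\to\mathbb{C}$ with $\lim_{t\to+\infty}|\gamma(t)|=\infty$ and $f(\gamma(t))=\gamma(t+1)$ for all $t$; $\overline{\gamma}$ denotes the closure of its image. The accumulation set of $\gamma$ is the set of all $z\in\mathbb{C}$ for which there are $t_n\to-\infty$ with $\gamma(t_n)\to z$. The ray $\gamma$ lands at $z_0\in\mathbb{C}\cup\{\infty\}$ if $\lim_{t\to-\infty}\gamma(t)=z_0$. A fixed point $z_0\in\mathbb{C}$ of $f$ is repelling if $|f'(z_0)|>1$ and parabolic if $f'(z_0)$ is a root of unity. *)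

theory Defs
  imports "HOL-Complex_Analysis.Complex_Analysis"
begin

definition transcendental_entire :: "(complex \<Rightarrow> complex) \<Rightarrow> bool" where
  "transcendental_entire f \<longleftrightarrow> f holomorphic_on UNIV \<and> (\<nexists>p. \<forall>z. f z = poly p z)"


text \<open>
  Normality in the sense of Montel. The constant limit \<open>\<infinity>\<close> is admitted, as the second disjunct;
  on a connected open set, any locally uniform limit in the spherical metric of holomorphic
  functions is either holomorphic or identically \<open>\<infinity>\<close>.
\<close>

definition normal_family_on :: "complex set \<Rightarrow> (complex \<Rightarrow> complex) set \<Rightarrow> bool" where
  "normal_family_on U \<F> \<longleftrightarrow>
     (\<forall>h :: nat \<Rightarrow> complex \<Rightarrow> complex. range h \<subseteq> \<F> \<longrightarrow>
       (\<exists>r :: nat \<Rightarrow> nat. strict_mono r \<and>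
         ((\<exists>g. g holomorphic_on U \<and>
             (\<forall>K. compact K \<and> K \<subseteq> U \<longrightarrow> uniform_limit K (\<lambda>n. h (r n)) g sequentially)) \<or>
          (\<forall>K. compact K \<and> K \<subseteq> U \<longrightarrow>
             (\<forall>R. \<forall>\<^sub>F n in sequentially. \<forall>z\<in>K. R < norm (h (r n) z))))))"

definition fatou_set :: "(complex \<Rightarrow> complex) \<Rightarrow> complex set" where
  "fatou_set f = {z. \<exists>U. open U \<and> connected U \<and> z \<in> U \<and> normal_family_on U (range (\<lambda>n. f ^^ n))}"

definition julia_set :: "(complex \<Rightarrow> complex) \<Rightarrow> complex set" where
  "julia_set f = - fatou_set f"


definition critical_point :: "(complex \<Rightarrow> complex) \<Rightarrow> complex \<Rightarrow> bool" where
  "critical_point f z \<longleftrightarrow> deriv f z = 0"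

definition critical_values :: "(complex \<Rightarrow> complex) \<Rightarrow> complex set" where
  "critical_values f = f ` {z. critical_point f z}"

definition asymptotic_values :: "(complex \<Rightarrow> complex) \<Rightarrow> complex set" where
  "asymptotic_values f =
     {a. \<exists>c :: real \<Rightarrow> complex. continuous_on {0..} c \<and> filterlim c at_infinity at_top \<and>
           ((\<lambda>t. f (c t)) \<longlongrightarrow> a) at_top}"

definition singular_values :: "(complex \<Rightarrow> complex) \<Rightarrow> complex set" where
  "singular_values f = closure (critical_values f \<union> asymptotic_values f)"

definition eremenko_lyubich_class :: "(complex \<Rightarrow> complex) set" where
  "eremenko_lyubich_class = {f. transcendental_entire f \<and> bounded (singular_values f)}"


definition fixed_ray :: "(complex \<Rightarrow> complex) \<Rightarrow> (real \<Rightarrow> complex) \<Rightarrow> bool" where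
  "fixed_ray f \<gamma> \<longleftrightarrow>
     continuous_on UNIV \<gamma> \<and> filterlim (\<lambda>t. norm (\<gamma> t)) at_top at_top \<and>
     (\<forall>t. f (\<gamma> t) = \<gamma> (t + 1))"

definition accumulation_set :: "(real \<Rightarrow> complex) \<Rightarrow> complex set" where
  "accumulation_set \<gamma> =
     {z. \<exists>t :: nat \<Rightarrow> real. filterlim t at_bot sequentially \<and> (\<lambda>n. \<gamma> (t n)) \<longlonglongrightarrow> z}"

definition lands_at :: "(real \<Rightarrow> complex) \<Rightarrow> complex \<Rightarrow> bool" where
  "lands_at \<gamma> z\<^sub>0 \<longleftrightarrow> (\<gamma> \<longlongrightarrow> z\<^sub>0) at_bot"


definition repelling_fixed_point :: "(complex \<Rightarrow> complex) \<Rightarrow> complex \<Rightarrow> bool" where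
  "repelling_fixed_point f z\<^sub>0 \<longleftrightarrow> f z\<^sub>0 = z\<^sub>0 \<and> norm (deriv f z\<^sub>0) > 1"

definition parabolic_fixed_point :: "(complex \<Rightarrow> complex) \<Rightarrow> complex \<Rightarrow> bool" where
  "parabolic_fixed_point f z\<^sub>0 \<longleftrightarrow> f z\<^sub>0 = z\<^sub>0 \<and> (\<exists>n>0. deriv f z\<^sub>0 ^ n = 1)"

end

theory Submission imports Defs "HOL-Real_Asymp.Real_Asymp"
begin

text \<open>
  Let \<open>A\<close> be the accumulation set of the ray. Both parts reduce to a holomorphic branch \<open>g\<close> of the
  inverse of \<open>f\<close> near \<open>A\<close> with \<open>g A \<subseteq> A\<close> and \<open>g (\<gamma> t) = \<gamma> (t - 1)\<close> for \<open>t\<close> near \<open>- \<infinity>\<close>.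

  Suppose that \<open>A\<close> has two points. A Riemann map of the exterior of \<open>A\<close>, composed with an exponential,
  lifts \<open>g\<close> to a map of a strip above the real axis, and Schwarz reflection extends it to an increasing
  lift of a circle map of degree one. If this has a fixed point, local dynamics there, and otherwise the
  ray and its translates as barriers, give an open set that contains the image of a unit interval under the
  ray and on which all \<open>g ^^ n\<close> are defined and bounded. The iterates avoid \<open>A\<close> there, while their limits take values in \<open>A\<close> along the ray; by
  Hurwitz's theorem these limits are constant, so \<open>\<gamma> t\<close> and \<open>\<gamma> (t + 1)\<close> become close and \<open>A\<close> consists of fixed points of \<open>f\<close>, which is absurd. Hence \<open>A\<close> is a
  point; it is not attracting, and the barrier argument at this point excludes multipliers on the unit
  circle other than 1.

  In part (ii), the growth of the iterates near the Julia set prevents a loop made of a ray arc and a curve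
  in a slow set \<open>{z. norm ((f ^^ q) z) \<le> R}\<close> from surrounding a singular value, as the maximum principle shows.
  Suppose that \<open>\<gamma> (s k)\<close> converges and \<open>\<gamma> (s k - 1)\<close> tends to infinity. Ray arcs from \<open>s k\<close> to \<open>s l\<close> are closed
  up near the limit. If the loop might surround singular values, both ends of the arc are joined inside one of
  finitely many components of a slow set. The winding numbers of the resulting Jordan curves about finitely
  many centres form a cocycle with values in \<open>{- 1, 0, 1}\<close>, so for infinitely many \<open>l\<close> they vanish and the
  inverse branches agree: a contradiction. Expansion in logarithmic coordinates then makes the ray bounded
  near \<open>- \<infinity>\<close>, and \<open>A\<close> surrounds no singular value.
\<close>

section \<open>Lifting off the singular values\<close>

text \<open>The first obstacle is that \<open>f\<close> is not proper:
  \<open>\<gamma> (t + 1)\<close> may stay bounded while \<open>\<gamma> t\<close> is large, so the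
  ray need not be bounded near \<open>- \<infinity>\<close>. Properness along the ray is therefore
  established first. In part (i) it is continuity of the inverse homeomorphism on compact sets; in
  part (ii) it is the purpose of the whole loop argument. Class B then turns properness into
  boundedness, because \<open>f\<close> expands logarithmic coordinates by a factor 2 deep in its
  tracts.

  The second obstacle is rotation. A circle map without fixed points, or a multiplier on the unit
  circle other than 1, could a priori make points near the boundary leave under iteration. The ray
  excludes this topologically: the image of a short vertical segment that climbs through the strip
  meets a translate of the lifted ray, and pulling the crossing back puts a point of the segment on
  a stretch of that translate which lies strictly to one side of it. At a fixed point of the circle
  map no rotation occurs, since reflection makes its multiplier real and nonnegative.\<close>

lemma holomorphic_glue:
  fixes g :: "'i \<Rightarrow> complex \<Rightarrow> complex"
  assumes "\<And>i. i \<in> I \<Longrightarrow> open (U i)" "\<And>i. i \<in> I \<Longrightarrow> g i holomorphic_on U i"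
    and "\<And>i j x. \<lbrakk>i \<in> I; j \<in> I; x \<in> U i; x \<in> U j\<rbrakk> \<Longrightarrow> g i x = g j x"
  obtains G where "G holomorphic_on (\<Union>i\<in>I. U i)" "\<And>i x. \<lbrakk>i \<in> I; x \<in> U i\<rbrakk> \<Longrightarrow> G x = g i x"
proof -
  define G where "G x = g (SOME i. i \<in> I \<and> x \<in> U i) x" for x
  have G: "G x = g i x" if "i \<in> I" "x \<in> U i" for i x
  proof -
    have "(SOME i. i \<in> I \<and> x \<in> U i) \<in> I \<and> x \<in> U (SOME i. i \<in> I \<and> x \<in> U i)"
      using someI[of "\<lambda>i. i \<in> I \<and> x \<in> U i" i] that by blast
    then show ?thesis unfolding G_def using assms(3) that by blast
  qed
  have "G holomorphic_on (\<Union>i\<in>I. U i)"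
  proof (rule holomorphic_on_UN_open)
    fix i assume i: "i \<in> I"
    show "G holomorphic_on U i"
      using assms(2)[OF i] by (rule holomorphic_transform) (simp add: G[OF i])
  qed (use assms in auto)
  then show thesis using G that by blast
qed

text \<open>The coincidence set is closed by continuity and open by local injectivity of
  \<open>f\<close>. The domain type is general so that the lemma serves for branches on plane sets,
  for time intervals of the ray, and, with \<open>exp\<close> in place of \<open>f\<close>, for
  logarithms.\<close>

lemma lift_unique:
  fixes g1 g2 :: "'a::topological_space \<Rightarrow> complex"
  assumes hol: "f holomorphic_on UNIV" and T: "connected T" "a \<in> T"
    and c: "continuous_on T g1" "continuous_on T g2"
    and eq: "\<And>x. x \<in> T \<Longrightarrow> f (g1 x) = f (g2 x)" and d: "\<And>x. x \<in> T \<Longrightarrow> deriv f (g1 x) \<noteq> 0"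
    and a: "g1 a = g2 a" and x: "x \<in> T"
  shows "g1 x = g2 x"
proof -
  let ?E = "{x \<in> T. g1 x = g2 x}"
  have "closedin (top_of_set T) ?E"
    using continuous_closedin_preimage_constant[of T "\<lambda>x. g1 x - g2 x" 0] c
    by (auto intro!: continuous_intros simp: vimage_def Int_def)
  moreover have "openin (top_of_set T) ?E"
  proof (subst openin_subopen, intro ballI)
    fix y assume y: "y \<in> ?E"
    then obtain r where r: "r > 0" "inj_on f (ball (g1 y) r)"
      using has_complex_derivative_locally_injective[OF hol _ _ d[of y]] by auto
    let ?W = "(T \<inter> g1 -` ball (g1 y) r) \<inter> (T \<inter> g2 -` ball (g1 y) r)"
    have "openin (top_of_set T) ?W"
      by (intro openin_Int continuous_openin_preimage_gen c open_ball)
    moreover have "y \<in> ?W" using y r by auto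
    moreover have "?W \<subseteq> ?E" using r eq by (auto simp: inj_on_def)
    ultimately show "\<exists>T'. openin (top_of_set T) T' \<and> y \<in> T' \<and> T' \<subseteq> ?E" by blast
  qed
  ultimately have "?E = {} \<or> ?E = T" using T(1) unfolding connected_clopen by blast
  then show ?thesis using T a x by blast
qed

lemma local_inverse:
  assumes hol: "f holomorphic_on UNIV" and d: "deriv f z \<noteq> 0"
  obtains r e g where "r > 0" "e > 0" "g holomorphic_on ball (f z) e" "g (f z) = z"
    "\<And>w. w \<in> ball (f z) e \<Longrightarrow> f (g w) = w \<and> g w \<in> ball z r"
    "\<And>z'. z' \<in> ball z r \<Longrightarrow> g (f z') = z'" "inj_on f (ball z r)"
proof -
  obtain r where r: "r > 0" "inj_on f (ball z r)"
    using has_complex_derivative_locally_injective[OF hol _ _ d] by auto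
  have holr: "f holomorphic_on ball z r" using hol by (rule holomorphic_on_subset) auto
  obtain g where g: "g holomorphic_on f ` ball z r" "\<And>x. x \<in> ball z r \<Longrightarrow> g (f x) = x"
    using holomorphic_has_inverse[OF holr open_ball r(2)] by metis
  have "open (f ` ball z r)"
    using open_mapping_thm3[OF holr open_ball r(2)] .
  moreover have "f z \<in> f ` ball z r" using r by auto
  ultimately obtain e where e: "e > 0" "ball (f z) e \<subseteq> f ` ball z r"
    using open_contains_ball by blast
  show thesis
  proof
    show "g holomorphic_on ball (f z) e" using g(1) e(2) holomorphic_on_subset by blast
    show "f (g w) = w \<and> g w \<in> ball z r" if "w \<in> ball (f z) e" for w
      using that e(2) g(2) by auto
  qed (use r e g in auto)
qed

text \<open>Radial continuation. Let \<open>R\<close> be the supremum of the radii reached. If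
  \<open>R < r\<close>, then at a point \<open>b\<close> of the sphere of radius \<open>R\<close>
  the branch along the radius cannot tend to infinity, since \<open>b\<close> is no asymptotic
  value, so it has a finite limit point over \<open>b\<close>. That point is not critical, and the
  local inverse there extends the branch across \<open>b\<close>. Compactness of the sphere then
  contradicts the choice of \<open>R\<close>.\<close>

lemma inverse_branch_ball:
  assumes hol: "f holomorphic_on UNIV" and r: "r > 0"
    and disj: "ball w0 r \<inter> (critical_values f \<union> asymptotic_values f) = {}" and z0: "f z0 = w0"
  obtains g where "g holomorphic_on ball w0 r" "g w0 = z0" "\<And>w. w \<in> ball w0 r \<Longrightarrow> f (g w) = w"
proof -
  have dnz: "deriv f z \<noteq> 0" if "f z \<in> ball w0 r" for z
    using that disj by (auto simp: critical_values_def critical_point_def)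
  define P where "P g \<rho> \<longleftrightarrow> g holomorphic_on ball w0 \<rho> \<and> g w0 = z0 \<and> (\<forall>w \<in> ball w0 \<rho>. f (g w) = w)" for g \<rho>
  have uniq: "g1 w = g2 w" if U: "connected U" "U \<subseteq> ball w0 r" "a \<in> U" "g1 a = g2 a" "w \<in> U"
    and "g1 holomorphic_on U" "g2 holomorphic_on U" "\<forall>w\<in>U. f (g1 w) = w" "\<forall>w\<in>U. f (g2 w) = w" for U a g1 g2 w
    by (rule lift_unique[where T=U and a=a and f=f, OF hol])
      (use that dnz in \<open>auto simp: holomorphic_on_imp_continuous_on subset_iff\<close>)
  define M where "M = {\<rho>. 0 < \<rho> \<and> \<rho> \<le> r \<and> (\<exists>g. P g \<rho>)}"
  obtain s0 where s0: "s0 \<in> M"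
  proof -
    have "deriv f z0 \<noteq> 0" using dnz z0 r by auto
    then obtain s e g where "e > 0" "g holomorphic_on ball (f z0) e" "g (f z0) = z0"
      "\<And>w. w \<in> ball (f z0) e \<Longrightarrow> f (g w) = w \<and> g w \<in> ball z0 s"
      using local_inverse[OF hol] by metis
    then have "P g (min e r)" unfolding P_def using z0
        holomorphic_on_subset[of g "ball w0 e" "ball w0 (min e r)"] by auto
    then have "min e r \<in> M" unfolding M_def using \<open>e > 0\<close> r by auto
    then show thesis using that by blast
  qed
  have bdd: "bdd_above M" unfolding M_def by (auto intro: bdd_aboveI)
  define R where "R = Sup M"
  have Rpos: "R > 0" using cSup_upper[OF s0 bdd] s0 unfolding R_def M_def by auto
  have Rr: "R \<le> r" unfolding R_def by (rule cSup_least) (use s0 in \<open>auto simp: M_def\<close>)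
  obtain gg where gg: "\<And>\<rho>. \<rho> \<in> M \<Longrightarrow> P (gg \<rho>) \<rho>"
    using bchoice[of M "\<lambda>\<rho> g. P g \<rho>"] unfolding M_def by blast
  have un: "(\<Union>\<rho>\<in>M. ball w0 \<rho>) = ball w0 R"
  proof (intro equalityI subsetI)
    fix x assume "x \<in> ball w0 R"
    then obtain \<rho> where "\<rho> \<in> M" "dist w0 x < \<rho>" using less_cSup_iff[OF _ bdd] s0 unfolding R_def by auto
    then show "x \<in> (\<Union>\<rho>\<in>M. ball w0 \<rho>)" by auto
  next
    fix x assume "x \<in> (\<Union>\<rho>\<in>M. ball w0 \<rho>)"
    then obtain \<rho> where "\<rho> \<in> M" "dist w0 x < \<rho>" by auto
    then show "x \<in> ball w0 R" using cSup_upper[OF _ bdd, of \<rho>] unfolding R_def by auto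
  qed
  have agree: "gg i x = gg j x" if "i \<in> M" "j \<in> M" "x \<in> ball w0 i" "x \<in> ball w0 j" for i j x
  proof (rule uniq[of "ball w0 (min i j)" w0 "gg i" "gg j" x])
    show "gg i holomorphic_on ball w0 (min i j)" "gg j holomorphic_on ball w0 (min i j)"
      using gg[OF that(1)] gg[OF that(2)] holomorphic_on_subset[of _ _ "ball w0 (min i j)"] unfolding P_def
      by (meson min.cobounded1 min.cobounded2 subset_ball)+
  qed (use that gg[OF that(1)] gg[OF that(2)] in \<open>auto simp: P_def M_def\<close>)
  obtain g where g: "g holomorphic_on (\<Union>\<rho>\<in>M. ball w0 \<rho>)" "\<And>i x. \<lbrakk>i \<in> M; x \<in> ball w0 i\<rbrakk> \<Longrightarrow> g x = gg i x"
  proof (rule holomorphic_glue[of M "\<lambda>\<rho>. ball w0 \<rho>" gg])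
    show "gg i holomorphic_on ball w0 i" if "i \<in> M" for i using gg[OF that] by (simp add: P_def)
  qed (auto intro: agree)
  have PR: "P g R"
  proof -
    have "g w0 = gg s0 w0" using g(2)[OF s0, of w0] s0 by (simp add: M_def)
    then have "g w0 = z0" using gg[OF s0] by (simp add: P_def)
    moreover have "f (g w) = w" if "w \<in> ball w0 R" for w
    proof -
      obtain \<rho> where \<rho>: "\<rho> \<in> M" "w \<in> ball w0 \<rho>" using \<open>w \<in> ball w0 R\<close> un by blast
      then show ?thesis using g(2)[OF \<rho>] gg[OF \<rho>(1)] by (simp add: P_def)
    qed
    ultimately show ?thesis using g(1) unfolding un P_def by blast
  qed
  have "R = r"
  proof (rule ccontr)
    assume "R \<noteq> r"
    then have lt: "R < r" using Rr by simp
    have bd: "\<exists>d h. d > 0 \<and> h holomorphic_on ball b d \<and> (\<forall>w\<in>ball b d. f (h w) = w) \<and> ball b d \<subseteq> ball w0 r \<and>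
        (\<forall>w \<in> ball b d \<inter> ball w0 R. h w = g w)" if b: "b \<in> sphere w0 R" for b
    proof -
      have b_in: "b \<in> ball w0 r" using b lt by auto
      \<comment> \<open>The radius to \<open>b\<close>, run through in infinite time because
        \<open>asymptotic_values\<close> is defined by curves on a half-line.\<close>
      define p where "p x = w0 + of_real (1 - 1 / (x + 1)) * (b - w0)" for x::real
      have pin: "p x \<in> ball w0 R" if "x \<ge> 0" for x
      proof -
        have "dist w0 (p x) = \<bar>1 - 1/(x+1)\<bar> * R"
        proof -
          have "dist w0 (p x) = norm (complex_of_real (1 - 1/(x+1)) * (b - w0))"
            unfolding p_def dist_norm by (simp only: norm_minus_commute[of w0] add_diff_cancel_left')
          then show ?thesis unfolding norm_mult norm_of_real using b by (simp add: dist_norm norm_minus_commute)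
        qed
        also have "\<bar>1 - 1/(x+1)\<bar> < 1" using that by (auto simp: abs_if field_simps)
        then have "\<bar>1 - 1/(x+1)\<bar> * R < 1 * R" using Rpos by (intro mult_strict_right_mono)
        finally show ?thesis by simp
      qed
      have plim: "(p \<longlongrightarrow> b) at_top"
      proof -
        have "((\<lambda>x::real. 1 / (x+1)) \<longlongrightarrow> 0) at_top" by real_asymp
        then have "(p \<longlongrightarrow> w0 + of_real (1 - 0) * (b - w0)) at_top" unfolding p_def
          by (intro tendsto_intros)
        then show ?thesis by simp
      qed
      have fgp: "f (g (p x)) = p x" if "x \<ge> 0" for x using PR pin[OF that] by (auto simp: P_def)
      have "\<not> filterlim (\<lambda>x. g (p x)) at_infinity at_top"
      proof
        assume inf: "filterlim (\<lambda>x. g (p x)) at_infinity at_top"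
        have "continuous_on {0..} (\<lambda>x. g (p x))"
        proof (rule continuous_on_compose2[of "ball w0 R" g])
          show "continuous_on (ball w0 R) g" using PR by (auto simp: P_def holomorphic_on_imp_continuous_on)
          show "continuous_on {0..} p" unfolding p_def by (intro continuous_intros) auto
        qed (use pin in auto)
        moreover have "((\<lambda>x. f (g (p x))) \<longlongrightarrow> b) at_top"
          using plim by (rule Lim_transform_eventually) (rule eventually_mono[OF eventually_ge_at_top[of 0]], simp add: fgp)
        ultimately have "b \<in> asymptotic_values f"
          unfolding asymptotic_values_def using inf by blast
        then show False using disj b_in by blast
      qed
      then obtain B where B: "\<not> (\<forall>\<^sub>F x in at_top. B \<le> norm (g (p x)))"
        unfolding filterlim_at_infinity[OF order_refl, of "\<lambda>x. g (p x)" at_top] by blast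
      have "\<exists>x \<ge> real n. norm (g (p x)) \<le> B" for n
        using B unfolding eventually_at_top_linorder by (meson linear nle_le)
      then obtain xs where xs: "\<And>n. xs n \<ge> real n" "\<And>n. norm (g (p (xs n))) \<le> B" by metis
      have "compact (cball 0 B :: complex set)" by simp
      then obtain z \<sigma> where z: "strict_mono \<sigma>" "((\<lambda>n. g (p (xs n))) \<circ> \<sigma>) \<longlonglongrightarrow> z"
        using xs(2) unfolding compact_def by (metis mem_cball_0)
      have xslim: "filterlim (\<lambda>n. xs (\<sigma> n)) at_top sequentially"
      proof (rule filterlim_at_top_mono[OF filterlim_real_sequentially])
        show "\<forall>\<^sub>F n in sequentially. real n \<le> xs (\<sigma> n)"
          using xs(1) strict_mono_imp_increasing[OF z(1)] by (intro always_eventually) (meson of_nat_mono order_trans)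
      qed
      have l1: "(\<lambda>n. p (xs (\<sigma> n))) \<longlonglongrightarrow> b" using filterlim_compose[OF plim xslim] .
      have "(\<lambda>n. f (g (p (xs (\<sigma> n))))) \<longlonglongrightarrow> f z"
      proof -
        have "isCont f z" using hol holomorphic_on_imp_continuous_on continuous_on_eq_continuous_at by blast
        from isCont_tendsto_compose[OF this z(2)] show ?thesis by (simp add: o_def)
      qed
      moreover have "(\<lambda>n. f (g (p (xs (\<sigma> n))))) = (\<lambda>n. p (xs (\<sigma> n)))"
        using fgp xs(1) by (metis of_nat_0_le_iff order_trans)
      ultimately have fz: "f z = b" using l1 LIMSEQ_unique by metis
      then have "deriv f z \<noteq> 0" using dnz b_in by auto
      then obtain \<rho> e h where h: "\<rho> > 0" "e > 0" "h holomorphic_on ball b e" "h b = z"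
        "\<And>w. w \<in> ball b e \<Longrightarrow> f (h w) = w \<and> h w \<in> ball z \<rho>" "\<And>z'. z' \<in> ball z \<rho> \<Longrightarrow> h (f z') = z'"
        using local_inverse[OF hol] fz by metis
      obtain e' where e': "e' > 0" "ball b e' \<subseteq> ball w0 r" using b_in open_contains_ball by blast
      define d where "d = min e e'"
      have "\<forall>\<^sub>F n in sequentially. g (p (xs (\<sigma> n))) \<in> ball z \<rho>"
        using z(2) h(1) by (auto simp: o_def dist_commute dest: tendstoD)
      moreover have "\<forall>\<^sub>F n in sequentially. p (xs (\<sigma> n)) \<in> ball b d"
        using l1 h(2) e'(1) unfolding d_def mem_ball dist_commute[of b] by (intro tendstoD) auto
      ultimately obtain n where n: "g (p (xs (\<sigma> n))) \<in> ball z \<rho>" "p (xs (\<sigma> n)) \<in> ball b d"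
        using eventually_happens[OF eventually_conj, of _ sequentially] by (auto simp: trivial_limit_sequentially)
      have nn: "xs (\<sigma> n) \<ge> 0" using xs(1) of_nat_0_le_iff order_trans by blast
      have "h w = g w" if w: "w \<in> ball b d \<inter> ball w0 R" for w
      proof (rule uniq[of "ball b d \<inter> ball w0 R" "p (xs (\<sigma> n))" h g w])
        show "h (p (xs (\<sigma> n))) = g (p (xs (\<sigma> n)))" using h(6)[OF n(1)] fgp[OF nn] by simp
        show "connected (ball b d \<inter> ball w0 R)" by (intro convex_connected convex_Int convex_ball)
        show "h holomorphic_on ball b d \<inter> ball w0 R" using h(3) by (rule holomorphic_on_subset) (auto simp: d_def)
        show "g holomorphic_on ball b d \<inter> ball w0 R" using PR unfolding P_def by (meson holomorphic_on_subset inf_le2)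
      qed (use w n(2) pin[OF nn] h(5) PR Rr e' in \<open>auto simp: P_def d_def\<close>)
      moreover have "h holomorphic_on ball b d" using h(3) by (rule holomorphic_on_subset) (auto simp: d_def)
      ultimately show ?thesis using h(2,5) e' unfolding d_def
        by (intro exI[of _ "min e e'"] exI[of _ h]) auto
    qed
    obtain d h where dh: "\<And>b. b \<in> sphere w0 R \<Longrightarrow> d b > 0 \<and> h b holomorphic_on ball b (d b) \<and>
        (\<forall>w\<in>ball b (d b). f (h b w) = w) \<and> ball b (d b) \<subseteq> ball w0 r \<and> (\<forall>w \<in> ball b (d b) \<inter> ball w0 R. h b w = g w)"
      using bd by metis
    \<comment> \<open>The centre \<open>w0\<close> doubles as the index of the open ball on which
      the branch is already known.\<close>
    define I where "I = insert w0 (sphere w0 R)"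
    define U where "U i = (if i = w0 then ball w0 R else ball i (d i))" for i
    define k where "k i = (if i = w0 then g else h i)" for i
    have w0: "w0 \<notin> sphere w0 R" using Rpos by auto
    have kU: "open (U i)" "k i holomorphic_on U i" "\<forall>w\<in>U i. f (k i w) = w" "U i \<subseteq> ball w0 r" if "i \<in> I" for i
      using that dh[of i] PR Rr unfolding I_def U_def k_def P_def by auto
    have kg: "k i w = g w" if "i \<in> I" "w \<in> U i" "w \<in> ball w0 R" for i w
      using that dh unfolding I_def U_def k_def by (auto split: if_splits)
    have kk: "k i x = k j x" if ij: "i \<in> I" "j \<in> I" "x \<in> U i" "x \<in> U j" for i j x
    proof (cases "i = j \<or> x \<in> ball w0 R")
      case True then show ?thesis using kg ij by auto
    next
      case False
      then have ne: "i \<noteq> j" "i \<in> sphere w0 R" "j \<in> sphere w0 R" "i \<noteq> w0" "j \<noteq> w0"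
        using ij w0 unfolding I_def U_def by auto
      have dd: "d i > 0" "d j > 0" using dh ne by auto
      have lt2: "dist i j < d i + d j"
        using ij ne unfolding U_def by (auto intro: le_less_trans[OF dist_triangle2[of i j x]] simp: dist_commute)
      define D where "D = dist i j"
      have Dpos: "D > 0" using ne unfolding D_def by auto
      \<comment> \<open>Two boundary balls that overlap share the point dividing the segment between
        their centres in the ratio of the radii. It lies on an open chord of the sphere, hence in
        \<open>ball w0 R\<close>, where both extensions equal \<open>g\<close>.\<close>
      define u where "u = d i / (d i + d j)"
      have u: "0 < u" "u < 1" "u * (d i + d j) = d i" "(1-u) * (d i + d j) = d j"
        using dd unfolding u_def by (auto simp: field_simps)
      define a where "a = (1 - u) *\<^sub>R i + u *\<^sub>R j"
      have ai: "i - a = u *\<^sub>R (i - j)" unfolding a_def by (simp add: algebra_simps)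
      have aj: "j - a = (1-u) *\<^sub>R (j - i)" unfolding a_def by (simp add: algebra_simps)
      have "dist i a = u * D" unfolding dist_norm ai D_def using u by simp
      also have "\<dots> < u * (d i + d j)" using lt2 u unfolding D_def by (intro mult_strict_left_mono) auto
      finally have 1: "a \<in> ball i (d i)" using u by simp
      have "dist j a = (1-u) * D" unfolding dist_norm aj D_def using u by (simp add: norm_minus_commute)
      also have "\<dots> < (1-u) * (d i + d j)" using lt2 u unfolding D_def by (intro mult_strict_left_mono) auto
      finally have 2: "a \<in> ball j (d j)" using u by simp
      have "a \<in> open_segment i j" unfolding in_segment a_def using ne u by auto
      then have 3: "a \<in> ball w0 R"
        using ne dist_decreases_open_segment[of a i j w0] by (auto simp: dist_commute)
      show ?thesis
      proof (rule uniq[of "U i \<inter> U j" a "k i" "k j" x])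
        show "connected (U i \<inter> U j)" unfolding U_def using ne by (auto intro!: convex_connected convex_Int)
        show "k i holomorphic_on U i \<inter> U j" "k j holomorphic_on U i \<inter> U j"
          using kU ij holomorphic_on_subset by (meson inf_le1 inf_le2)+
        show "k i a = k j a" using kg[of i a] kg[of j a] 1 2 3 ij ne unfolding U_def by auto
        show "U i \<inter> U j \<subseteq> ball w0 r" using kU(4)[OF ij(1)] by blast
        show "\<forall>w\<in>U i \<inter> U j. f (k i w) = w" "\<forall>w\<in>U i \<inter> U j. f (k j w) = w"
          using kU(3)[OF ij(1)] kU(3)[OF ij(2)] by blast+
      qed (use 1 2 ne ij in \<open>auto simp: U_def\<close>)
    qed
    obtain G where G: "G holomorphic_on (\<Union>i\<in>I. U i)" "\<And>i x. \<lbrakk>i \<in> I; x \<in> U i\<rbrakk> \<Longrightarrow> G x = k i x"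
      using holomorphic_glue[of I U k] kU kk by metis
    have opU: "open (\<Union>i\<in>I. U i)" using kU(1) by blast
    have "cball w0 R \<subseteq> (\<Union>i\<in>I. U i)"
    proof
      fix x assume x: "x \<in> cball w0 R"
      show "x \<in> (\<Union>i\<in>I. U i)"
      proof (cases "dist w0 x < R")
        case True then show ?thesis unfolding I_def U_def by auto
      next
        case False
        then have "x \<in> sphere w0 R" using x by auto
        moreover from this have "x \<in> U x" using dh[of x] w0 unfolding U_def by auto
        ultimately show ?thesis unfolding I_def by blast
      qed
    qed
    then obtain \<delta> where \<delta>: "\<delta> > 0" "\<And>x. x \<in> cball w0 R \<Longrightarrow> ball x \<delta> \<subseteq> (\<Union>i\<in>I. U i)"
      using compact_subset_open_imp_ball_epsilon_subset[OF compact_cball opU]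
      by (metis (no_types, lifting) UN_subset_iff)
    have sub: "ball w0 (R + \<delta>) \<subseteq> (\<Union>i\<in>I. U i)"
    proof
      fix x assume x: "x \<in> ball w0 (R + \<delta>)"
      show "x \<in> (\<Union>i\<in>I. U i)"
      proof (cases "x \<in> cball w0 R")
        case True then show ?thesis using \<delta>(2)[OF True] \<delta>(1) by (meson centre_in_ball subsetD)
      next
        case False
        then have D: "dist w0 x > R" by auto
        define y where "y = w0 + (R / dist w0 x) *\<^sub>R (x - w0)"
        have ne: "norm (w0 - x) > 0" "norm (x - w0) = norm (w0 - x)"
          using D Rpos by (auto simp: dist_norm norm_minus_commute)
        have dy: "dist w0 y = R" using D Rpos ne(1) unfolding y_def dist_norm by (simp add: ne(2))
        have xy: "x - y = (1 - R / dist w0 x) *\<^sub>R (x - w0)" unfolding y_def by (simp add: algebra_simps)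
        have "dist y x = norm ((1 - R / dist w0 x) *\<^sub>R (x - w0))"
          unfolding dist_norm[of y] norm_minus_commute[of y] xy ..
        also have "\<dots> = (1 - R / dist w0 x) * dist w0 x"
          using D Rpos ne by (simp add: dist_norm abs_if)
        also have "\<dots> = dist w0 x - R" using D Rpos ne by (simp add: dist_norm field_simps)
        finally have "dist y x = dist w0 x - R" .
        then have "dist y x < \<delta>" using x by simp
        then show ?thesis using \<delta>(2)[of y] dy by auto
      qed
    qed
    define q where "q = min r (R + \<delta>)"
    have "P G q" unfolding P_def
    proof (intro conjI ballI)
      show "G holomorphic_on ball w0 q" using G(1) by (rule holomorphic_on_subset) (use sub in \<open>auto simp: q_def\<close>)
      show "G w0 = z0" using G(2)[of w0 w0] PR Rpos unfolding I_def U_def k_def P_def by auto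
      fix w assume "w \<in> ball w0 q"
      then obtain i where "i \<in> I" "w \<in> U i" using sub unfolding q_def by auto
      then show "f (G w) = w" using G(2) kU(3) by auto
    qed
    then have "q \<in> M" unfolding M_def q_def using r Rpos \<delta> by auto
    then have "q \<le> R" unfolding R_def using cSup_upper bdd by blast
    then show False using lt \<delta> unfolding q_def by (auto simp: min_def split: if_splits)
  qed
  then show thesis using PR that unfolding P_def by blast
qed

lemma closed_singular_values [simp]: "closed (singular_values f)"
  by (simp only: singular_values_def closed_closure)

lemma critical_asymptotic_subset_singular: "critical_values f \<union> asymptotic_values f \<subseteq> singular_values f"
  unfolding singular_values_def by (rule closure_subset)

lemma deriv_nonzero_off_singular: "f z \<notin> singular_values f \<Longrightarrow> deriv f z \<noteq> 0"
  using critical_asymptotic_subset_singular by (force simp: critical_values_def critical_point_def)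

lemma ball_off_singular:
  assumes "w \<notin> singular_values f" obtains r where "r > 0" "ball w r \<inter> singular_values f = {}"
  using openE[of "- singular_values f" w] assms by (auto simp: open_Compl disjoint_eq_subset_Compl)

text \<open>The factor 3 leaves room for a branch centred at \<open>f z\<close> instead of
  \<open>w\<close>: its ball of radius \<open>2*r/3\<close> lies in \<open>ball w r\<close> and
  still contains \<open>ball w (r/3)\<close>. Thus one fixed ball carries a branch through every
  preimage in it.\<close>

lemma inverse_branch_near:
  assumes hol: "f holomorphic_on UNIV" and r: "r > 0" and disj: "ball w r \<inter> singular_values f = {}"
    and z: "f z \<in> ball w (r/3)"
  obtains g where "g holomorphic_on ball w (r/3)" "g (f z) = z" "\<And>w'. w' \<in> ball w (r/3) \<Longrightarrow> f (g w') = w'"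
proof -
  have sub: "ball (f z) (2*r/3) \<subseteq> ball w r" "ball w (r/3) \<subseteq> ball (f z) (2*r/3)"
    using z by (auto, (smt (verit) dist_commute dist_triangle)+)
  then have "ball (f z) (2*r/3) \<inter> (critical_values f \<union> asymptotic_values f) = {}"
    using disj critical_asymptotic_subset_singular by blast
  then obtain g where "g holomorphic_on ball (f z) (2*r/3)" "g (f z) = z" "\<And>w. w \<in> ball (f z) (2*r/3) \<Longrightarrow> f (g w) = w"
    using inverse_branch_ball[OF hol, of "2*r/3" "f z" z] r by auto
  then show thesis using that sub holomorphic_on_subset by blast
qed

text \<open>A ball of a third of the distance to the singular values is evenly covered. The sheets
  are the images of the branches from \<open>inverse_branch_near\<close>; two sheets that meet are
  equal by uniqueness of lifts. The base is taken to be the image of \<open>f\<close>, which makes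
  surjectivity immediate.\<close>

lemma covering_space_entire:
  assumes hol: "f holomorphic_on UNIV"
  shows "covering_space (f -` (- singular_values f)) f (f ` (f -` (- singular_values f)))"
proof
  let ?S = "singular_values f" and ?c = "f -` (- singular_values f)"
  have cf: "continuous_on UNIV f" using hol holomorphic_on_imp_continuous_on by blast
  then show "continuous_on ?c f" using continuous_on_subset by blast
  have oc: "open ?c" using cf by (intro open_vimage) (auto simp: open_Compl)
  show "f ` ?c = f ` ?c" ..
  fix x assume x: "x \<in> f ` ?c"
  then obtain r where r: "r > 0" "ball x r \<inter> ?S = {}"
    using ball_off_singular[of x f] by auto
  define T where "T = ball x (r/3)"
  have "T \<subseteq> ball x r" using r unfolding T_def by (intro subset_ball) auto
  then have TS: "T \<inter> ?S = {}" using r by auto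
  have dnz: "deriv f z \<noteq> 0" if "f z \<in> T" for z using that TS deriv_nonzero_off_singular by blast
  have "\<exists>g. g holomorphic_on T \<and> g (f z) = z \<and> (\<forall>w\<in>T. f (g w) = w)" if "f z \<in> T" for z
    using inverse_branch_near[OF hol r, of z] that unfolding T_def by metis
  then obtain g where g: "\<And>z. f z \<in> T \<Longrightarrow> g z holomorphic_on T \<and> g z (f z) = z \<and> (\<forall>w\<in>T. f (g z w) = w)"
    by metis
  define v where "v = {g z ` T | z. f z \<in> T}"
  have gc: "g z ` T \<subseteq> ?c \<inter> f -` T" if "f z \<in> T" for z using g[OF that] TS by auto
  have "T \<subseteq> f ` ?c"
  proof
    fix y assume y: "y \<in> T"
    obtain z where "f z = x" using x by auto
    then have z: "f z \<in> T" using r unfolding T_def by auto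
    show "y \<in> f ` ?c" using g[OF z] y gc[OF z] by (metis Int_iff image_subset_iff rev_image_eqI)
  qed
  have injg: "inj_on (g z) T" if "f z \<in> T" for z using g[OF that] by (metis inj_onI)
  show "\<exists>T. x \<in> T \<and> openin (top_of_set (f ` ?c)) T \<and>
      (\<exists>v. \<Union>v = ?c \<inter> f -` T \<and> (\<forall>u\<in>v. openin (top_of_set ?c) u) \<and> pairwise disjnt v \<and> (\<forall>u\<in>v. \<exists>q. homeomorphism u T f q))"
  proof (intro exI[of _ T] conjI exI[of _ v] ballI)
    show "x \<in> T" using r unfolding T_def by simp
    show "openin (top_of_set (f ` ?c)) T" 
      using \<open>T \<subseteq> f ` ?c\<close> by (rule open_subset) (simp add: T_def)
    show "\<Union>v = ?c \<inter> f -` T"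
    proof
      show "\<Union>v \<subseteq> ?c \<inter> f -` T" using gc unfolding v_def by blast
      show "?c \<inter> f -` T \<subseteq> \<Union>v"
      proof
        fix z assume "z \<in> ?c \<inter> f -` T"
        then have z: "f z \<in> T" by auto
        then have "z \<in> g z ` T" using g[OF z] by (metis image_eqI)
        then show "z \<in> \<Union>v" unfolding v_def using z by blast
      qed
    qed
    show "openin (top_of_set ?c) u" if "u \<in> v" for u
    proof -
      obtain z where z: "f z \<in> T" "u = g z ` T" using \<open>u \<in> v\<close> unfolding v_def by blast
      have "open u" unfolding z(2)
        using open_mapping_thm3[of "g z" T] g[OF z(1)] injg[OF z(1)] unfolding T_def by auto
      then show ?thesis using gc[OF z(1)] z(2) by (intro open_openin_trans oc) auto
    qed
    show "pairwise disjnt v"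
    proof (rule pairwiseI)
      fix u u' assume "u \<in> v" "u' \<in> v" "u \<noteq> u'"
      then obtain z z' where z: "f z \<in> T" "u = g z ` T" "f z' \<in> T" "u' = g z' ` T" unfolding v_def by blast
      show "disjnt u u'"
      proof (rule ccontr)
        assume "\<not> disjnt u u'"
        then obtain a b where ab: "a \<in> T" "b \<in> T" "g z a = g z' b" unfolding disjnt_def z by auto
        then have "a = b" using g[OF z(1)] g[OF z(3)] by metis
        have "g z w = g z' w" if "w \<in> T" for w
          by (rule lift_unique[where T=T and a=a and f=f, OF hol])
            (use that ab \<open>a = b\<close> g[OF z(1)] g[OF z(3)] dnz in
              \<open>auto intro: holomorphic_on_imp_continuous_on simp: T_def\<close>)
        then have "u = u'" unfolding z by auto
        then show False using \<open>u \<noteq> u'\<close> by simp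
      qed
    qed
    show "\<exists>q. homeomorphism u T f q" if "u \<in> v" for u
    proof -
      obtain z where z: "f z \<in> T" "u = g z ` T" using \<open>u \<in> v\<close> unfolding v_def by blast
      have "homeomorphism u T f (g z)"
        unfolding homeomorphism_def z(2)
      proof (intro conjI)
        show "continuous_on (g z ` T) f" using cf continuous_on_subset by blast
        show "continuous_on T (g z)" using g[OF z(1)] holomorphic_on_imp_continuous_on by blast
        show "f ` g z ` T = T" using g[OF z(1)] by (auto simp: image_iff)
      qed (use g[OF z(1)] in auto)
      then show ?thesis by blast
    qed
  qed
qed

text \<open>Monodromy. Since the covering has the image of \<open>f\<close> as its base, it must be
  seen that the lifted map stays in this image: small balls off the singular values are contained in
  it or disjoint from it, so it is open and closed among the nonsingular values, and a connected set
  that meets it lies in it.\<close>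

lemma entire_lift:
  fixes \<Phi> :: "'a::real_normed_vector \<Rightarrow> complex"
  assumes hol: "f holomorphic_on UNIV" and U: "simply_connected U" "locally path_connected U"
    and cont: "continuous_on U \<Phi>" and off: "\<And>u. u \<in> U \<Longrightarrow> \<Phi> u \<notin> singular_values f"
    and u0: "u0 \<in> U" "\<Phi> u0 = f z0"
  obtains g where "continuous_on U g" "g u0 = z0" "\<And>u. u \<in> U \<Longrightarrow> f (g u) = \<Phi> u"
proof -
  let ?S = "singular_values f" and ?c = "f -` (- singular_values f)"
  have ball: "ball w (r/3) \<subseteq> f ` ?c \<or> ball w (r/3) \<inter> f ` ?c = {}" if r: "r > 0" "ball w r \<inter> ?S = {}" for w r
  proof (rule disjCI)
    assume "\<not> ball w (r/3) \<inter> f ` ?c = {}"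
    then obtain z where "f z \<in> ball w (r/3)" by auto
    then obtain g where g: "\<And>w'. w' \<in> ball w (r/3) \<Longrightarrow> f (g w') = w'"
      using inverse_branch_near[OF hol r] by metis
    show "ball w (r/3) \<subseteq> f ` ?c"
    proof
      fix w' assume w': "w' \<in> ball w (r/3)"
      have "w' \<in> ball w r" using w' r(1) by auto
      then have "w' \<notin> ?S" using r(2) by auto
      then show "w' \<in> f ` ?c" using g[OF w'] by (metis ComplI image_eqI vimageI2)
    qed
  qed
  have rad: "\<exists>r>0. ball w r \<inter> ?S = {}" if "w \<notin> ?S" for w
    using ball_off_singular[OF that] by metis
  have op1: "open (f ` ?c)"
    unfolding open_contains_ball
  proof
    fix w assume w: "w \<in> f ` ?c"
    then obtain r where r: "r > 0" "ball w r \<inter> ?S = {}" using rad[of w] by auto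
    have "w \<in> ball w (r/3)" using r by simp
    then have "ball w (r/3) \<subseteq> f ` ?c" using ball[OF r] w by blast
    then show "\<exists>e>0. ball w e \<subseteq> f ` ?c" using r(1) by (intro exI[of _ "r/3"]) simp
  qed
  have op2: "open (- ?S - f ` ?c)"
    unfolding open_contains_ball
  proof
    fix w assume w: "w \<in> - ?S - f ` ?c"
    then obtain r where r: "r > 0" "ball w r \<inter> ?S = {}" using rad[of w] by auto
    have "ball w (r/3) \<subseteq> ball w r" using r by (intro subset_ball) auto
    moreover have "w \<in> ball w (r/3)" using r by simp
    ultimately have "ball w (r/3) \<subseteq> - ?S - f ` ?c" using ball[OF r] w r(2) by blast
    then show "\<exists>e>0. ball w e \<subseteq> - ?S - f ` ?c" using r(1) by (intro exI[of _ "r/3"]) simp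
  qed
  have "connected (\<Phi> ` U)" using cont U(1) connected_continuous_image simply_connected_imp_connected by blast
  moreover have "\<Phi> u0 \<in> f ` ?c" using u0 off[OF u0(1)] by auto
  ultimately have im: "\<Phi> ` U \<subseteq> f ` ?c"
    using connectedD[of "\<Phi> ` U" "f ` ?c" "- ?S - f ` ?c"] op1 op2 off u0(1) by blast
  show thesis
  proof (rule covering_space_lift_strong[OF covering_space_entire[OF hol], of z0 u0 U \<Phi>])
    show "z0 \<in> ?c" using u0 off[OF u0(1)] by auto
    show "\<Phi> \<in> U \<rightarrow> f ` ?c" using im by auto
  qed (use that U cont u0 in auto)
qed

lemma holomorphic_lift:
  assumes hol: "f holomorphic_on UNIV" and U: "open U" and g: "continuous_on U g"
    and \<Phi>: "\<Phi> holomorphic_on U" and fg: "\<And>u. u \<in> U \<Longrightarrow> f (g u) = \<Phi> u"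
    and d: "\<And>u. u \<in> U \<Longrightarrow> deriv f (g u) \<noteq> 0"
  shows "g holomorphic_on U"
proof (subst holomorphic_on_open[OF U], intro ballI)
  fix u assume u: "u \<in> U"
  obtain r e h where h: "r > 0" "e > 0" "h holomorphic_on ball (f (g u)) e"
    "\<And>z'. z' \<in> ball (g u) r \<Longrightarrow> h (f z') = z'"
    using local_inverse[OF hol d[OF u]] by metis
  let ?V = "(U \<inter> g -` ball (g u) r) \<inter> (U \<inter> \<Phi> -` ball (\<Phi> u) e)"
  have oV: "open ?V"
    using continuous_open_preimage[OF g U] continuous_open_preimage[OF _ U, of \<Phi>] \<Phi> holomorphic_on_imp_continuous_on
    by (intro open_Int[of "U \<inter> g -` ball (g u) r"]) auto
  have uV: "u \<in> ?V" using u h by auto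
  have "(h \<circ> \<Phi>) holomorphic_on ?V"
  proof (rule holomorphic_on_compose_gen)
    show "\<Phi> holomorphic_on ?V" using \<Phi> by (rule holomorphic_on_subset) blast
    show "h holomorphic_on ball (\<Phi> u) e" using h(3) unfolding fg[OF u] .
    show "\<Phi> ` ?V \<subseteq> ball (\<Phi> u) e" by blast
  qed
  moreover have "(h \<circ> \<Phi>) x = g x" if "x \<in> ?V" for x
    using h(4)[of "g x"] fg[of x] that by auto
  ultimately have "g holomorphic_on ?V" by (rule holomorphic_transform)
  then show "\<exists>f'. (g has_field_derivative f') (at u)"
    using holomorphic_on_open[OF oV] uV by blast
qed

lemma entire_lift_holomorphic:
  assumes hol: "f holomorphic_on UNIV" and U: "simply_connected U" "open U"
    and \<Phi>: "\<Phi> holomorphic_on U" and off: "\<And>u. u \<in> U \<Longrightarrow> \<Phi> u \<notin> singular_values f"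
    and u0: "u0 \<in> U" "\<Phi> u0 = f z0"
  obtains g where "g holomorphic_on U" "g u0 = z0" "\<And>u. u \<in> U \<Longrightarrow> f (g u) = \<Phi> u"
proof -
  obtain g where g: "continuous_on U g" "g u0 = z0" "\<And>u. u \<in> U \<Longrightarrow> f (g u) = \<Phi> u"
    using entire_lift[OF hol U(1) open_imp_locally_path_connected[OF U(2)] holomorphic_on_imp_continuous_on[OF \<Phi>] off u0]
    by metis
  have "g holomorphic_on U"
    by (rule holomorphic_lift[OF hol U(2) g(1) \<Phi> g(3)]) (use g(3) off deriv_nonzero_off_singular in metis)+
  then show thesis using that g by blast
qed

section \<open>Logarithmic coordinates on the tracts\<close>

text \<open>The condition on \<open>f 0\<close> keeps 0 out of all tracts, so that the tract maps
  never vanish and have logarithms.\<close>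

locale bounded_singular =
  fixes f :: "complex \<Rightarrow> complex" and R0 :: real
  assumes hol: "f holomorphic_on UNIV" and trans: "\<nexists>p. \<forall>z. f z = poly p z"
    and sing: "singular_values f \<subseteq> ball 0 R0" and f0: "norm (f 0) < R0"
begin

lemma R0_pos: "R0 > 0"
  using f0 norm_ge_zero[of "f 0"] by linarith

definition H :: "complex set" where "H = {\<zeta>. ln R0 < Re \<zeta>}"

text \<open>The inverse of a logarithm of \<open>f\<close> on a tract.\<close>

definition tract_map :: "(complex \<Rightarrow> complex) \<Rightarrow> bool" where
  "tract_map h \<longleftrightarrow> h holomorphic_on H \<and> (\<forall>\<zeta>\<in>H. f (h \<zeta>) = exp \<zeta>)"

lemma H_props: "open H" "convex H" "connected H" "simply_connected H" "H \<noteq> {}"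
proof -
  show "open H" unfolding H_def by (rule open_halfspace_Re_gt)
  show c: "convex H" unfolding H_def by (rule convex_halfspace_Re_gt)
  show "connected H" "simply_connected H"
    using c by (auto intro: convex_connected convex_imp_simply_connected)
  have "of_real (ln R0 + 1) \<in> H" unfolding H_def by simp
  then show "H \<noteq> {}" by blast
qed

lemma norm_exp_H: "\<zeta> \<in> H \<Longrightarrow> norm (exp \<zeta>) > R0"
  using R0_pos exp_less_cancel_iff[of "ln R0" "Re \<zeta>"] by (simp add: H_def norm_exp_eq_Re)

lemma exp_H_off: "\<zeta> \<in> H \<Longrightarrow> exp \<zeta> \<notin> singular_values f"
  using norm_exp_H[of \<zeta>] sing by (auto simp: subset_iff)

lemma bound_on_cball: "\<exists>m. \<forall>z. norm z \<le> b \<longrightarrow> norm (f z) \<le> m"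
proof -
  have "continuous_on (cball 0 b) f" using holomorphic_on_imp_continuous_on[OF hol] by (rule continuous_on_subset) auto
  then have "bounded (f ` cball 0 b)" using compact_imp_bounded compact_continuous_image compact_cball by blast
  then show ?thesis unfolding bounded_iff by (meson image_eqI mem_cball_0)
qed

lemma H_shift: "\<zeta> \<in> H \<Longrightarrow> \<zeta> + of_real x * \<i> \<in> H"
  by (simp add: H_def)

lemma tract_map_exists:
  assumes "\<zeta>0 \<in> H" "f z0 = exp \<zeta>0"
  obtains h where "tract_map h" "h \<zeta>0 = z0"
proof -
  obtain h where "h holomorphic_on H" "h \<zeta>0 = z0" "\<And>u. u \<in> H \<Longrightarrow> f (h u) = exp u"
    using entire_lift_holomorphic[OF hol H_props(4,1), of exp \<zeta>0 z0] exp_H_off assms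
    by (metis holomorphic_on_exp)
  then show thesis using that by (auto simp: tract_map_def)
qed

lemma tract_map_deriv_nz: "tract_map h \<Longrightarrow> \<zeta> \<in> H \<Longrightarrow> deriv f (h \<zeta>) \<noteq> 0"
  using exp_H_off deriv_nonzero_off_singular by (metis tract_map_def)

lemma tract_map_shift: "tract_map h \<Longrightarrow> tract_map (\<lambda>\<zeta>. h (\<zeta> + of_real (2 * pi * of_int k) * \<i>))"
proof -
  assume h: "tract_map h"
  have "(h \<circ> (\<lambda>\<zeta>. \<zeta> + of_real (2 * pi * of_int k) * \<i>)) holomorphic_on H"
    using h by (intro holomorphic_on_compose_gen[where t=H] holomorphic_intros) (auto simp: tract_map_def H_def)
  moreover have "exp (\<zeta> + of_real (2 * pi * of_int k) * \<i>) = exp \<zeta>" for \<zeta>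
    unfolding exp_eq by (intro exI[of _ k]) (simp add: mult_ac)
  ultimately show ?thesis using h H_shift unfolding tract_map_def o_def by metis
qed

lemma tract_map_unique:
  assumes "tract_map h" "tract_map h'" "a \<in> H" "h a = h' a" "\<zeta> \<in> H" shows "h \<zeta> = h' \<zeta>"
  by (rule lift_unique[where T=H and a=a and f=f, OF hol])
    (use assms H_props tract_map_deriv_nz[OF assms(1)] in \<open>auto simp: tract_map_def holomorphic_on_imp_continuous_on\<close>)

lemma tract_map_meet:
  assumes h: "tract_map h" "tract_map h'" and ab: "a \<in> H" "b \<in> H" "h a = h' b"
  obtains k :: int where "a = b + of_real (2 * pi * of_int k) * \<i>"
    "\<And>\<zeta>. \<zeta> \<in> H \<Longrightarrow> h (\<zeta> + of_real (2 * pi * of_int k) * \<i>) = h' \<zeta>"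
proof -
  have "exp a = exp b" using h ab by (metis tract_map_def)
  then obtain k :: int where k: "a = b + of_real (2 * pi * of_int k) * \<i>"
    unfolding exp_eq by (auto simp: mult_ac)
  have "h (\<zeta> + of_real (2 * pi * of_int k) * \<i>) = h' \<zeta>" if "\<zeta> \<in> H" for \<zeta>
    by (rule tract_map_unique[OF tract_map_shift[OF h(1)] h(2) ab(2) _ that]) (use k ab in simp)
  then show thesis using that k by blast
qed

text \<open>Otherwise infinity would be a pole and \<open>f\<close> a polynomial.\<close>

lemma not_tendsto_infinity: "\<exists>M. \<forall>B. \<exists>z. norm z > B \<and> norm (f z) < M"
proof (rule ccontr)
  assume "\<not> ?thesis"
  then have inf: "\<And>M. \<exists>B. \<forall>z. norm z > B \<longrightarrow> norm (f z) \<ge> M" by (meson not_le)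
  have "filterlim f at_infinity at_infinity"
    unfolding filterlim_at_infinity[OF order_refl] eventually_at_infinity
    using inf by (meson less_eq_real_def gt_ex order_less_le_trans)
  then have "((inverse \<circ> f) \<longlongrightarrow> 0) at_infinity"
    unfolding o_def by (rule tendsto_inverse_0[THEN filterlim_compose])
  then obtain a n where a: "\<And>z. f z = (\<Sum>i\<le>n. a i * z^i)" using pole_at_infinity[OF hol] by blast
  have "\<forall>z. f z = poly (\<Sum>i\<le>n. monom (a i) i) z" unfolding a by (simp add: poly_sum poly_monom)
  then show False using trans by blast
qed

text \<open>Points with equal images differ by a multiple of \<open>2 * pi * \<i>\<close>, so
  without injectivity \<open>h\<close> would be periodic. Then a vertical line would have compact
  image \<open>C\<close>, and the half-plane to its right would cover the whole exterior of
  \<open>C\<close>. This would force \<open>f\<close> to tend to infinity at infinity, which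
  transcendence forbids.\<close>

lemma tract_map_inj:
  assumes h: "tract_map h" shows "inj_on h H"
proof (rule ccontr)
  assume "\<not> inj_on h H"
  then obtain a b where ab: "a \<in> H" "b \<in> H" "a \<noteq> b" "h a = h b" by (auto simp: inj_on_def)
  obtain k :: int where k: "a = b + of_real (2 * pi * of_int k) * \<i>"
    "\<And>\<zeta>. \<zeta> \<in> H \<Longrightarrow> h (\<zeta> + of_real (2 * pi * of_int k) * \<i>) = h \<zeta>"
    using tract_map_meet[OF h h ab(1,2,4)] by metis
  define P where "P = \<bar>2 * pi * of_int k\<bar>"
  have P: "P > 0" using k(1) ab(3) unfolding P_def by auto
  have per1: "h (\<zeta> + of_real P * \<i>) = h \<zeta>" if "\<zeta> \<in> H" for \<zeta>
  proof (cases "k \<ge> 0")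
    case True then show ?thesis using k(2)[OF that] unfolding P_def by simp
  next
    case False
    then have "P = - (2 * pi * of_int k)" unfolding P_def by (simp add: mult_nonneg_nonpos)
    then show ?thesis using k(2)[OF H_shift[OF that, of P]] by (simp add: algebra_simps)
  qed
  have pern: "h (\<zeta> + of_real (P * of_nat n) * \<i>) = h \<zeta>" if "\<zeta> \<in> H" for \<zeta> n
  proof (induction n)
    case (Suc n)
    have "\<zeta> + of_real (P * of_nat (Suc n)) * \<i> = (\<zeta> + of_real (P * of_nat n) * \<i>) + of_real P * \<i>"
      by (simp add: algebra_simps)
    then show ?case using per1[OF H_shift[OF that]] Suc by metis
  qed simp
  have perz: "h (\<zeta> + of_real (P * of_int m) * \<i>) = h \<zeta>" if "\<zeta> \<in> H" for \<zeta> m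
  proof (cases "m \<ge> 0")
    case True then show ?thesis using pern[OF that, of "nat m"] by simp
  next
    case False
    have "h ((\<zeta> + of_real (P * of_int m) * \<i>) + of_real (P * of_nat (nat (-m))) * \<i>) = h (\<zeta> + of_real (P * of_int m) * \<i>)"
      by (rule pern[OF H_shift[OF that]])
    then show ?thesis using False by (simp add: algebra_simps)
  qed
  \<comment> \<open>Periodicity reduces every value of \<open>h\<close> to a point of the same real
    part in one period, which supplies the compactness used below.\<close>
  have red: "\<exists>\<zeta>'. Re \<zeta>' = Re \<zeta> \<and> 0 \<le> Im \<zeta>' \<and> Im \<zeta>' \<le> P \<and> h \<zeta>' = h \<zeta>" if "\<zeta> \<in> H" for \<zeta>
  proof -
    define m where "m = \<lfloor>Im \<zeta> / P\<rfloor>"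
    have "of_int m \<le> Im \<zeta> / P" "Im \<zeta> / P < of_int m + 1" unfolding m_def by linarith+
    then have "P * of_int m \<le> Im \<zeta>" "Im \<zeta> \<le> P * of_int m + P"
      using P by (auto simp: field_simps)
    then show ?thesis using perz[OF that, of "-m"]
      by (intro exI[of _ "\<zeta> + of_real (P * of_int (-m)) * \<i>"]) auto
  qed
  have ch: "continuous_on H h" using h by (auto simp: tract_map_def holomorphic_on_imp_continuous_on)
  have fh: "f (h \<zeta>) = exp \<zeta>" if "\<zeta> \<in> H" for \<zeta> using h that by (auto simp: tract_map_def)
  have "\<exists>B. \<forall>z. norm z > B \<longrightarrow> norm (f z) \<ge> M" for M
  proof -
    define x0 where "x0 = max (ln R0 + 1) (ln (max M 1))"
    have x0: "x0 > ln R0" "exp x0 \<ge> M"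
    proof -
      show "x0 > ln R0" unfolding x0_def by linarith
      have "exp x0 \<ge> exp (ln (max M 1))" unfolding x0_def by (intro iffD2[OF exp_le_cancel_iff]) linarith
      then show "exp x0 \<ge> M" by simp
    qed
    have subH: "{\<zeta>. Re \<zeta> \<ge> x0} \<subseteq> H" using x0 by (auto simp: H_def)
    define C where "C = h ` {\<zeta>. Re \<zeta> = x0 \<and> 0 \<le> Im \<zeta> \<and> Im \<zeta> \<le> P}"
    have box: "{\<zeta>. Re \<zeta> \<in> {a..b} \<and> 0 \<le> Im \<zeta> \<and> Im \<zeta> \<le> P} = cbox (Complex a 0) (Complex b P)" for a b
      by (auto simp: in_cbox_complex_iff)
    have cC: "compact C" unfolding C_def
    proof (rule compact_continuous_image)
      have "{\<zeta>. Re \<zeta> = x0 \<and> 0 \<le> Im \<zeta> \<and> Im \<zeta> \<le> P} = cbox (Complex x0 0) (Complex x0 P)"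
        using box[of x0 x0] by auto
      then show "compact {\<zeta>. Re \<zeta> = x0 \<and> 0 \<le> Im \<zeta> \<and> Im \<zeta> \<le> P}" by simp
      show "continuous_on {\<zeta>. Re \<zeta> = x0 \<and> 0 \<le> Im \<zeta> \<and> Im \<zeta> \<le> P} h"
        using ch by (rule continuous_on_subset) (use subH in auto)
    qed
    obtain B where B: "C \<subseteq> cball 0 B" using compact_imp_bounded[OF cC] unfolding bounded_iff by (auto simp: subset_iff)
    have outB: "- cball 0 B \<subseteq> outside C" using B by (intro outside_subset_convex) auto
    define D where "D = {\<zeta>. Re \<zeta> > x0}"
    have DH: "D \<subseteq> H" "open D" "connected D" unfolding D_def using subH
      by (auto simp: open_halfspace_Re_gt intro!: convex_connected convex_halfspace_Re_gt)
    have opT: "open (h ` D)"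
    proof (rule open_mapping_thm[of h D D])
      show "h holomorphic_on D" using h DH holomorphic_on_subset by (auto simp: tract_map_def)
      show "\<not> h constant_on D"
      proof
        assume "h constant_on D"
        then have "h (of_real (x0 + 1)) = h (of_real (x0 + 2))" unfolding constant_on_def D_def by force
        then have "exp (of_real (x0 + 1)) = (exp (of_real (x0 + 2)) :: complex)"
          using fh[of "of_real (x0 + 1)"] fh[of "of_real (x0 + 2)"] subH by (simp add: subset_iff)
        then show False by (simp only: exp_of_real of_real_eq_iff exp_inj_iff)
      qed
    qed (use DH in auto)
    \<comment> \<open>For closedness, preimages are chosen within one period. Their real parts are
      bounded because \<open>f\<close> is bounded on bounded sets, so they have a limit point; it is
      not on the line \<open>Re \<zeta> = x0\<close>, because \<open>z\<close> is outside
      \<open>C\<close>.\<close>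
    have clT: "closedin (top_of_set (outside C)) (h ` D \<inter> outside C)"
      unfolding closedin_limpt
    proof (intro conjI allI impI)
      fix z assume z: "z islimpt h ` D \<inter> outside C \<and> z \<in> outside C"
      then obtain zs where zs: "\<And>n. zs n \<in> h ` D \<inter> outside C" "zs \<longlonglongrightarrow> z"
        unfolding islimpt_sequential by blast
      have "\<exists>\<zeta>. Re \<zeta> > x0 \<and> 0 \<le> Im \<zeta> \<and> Im \<zeta> \<le> P \<and> h \<zeta> = zs n" for n
      proof -
        obtain \<zeta> where "\<zeta> \<in> D" "h \<zeta> = zs n" using zs(1) by (metis Int_iff image_iff)
        then show ?thesis using red[of \<zeta>] DH(1) unfolding D_def by (metis (mono_tags, lifting) mem_Collect_eq subsetD)
      qed
      then obtain \<zeta>s where \<zeta>s: "\<And>n. Re (\<zeta>s n) > x0 \<and> 0 \<le> Im (\<zeta>s n) \<and> Im (\<zeta>s n) \<le> P \<and> h (\<zeta>s n) = zs n" by metis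
      have \<zeta>H: "\<zeta>s n \<in> H" for n using \<zeta>s subH by (force simp: less_imp_le)
      have "bounded (range zs)" using zs(2) convergent_imp_bounded by blast
      then obtain b where b: "range zs \<subseteq> cball 0 b" unfolding bounded_iff by (auto simp: subset_iff)
      obtain m where m: "\<And>z. z \<in> cball 0 b \<Longrightarrow> norm (f z) \<le> m" using bound_on_cball[of b] by auto
      have "exp (Re (\<zeta>s n)) \<le> max m 1" for n
        using m[of "zs n"] b fh[OF \<zeta>H[of n]] \<zeta>s[of n] by (fastforce simp: norm_exp_eq_Re)
      then have "Re (\<zeta>s n) \<le> ln (max m 1)" for n by (simp add: ln_ge_iff)
      then have "\<zeta>s n \<in> cbox (Complex x0 0) (Complex (ln (max m 1)) P)" for n
        using \<zeta>s[of n] by (auto simp: in_cbox_complex_iff)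
      then obtain \<zeta> \<sigma> where \<zeta>: "strict_mono \<sigma>" "(\<zeta>s \<circ> \<sigma>) \<longlonglongrightarrow> \<zeta>" "\<zeta> \<in> cbox (Complex x0 0) (Complex (ln (max m 1)) P)"
        using compact_cbox[of "Complex x0 0" "Complex (ln (max m 1)) P"] unfolding compact_def by metis
      have "\<zeta> \<in> H" using \<zeta>(3) subH by (auto simp: in_cbox_complex_iff)
      then have "(\<lambda>n. h ((\<zeta>s \<circ> \<sigma>) n)) \<longlonglongrightarrow> h \<zeta>"
        using ch \<zeta>(2) \<zeta>H by (intro continuous_on_tendsto_compose[OF ch]) (auto simp: o_def)
      moreover have "(\<lambda>n. h ((\<zeta>s \<circ> \<sigma>) n)) = zs \<circ> \<sigma>" using \<zeta>s by auto
      ultimately have hz: "h \<zeta> = z" using LIMSEQ_subseq_LIMSEQ[OF zs(2) \<zeta>(1)] LIMSEQ_unique by metis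
      have "Re \<zeta> \<noteq> x0"
      proof
        assume "Re \<zeta> = x0"
        then have "z \<in> C" using \<zeta>(3) hz unfolding C_def by (auto simp: in_cbox_complex_iff)
        then show False using z outside_no_overlap[of C] by blast
      qed
      then have "\<zeta> \<in> D" using \<zeta>(3) unfolding D_def by (auto simp: in_cbox_complex_iff)
      then show "z \<in> h ` D \<inter> outside C" using hz z by blast
    qed auto
    have opT': "openin (top_of_set (outside C)) (h ` D \<inter> outside C)"
      using opT by (simp add: Int_commute openin_open_Int)
    have "h ` D \<inter> outside C \<noteq> {}"
    proof -
      obtain m where m: "\<And>z. z \<in> cball 0 B \<Longrightarrow> norm (f z) \<le> m" using bound_on_cball[of B] by auto
      define x where "x = max (x0 + 1) (ln (max m 1) + 1)"
      have x: "of_real x \<in> D" unfolding D_def x_def by simp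
      have "m < exp x"
      proof -
        have "m \<le> exp (ln (max m 1))" by simp
        also have "\<dots> < exp x" unfolding x_def exp_less_cancel_iff by linarith
        finally show ?thesis .
      qed
      then have "h (of_real x) \<notin> cball 0 B"
        using m[of "h (of_real x)"] fh[of "of_real x"] x DH(1) by (auto simp: norm_exp_eq_Re)
      then show ?thesis using outB x by blast
    qed
    moreover have "connected (outside C)" using compact_imp_bounded[OF cC] by (intro connected_outside) auto
    ultimately have "h ` D \<inter> outside C = outside C"
      using opT' clT unfolding connected_clopen by blast
    then have sub: "- cball 0 B \<subseteq> h ` D" using outB by blast
    have "norm (f z) \<ge> M" if "norm z > B" for z
    proof -
      have "z \<in> h ` D" using that sub by auto
      then obtain \<zeta> where "\<zeta> \<in> D" "z = h \<zeta>" by blast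
      then have "norm (f z) = exp (Re \<zeta>)" "Re \<zeta> > x0" using fh DH by (auto simp: norm_exp_eq_Re D_def)
      then show ?thesis using x0(2) by (smt (verit) exp_less_mono)
    qed
    then show ?thesis by blast
  qed
  then show False using not_tendsto_infinity by (meson not_le)
qed

lemma tract_map_log:
  assumes h: "tract_map h"
  obtains \<Phi> where "\<Phi> holomorphic_on H" "\<And>\<zeta>. \<zeta> \<in> H \<Longrightarrow> exp (\<Phi> \<zeta>) = h \<zeta>"
proof -
  have "h \<zeta> \<noteq> 0" if "\<zeta> \<in> H" for \<zeta>
  proof
    assume "h \<zeta> = 0"
    then have "f 0 = exp \<zeta>" using h that by (metis tract_map_def)
    then show False using f0 norm_exp_H[OF that] by simp
  qed
  moreover have "h holomorphic_on H" using h by (simp add: tract_map_def)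
  ultimately obtain g where "g holomorphic_on H" "\<And>z. z \<in> H \<Longrightarrow> h z = exp (g z)"
    using simply_connected_imp_holomorphic_log[of h H] H_props(4) open_imp_locally_path_connected[OF H_props(1)] by blast
  then show thesis using that by metis
qed

text \<open>Not only \<open>\<Phi>\<close> but also \<open>exp \<circ> \<Phi>\<close> is injective,
  so the image of \<open>\<Phi>\<close> contains no two points that differ by
  \<open>2 * pi * \<i>\<close> and hence no disc of radius greater than \<open>pi\<close>. Bloch's
  theorem turns this into a bound on the derivative.\<close>

lemma tract_log_contraction:
  assumes h: "tract_map h" and \<Phi>: "\<Phi> holomorphic_on H" "\<And>\<zeta>. \<zeta> \<in> H \<Longrightarrow> exp (\<Phi> \<zeta>) = h \<zeta>"
    and z: "Re \<zeta> \<ge> ln R0 + 24 * pi" "Re \<zeta>' \<ge> ln R0 + 24 * pi"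
  shows "norm (\<Phi> \<zeta> - \<Phi> \<zeta>') \<le> 1/2 * norm (\<zeta> - \<zeta>')"
proof -
  let ?A = "{\<zeta>. Re \<zeta> \<ge> ln R0 + 24 * pi}"
  have "(24::real) * pi > 0" by simp
  then have AH: "?A \<subseteq> H" unfolding H_def by (smt (verit) Collect_mono)
  have inj: "\<Phi> a = \<Phi> b" if "a \<in> H" "b \<in> H" "exp (\<Phi> a) = exp (\<Phi> b)" for a b
    using tract_map_inj[OF h] \<Phi>(2) that by (metis inj_onD)
  have d: "norm (deriv \<Phi> \<eta>) \<le> 1/2" if \<eta>: "\<eta> \<in> ?A" for \<eta>
  proof (rule ccontr)
    assume "\<not> ?thesis"
    then have gt: "norm (deriv \<Phi> \<eta>) > 1/2" by simp
    have sub: "ball \<eta> (24*pi) \<subseteq> H"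
    proof
      fix w assume "w \<in> ball \<eta> (24*pi)"
      then have "norm (\<eta> - w) < 24 * pi" by (simp add: dist_norm)
      then have "Re \<eta> - Re w < 24 * pi" using complex_Re_le_cmod[of "\<eta> - w"] by simp
      then show "w \<in> H" using \<eta> by (simp add: H_def)
    qed
    \<comment> \<open>Bloch's theorem with constant 1/12 on a disc of radius \<open>24 * pi\<close>:
      a derivative above 1/2 would yield a disc of radius greater than \<open>pi\<close>. This is
      the origin of \<open>24 * pi\<close>.\<close>
    define r where "r = 24 * pi * norm (deriv \<Phi> \<eta>) / 12"
    have r: "r > pi" using gt pi_gt_zero unfolding r_def by (simp add: field_simps)
    obtain b where b: "ball b r \<subseteq> \<Phi> ` ball \<eta> (24*pi)"
      using Bloch[OF holomorphic_on_subset[OF \<Phi>(1) sub], of r] unfolding r_def by auto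
    have "b + of_real pi * \<i> \<in> ball b r" "b - of_real pi * \<i> \<in> ball b r"
      using r by (auto simp: dist_norm norm_mult)
    then have "b + of_real pi * \<i> \<in> \<Phi> ` ball \<eta> (24*pi)" "b - of_real pi * \<i> \<in> \<Phi> ` ball \<eta> (24*pi)"
      using b by blast+
    then obtain u v where uv: "u \<in> ball \<eta> (24*pi)" "v \<in> ball \<eta> (24*pi)" "\<Phi> u = b + of_real pi * \<i>" "\<Phi> v = b - of_real pi * \<i>"
      by (elim imageE) (metis)
    then have uv': "u \<in> H" "v \<in> H" using sub by blast+
    have "exp (\<Phi> u) = exp (\<Phi> v)" unfolding uv exp_eq by (intro exI[of _ 1]) simp
    then have "\<Phi> u = \<Phi> v" using inj uv' by blast
    then show False unfolding uv using pi_gt_zero by (simp add: algebra_simps)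
  qed
  show ?thesis
  proof (rule field_differentiable_bound[of ?A \<Phi> "deriv \<Phi>"])
    show "convex ?A" by (rule convex_halfspace_Re_ge)
    show "(\<Phi> has_field_derivative deriv \<Phi> w) (at w within ?A)" if "w \<in> ?A" for w
      using holomorphic_derivI[OF \<Phi>(1) H_props(1)] AH that by blast
  qed (use d z in auto)
qed

text \<open>The domain is a disjoint union of images of \<open>H\<close>: two images that meet
  coincide, because the tract maps then differ by a translation by a multiple of
  \<open>2 * pi * \<i>\<close>. On each image the logarithm is \<open>\<Phi>\<close> after the
  inverse of \<open>h\<close>.\<close>

lemma tract_logarithm:
  obtains L where "L holomorphic_on {z. norm (f z) > R0}" "\<And>z. norm (f z) > R0 \<Longrightarrow> exp (L z) = z"
proof -
  define I where "I = {h ` H | h. tract_map h}"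
  have ex: "\<exists>l. l holomorphic_on V \<and> (\<forall>z\<in>V. exp (l z) = z)" if "V \<in> I" for V
  proof -
    obtain h where h: "tract_map h" "V = h ` H" using \<open>V \<in> I\<close> unfolding I_def by blast
    obtain g where g: "g holomorphic_on h ` H" "\<And>z. z \<in> H \<Longrightarrow> g (h z) = z"
      using holomorphic_has_inverse[of h H] h(1) H_props(1) tract_map_inj[OF h(1)] by (metis tract_map_def)
    obtain \<Phi> where \<Phi>: "\<Phi> holomorphic_on H" "\<And>\<zeta>. \<zeta> \<in> H \<Longrightarrow> exp (\<Phi> \<zeta>) = h \<zeta>" using tract_map_log[OF h(1)] by metis
    have "(\<Phi> \<circ> g) holomorphic_on V" unfolding h(2)
      by (rule holomorphic_on_compose_gen[OF g(1) \<Phi>(1)]) (use g(2) in auto)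
    then show ?thesis using \<Phi>(2) g(2) h(2) by (intro exI[of _ "\<Phi> \<circ> g"]) auto
  qed
  then obtain l where l: "\<And>V. V \<in> I \<Longrightarrow> l V holomorphic_on V \<and> (\<forall>z\<in>V. exp (l V z) = z)" by metis
  have op: "open V" if "V \<in> I" for V
    using that open_mapping_thm3[OF _ H_props(1) tract_map_inj] unfolding I_def tract_map_def by blast
  have sub: "h ` H \<subseteq> h' ` H" if ab: "tract_map h" "tract_map h'" "a \<in> H" "b \<in> H" "h a = h' b" for h h' a b
  proof -
    obtain k :: int where "\<And>\<zeta>. \<zeta> \<in> H \<Longrightarrow> h' (\<zeta> + of_real (2 * pi * of_int k) * \<i>) = h \<zeta>"
      using tract_map_meet[OF ab(2,1,4,3)] ab(5) by metis
    then show ?thesis using H_shift by (metis image_subsetI image_eqI)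
  qed
  have dj: "V = V'" if "V \<in> I" "V' \<in> I" "x \<in> V" "x \<in> V'" for V V' x
  proof -
    obtain h h' a b where "tract_map h" "V = h ` H" "tract_map h'" "V' = h' ` H" "a \<in> H" "b \<in> H" "x = h a" "x = h' b"
      using \<open>V \<in> I\<close> \<open>V' \<in> I\<close> \<open>x \<in> V\<close> \<open>x \<in> V'\<close> unfolding I_def by blast
    then show ?thesis using sub[of h h' a b] sub[of h' h b a] by auto
  qed
  obtain L where L: "L holomorphic_on (\<Union>V\<in>I. V)" "\<And>V x. V \<in> I \<Longrightarrow> x \<in> V \<Longrightarrow> L x = l V x"
  proof (rule holomorphic_glue[of I "\<lambda>V. V" l])
    show "l i x = l j x" if "i \<in> I" "j \<in> I" "x \<in> i" "x \<in> j" for i j x using dj[OF that] by simp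
  qed (use op l in auto)
  have un: "\<exists>V\<in>I. z \<in> V" if "norm (f z) > R0" for z
  proof -
    have nz: "f z \<noteq> 0" using that R0_pos by auto
    define \<zeta> where "\<zeta> = Ln (f z)"
    have "\<zeta> \<in> H" unfolding \<zeta>_def H_def using nz that R0_pos by simp
    moreover have "f z = exp \<zeta>" unfolding \<zeta>_def using nz by simp
    ultimately obtain h where "tract_map h" "h \<zeta> = z" using tract_map_exists by metis
    then show ?thesis unfolding I_def using \<open>\<zeta> \<in> H\<close> by blast
  qed
  show thesis
  proof
    show "L holomorphic_on {z. norm (f z) > R0}" using L(1) by (rule holomorphic_on_subset) (use un in auto)
    show "exp (L z) = z" if "norm (f z) > R0" for z using un[OF that] L(2) l by metis
  qed
qed

end

section \<open>Boundedness from properness along the ray\<close>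

lemma first_time_below:
  fixes u :: "real \<Rightarrow> real"
  assumes u: "continuous_on {a..T} u" "c \<le> u a" "a \<le> T"
  obtains b where "a \<le> b" "b \<le> T" "\<And>s. a \<le> s \<Longrightarrow> s \<le> b \<Longrightarrow> c \<le> u s" "b = T \<or> u b = c"
proof (cases "\<forall>s\<in>{a..T}. c \<le> u s")
  case True then show thesis using that[of T] u by auto
next
  case False
  define Z where "Z = {s \<in> {a..T}. u s \<le> c}"
  obtain s where "s \<in> {a..T}" "u s < c" using False by (auto simp: not_le)
  then have "s \<in> Z" unfolding Z_def by simp
  then have ne: "Z \<noteq> {}" by blast
  have "Z = {a..T} \<inter> u -` {..c}" unfolding Z_def by auto
  then have "closed Z" using continuous_closed_preimage[OF u(1), of "{..c}"] by simp
  moreover have "bounded Z" by (rule bounded_subset[of "{a..T}"]) (auto simp: Z_def)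
  ultimately have "compact Z" by (simp add: compact_eq_bounded_closed)
  then obtain b where b: "b \<in> Z" "\<And>s. s \<in> Z \<Longrightarrow> b \<le> s" using compact_attains_inf[OF _ ne] by blast
  have gt: "c < u s" if "a \<le> s" "s < b" for s using b(2)[of s] that b(1) unfolding Z_def by force
  have "u b = c"
  proof (rule ccontr)
    assume "u b \<noteq> c"
    then have lt: "u b < c" using b(1) unfolding Z_def by auto
    obtain s where s: "a \<le> s" "s \<le> b" "u s = c"
      using IVT2'[of u b c a] u b(1) lt continuous_on_subset[OF u(1), of "{a..b}"] unfolding Z_def by auto
    then have "s = b" using gt[of s] by force
    then show False using s lt by simp
  qed
  then show thesis using that[of b] gt b(1) unfolding Z_def by (smt (verit) atLeastAtMost_iff mem_Collect_eq)
qed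

context bounded_singular
begin

text \<open>Follow the ray from a far point \<open>\<gamma> t\<close> to the first time
  \<open>b\<close> at which it is no longer far. On this stretch one tract map recovers
  \<open>\<gamma>\<close> from its image, and contraction of its logarithm gives that the logarithm
  at \<open>t + 1\<close> is at least twice the one at \<open>t\<close>, up to a constant. A point
  far out would thus remain far out under integer steps up to \<open>T1\<close>, although the ray is
  bounded there.\<close>

lemma proper_imp_bounded_tail:
  fixes \<gamma> :: "real \<Rightarrow> complex"
  assumes c: "continuous_on UNIV \<gamma>" and f\<gamma>: "\<And>t. f (\<gamma> t) = \<gamma> (t + 1)"
    and P: "\<And>x. \<exists>y. \<forall>t\<le>T0. norm (\<gamma> (t + 1)) \<le> x \<longrightarrow> norm (\<gamma> t) \<le> y"
  shows "bounded (\<gamma> ` {..T0})"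
proof (rule ccontr)
  assume unb: "\<not> bounded (\<gamma> ` {..T0})"
  \<comment> \<open>The radius at which \<open>ln\<close> reaches the half-plane of
    \<open>tract_log_contraction\<close>.\<close>
  define R1 where "R1 = R0 * exp (24 * pi)"
  have R1: "R1 > R0" "R1 > 0" "ln R1 = ln R0 + 24 * pi"
    using R0_pos by (simp_all add: R1_def ln_mult)
  obtain L where L: "L holomorphic_on {z. norm (f z) > R0}" "\<And>z. norm (f z) > R0 \<Longrightarrow> exp (L z) = z"
    using tract_logarithm by blast
  obtain y1 where y1: "\<forall>t\<le>T0. norm (\<gamma> (t + 1)) \<le> R1 \<longrightarrow> norm (\<gamma> t) \<le> y1" using P by blast
  define \<rho>1 where "\<rho>1 = y1 + 1"
  have \<rho>1: "norm (\<gamma> (t + 1)) > R1" if "t \<le> T0" "norm (\<gamma> t) \<ge> \<rho>1" for t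
    using y1 that unfolding \<rho>1_def by force
  \<comment> \<open>Properness is used twice: beyond \<open>\<rho>2\<close> not only the next point
    of the ray but also the one after it has modulus above \<open>R1\<close>, so that
    \<open>L\<close> is defined both at \<open>\<gamma> t\<close> and at
    \<open>\<gamma> (t + 1)\<close>.\<close>
  obtain y2 where y2: "\<forall>t\<le>T0. norm (\<gamma> (t + 1)) \<le> \<rho>1 \<longrightarrow> norm (\<gamma> t) \<le> y2" using P by blast
  define \<rho>2 where "\<rho>2 = max (max \<rho>1 y2 + 1) 1"
  have \<rho>2: "norm (\<gamma> (t + 1)) > \<rho>1" if "t \<le> T0" "norm (\<gamma> t) \<ge> \<rho>2" for t
    using y2 that unfolding \<rho>2_def by force
  have \<rho>2ge: "\<rho>2 \<ge> \<rho>1" "\<rho>2 \<ge> 1" unfolding \<rho>2_def by auto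
  define T1 where "T1 = T0 - 1"
  have "compact (\<gamma> ` {T1-1..T0})" by (intro compact_continuous_image continuous_on_subset[OF c]) auto
  then obtain m0 where m0: "\<And>t. T1-1 \<le> t \<Longrightarrow> t \<le> T0 \<Longrightarrow> norm (\<gamma> t) \<le> m0"
    using compact_imp_bounded[OF \<open>compact (\<gamma> ` {T1-1..T0})\<close>] unfolding bounded_iff ball_simps by (metis atLeastAtMost_iff)
  define m1 where "m1 = max \<rho>2 m0"
  obtain m2 where m2: "\<And>z. norm z \<le> m1 \<Longrightarrow> norm (f z) \<le> m2" using bound_on_cball[of m1] by blast
  define m where "m = max m1 m2"
  \<comment> \<open>The number \<open>m\<close> bounds the ray at the exit time \<open>b\<close> and
    at \<open>b + 1\<close>; hence \<open>B\<close> bounds the two logarithms at the end of the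
    stretch.\<close>
  have "\<exists>B\<ge>0. \<forall>z. norm z \<le> m \<and> norm (f z) \<ge> R1 \<longrightarrow> norm (L z) \<le> B"
  proof -
    let ?K = "cball 0 m \<inter> {z. norm (f z) \<ge> R1}"
    have "closed {z. norm (f z) \<ge> R1}"
      using holomorphic_on_imp_continuous_on[OF hol] by (intro closed_Collect_le continuous_intros) auto
    then have K: "compact ?K" by (intro compact_Int_closed) auto
    have "continuous_on ?K L"
      using holomorphic_on_imp_continuous_on[OF L(1)] by (rule continuous_on_subset) (use R1 in auto)
    then have "bounded (L ` ?K)" using K compact_continuous_image compact_imp_bounded by blast
    then obtain B where B: "\<And>z. z \<in> ?K \<Longrightarrow> norm (L z) \<le> B" unfolding bounded_iff by blast
    then show ?thesis by (intro exI[of _ "max B 0"]) force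
  qed
  then obtain B where B: "B \<ge> 0" "\<And>z. norm z \<le> m \<Longrightarrow> norm (f z) \<ge> R1 \<Longrightarrow> norm (L z) \<le> B" by blast
  have big1: "norm (\<gamma> (t + 1)) > R1" if "t \<le> T1" "norm (\<gamma> t) \<ge> \<rho>2" for t
    using \<rho>1[of t] that \<rho>2ge unfolding T1_def by auto
  have big2: "norm (\<gamma> (t + 1 + 1)) > R1" if "t \<le> T1" "norm (\<gamma> t) \<ge> \<rho>2" for t
    using \<rho>1[of "t + 1"] \<rho>2[of t] that unfolding T1_def by auto
  have step: "norm (L (\<gamma> (t + 1))) \<ge> 2 * norm (L (\<gamma> t)) - 3 * B" if t: "t \<le> T1" "norm (\<gamma> t) \<ge> \<rho>2" for t
  proof -
    have "continuous_on {t..T1} (\<lambda>s. norm (\<gamma> s))" by (intro continuous_intros continuous_on_subset[OF c]) auto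
    then obtain b where b: "t \<le> b" "b \<le> T1" "\<And>s. t \<le> s \<Longrightarrow> s \<le> b \<Longrightarrow> \<rho>2 \<le> norm (\<gamma> s)" "b = T1 \<or> norm (\<gamma> b) = \<rho>2"
      using first_time_below[of t T1 "\<lambda>s. norm (\<gamma> s)" \<rho>2] t by blast
    let ?I = "{t..b}"
    define \<Lambda> where "\<Lambda> s = L (\<gamma> s)" for s
    define \<Lambda>' where "\<Lambda>' s = L (\<gamma> (s + 1))" for s
    have bg: "norm (\<gamma> (s + 1)) > R1" "norm (\<gamma> (s + 1 + 1)) > R1" if "s \<in> ?I" for s
      using big1[of s] big2[of s] b that by auto
    have fb: "norm (f (\<gamma> s)) > R0" "norm (f (\<gamma> (s + 1))) > R0" if "s \<in> ?I" for s
      using bg[OF that] R1 unfolding f\<gamma> by auto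
    have e\<Lambda>: "exp (\<Lambda> s) = \<gamma> s" "exp (\<Lambda>' s) = \<gamma> (s + 1)" if "s \<in> ?I" for s
      unfolding \<Lambda>_def \<Lambda>'_def using L(2) fb[OF that] by auto
    have c\<Lambda>: "continuous_on ?I \<Lambda>" "continuous_on ?I \<Lambda>'"
      unfolding \<Lambda>_def \<Lambda>'_def using fb
      by (auto intro!: continuous_on_compose2[OF holomorphic_on_imp_continuous_on[OF L(1)]] continuous_on_subset[OF c]
          continuous_on_compose2[OF c] continuous_intros)
    have Re\<Lambda>: "Re (\<Lambda>' s) \<ge> ln R0 + 24 * pi" if "s \<in> ?I" for s
    proof -
      have "R1 < exp (Re (\<Lambda>' s))" using bg(1)[OF that] e\<Lambda>(2)[OF that] norm_exp_eq_Re by metis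
      then have "ln R1 < Re (\<Lambda>' s)" using R1 ln_less_cancel_iff[of R1 "exp (Re (\<Lambda>' s))"] by simp
      then show ?thesis using R1 by simp
    qed
    have H\<Lambda>: "\<Lambda>' s \<in> H" if "s \<in> ?I" for s
    proof -
      have "24 * pi > 0" by simp
      then show ?thesis using Re\<Lambda>[OF that] unfolding H_def mem_Collect_eq by linarith
    qed
    have bI: "b \<in> ?I" "t \<in> ?I" using b by auto
    have "f (\<gamma> b) = exp (\<Lambda>' b)" using e\<Lambda>(2)[OF bI(1)] f\<gamma> by simp
    then obtain h where h: "tract_map h" "h (\<Lambda>' b) = \<gamma> b" using tract_map_exists H\<Lambda>[OF bI(1)] by metis
    obtain \<Phi> where \<Phi>: "\<Phi> holomorphic_on H" "\<And>\<zeta>. \<zeta> \<in> H \<Longrightarrow> exp (\<Phi> \<zeta>) = h \<zeta>" using tract_map_log[OF h(1)] by metis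
    have hc: "continuous_on H h" "continuous_on H \<Phi>" using h(1) \<Phi>(1) by (auto simp: tract_map_def holomorphic_on_imp_continuous_on)
    have heq: "h (\<Lambda>' s) = \<gamma> s" if s: "s \<in> ?I" for s
    proof (rule lift_unique[where T="?I" and a=b and f=f and ?g1.0="\<lambda>s. h (\<Lambda>' s)" and ?g2.0=\<gamma>])
      show "continuous_on ?I (\<lambda>s. h (\<Lambda>' s))" by (rule continuous_on_compose2[OF hc(1) c\<Lambda>(2)]) (use H\<Lambda> in auto)
      show "continuous_on ?I \<gamma>" by (rule continuous_on_subset[OF c]) auto
      show "f (h (\<Lambda>' x)) = f (\<gamma> x)" if "x \<in> ?I" for x
        using h(1) H\<Lambda>[OF that] e\<Lambda>(2)[OF that] f\<gamma> by (simp add: tract_map_def)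
      show "deriv f (h (\<Lambda>' x)) \<noteq> 0" if "x \<in> ?I" for x using tract_map_deriv_nz[OF h(1) H\<Lambda>[OF that]] .
    qed (use hol bI h s in auto)
    \<comment> \<open>Both \<open>\<Phi> (\<Lambda>' s)\<close> and \<open>\<Lambda> s\<close> are
      logarithms of \<open>\<gamma> s\<close>. Their difference is constant along the stretch and
      cancels in the comparison of its ends.\<close>
    define d where "d = \<Phi> (\<Lambda>' b) - \<Lambda> b"
    have "exp d = 1" unfolding d_def exp_diff using \<Phi>(2)[OF H\<Lambda>[OF bI(1)]] heq[OF bI(1)] e\<Lambda>(1)[OF bI(1)]
      by (metis divide_self exp_not_eq_zero)
    have d: "\<Phi> (\<Lambda>' s) = \<Lambda> s + d" if s: "s \<in> ?I" for s
    proof (rule lift_unique[where T="?I" and a=b and f=exp and ?g1.0="\<lambda>s. \<Phi> (\<Lambda>' s)" and ?g2.0="\<lambda>s. \<Lambda> s + d"])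
      show "exp holomorphic_on UNIV" by (intro holomorphic_intros)
      show "continuous_on ?I (\<lambda>s. \<Phi> (\<Lambda>' s))" by (rule continuous_on_compose2[OF hc(2) c\<Lambda>(2)]) (use H\<Lambda> in auto)
      show "continuous_on ?I (\<lambda>s. \<Lambda> s + d)" by (intro continuous_intros c\<Lambda>)
      show "exp (\<Phi> (\<Lambda>' x)) = exp (\<Lambda> x + d)" if "x \<in> ?I" for x
        using \<Phi>(2)[OF H\<Lambda>[OF that]] heq[OF that] e\<Lambda>(1)[OF that] \<open>exp d = 1\<close> by (simp add: exp_add)
      show "\<Phi> (\<Lambda>' b) = \<Lambda> b + d" unfolding d_def by simp
      show "deriv exp (\<Phi> (\<Lambda>' x)) \<noteq> 0" for x using DERIV_imp_deriv[OF DERIV_exp, of "\<Phi> (\<Lambda>' x)"] by simp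
    qed (use bI s in auto)
    have "norm (\<Lambda> t - \<Lambda> b) = norm (\<Phi> (\<Lambda>' t) - \<Phi> (\<Lambda>' b))" using d[OF bI(1)] d[OF bI(2)] by simp
    also have "\<dots> \<le> 1/2 * norm (\<Lambda>' t - \<Lambda>' b)"
      by (rule tract_log_contraction[OF h(1) \<Phi> Re\<Lambda>[OF bI(2)] Re\<Lambda>[OF bI(1)]])
    finally have half: "2 * norm (\<Lambda> t - \<Lambda> b) \<le> norm (\<Lambda>' t - \<Lambda>' b)" by simp
    have gb: "norm (\<gamma> b) \<le> m1" using b m0[of b] unfolding m1_def T1_def by auto
    have "norm (\<Lambda> b) \<le> B" unfolding \<Lambda>_def
      by (rule B(2)) (use gb bg(1)[OF bI(1)] f\<gamma> m_def in auto)
    moreover have "norm (\<Lambda>' b) \<le> B" unfolding \<Lambda>'_def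
      by (rule B(2)) (use m2[OF gb] bg(2)[OF bI(1)] f\<gamma> m_def in auto)
    moreover have "norm (\<Lambda>' t) \<ge> norm (\<Lambda>' t - \<Lambda>' b) - norm (\<Lambda>' b)" using norm_triangle_ineq4[of "\<Lambda>' t" "\<Lambda>' b"] by linarith
    moreover have "norm (\<Lambda> t - \<Lambda> b) \<ge> norm (\<Lambda> t) - norm (\<Lambda> b)" using norm_triangle_ineq2 by blast
    ultimately show ?thesis using half unfolding \<Lambda>_def \<Lambda>'_def by linarith
  qed
  \<comment> \<open>The threshold \<open>4 * B\<close> lies above the fixed point
    \<open>3 * B\<close> of the map that sends \<open>x\<close> to \<open>2 * x - 3 * B\<close>, so
    it is preserved by \<open>step\<close>.\<close>
  define G where "G t \<longleftrightarrow> norm (\<gamma> t) \<ge> \<rho>2 \<and> norm (L (\<gamma> t)) > 4 * B" for t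
  have G1: "G (t + 1)" if "G t" "t \<le> T1 - 1" for t
  proof -
    have t: "t \<le> T1" "norm (\<gamma> t) \<ge> \<rho>2" using that by (auto simp: G_def)
    have 1: "norm (L (\<gamma> (t + 1))) > 4 * B" using step[OF t] that(1) B(1) by (auto simp: G_def)
    have "norm (\<gamma> (t + 1)) \<ge> \<rho>2"
    proof (rule ccontr)
      assume "\<not> ?thesis"
      then have "norm (\<gamma> (t + 1)) \<le> m" unfolding m_def m1_def by linarith
      then show False using B(2)[of "\<gamma> (t + 1)"] big2[OF t] 1 B(1) unfolding f\<gamma> by auto
    qed
    then show ?thesis using 1 by (simp add: G_def)
  qed
  have Gn: "G (t + real n)" if "G t" "t + real n \<le> T1" for t n
    using that(2)
  proof (induction n)
    case 0 then show ?case using that by simp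
  next
    case (Suc n)
    then have "G (t + real n + 1)" using G1[of "t + real n"] by simp
    then show ?case by (simp add: add_ac)
  qed
  have Gw: "\<not> G t" if "T1 - 1 \<le> t" "t \<le> T1" for t
  proof
    assume "G t"
    then have "norm (\<gamma> (t + 1)) > R1" using big1 that by (auto simp: G_def)
    moreover have "norm (\<gamma> t) \<le> m" using m0[of t] that unfolding m_def m1_def T1_def by auto
    ultimately show False using B(2)[of "\<gamma> t"] \<open>G t\<close> B(1) unfolding f\<gamma> G_def by auto
  qed
  obtain t where t: "t \<le> T0" "norm (\<gamma> t) > max (max m \<rho>2) (exp (4 * B))"
    using unb unfolding bounded_iff image_iff by (metis (no_types, lifting) atMost_iff image_eqI image_iff not_le)
  have t1: "t < T1 - 1" using m0[of t] t unfolding m_def m1_def by force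
  have "G t"
  proof -
    have "norm (\<gamma> (t + 1)) > R1" using big1[of t] t1 t by auto
    then have e: "exp (L (\<gamma> t)) = \<gamma> t" using L(2)[of "\<gamma> t"] R1 unfolding f\<gamma> by simp
    have "exp (4 * B) < exp (Re (L (\<gamma> t)))" using t e norm_exp_eq_Re[of "L (\<gamma> t)"] by auto
    then have "4 * B < Re (L (\<gamma> t))" by simp
    then show ?thesis using complex_Re_le_cmod[of "L (\<gamma> t)"] t unfolding G_def by auto
  qed
  define n where "n = nat \<lfloor>T1 - t\<rfloor>"
  have "real n \<le> T1 - t" "T1 - t < real n + 1" using t1 unfolding n_def by auto
  then show False using Gn[OF \<open>G t\<close>, of n] Gw[of "t + real n"] by auto
qed

end

section \<open>Accumulation sets and inverse branches along a ray\<close>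

text \<open>As a nested intersection the accumulation set inherits connectedness and compactness
  from the closures of the tails.\<close>

lemma accumulation_set_eq: "accumulation_set \<gamma> = (\<Inter>n. closure (\<gamma> ` {..-real n}))"
proof (intro equalityI subsetI)
  fix z assume "z \<in> accumulation_set \<gamma>"
  then obtain t where t: "filterlim t at_bot sequentially" "(\<lambda>n. \<gamma> (t n)) \<longlonglongrightarrow> z"
    by (auto simp: accumulation_set_def)
  show "z \<in> (\<Inter>n. closure (\<gamma> ` {..-real n}))"
  proof
    fix n
    have ev: "eventually (\<lambda>k. \<gamma> (t k) \<in> closure (\<gamma> ` {..-real n})) sequentially"
      using t(1) unfolding filterlim_at_bot by (auto elim!: allE[of _ "- real n"] eventually_mono intro!: closure_subset[THEN subsetD])
    show "z \<in> closure (\<gamma> ` {..-real n})"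
      by (rule Lim_in_closed_set[OF closed_closure ev sequentially_bot t(2)])
  qed
next
  fix z assume z: "z \<in> (\<Inter>n. closure (\<gamma> ` {..-real n}))"
  have "\<exists>t. t \<le> - real n \<and> dist (\<gamma> t) z < 1 / real (Suc n)" for n
  proof -
    have "z \<in> closure (\<gamma> ` {..-real n})" using z by blast
    then show ?thesis unfolding closure_approachable by (auto elim!: allE[of _ "1 / real (Suc n)"])
  qed
  then obtain t where t: "\<And>n. t n \<le> - real n" "\<And>n. dist (\<gamma> (t n)) z < 1 / real (Suc n)" by metis
  have "filterlim t at_bot sequentially"
    by (rule filterlim_at_bot_mono[OF filterlim_uminus_at_bot_at_top[THEN filterlim_compose, OF filterlim_real_sequentially]]) (use t(1) in auto)
  moreover have "(\<lambda>n. \<gamma> (t n)) \<longlonglongrightarrow> z"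
    unfolding tendsto_dist_iff[of _ z]
    by (rule tendsto_sandwich[OF _ _ tendsto_const LIMSEQ_Suc[OF lim_inverse_n']]) (use less_imp_le[OF t(2)] in auto)
  ultimately show "z \<in> accumulation_set \<gamma>" unfolding accumulation_set_def by blast
qed

lemma accumulation_subsequence:
  assumes t: "filterlim t at_bot sequentially" and b: "\<And>n. norm (\<gamma> (t n)) \<le> B"
  obtains z r where "z \<in> accumulation_set \<gamma>" "strict_mono r" "(\<lambda>n. \<gamma> (t (r n))) \<longlonglongrightarrow> z"
proof -
  obtain z r where zr: "strict_mono (r::nat\<Rightarrow>nat)" "((\<lambda>n. \<gamma> (t n)) \<circ> r) \<longlonglongrightarrow> z"
    using compact_cball[of "0::complex" B, unfolded compact_def, rule_format, of "\<lambda>n. \<gamma> (t n)"] b by auto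
  have "filterlim (\<lambda>n. t (r n)) at_bot sequentially"
    using filterlim_compose[OF t filterlim_subseq[OF zr(1)]] .
  then show thesis using zr by (intro that[of z r]) (auto simp: accumulation_set_def o_def)
qed

lemma tail_near_accumulation:
  assumes b: "bounded (\<gamma> ` {..T0})" and V: "open V" "accumulation_set \<gamma> \<subseteq> V"
  obtains T where "\<And>t. t \<le> T \<Longrightarrow> \<gamma> t \<in> V"
proof (rule ccontr)
  assume "\<not> thesis"
  then have "\<forall>T. \<exists>t\<le>T. \<gamma> t \<notin> V" using that by blast
  then have "\<exists>t. t \<le> min T0 (- real n) \<and> \<gamma> t \<notin> V" for n by blast
  then obtain t where t: "\<And>n. t n \<le> min T0 (- real n)" "\<And>n. \<gamma> (t n) \<notin> V" by metis
  obtain B where B: "\<And>s. s \<le> T0 \<Longrightarrow> norm (\<gamma> s) \<le> B" using b unfolding bounded_iff by auto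
  have "filterlim t at_bot sequentially"
    by (rule filterlim_at_bot_mono[OF filterlim_uminus_at_bot_at_top[THEN filterlim_compose, OF filterlim_real_sequentially]]) (use t(1) in auto)
  then obtain z r where z: "z \<in> accumulation_set \<gamma>" "strict_mono r" "(\<lambda>n. \<gamma> (t (r n))) \<longlonglongrightarrow> z"
    using accumulation_subsequence[of t \<gamma> B] B t(1) by (metis min.bounded_iff)
  then have "eventually (\<lambda>n. \<gamma> (t (r n)) \<in> V) sequentially" using V topological_tendstoD by blast
  then show False using t(2) by auto
qed

lemma accumulation_compact_connected:
  assumes c: "continuous_on UNIV \<gamma>" and b: "bounded (\<gamma> ` {..T0})"
  shows "compact (accumulation_set \<gamma>)" "connected (accumulation_set \<gamma>)" "accumulation_set \<gamma> \<noteq> {}"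
proof -
  define k where "k = nat \<lceil>\<bar>T0\<bar>\<rceil>"
  have k: "- real k \<le> T0" unfolding k_def by linarith
  have com: "compact (closure (\<gamma> ` {..-real k}))"
    unfolding compact_closure using b by (rule bounded_subset) (use k in auto)
  have con: "connected (closure (\<gamma> ` {..-real n}))" for n
    by (intro connected_imp_connected_closure connected_continuous_image continuous_on_subset[OF c]) auto
  show "connected (accumulation_set \<gamma>)" unfolding accumulation_set_eq
    by (rule connected_nest_gen[where k=k]) (use con com in \<open>auto intro!: closure_mono\<close>)
  have "accumulation_set \<gamma> = closure (\<gamma> ` {..-real k}) \<inter> accumulation_set \<gamma>" unfolding accumulation_set_eq by auto
  moreover have "closed (accumulation_set \<gamma>)" unfolding accumulation_set_eq by auto
  ultimately show "compact (accumulation_set \<gamma>)" using com by (metis compact_Int_closed)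
  show "accumulation_set \<gamma> \<noteq> {}"
  proof
    assume "accumulation_set \<gamma> = {}"
    then show False using tail_near_accumulation[OF b, of "{}"] by (metis empty_iff empty_subsetI open_empty order_refl)
  qed
qed

lemma filterlim_shift_at_bot: "filterlim t at_bot F \<Longrightarrow> filterlim (\<lambda>n. t n + c) at_bot F" for c :: real
  unfolding filterlim_at_bot by (subst le_diff_eq[symmetric]) blast

lemma accumulation_invariant:
  assumes f: "continuous_on UNIV f" and f\<gamma>: "\<And>t. f (\<gamma> t) = \<gamma> (t + 1)"
  shows "f ` accumulation_set \<gamma> \<subseteq> accumulation_set \<gamma>"
    and "bounded (\<gamma> ` {..T0}) \<Longrightarrow> accumulation_set \<gamma> \<subseteq> f ` accumulation_set \<gamma>"
proof -
  have fc: "isCont f z" for z using f by (simp add: continuous_on_eq_continuous_at)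
  show "f ` accumulation_set \<gamma> \<subseteq> accumulation_set \<gamma>"
  proof clarify
    fix z assume "z \<in> accumulation_set \<gamma>"
    then obtain t where t: "filterlim t at_bot sequentially" "(\<lambda>n. \<gamma> (t n)) \<longlonglongrightarrow> z"
      by (auto simp: accumulation_set_def)
    have "(\<lambda>n. \<gamma> (t n + 1)) \<longlonglongrightarrow> f z" using isCont_tendsto_compose[OF fc t(2)] f\<gamma> by simp
    then show "f z \<in> accumulation_set \<gamma>"
      using filterlim_shift_at_bot[OF t(1), of 1] unfolding accumulation_set_def by blast
  qed
  assume b: "bounded (\<gamma> ` {..T0})"
  show "accumulation_set \<gamma> \<subseteq> f ` accumulation_set \<gamma>"
  proof
    fix z assume "z \<in> accumulation_set \<gamma>"
    then obtain t where t: "filterlim t at_bot sequentially" "(\<lambda>n. \<gamma> (t n)) \<longlonglongrightarrow> z"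
      by (auto simp: accumulation_set_def)
    obtain B where B: "\<And>s. s \<le> T0 \<Longrightarrow> norm (\<gamma> s) \<le> B" using b unfolding bounded_iff by auto
    have "eventually (\<lambda>n. t n - 1 \<le> T0) sequentially"
      using t(1) unfolding filterlim_at_bot by (auto elim!: allE[of _ "T0"] eventually_mono)
    then obtain M where M: "\<And>n. n \<ge> M \<Longrightarrow> t n - 1 \<le> T0" unfolding eventually_sequentially by blast
    have fl: "filterlim (\<lambda>n. t (n + M) + -1) at_bot sequentially"
      by (intro filterlim_shift_at_bot filterlim_compose[OF t(1)] filterlim_add_const_nat_at_top)
    obtain w r where w: "w \<in> accumulation_set \<gamma>" "strict_mono r" "(\<lambda>n. \<gamma> (t (r n + M) + -1)) \<longlonglongrightarrow> w"
      using accumulation_subsequence[OF fl, of \<gamma> B] B M by (metis add_uminus_conv_diff le_add2)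
    have "(\<lambda>n. \<gamma> (t (r n + M))) \<longlonglongrightarrow> f w" using isCont_tendsto_compose[OF fc w(3)] f\<gamma> by simp
    moreover have "(\<lambda>n. \<gamma> (t (r n + M))) \<longlonglongrightarrow> z"
      using LIMSEQ_subseq_LIMSEQ[OF LIMSEQ_ignore_initial_segment[OF t(2), of M] w(2)] by (simp add: o_def)
    ultimately have "f w = z" using LIMSEQ_unique by blast
    then show "z \<in> f ` accumulation_set \<gamma>" using w(1) by blast
  qed
qed

text \<open>Pairs that violate injectivity in shrinking neighbourhoods accumulate at a pair in
  \<open>A\<close> with equal images, hence at a single point, where \<open>f\<close> is locally
  injective.\<close>

lemma inj_on_nbhd_compact:
  fixes f :: "complex \<Rightarrow> complex"
  assumes hol: "f holomorphic_on UNIV" and A: "compact A" "inj_on f A" "\<And>z. z \<in> A \<Longrightarrow> deriv f z \<noteq> 0"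
  obtains V where "open V" "A \<subseteq> V" "inj_on f V"
proof -
  have fc: "isCont f z" for z
    using holomorphic_on_imp_continuous_on[OF hol] by (simp add: continuous_on_eq_continuous_at)
  define V where "V n = (\<Union>a\<in>A. ball a (1 / real (Suc n)))" for n
  have V: "open (V n)" "A \<subseteq> V n" for n unfolding V_def by auto
  have "\<exists>n. inj_on f (V n)"
  proof (rule ccontr)
    assume "\<nexists>n. inj_on f (V n)"
    then have "\<exists>x y. x \<in> V n \<and> y \<in> V n \<and> x \<noteq> y \<and> f x = f y" for n unfolding inj_on_def by blast
    then obtain x y where xy: "\<And>n. x n \<in> V n" "\<And>n. y n \<in> V n" "\<And>n. x n \<noteq> y n" "\<And>n. f (x n) = f (y n)" by metis
    have "\<exists>a b. a \<in> A \<and> b \<in> A \<and> dist a (x n) < 1 / real (Suc n) \<and> dist b (y n) < 1 / real (Suc n)" for n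
      using xy(1,2)[of n] unfolding V_def by auto
    then obtain a b where ab: "\<And>n. a n \<in> A" "\<And>n. b n \<in> A" "\<And>n. dist (a n) (x n) < 1 / real (Suc n)"
      "\<And>n. dist (b n) (y n) < 1 / real (Suc n)" by metis
    obtain p r where p: "p \<in> A \<times> A" "strict_mono (r::nat\<Rightarrow>nat)" "((\<lambda>n. (a n, b n)) \<circ> r) \<longlonglongrightarrow> p"
      using compact_Times[OF A(1) A(1), unfolded compact_def, rule_format, of "\<lambda>n. (a n, b n)"] ab by auto
    obtain u v where uv: "p = (u, v)" by force
    have "(\<lambda>n. fst (((\<lambda>n. (a n, b n)) \<circ> r) n)) \<longlonglongrightarrow> fst p" "(\<lambda>n. snd (((\<lambda>n. (a n, b n)) \<circ> r) n)) \<longlonglongrightarrow> snd p"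
      by (rule tendsto_fst[OF p(3)], rule tendsto_snd[OF p(3)])
    then have au: "(\<lambda>n. a (r n)) \<longlonglongrightarrow> u" "(\<lambda>n. b (r n)) \<longlonglongrightarrow> v" unfolding uv by (simp_all add: o_def)
    have inv: "(\<lambda>n. 1 / real (Suc (r n))) \<longlonglongrightarrow> 0"
      using LIMSEQ_subseq_LIMSEQ[OF LIMSEQ_Suc[OF lim_inverse_n'] p(2)] by (simp add: o_def)
    have "(\<lambda>n. a (r n) - x (r n)) \<longlonglongrightarrow> 0"
      by (rule Lim_null_comparison[OF _ inv]) (use ab in \<open>auto simp: dist_norm intro!: always_eventually less_imp_le\<close>)
    then have xu: "(\<lambda>n. x (r n)) \<longlonglongrightarrow> u" using tendsto_diff[OF au(1)] by fastforce
    have "(\<lambda>n. b (r n) - y (r n)) \<longlonglongrightarrow> 0"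
      by (rule Lim_null_comparison[OF _ inv]) (use ab in \<open>auto simp: dist_norm intro!: always_eventually less_imp_le\<close>)
    then have yv: "(\<lambda>n. y (r n)) \<longlonglongrightarrow> v" using tendsto_diff[OF au(2)] by fastforce
    have "f u = f v"
      using isCont_tendsto_compose[OF fc xu] isCont_tendsto_compose[OF fc yv] unfolding xy(4) by (rule LIMSEQ_unique)
    then have uv': "u = v" "u \<in> A" using A(2) p(1) unfolding uv inj_on_def by auto
    obtain e where e: "e > 0" "inj_on f (ball u e)"
      using has_complex_derivative_locally_injective[OF hol, of u] A(3)[OF uv'(2)] by auto
    have "eventually (\<lambda>n. x (r n) \<in> ball u e \<and> y (r n) \<in> ball u e) sequentially"
      using topological_tendstoD[OF xu, of "ball u e"] topological_tendstoD[OF yv, of "ball u e"] e(1) uv'(1)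
      by (auto intro: eventually_conj)
    then obtain n where "x (r n) \<in> ball u e" "y (r n) \<in> ball u e" by (auto simp: eventually_sequentially)
    then show False using e(2) xy(3,4) unfolding inj_on_def by blast
  qed
  then show thesis using that V by blast
qed

text \<open>The common ground of the two parts: a single branch near \<open>A\<close> that shifts
  time by \<open>- 1\<close> along the tail of the ray. Forward invariance of \<open>A\<close>
  follows from continuity, whereas backward invariance under \<open>g\<close> is a genuine choice of
  branch.\<close>

locale ray_inverse =
  fixes f :: "complex \<Rightarrow> complex" and \<gamma> :: "real \<Rightarrow> complex" and A N :: "complex set" and g :: "complex \<Rightarrow> complex" and T :: real
  assumes hol: "f holomorphic_on UNIV" and trans: "\<nexists>p. \<forall>z. f z = poly p z"
    and \<gamma>c: "continuous_on UNIV \<gamma>" and \<gamma>inf: "filterlim (\<lambda>t. norm (\<gamma> t)) at_top at_top" and f\<gamma>: "f (\<gamma> t) = \<gamma> (t + 1)"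
    and A_eq: "A = accumulation_set \<gamma>" and bd: "bounded (\<gamma> ` {..T})"
    and N: "open N" "A \<subseteq> N" "g holomorphic_on N" and fg: "z \<in> N \<Longrightarrow> f (g z) = z" and gA: "g ` A \<subseteq> A"
    and \<gamma>N: "t \<le> T \<Longrightarrow> \<gamma> t \<in> N" and g\<gamma>: "t \<le> T \<Longrightarrow> g (\<gamma> t) = \<gamma> (t - 1)"

text \<open>The inverse \<open>G\<close> is bounded on the compact parts of the ray closure, which
  is properness along the ray. Then \<open>A\<close> is compact and lies in the closure of the ray,
  so \<open>f\<close> is injective on \<open>A\<close>; without critical points there it is
  injective near \<open>A\<close>, and \<open>g\<close> is its inverse.\<close>

lemma homeomorphism_ray_inverse:
  assumes cl: "f \<in> eremenko_lyubich_class" and ray: "fixed_ray f \<gamma>"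
    and G: "homeomorphism (closure (range \<gamma>)) (closure (range \<gamma>)) f G"
    and cp: "\<forall>z \<in> accumulation_set \<gamma>. \<not> critical_point f z"
  obtains N g T where "ray_inverse f \<gamma> (accumulation_set \<gamma>) N g T"
proof -
  have hol: "f holomorphic_on UNIV" and trans: "\<nexists>p. \<forall>z. f z = poly p z" and bs: "bounded (singular_values f)"
    using cl by (auto simp: eremenko_lyubich_class_def transcendental_entire_def)
  have \<gamma>: "continuous_on UNIV \<gamma>" "filterlim (\<lambda>t. norm (\<gamma> t)) at_top at_top" "\<And>t. f (\<gamma> t) = \<gamma> (t + 1)"
    using ray by (auto simp: fixed_ray_def)
  have fc: "continuous_on UNIV f" using holomorphic_on_imp_continuous_on[OF hol] .
  obtain b where b: "\<And>z. z \<in> singular_values f \<Longrightarrow> norm z \<le> b" using bs unfolding bounded_iff by blast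
  define R0 where "R0 = max b (norm (f 0)) + 1"
  interpret bounded_singular f R0
    by unfold_locales (use hol trans b in \<open>force simp: R0_def subset_iff\<close>)+
  define A where "A = accumulation_set \<gamma>"
  let ?Y = "closure (range \<gamma>)"
  have \<gamma>Y: "\<gamma> t \<in> ?Y" for t by (meson closure_subset rangeI subsetD)
  have "\<exists>y. \<forall>t\<le>0. norm (\<gamma> (t + 1)) \<le> x \<longrightarrow> norm (\<gamma> t) \<le> y" for x
  proof -
    have "compact (?Y \<inter> cball 0 x)" by (intro closed_Int_compact) auto
    moreover have "continuous_on (?Y \<inter> cball 0 x) G"
      using G by (auto simp: homeomorphism_def intro: continuous_on_subset)
    ultimately have "bounded (G ` (?Y \<inter> cball 0 x))" using compact_continuous_image compact_imp_bounded by blast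
    then obtain y where y: "\<And>z. z \<in> ?Y \<inter> cball 0 x \<Longrightarrow> norm (G z) \<le> y" unfolding bounded_iff by blast
    have "G (\<gamma> (t + 1)) = \<gamma> t" for t using G \<gamma>Y[of t] \<gamma>(3)[of t] unfolding homeomorphism_def by metis
    then have "norm (\<gamma> t) \<le> y" if "norm (\<gamma> (t + 1)) \<le> x" for t
      using y[of "\<gamma> (t + 1)"] \<gamma>Y that by auto
    then show ?thesis by blast
  qed
  then have bd: "bounded (\<gamma> ` {..0})" by (rule proper_imp_bounded_tail[OF \<gamma>(1,3)])
  note AC = accumulation_compact_connected[OF \<gamma>(1) bd, folded A_def]
  have AI: "f ` A \<subseteq> A" "A \<subseteq> f ` A"
    unfolding A_def using accumulation_invariant[of f \<gamma>] fc \<gamma>(3) bd by metis+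
  have "A \<subseteq> closure (\<gamma> ` {..- real 0})" unfolding A_def accumulation_set_eq by blast
  also have "\<dots> \<subseteq> ?Y" by (intro closure_mono) auto
  finally have AY: "A \<subseteq> ?Y" .
  have "inj_on f ?Y" using G unfolding homeomorphism_def by (metis inj_on_inverseI)
  then have "inj_on f A" using AY inj_on_subset by blast
  moreover have "\<And>z. z \<in> A \<Longrightarrow> deriv f z \<noteq> 0" using cp by (auto simp: A_def critical_point_def)
  ultimately obtain V where V: "open V" "A \<subseteq> V" "inj_on f V" using inj_on_nbhd_compact[OF hol AC(1)] by metis
  have hV: "f holomorphic_on V" using hol by (rule holomorphic_on_subset) auto
  obtain g where g: "g holomorphic_on (f ` V)" "\<And>z. z \<in> V \<Longrightarrow> g (f z) = z"
    using holomorphic_has_inverse[OF hV V(1,3)] by metis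
  obtain T' where T': "\<And>t. t \<le> T' \<Longrightarrow> \<gamma> t \<in> V" using tail_near_accumulation[OF bd V(1)] V(2) A_def by metis
  define T where "T = min 0 T'"
  have "ray_inverse f \<gamma> A (f ` V) g T"
  proof
    show "bounded (\<gamma> ` {..T})" using bd by (rule bounded_subset) (auto simp: T_def)
    show "open (f ` V)" by (rule open_mapping_thm3[OF hV V(1,3)])
    show "A \<subseteq> f ` V" using AI(2) V(2) by blast
    show "f (g z) = z" if "z \<in> f ` V" for z using g(2) that by auto
    show "g ` A \<subseteq> A"
    proof clarify
      fix z assume "z \<in> A"
      then obtain a where "a \<in> A" "z = f a" using AI(2) by blast
      then show "g z \<in> A" using g(2)[of a] V(2) by auto
    qed
    fix t assume "t \<le> T"
    then have *: "\<gamma> (t - 1) \<in> V" "\<gamma> t = f (\<gamma> (t - 1))" using T'[of "t-1"] \<gamma>(3)[of "t - 1"] by (auto simp: T_def)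
    show "\<gamma> t \<in> f ` V" using * by blast
    show "g (\<gamma> t) = \<gamma> (t - 1)" using * g(2) by simp
  qed (use hol trans \<gamma> g(1) A_def in auto)
  then show thesis using that unfolding A_def by blast
qed

section \<open>Barriers against spiralling\<close>

text \<open>The coordinate in which a curve is not confined is clamped to the rectangle, so that
  Fashoda's theorem applies. At the resulting meeting point the strict bounds on the other curve
  show that no clamping took place.\<close>

lemma curves_cross:
  assumes c: "path c" and e: "path e"
    and cx: "\<And>t. t \<in> {0..1} \<Longrightarrow> x1 < Re (c t) \<and> Re (c t) < x2"
    and ey: "\<And>t. t \<in> {0..1} \<Longrightarrow> y1 < Im (e t) \<and> Im (e t) < y2"
    and ends: "Im (c 0) \<le> y1" "y2 \<le> Im (c 1)" "Re (e 0) \<le> x1" "x2 \<le> Re (e 1)"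
  obtains s t where "s \<in> {0..1}" "t \<in> {0..1}" "e s = c t"
proof -
  have x: "x1 < x2" using cx[of 0] by auto
  have y: "y1 < y2" using ey[of 0] by auto
  define F :: "real \<Rightarrow> real^2" where "F t = vector [max x1 (min x2 (Re (e t))), Im (e t)]" for t
  define K :: "real \<Rightarrow> real^2" where "K t = vector [Re (c t), max y1 (min y2 (Im (c t)))]" for t
  have F: "F t $ 1 = max x1 (min x2 (Re (e t)))" "F t $ 2 = Im (e t)" for t by (auto simp: F_def)
  have K: "K t $ 1 = Re (c t)" "K t $ 2 = max y1 (min y2 (Im (c t)))" for t by (auto simp: K_def)
  have vec: "(\<lambda>t. vector [a t, b t] :: real^2) = (\<lambda>t. a t *\<^sub>R axis 1 1 + b t *\<^sub>R axis 2 1)" for a b :: "real \<Rightarrow> real"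
    by (auto simp: vec_eq_iff forall_2 axis_def)
  have pF: "path F" using e unfolding path_def F_def[abs_def] vec by (intro continuous_intros)
  have pK: "path K" using c unfolding path_def K_def[abs_def] vec by (intro continuous_intros)
  obtain z where "z \<in> path_image F" "z \<in> path_image K"
  proof (rule fashoda[OF pF pK, of "vector [x1, y1]" "vector [x2, y2]"])
    show "path_image F \<subseteq> cbox (vector [x1, y1]) (vector [x2, y2])"
      using ey x by (auto simp: path_image_def mem_box_cart forall_2 F less_imp_le)
    show "path_image K \<subseteq> cbox (vector [x1, y1]) (vector [x2, y2])"
      using cx y by (auto simp: path_image_def mem_box_cart forall_2 K less_imp_le)
  qed (use ends x y in \<open>auto simp: pathstart_def pathfinish_def F K\<close>)
  then obtain s t where st: "s \<in> {0..1}" "t \<in> {0..1}" "F s = K t" by (auto simp: path_image_def)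
  have "max x1 (min x2 (Re (e s))) = Re (c t)" "Im (e s) = max y1 (min y2 (Im (c t)))"
    using arg_cong[OF st(3), of "\<lambda>v::real^2. v $ 1"] arg_cong[OF st(3), of "\<lambda>v::real^2. v $ 2"] unfolding F K .
  then have "Re (e s) = Re (c t)" "Im (e s) = Im (c t)"
    using cx[OF st(2)] ey[OF st(1)] by (auto simp: max_def min_def split: if_splits)
  then show thesis using that st by (simp add: complex_eqI)
qed

text \<open>Let \<open>n\<close> be the first step at which an image of the vertical segment
  \<open>V\<close> below \<open>z\<close> leaves the strip. Height grows by at most the factor
  \<open>C'\<close> per step, so \<open>n\<close> is large, and the image of \<open>V\<close> has
  meanwhile drifted far to the left. A translate of \<open>\<Gamma>\<close> can therefore be chosen
  that starts to the left of this image and ends to its right, while its entire part up to time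
  \<open>Tc\<close> lies to the left of \<open>V\<close>. The two curves cross, and pulling the
  crossing back by \<open>n\<close> steps gives a point of \<open>V\<close> on that part of the
  translate.\<close>

lemma no_spiral_left:
  fixes G :: "complex \<Rightarrow> complex" and \<Gamma> :: "real \<Rightarrow> complex"
  defines "S h \<equiv> {z. 0 < Im z \<and> Im z < h}"
  assumes h: "h > 0" and \<delta>: "\<delta> > 0" and cG: "continuous_on (S h) G"
    and GIm: "\<And>z. z \<in> S h \<Longrightarrow> 0 < Im (G z) \<and> Im (G z) \<le> C * Im z"
    and GRe: "\<And>z. z \<in> S h \<Longrightarrow> Re z - D \<le> Re (G z) \<and> Re (G z) \<le> Re z - \<delta>"
    and per: "\<And>z j. z \<in> S h \<Longrightarrow> G (z + of_real (2 * pi * of_int j)) = G z + of_real (2 * pi * of_int j)"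
    and \<Gamma>c: "continuous_on UNIV \<Gamma>" and \<Gamma>0: "\<And>t. 0 < Im (\<Gamma> t)"
    and low: "\<And>t. t \<le> Tc \<Longrightarrow> Im (\<Gamma> t) < h" and high: "\<And>t. t > Tb \<Longrightarrow> h \<le> Im (\<Gamma> t)"
    and G\<Gamma>: "\<And>t. t \<le> Tc \<Longrightarrow> G (\<Gamma> t) = \<Gamma> (t - 1)"
    and bck: "\<And>z s j. z \<in> S h \<Longrightarrow> G z = \<Gamma> s + of_real (2 * pi * of_int j) \<Longrightarrow> \<exists>j'. z = \<Gamma> (s + 1) + of_real (2 * pi * of_int j')"
  obtains r where "0 < r" "r \<le> h" "\<And>z n. 0 < Im z \<Longrightarrow> Im z < r \<Longrightarrow> (G ^^ n) z \<in> S h"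
proof -
  define C' where "C' = max C 1"
  have C': "C' \<ge> 1" "C' \<ge> C" unfolding C'_def by auto
  have GIm': "Im (G z) \<le> C' * Im z" if "z \<in> S h" for z
    using GIm[OF that] mult_right_mono[OF C'(2), of "Im z"] that unfolding S_def mem_Collect_eq by linarith
  have Gn: "G ((\<Gamma> t)) = \<Gamma> (t - 1) \<and> \<Gamma> t \<in> S h" if "t \<le> Tc" for t using that G\<Gamma> low \<Gamma>0 by (auto simp: S_def)
  have Rn: "Re (\<Gamma> (t - real n)) \<le> Re (\<Gamma> t) - real n * \<delta>" if "t \<le> Tc" for t n
  proof (induction n)
    case (Suc n)
    have "G (\<Gamma> (t - real n)) = \<Gamma> (t - real (Suc n))" using Gn[of "t - real n"] that by (simp add: algebra_simps)
    then show ?case using Suc GRe[of "\<Gamma> (t - real n)"] Gn[of "t - real n"] that by (simp add: algebra_simps)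
  qed simp
  have "compact (\<Gamma> ` {Tc-1..Tc})" by (intro compact_continuous_image continuous_on_subset[OF \<Gamma>c]) auto
  then have "bounded (\<Gamma> ` {Tc-1..Tc})" by (rule compact_imp_bounded)
  then obtain K where K0: "\<forall>x\<in>\<Gamma> ` {Tc-1..Tc}. norm x \<le> K" unfolding bounded_iff by blast
  \<comment> \<open>Backwards in time the curve moves left at each unit step, so its rightmost
    extent up to \<open>Tc\<close> is already bounded by the last unit of time.\<close>
  have K: "Re (\<Gamma> t) \<le> K" if "t \<le> Tc" for t
  proof -
    define n where "n = nat \<lfloor>Tc - t\<rfloor>"
    have n: "real n \<le> Tc - t" "Tc - t < real n + 1" using that unfolding n_def by auto
    then have "\<Gamma> (t + real n) \<in> \<Gamma> ` {Tc-1..Tc}" by auto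
    then have "norm (\<Gamma> (t + real n)) \<le> K" using K0 by blast
    then have "Re (\<Gamma> (t + real n)) \<le> K" using complex_Re_le_cmod[of "\<Gamma> (t + real n)"] by linarith
    moreover have "Re (\<Gamma> (t + real n - real n)) \<le> Re (\<Gamma> (t + real n)) - real n * \<delta>"
      by (rule Rn) (use n in auto)
    moreover have "0 \<le> real n * \<delta>" using \<delta> by simp
    ultimately show ?thesis by simp
  qed
  have minIm: "\<exists>\<mu>>0. \<forall>t\<in>{a..b}. \<mu> \<le> Im (\<Gamma> t)" for a b
  proof (cases "a \<le> b")
    case True
    have "\<exists>x\<in>{a..b}. \<forall>y\<in>{a..b}. Im (\<Gamma> x) \<le> Im (\<Gamma> y)"
      by (rule continuous_attains_inf) (use True in \<open>auto intro!: continuous_intros continuous_on_subset[OF \<Gamma>c]\<close>)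
    then show ?thesis using \<Gamma>0 by blast
  qed (auto intro: exI[of _ 1])
  obtain \<mu> where \<mu>: "\<mu> > 0" "\<And>t. Tc \<le> t \<Longrightarrow> t \<le> Tb \<Longrightarrow> \<mu> \<le> Im (\<Gamma> t)" using minIm[of Tc Tb] by auto
  \<comment> \<open>After \<open>n0\<close> steps the drift exceeds the distance from
    \<open>\<Gamma> Tc\<close> to the right bound \<open>K\<close> plus one period; the period is
    lost in rounding to an integer \<open>j\<close>.\<close>
  obtain n0 :: nat where n0: "real n0 * \<delta> > K - Re (\<Gamma> Tc) + 2 * pi"
    using reals_Archimedean3[OF \<delta>] by blast
  \<comment> \<open>Below \<open>\<mu>\<close> the curve can only be found at times up to
    \<open>Tc\<close>; below \<open>h / C' ^ n0\<close> an orbit needs more than \<open>n0\<close>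
    steps to climb to height \<open>h\<close>.\<close>
  define r where "r = min (min h \<mu>) (h / C' ^ n0)"
  have Cn0: "C' ^ n > 0" for n using C' by auto
  have r: "r > 0" "r \<le> h" "r \<le> \<mu>" "r \<le> h / C' ^ n0" using h \<mu>(1) Cn0[of n0] unfolding r_def by auto
  have main: "(G ^^ n) z \<in> S h" if z: "0 < Im z" "Im z < r" for z n
  proof (rule ccontr)
    define V where "V = {w. Re w = Re z \<and> 0 < Im w \<and> Im w \<le> Im z}"
    assume "(G ^^ n) z \<notin> S h"
    then have "\<exists>n. \<exists>v\<in>V. (G ^^ n) v \<notin> S h" using z unfolding V_def by auto
    then obtain n v where v: "v \<in> V" "(G ^^ n) v \<notin> S h" and least: "\<And>k w. k < n \<Longrightarrow> w \<in> V \<Longrightarrow> (G ^^ k) w \<in> S h"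
      using exists_least_iff[of "\<lambda>n. \<exists>v\<in>V. (G ^^ n) v \<notin> S h"] by blast
    have VS: "w \<in> S h" "Im w < r" if "w \<in> V" for w using that z r unfolding V_def S_def by auto
    have bd: "0 < Im ((G ^^ k) w) \<and> Im ((G ^^ k) w) \<le> C' ^ k * Im w \<and> Re z - real k * D \<le> Re ((G ^^ k) w) \<and> Re ((G ^^ k) w) \<le> Re z - real k * \<delta>"
      if "w \<in> V" "k \<le> n" for w k using that(2)
    proof (induction k)
      case 0 then show ?case using that(1) unfolding V_def by auto
    next
      case (Suc k)
      let ?u = "(G ^^ k) w"
      have u: "?u \<in> S h" using least[of k w] Suc that by auto
      have "C' * Im ?u \<le> C' * (C' ^ k * Im w)" using Suc C' by (intro mult_left_mono) auto
      then show ?case using Suc GIm[OF u] GIm'[OF u] GRe[OF u] by (auto simp: algebra_simps)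
    qed
    have cont: "continuous_on V (G ^^ k)" if "k \<le> n" for k using that
    proof (induction k)
      case (Suc k)
      then have "continuous_on V (G ^^ k)" by simp
      moreover have "continuous_on ((G ^^ k) ` V) G" by (rule continuous_on_subset[OF cG]) (use least[of k] Suc in auto)
      ultimately show ?case using continuous_on_compose[of V "G ^^ k" G] by simp
    qed simp
    have vh: "h \<le> Im ((G ^^ n) v)" using bd[OF v(1), of n] v(2) unfolding S_def by auto
    have nn0: "n0 < n"
    proof (rule ccontr)
      assume "\<not> n0 < n"
      then have "C' ^ n \<le> C' ^ n0" using C' by (intro power_increasing) auto
      then have "C' ^ n * Im v \<le> C' ^ n0 * Im v" using v(1) unfolding V_def by (intro mult_right_mono) auto
      also have "\<dots> < C' ^ n0 * r" using VS(2)[OF v(1)] Cn0[of n0] by (intro mult_strict_left_mono) auto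
      also have "\<dots> \<le> h" using r(4) Cn0[of n0] by (simp add: field_simps)
      finally show False using vh bd[OF v(1), of n] by linarith
    qed
    \<comment> \<open>The largest translate whose part up to \<open>Tc\<close> is strictly to the
      left of \<open>V\<close>.\<close>
    define j where "j = \<lceil>(Re z - K) / (2 * pi)\<rceil> - 1"
    have j: "2 * pi * of_int j < Re z - K" "Re z - K - 2 * pi \<le> 2 * pi * of_int j"
    proof -
      have "of_int j < (Re z - K) / (2 * pi)" "(Re z - K) / (2 * pi) \<le> of_int j + 1" unfolding j_def by linarith+
      then show "2 * pi * of_int j < Re z - K" "Re z - K - 2 * pi \<le> 2 * pi * of_int j"
        by (auto simp: field_simps)
    qed
    have "real n0 * \<delta> \<le> real n * \<delta>" using nn0 \<delta> by auto
    then have jx: "Re z - real n * \<delta> < Re (\<Gamma> Tc) + 2 * pi * of_int j" using j(2) n0 by linarith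
    obtain q :: nat where q: "real q * \<delta> > Re (\<Gamma> Tc) + 2 * pi * of_int j - Re z + real n * D"
      using reals_Archimedean3[OF \<delta>] by blast
    define t1 where "t1 = Tc - real q"
    have t1: "t1 \<le> Tc" "Re (\<Gamma> t1) + 2 * pi * of_int j < Re z - real n * D"
      using Rn[of Tc q] q unfolding t1_def by auto
    obtain \<mu>1 where \<mu>1: "\<mu>1 > 0" "\<And>t. t1 \<le> t \<Longrightarrow> t \<le> Tc \<Longrightarrow> \<mu>1 \<le> Im (\<Gamma> t)" using minIm[of t1 Tc] by auto
    \<comment> \<open>The lower end of the path is placed so low that even its image after
      \<open>n\<close> steps stays below the arc of \<open>\<Gamma>\<close> between
      \<open>t1\<close> and \<open>Tc\<close>.\<close>
    define ya where "ya = min (Im v) (\<mu>1 / (2 * C' ^ n))"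
    have Imv: "0 < Im v" "Im v \<le> Im z" "Re v = Re z" using v(1) unfolding V_def by auto
    have ya: "0 < ya" "ya \<le> Im v" "C' ^ n * ya \<le> \<mu>1 / 2"
    proof -
      show "0 < ya" "ya \<le> Im v" using Imv \<mu>1(1) Cn0[of n] unfolding ya_def by auto
      have "ya \<le> \<mu>1 / (2 * C' ^ n)" unfolding ya_def by simp
      then show "C' ^ n * ya \<le> \<mu>1 / 2" using Cn0[of n] by (simp add: field_simps)
    qed
    define L where "L t = Complex (Re z) (ya + t * (Im v - ya))" for t
    define E where "E t = \<Gamma> (t1 + t * (Tc - t1)) + of_real (2 * pi * of_int j)" for t
    have LV: "L t \<in> V" if "t \<in> {0..1}" for t
    proof -
      have "0 \<le> t * (Im v - ya)" "t * (Im v - ya) \<le> 1 * (Im v - ya)" using that ya by (auto intro: mult_left_le_one_le)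
      then show ?thesis using ya Imv unfolding L_def V_def by auto
    qed
    have L01: "L 0 \<in> V" "L 1 = v" using LV[of 0] Imv by (auto simp: L_def complex_eq_iff)
    have ts: "t1 \<le> t1 + t * (Tc - t1)" "t1 + t * (Tc - t1) \<le> Tc" if "t \<in> {0..1}" for t
    proof -
      have "0 \<le> t * (Tc - t1)" "t * (Tc - t1) \<le> 1 * (Tc - t1)" using that t1 by (auto intro: mult_left_le_one_le)
      then show "t1 \<le> t1 + t * (Tc - t1)" "t1 + t * (Tc - t1) \<le> Tc" by auto
    qed
    obtain s t where st: "s \<in> {0..1}" "t \<in> {0..1}" "E s = (G ^^ n) (L t)"
    proof (rule curves_cross[of "\<lambda>t. (G ^^ n) (L t)" E])
      have "continuous_on {0..1} L" unfolding L_def[abs_def] by (intro continuous_intros)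
      then show "path (\<lambda>t. (G ^^ n) (L t))" unfolding path_def
        using continuous_on_compose2[OF cont[of n]] LV by blast
      show "path E" unfolding path_def E_def by (intro continuous_intros continuous_on_compose2[OF \<Gamma>c]) auto
      show "Re (\<Gamma> t1) + 2 * pi * of_int j < Re ((G ^^ n) (L t)) \<and> Re ((G ^^ n) (L t)) < Re (\<Gamma> Tc) + 2 * pi * of_int j"
        if "t \<in> {0..1}" for t using bd[OF LV[OF that], of n] t1 jx by auto
      show "\<mu>1 / 2 < Im (E t) \<and> Im (E t) < h" if "t \<in> {0..1}" for t
        using \<mu>1(2)[OF ts[OF that]] \<mu>1(1) low[OF ts(2)[OF that]] by (simp add: E_def)
      have "Im ((G ^^ n) (L 0)) \<le> C' ^ n * ya" using bd[OF L01(1), of n] by (simp add: L_def)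
      then show "Im ((G ^^ n) (L 0)) \<le> \<mu>1 / 2" using ya(3) by linarith
    qed (use vh L01 in \<open>auto simp: E_def\<close>)
    define w where "w = L t"
    define s' where "s' = t1 + s * (Tc - t1)"
    have w: "w \<in> V" "(G ^^ n) w = \<Gamma> s' + of_real (2 * pi * of_int j)" "s' \<le> Tc"
      using LV[OF st(2)] st(3) ts[OF st(1)] by (auto simp: w_def s'_def E_def)
    \<comment> \<open>Each backward step may a priori change the translate. Once the pulled-back
      point is known to be low, iterating forwards again identifies \<open>j'\<close> with
      \<open>j\<close>.\<close>
    have "\<exists>j'. (G ^^ (n - k)) w = \<Gamma> (s' + real k) + of_real (2 * pi * of_int j')" if "k \<le> n" for k
      using that
    proof (induction k)
      case 0 then show ?case using w by auto
    next
      case (Suc k)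
      then obtain j' where j': "(G ^^ (n - k)) w = \<Gamma> (s' + real k) + of_real (2 * pi * of_int j')" by auto
      have "n - k = Suc (n - Suc k)" using Suc by simp
      then have "G ((G ^^ (n - Suc k)) w) = \<Gamma> (s' + real k) + of_real (2 * pi * of_int j')" using j' by simp
      moreover have "(G ^^ (n - Suc k)) w \<in> S h" using least[of "n - Suc k" w] w Suc by auto
      ultimately show ?case using bck[of "(G ^^ (n - Suc k)) w" "s' + real k" j'] by (simp add: add_ac)
    qed
    from this[of n] obtain j' where j': "w = \<Gamma> (s' + real n) + of_real (2 * pi * of_int j')" by auto
    have Imw: "Im (\<Gamma> (s' + real n)) < r" using arg_cong[OF j', of Im] VS(2)[OF w(1)] by simp
    have sn: "s' + real n \<le> Tc" using high[of "s' + real n"] \<mu>(2)[of "s' + real n"] Imw r by force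
    have "(G ^^ k) w = \<Gamma> (s' + real n - real k) + of_real (2 * pi * of_int j')" for k
    proof (induction k)
      case 0 then show ?case using j' by simp
    next
      case (Suc k)
      have "s' + real n - real k \<le> Tc" using sn by simp
      then show ?case using Suc Gn[of "s' + real n - real k"] per[of "\<Gamma> (s' + real n - real k)" j'] by (simp add: algebra_simps)
    qed
    from this[of n] w(2) have "of_real (2 * pi * of_int j) = (of_real (2 * pi * of_int j') :: complex)" by simp
    then have "Re w = Re (\<Gamma> (s' + real n)) + 2 * pi * of_int j" using arg_cong[OF j', of Re] by simp
    then show False using K[OF sn] j(1) w(1) unfolding V_def by auto
  qed
  show thesis using that[OF r(1,2) main] .
qed

text \<open>The drift to the right is conjugate to the drift to the left by reflection in the
  imaginary axis.\<close>

lemma no_spiral: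
  fixes G :: "complex \<Rightarrow> complex" and \<Gamma> :: "real \<Rightarrow> complex"
  defines "S h \<equiv> {z. 0 < Im z \<and> Im z < h}"
  assumes h: "h > 0" and \<delta>: "\<delta> > 0" and cG: "continuous_on (S h) G"
    and GIm: "\<And>z. z \<in> S h \<Longrightarrow> 0 < Im (G z) \<and> Im (G z) \<le> C * Im z"
    and GRe: "(\<forall>z \<in> S h. Re z - D \<le> Re (G z) \<and> Re (G z) \<le> Re z - \<delta>) \<or> (\<forall>z \<in> S h. Re z + \<delta> \<le> Re (G z) \<and> Re (G z) \<le> Re z + D)"
    and per: "\<And>z j. z \<in> S h \<Longrightarrow> G (z + of_real (2 * pi * of_int j)) = G z + of_real (2 * pi * of_int j)"
    and \<Gamma>c: "continuous_on UNIV \<Gamma>" and \<Gamma>0: "\<And>t. 0 < Im (\<Gamma> t)"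
    and low: "\<And>t. t \<le> Tc \<Longrightarrow> Im (\<Gamma> t) < h" and high: "\<And>t. t > Tb \<Longrightarrow> h \<le> Im (\<Gamma> t)"
    and G\<Gamma>: "\<And>t. t \<le> Tc \<Longrightarrow> G (\<Gamma> t) = \<Gamma> (t - 1)"
    and bck: "\<And>z s j. z \<in> S h \<Longrightarrow> G z = \<Gamma> s + of_real (2 * pi * of_int j) \<Longrightarrow> \<exists>j'. z = \<Gamma> (s + 1) + of_real (2 * pi * of_int j')"
  obtains r where "0 < r" "r \<le> h" "\<And>z n. 0 < Im z \<Longrightarrow> Im z < r \<Longrightarrow> (G ^^ n) z \<in> S h"
  using GRe
proof
  assume "\<forall>z \<in> S h. Re z - D \<le> Re (G z) \<and> Re (G z) \<le> Re z - \<delta>"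
  then show thesis
    using no_spiral_left[of h \<delta> G C D \<Gamma> Tc Tb thesis] that h \<delta> cG GIm per \<Gamma>c \<Gamma>0 low high G\<Gamma> bck unfolding S_def by blast
next
  assume R: "\<forall>z \<in> S h. Re z + \<delta> \<le> Re (G z) \<and> Re (G z) \<le> Re z + D"
  define m where "m z = - cnj z" for z
  have m: "Re (m z) = - Re z" "Im (m z) = Im z" "m (m z) = z" "m z \<in> S h \<longleftrightarrow> z \<in> S h" for z
    by (auto simp: m_def S_def)
  have ma: "m (z + of_real (2 * pi * of_int j)) = m z + of_real (2 * pi * of_int (- j))" for z j
    by (simp add: m_def)
  have ma': "m z + of_real (2 * pi * of_int j) = m (z + of_real (2 * pi * of_int (-j)))" for z j
    by (simp add: m_def)
  have mc: "continuous_on X m" for X unfolding m_def[abs_def] by (intro continuous_intros)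
  define G' where "G' z = m (G (m z))" for z
  define \<Gamma>' where "\<Gamma>' t = m (\<Gamma> t)" for t
  have "\<exists>r. 0 < r \<and> r \<le> h \<and> (\<forall>z n. 0 < Im z \<longrightarrow> Im z < r \<longrightarrow> (G' ^^ n) z \<in> S h)"
  proof (rule no_spiral_left[of h \<delta> G' C D \<Gamma>' Tc Tb, folded S_def])
    have "continuous_on (S h) (\<lambda>z. G (m z))" by (rule continuous_on_compose2[OF cG mc]) (auto simp: m)
    then show "continuous_on (S h) G'" unfolding G'_def by (intro continuous_on_compose2[OF mc]) auto
    show "0 < Im (G' z) \<and> Im (G' z) \<le> C * Im z" if "z \<in> S h" for z using GIm[of "m z"] that by (simp add: m G'_def)
    show "Re z - D \<le> Re (G' z) \<and> Re (G' z) \<le> Re z - \<delta>" if "z \<in> S h" for z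
      using R[rule_format, of "m z"] that by (simp add: m G'_def)
    show "G' (z + of_real (2 * pi * of_int j)) = G' z + of_real (2 * pi * of_int j)" if "z \<in> S h" for z j
      unfolding G'_def ma using per[of "m z" "-j"] that by (simp only: m ma) simp
    show "continuous_on UNIV \<Gamma>'" unfolding \<Gamma>'_def by (intro continuous_on_compose2[OF mc \<Gamma>c]) auto
    show "G' (\<Gamma>' t) = \<Gamma>' (t - 1)" if "t \<le> Tc" for t using G\<Gamma>[OF that] by (simp add: G'_def \<Gamma>'_def m)
    show "\<exists>j'. z = \<Gamma>' (s + 1) + of_real (2 * pi * of_int j')" if z: "z \<in> S h" "G' z = \<Gamma>' s + of_real (2 * pi * of_int j)" for z s j
    proof -
      have "m (G' z) = \<Gamma> s + of_real (2 * pi * of_int (-j))" unfolding z(2) \<Gamma>'_def ma m(3) ..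
      then have "G (m z) = \<Gamma> s + of_real (2 * pi * of_int (-j))" unfolding G'_def m(3) .
      then obtain j' where "m z = \<Gamma> (s + 1) + of_real (2 * pi * of_int j')" using bck[of "m z"] m(4) z(1) by blast
      then have "m (m z) = \<Gamma>' (s + 1) + of_real (2 * pi * of_int (-j'))" unfolding \<Gamma>'_def by (simp only: ma)
      then show ?thesis unfolding m(3) by blast
    qed
  qed (use h \<delta> \<Gamma>0 low high in \<open>auto simp: \<Gamma>'_def m\<close>)
  then obtain r where r: "0 < r" "r \<le> h" "\<And>z n. 0 < Im z \<Longrightarrow> Im z < r \<Longrightarrow> (G' ^^ n) z \<in> S h" by blast
  have "(G ^^ n) z = m ((G' ^^ n) (m z))" for n z by (induction n) (auto simp: m G'_def)
  then show thesis using that[OF r(1,2)] r(3) m by metis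
qed

section \<open>Rays that accumulate at one point\<close>

context ray_inverse
begin

lemma fc: "continuous_on UNIV f" using holomorphic_on_imp_continuous_on[OF hol] .

lemma f_isCont: "isCont f z" using fc by (simp add: continuous_on_eq_continuous_at)

lemma A_compact: "compact A" and A_connected: "connected A" and A_nonempty: "A \<noteq> {}"
  using accumulation_compact_connected[OF \<gamma>c bd] by (auto simp: A_eq)

lemma fA: "z \<in> A \<Longrightarrow> f z \<in> A"
  using accumulation_invariant(1)[OF fc, of \<gamma>] f\<gamma> by (auto simp: A_eq)

lemma iterate_ray: "(f ^^ n) (\<gamma> t) = \<gamma> (t + real n)"
  by (induction n) (auto simp: f\<gamma> add_ac)

lemma ray_bounded_below: "\<exists>t0. \<forall>t\<ge>t0. norm (\<gamma> t) > B"
  using \<gamma>inf unfolding filterlim_at_top_dense eventually_at_top_linorder by blast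

text \<open>The bounded set \<open>A\<close> is forward invariant, whereas every point of the ray
  escapes to infinity.\<close>

lemma ray_notin_A: "\<gamma> t \<notin> A"
proof
  assume "\<gamma> t \<in> A"
  then have A: "(f ^^ n) (\<gamma> t) \<in> A" for n by (induction n) (auto simp: fA)
  obtain B where B: "\<And>z. z \<in> A \<Longrightarrow> norm z \<le> B" using compact_imp_bounded[OF A_compact] unfolding bounded_iff by blast
  obtain t0 where t0: "\<And>t. t \<ge> t0 \<Longrightarrow> norm (\<gamma> t) > B" using ray_bounded_below by blast
  have "t + real (nat \<lceil>t0 - t\<rceil>) \<ge> t0" by linarith
  then show False using t0 B[OF A[of "nat \<lceil>t0 - t\<rceil>"]] unfolding iterate_ray by fastforce
qed

lemma tail_near: "open V \<Longrightarrow> A \<subseteq> V \<Longrightarrow> \<exists>T'. \<forall>t\<le>T'. \<gamma> t \<in> V"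
  using tail_near_accumulation[OF bd, of V] unfolding A_eq by metis

lemma not_identity:
  assumes "open U" "U \<noteq> {}" "\<And>z. z \<in> U \<Longrightarrow> f z = z" shows False
proof -
  have "f z = z" for z
    using analytic_continuation_open[of U UNIV f "\<lambda>z. z" z] assms hol by auto
  then have "\<forall>z. f z = poly [:0, 1:] z" by simp
  then show False using trans by blast
qed

text \<open>A connected set with two points is perfect, so by the identity theorem \<open>f\<close>
  would be the identity.\<close>

lemma fixed_imp_singleton:
  assumes "\<And>z. z \<in> A \<Longrightarrow> f z = z" shows "\<exists>z0. A = {z0}"
proof (rule ccontr)
  assume ns: "\<nexists>z0. A = {z0}"
  obtain a where a: "a \<in> A" using A_nonempty by blast
  have lp: "a islimpt A" using connected_imp_perfect[OF A_connected a] ns by blast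
  have "f w - w = 0" for w
    by (rule analytic_continuation[of "\<lambda>z. f z - z" UNIV A a w]) (use assms hol lp in \<open>auto intro!: holomorphic_intros connected_UNIV\<close>)
  then show False using not_identity[of UNIV] by auto
qed

text \<open>A limit function of the \<open>k n\<close> takes a value in \<open>A\<close> at
  \<open>c 0\<close>, a value omitted by all \<open>k n\<close>; by Hurwitz it is constant. Uniform
  convergence on the compact curve identifies this constant with any prescribed point of
  \<open>A\<close>, and comparing the two ends of the curve, which \<open>f\<close> links, shows
  that the constant is a fixed point.\<close>

lemma stable_imp_singleton:
  fixes k :: "nat \<Rightarrow> complex \<Rightarrow> complex"
  assumes W: "open W" "connected W" and k: "\<And>n. k n holomorphic_on W" "\<And>n z. z \<in> W \<Longrightarrow> norm (k n z) \<le> B"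
    and kA: "\<And>n z. z \<in> W \<Longrightarrow> k n z \<notin> A"
    and c: "continuous_on {0..1} c" "c ` {0..1} \<subseteq> W"
    and kc: "\<And>n u. u \<in> {0..1} \<Longrightarrow> k n (c u) = \<gamma> (u0 + u - real n)"
  shows "\<exists>z0. A = {z0}"
proof (rule fixed_imp_singleton)
  fix z assume "z \<in> A"
  then obtain t where t: "filterlim t at_bot sequentially" "(\<lambda>n. \<gamma> (t n)) \<longlonglongrightarrow> z"
    by (auto simp: A_eq accumulation_set_def)
  \<comment> \<open>The number of backward steps after which the fundamental interval from
    \<open>u0\<close> to \<open>u0 + 1\<close> contains the time \<open>t i\<close>.\<close>
  define n where "n i = nat \<lceil>u0 - t i\<rceil>" for i
  define u where "u i = t i - u0 + real (n i)" for i
  have ev: "eventually (\<lambda>i. u i \<in> {0..1} \<and> real (n i) \<ge> b) sequentially" for b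
  proof -
    have "eventually (\<lambda>i. t i \<le> min u0 (u0 - b)) sequentially" using t(1) unfolding filterlim_at_bot by blast
    then show ?thesis
    proof eventually_elim
      case (elim i)
      then have "real (n i) = of_int \<lceil>u0 - t i\<rceil>" unfolding n_def by simp
      then show ?case using elim unfolding u_def by (auto; linarith)
    qed
  qed
  then obtain M where M: "\<And>i. i \<ge> M \<Longrightarrow> u i \<in> {0..1}" unfolding eventually_sequentially by (meson)
  have nlim: "filterlim (\<lambda>i. real (n i)) at_top sequentially"
    unfolding filterlim_at_top
  proof
    fix b show "eventually (\<lambda>i. b \<le> real (n i)) sequentially" using ev[of b] by (rule eventually_mono) simp
  qed
  obtain \<phi> r where \<phi>: "\<phi> holomorphic_on W" "strict_mono (r :: nat \<Rightarrow> nat)"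
    "\<And>x. x \<in> W \<Longrightarrow> (\<lambda>i. k (n (r i)) x) \<longlonglongrightarrow> \<phi> x"
    "\<And>K. compact K \<Longrightarrow> K \<subseteq> W \<Longrightarrow> uniform_limit K (\<lambda>i. k (n (r i))) \<phi> sequentially"
  proof (rule Montel[of W "range k" "\<lambda>i. k (n i)"])
    show "\<exists>B. \<forall>h\<in>range k. \<forall>z\<in>K. norm (h z) \<le> B" if "compact K" "K \<subseteq> W" for K using k(2) that by blast
  qed (use W k in \<open>auto simp: o_def\<close>)
  have nr: "filterlim (\<lambda>i. real (n (r i))) at_top sequentially"
    using filterlim_compose[OF nlim filterlim_subseq[OF \<phi>(2)]] .
  have acc: "\<phi> (c v) \<in> A" if "v \<in> {0..1}" for v
  proof -
    have "filterlim (\<lambda>i. u0 + v - real (n (r i))) at_bot sequentially"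
      using filterlim_shift_at_bot[OF filterlim_compose[OF filterlim_uminus_at_bot_at_top nr], of "u0 + v"] by simp
    moreover have "(\<lambda>i. \<gamma> (u0 + v - real (n (r i)))) \<longlonglongrightarrow> \<phi> (c v)"
      using \<phi>(3)[of "c v"] kc[OF that] c(2) that by (simp add: image_subset_iff)
    ultimately show ?thesis unfolding A_eq accumulation_set_def by blast
  qed
  define w where "w = \<phi> (c 0)"
  have cW: "c v \<in> W" if "v \<in> {0..1}" for v using that c(2) by blast
  have "\<phi> constant_on W"
  proof (rule ccontr)
    assume nc: "\<not> \<phi> constant_on W"
    have "(\<lambda>z. \<phi> z - w) (c 0) \<noteq> 0"
    proof (rule Hurwitz_no_zeros[OF W, of "\<lambda>i z. k (n (r i)) z - w" "\<lambda>z. \<phi> z - w" "c 0"])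
      show "\<not> (\<lambda>z. \<phi> z - w) constant_on W"
      proof
        assume "(\<lambda>z. \<phi> z - w) constant_on W"
        then obtain d where "\<forall>z\<in>W. \<phi> z - w = d" unfolding constant_on_def by blast
        then have "\<forall>z\<in>W. \<phi> z = d + w" by (metis diff_add_cancel)
        then show False using nc unfolding constant_on_def by blast
      qed
      show "uniform_limit K (\<lambda>i z. k (n (r i)) z - w) (\<lambda>z. \<phi> z - w) sequentially" if "compact K" "K \<subseteq> W" for K
        by (intro uniform_limit_intros \<phi> that)
      show "k (n (r i)) z - w \<noteq> 0" if "z \<in> W" for i z using kA[OF that, of "n (r i)"] acc[of 0] unfolding w_def by auto
      show "(\<lambda>z. k (n (r i)) z - w) holomorphic_on W" for i by (intro holomorphic_intros k)
      show "(\<lambda>z. \<phi> z - w) holomorphic_on W" by (intro holomorphic_intros \<phi>)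
      show "c 0 \<in> W" using cW[of 0] by simp
    qed
    then show False unfolding w_def by simp
  qed
  then have cst: "\<phi> x = w" if "x \<in> W" for x using that cW[of 0] unfolding constant_on_def w_def by auto
  have "(\<lambda>i. \<gamma> (t (r i))) \<longlonglongrightarrow> w"
  proof -
    have "compact (c ` {0..1})" using c(1) by (intro compact_continuous_image) auto
    then have ul: "uniform_limit (c ` {0..1}) (\<lambda>i. k (n (r i))) \<phi> sequentially" using \<phi>(4) c(2) by blast
    show ?thesis
    proof (rule tendstoI)
      fix e :: real assume "e > 0"
      then have "eventually (\<lambda>i. \<forall>x\<in>c ` {0..1}. dist (k (n (r i)) x) (\<phi> x) < e) sequentially"
        using ul unfolding uniform_limit_iff by blast
      moreover have "eventually (\<lambda>i. i \<ge> M) sequentially" by (rule eventually_ge_at_top)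
      ultimately show "eventually (\<lambda>i. dist (\<gamma> (t (r i))) w < e) sequentially"
      proof eventually_elim
        case (elim i)
        have "r i \<ge> M" using elim(2) seq_suble[OF \<phi>(2), of i] by linarith
        then have ui: "u (r i) \<in> {0..1}" using M by blast
        have "k (n (r i)) (c (u (r i))) = \<gamma> (t (r i))" using kc[OF ui] by (simp add: u_def)
        then show ?case using elim(1) ui cst[OF cW[OF ui]] by (metis image_eqI)
      qed
    qed
  qed
  moreover have "(\<lambda>i. \<gamma> (t (r i))) \<longlonglongrightarrow> z" using LIMSEQ_subseq_LIMSEQ[OF t(2) \<phi>(2)] by (simp add: o_def)
  ultimately have zw: "z = w" using LIMSEQ_unique by blast
  have 0: "(\<lambda>i. \<gamma> (u0 - real (n (r i)))) \<longlonglongrightarrow> w" using \<phi>(3)[OF cW[of 0]] kc[of 0] unfolding w_def by simp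
  have "(\<lambda>i. \<gamma> (u0 + 1 - real (n (r i)))) \<longlonglongrightarrow> \<phi> (c 1)" using \<phi>(3)[OF cW[of 1]] kc[of 1] by simp
  moreover have "f (\<gamma> (u0 - real (n (r i)))) = \<gamma> (u0 + 1 - real (n (r i)))" for i by (simp add: f\<gamma> algebra_simps)
  ultimately have "f w = \<phi> (c 1)"
    using isCont_tendsto_compose[OF f_isCont 0] LIMSEQ_unique[of "\<lambda>i. \<gamma> (u0 + 1 - real (n (r i)))"] by simp
  then show "f z = z" using cst[OF cW[of 1]] zw by simp
qed

lemma singleton_lands:
  assumes A: "A = {z0}" shows "lands_at \<gamma> z0"
  unfolding lands_at_def
proof (rule topological_tendstoI)
  fix S assume "open S" "z0 \<in> S"
  then show "eventually (\<lambda>t. \<gamma> t \<in> S) at_bot"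
    using tail_near[of S] A unfolding eventually_at_bot_linorder by auto
qed

text \<open>An attracting fixed point would hold the orbit of a nearby ray point in a disc, but that
  orbit escapes.\<close>

lemma singleton_not_attracting:
  assumes A: "A = {z0}" shows "norm (deriv f z0) \<ge> 1"
proof (rule ccontr)
  assume lt: "\<not> ?thesis"
  have fz: "f z0 = z0" using fA[of z0] A by auto
  have "(f has_field_derivative deriv f z0) (at z0)" using holomorphic_derivI[OF hol] by auto
  then have "((\<lambda>z. (f z - f z0) / (z - z0)) \<longlongrightarrow> deriv f z0) (at z0)" by (simp add: has_field_derivative_iff)
  then have "((\<lambda>z. norm ((f z - f z0) / (z - z0))) \<longlongrightarrow> norm (deriv f z0)) (at z0)" by (rule tendsto_norm)
  then have "eventually (\<lambda>z. norm ((f z - f z0) / (z - z0)) < 1) (at z0)" by (rule order_tendstoD(2)) (use lt in simp)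
  then obtain d where d: "d > 0" "\<And>z. z \<noteq> z0 \<Longrightarrow> dist z z0 < d \<Longrightarrow> norm ((f z - f z0) / (z - z0)) < 1"
    unfolding eventually_at by auto
  have step: "dist (f z) z0 \<le> dist z z0" if "dist z z0 < d" for z
  proof (cases "z = z0")
    case False
    then have "norm (f z - z0) / norm (z - z0) < 1" using d(2)[OF False that] fz by (simp add: norm_divide)
    then show ?thesis using False by (simp add: dist_norm field_simps)
  qed (simp add: fz)
  obtain T' where T': "\<And>t. t \<le> T' \<Longrightarrow> \<gamma> t \<in> ball z0 d" using tail_near[of "ball z0 d"] A d(1) by auto
  have b: "dist ((f ^^ n) (\<gamma> T')) z0 < d" for n
  proof (induction n)
    case 0 then show ?case using T'[of T'] by (simp add: dist_commute)
  next
    case (Suc n) then show ?case using step[of "(f ^^ n) (\<gamma> T')"] by simp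
  qed
  obtain t0 where t0: "\<And>t. t \<ge> t0 \<Longrightarrow> norm (\<gamma> t) > norm z0 + d" using ray_bounded_below by blast
  define n where "n = nat \<lceil>t0 - T'\<rceil>"
  have "T' + real n \<ge> t0" unfolding n_def by linarith
  then have "norm (\<gamma> (T' + real n)) > norm z0 + d" using t0 by blast
  moreover have "dist (\<gamma> (T' + real n)) z0 < d" using b[of n] unfolding iterate_ray .
  then have "norm (\<gamma> (T' + real n) - z0) < d" by (simp add: dist_norm)
  ultimately show False using norm_triangle_ineq2[of "\<gamma> (T' + real n)" z0] by linarith
qed

end

section \<open>Multipliers on the unit circle\<close>

lemma exp_polar: "exp z = of_real (exp (Re z)) * exp (\<i> * of_real (Im z))"
  using exp_eq_polar[of z] unfolding cis_conv_exp by simp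

text \<open>Here \<open>Im z\<close> is the modulus and \<open>- Re z\<close> an argument, so the
  coordinate is determined up to multiples of \<open>2 * pi\<close>.\<close>

lemma polar_eq_shift:
  assumes "of_real (Im z) * exp (- \<i> * of_real (Re z)) = of_real (Im z') * exp (- \<i> * of_real (Re z'))"
    and z: "0 < Im z" "0 < Im z'"
  obtains j :: int where "z = z' + of_real (2 * pi * of_int j)"
proof -
  have e: "of_real (Im u) * exp (- \<i> * of_real (Re u)) = exp (of_real (ln (Im u)) - \<i> * of_real (Re u))" if "0 < Im u" for u
    using that by (simp add: exp_diff exp_minus exp_of_real divide_inverse)
  have "exp (of_real (ln (Im z)) - \<i> * of_real (Re z)) = exp (of_real (ln (Im z')) - \<i> * of_real (Re z'))"
    using assms(1) e z by metis
  then obtain j :: int where j: "of_real (ln (Im z)) - \<i> * of_real (Re z) = of_real (ln (Im z')) - \<i> * of_real (Re z') + (of_int (2 * j) * of_real pi) * \<i>"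
    unfolding exp_eq by auto
  have "ln (Im z) = ln (Im z')" using arg_cong[OF j, of Re] by simp
  moreover have "Re z = Re z' + 2 * pi * of_int (-j)" using arg_cong[OF j, of Im] by (simp add: algebra_simps)
  ultimately have "z = z' + of_real (2 * pi * of_int (-j))" using z by (simp add: complex_eq_iff)
  then show thesis by (rule that)
qed

context ray_inverse
begin

text \<open>A multiplier different from 1 is a drift in polar coordinates, so
  \<open>no_spiral\<close> applies with the lifted ray as barrier and confines all iterates of
  \<open>g\<close> to a disc. They form a normal family whose limits are \<open>z0\<close> along the
  ray, hence everywhere; but their derivatives at \<open>z0\<close> have modulus 1.\<close>

lemma singleton_indifferent:
  assumes A: "A = {z0}" and d1: "norm (deriv f z0) = 1" shows "deriv f z0 = 1"
proof (rule ccontr)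
  assume d1': "deriv f z0 \<noteq> 1"
  have fz: "f z0 = z0" and gz: "g z0 = z0" using fA[of z0] gA A by auto
  have z0N: "z0 \<in> N" using N(2) A by auto
  define \<mu> where "\<mu> = deriv g z0"
  have "deriv f z0 * \<mu> = 1"
  proof -
    have "((\<lambda>z. f (g z)) has_field_derivative deriv f (g z0) * deriv g z0) (at z0)"
      by (rule DERIV_chain2[OF holomorphic_derivI[OF hol] holomorphic_derivI[OF N(3,1) z0N]]) auto
    moreover have "((\<lambda>z. f (g z)) has_field_derivative 1) (at z0)"
      by (rule has_field_derivative_transform_within_open[OF DERIV_ident N(1) z0N]) (simp add: fg)
    ultimately show ?thesis using DERIV_unique gz \<mu>_def by metis
  qed
  then have \<mu>: "norm \<mu> = 1" "\<mu> \<noteq> 1" using d1 d1' by (metis mult.right_neutral mult_1 norm_mult norm_one)+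
  define q where "q w = (if w = z0 then deriv g z0 else (g w - g z0) / (w - z0))" for w
  have qhol: "q holomorphic_on N" unfolding q_def by (rule pole_lemma_open[OF N(3,1)])
  have q0: "q z0 = \<mu>" unfolding q_def \<mu>_def by simp
  have qg: "g w - z0 = (w - z0) * q w" for w unfolding q_def using gz by auto
  have qnz: "q w \<noteq> 0" if "w \<in> N" for w
  proof
    assume 0: "q w = 0"
    then have "g w = z0" using qg[of w] by simp
    then have "w = z0" using fg[OF that] fz by simp
    then show False using 0 q0 \<mu> by auto
  qed
  obtain h1 where h1: "h1 > 0" "ball z0 h1 \<subseteq> N" using N(1) z0N open_contains_ball by blast
  have qb: "q holomorphic_on ball z0 h1" "\<And>w. w \<in> ball z0 h1 \<Longrightarrow> q w \<noteq> 0"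
    using h1 qhol qnz holomorphic_on_subset by blast+
  obtain lg0 where lg0: "lg0 holomorphic_on ball z0 h1" "\<And>w. w \<in> ball z0 h1 \<Longrightarrow> q w = exp (lg0 w)"
    using simply_connected_imp_holomorphic_log[OF qb(1), of] qb(2)
      convex_imp_simply_connected[OF convex_ball] open_imp_locally_path_connected[OF open_ball] by blast
  have \<gamma>nz: "\<gamma> t - z0 \<noteq> 0" for t using ray_notin_A[of t] A by auto
  have "continuous_on UNIV (\<lambda>t. \<gamma> t - z0)" by (intro continuous_intros \<gamma>c)
  then obtain L where L: "continuous_on UNIV L" "\<And>t. \<gamma> t - z0 = exp (L t)"
    using continuous_logarithm_on_contractible[of UNIV "\<lambda>t. \<gamma> t - z0"] \<gamma>nz convex_imp_contractible[OF convex_UNIV] by auto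
  obtain t1' where "\<forall>t\<le>t1'. \<gamma> t \<in> ball z0 h1" using tail_near[of "ball z0 h1"] A h1(1) by auto
  then obtain t1 where t1: "\<And>t. t \<le> t1 \<Longrightarrow> \<gamma> t \<in> ball z0 h1" "t1 \<le> T" by (metis min.bounded_iff order_refl)
  \<comment> \<open>The branch of the logarithm of the quotient is corrected by a period so that it
    advances the chosen lift \<open>L\<close> of the ray.\<close>
  define c where "c = L (t1 - 1) - L t1 - lg0 (\<gamma> t1)"
  have eL: "exp (L (t - 1)) = exp (lg0 (\<gamma> t) + L t)" if "t \<le> t1" for t
  proof -
    have "exp (L (t - 1)) = g (\<gamma> t) - z0" using g\<gamma>[of t] that t1 L(2)[of "t - 1"] by simp
    also have "\<dots> = exp (L t) * exp (lg0 (\<gamma> t))" using qg[of "\<gamma> t"] L(2)[of t] lg0(2)[OF t1(1)[OF that]] by simp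
    finally show ?thesis by (simp add: exp_add mult_ac)
  qed
  have c1: "exp c = 1" unfolding c_def exp_diff using eL[of t1] by (simp add: exp_add)
  define lg where "lg w = lg0 w + c" for w
  have lg: "lg holomorphic_on ball z0 h1" "\<And>w. w \<in> ball z0 h1 \<Longrightarrow> exp (lg w) = q w"
    unfolding lg_def using lg0 c1 by (auto intro!: holomorphic_intros simp: exp_add)
  have Llg: "L (t - 1) = lg (\<gamma> t) + L t" if t: "t \<le> t1" for t
  proof (rule lift_unique[where f=exp and T="{..t1}" and a=t1 and ?g1.0="\<lambda>t. L (t - 1)" and ?g2.0="\<lambda>t. lg (\<gamma> t) + L t"])
    show "continuous_on {..t1} (\<lambda>t. L (t - 1))" by (intro continuous_on_compose2[OF L(1)] continuous_intros) auto
    show "continuous_on {..t1} (\<lambda>t. lg (\<gamma> t) + L t)"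
      by (intro continuous_intros continuous_on_compose2[OF holomorphic_on_imp_continuous_on[OF lg(1)]] continuous_on_subset[OF L(1)] continuous_on_subset[OF \<gamma>c])
        (use t1 in auto)
    show "exp (L (x - 1)) = exp (lg (\<gamma> x) + L x)" if "x \<in> {..t1}" for x
      using eL[of x] that c1 by (simp add: lg_def exp_add)
    show "deriv exp (L (x - 1)) \<noteq> 0" for x using DERIV_imp_deriv[OF DERIV_exp, of "L (x - 1)"] by simp
    show "L (t1 - 1) = lg (\<gamma> t1) + L t1" by (simp add: lg_def c_def)
  qed (use t in \<open>auto intro: holomorphic_intros\<close>)
  define \<theta> where "\<theta> = Im (lg z0)"
  have e0: "exp (lg z0) = \<mu>" using lg(2)[of z0] h1 q0 by auto
  then have Re0: "Re (lg z0) = 0" using \<mu>(1) norm_exp_eq_Re[of "lg z0"] by simp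
  then have \<theta>: "\<theta> \<noteq> 0" using e0 \<mu>(2) complex_eqI[of "lg z0" 0] unfolding \<theta>_def by auto
  have "isCont lg z0" using holomorphic_on_imp_continuous_on[OF lg(1)] h1(1) by (simp add: continuous_on_eq_continuous_at)
  then obtain h2' where h2': "h2' > 0" "\<And>w. dist w z0 < h2' \<Longrightarrow> dist (lg w) (lg z0) < \<bar>\<theta>\<bar> / 2"
    unfolding continuous_at_eps_delta using \<theta> by (metis half_gt_zero zero_less_abs_iff)
  define h where "h = min h1 h2'"
  have h: "h > 0" "ball z0 h \<subseteq> ball z0 h1" using h1 h2' unfolding h_def by auto
  have lgnear: "\<bar>Re (lg w)\<bar> < \<bar>\<theta>\<bar> / 2" "\<bar>Im (lg w) - \<theta>\<bar> < \<bar>\<theta>\<bar> / 2" if "w \<in> ball z0 h" for w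
  proof -
    have "norm (lg w - lg z0) < \<bar>\<theta>\<bar> / 2" using h2'(2)[of w] that unfolding h_def by (simp add: dist_norm norm_minus_commute)
    then show "\<bar>Re (lg w)\<bar> < \<bar>\<theta>\<bar> / 2" "\<bar>Im (lg w) - \<theta>\<bar> < \<bar>\<theta>\<bar> / 2"
      using abs_Re_le_cmod[of "lg w - lg z0"] abs_Im_le_cmod[of "lg w - lg z0"] Re0 unfolding \<theta>_def by auto
  qed
  \<comment> \<open>Polar coordinates with the modulus itself as height: \<open>z0\<close>
    corresponds to the real axis, and a disc around \<open>z0\<close> to a strip, as
    \<open>no_spiral\<close> expects.\<close>
  define X where "X z = z0 + of_real (Im z) * exp (- \<i> * of_real (Re z))" for z
  define S where "S = {z. 0 < Im z \<and> Im z < h}"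
  have XS: "X z \<in> ball z0 h" "norm (X z - z0) = Im z" if "z \<in> S" for z
    using that unfolding X_def S_def by (auto simp: dist_norm norm_mult)
  have Xper: "X (z + of_real (2 * pi * of_int j)) = X z" for z j
  proof -
    have "exp (- \<i> * of_real (Re (z + of_real (2 * pi * of_int j)))) = exp (- \<i> * of_real (Re z))"
      unfolding exp_eq by (intro exI[of _ "-j"]) (simp add: algebra_simps)
    then show ?thesis unfolding X_def by simp
  qed
  have Xinj: "\<exists>j. z = z' + of_real (2 * pi * of_int j)" if "X z = X z'" "0 < Im z" "0 < Im z'" for z z'
    using polar_eq_shift[of z z'] that unfolding X_def by auto
  define G where "G z = Complex (Re z - Im (lg (X z))) (Im z * exp (Re (lg (X z))))" for z
  define \<Gamma> where "\<Gamma> t = Complex (- Im (L t)) (exp (Re (L t)))" for t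
  have X\<Gamma>: "X (\<Gamma> t) = \<gamma> t" for t
  proof -
    show ?thesis using L(2)[of t] exp_polar[of "L t"] unfolding X_def \<Gamma>_def by (simp add: algebra_simps)
  qed
  have XG: "X (G z) = g (X z)" if "z \<in> S" for z
  proof -
    let ?l = "lg (X z)"
    have "exp ?l = q (X z)" using lg(2)[of "X z"] XS(1)[OF that] h(2) by blast
    then have "g (X z) - z0 = (X z - z0) * exp ?l" using qg by simp
    moreover have "exp ?l = of_real (exp (Re ?l)) * exp (\<i> * of_real (Im ?l))" by (rule exp_polar)
    moreover have "exp (- \<i> * of_real (Re z)) * exp (\<i> * of_real (Im ?l)) = exp (- \<i> * of_real (Re (G z)))"
      unfolding exp_add[symmetric] by (simp add: G_def algebra_simps)
    ultimately show ?thesis unfolding X_def G_def by (simp add: algebra_simps)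
  qed
  have Im\<Gamma>: "Im (\<Gamma> t) = norm (\<gamma> t - z0)" for t using L(2)[of t] norm_exp_eq_Re[of "L t"] by (simp add: \<Gamma>_def)
  obtain Tc' where "\<forall>t\<le>Tc'. \<gamma> t \<in> ball z0 h" using tail_near[of "ball z0 h"] A h(1) by auto
  then obtain Tc where Tc: "\<And>t. t \<le> Tc \<Longrightarrow> \<gamma> t \<in> ball z0 h" "Tc \<le> t1" "Tc \<le> T" by (metis min.bounded_iff order_refl)
  obtain Tb where Tb: "\<And>t. t \<ge> Tb \<Longrightarrow> norm (\<gamma> t) > norm z0 + h" using ray_bounded_below by blast
  obtain r where r: "0 < r" "r \<le> h" "\<And>z n. 0 < Im z \<Longrightarrow> Im z < r \<Longrightarrow> (G ^^ n) z \<in> S"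
  proof (rule no_spiral[of h "\<bar>\<theta>\<bar> / 2" G "exp (\<bar>\<theta>\<bar> / 2)" "2 * \<bar>\<theta>\<bar>" \<Gamma> Tc Tb, folded S_def])
    have cX: "continuous_on S X" unfolding X_def[abs_def] by (intro continuous_intros)
    have "continuous_on S (\<lambda>z. lg (X z))"
      by (rule continuous_on_compose2[OF holomorphic_on_imp_continuous_on[OF lg(1)] cX]) (use XS h in blast)
    then show "continuous_on S G" unfolding G_def[abs_def] by (intro continuous_intros)
    show "0 < Im (G z) \<and> Im (G z) \<le> exp (\<bar>\<theta>\<bar> / 2) * Im z" if "z \<in> S" for z
    proof -
      have "exp (Re (lg (X z))) \<le> exp (\<bar>\<theta>\<bar> / 2)" using lgnear(1)[OF XS(1)[OF that]] by simp
      then show ?thesis using that unfolding G_def S_def by simp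
    qed
    show "(\<forall>z\<in>S. Re z - 2 * \<bar>\<theta>\<bar> \<le> Re (G z) \<and> Re (G z) \<le> Re z - \<bar>\<theta>\<bar> / 2) \<or>
      (\<forall>z\<in>S. Re z + \<bar>\<theta>\<bar> / 2 \<le> Re (G z) \<and> Re (G z) \<le> Re z + 2 * \<bar>\<theta>\<bar>)"
    proof (cases "\<theta> > 0")
      case True
      have "Re z - 2 * \<bar>\<theta>\<bar> \<le> Re (G z) \<and> Re (G z) \<le> Re z - \<bar>\<theta>\<bar> / 2" if "z \<in> S" for z
        using lgnear(2)[OF XS(1)[OF that]] True unfolding G_def abs_less_iff by auto
      then show ?thesis by blast
    next
      case False
      have "Re z + \<bar>\<theta>\<bar> / 2 \<le> Re (G z) \<and> Re (G z) \<le> Re z + 2 * \<bar>\<theta>\<bar>" if "z \<in> S" for z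
        using lgnear(2)[OF XS(1)[OF that]] False unfolding G_def abs_less_iff by auto
      then show ?thesis by blast
    qed
    show "G (z + of_real (2 * pi * of_int j)) = G z + of_real (2 * pi * of_int j)" if "z \<in> S" for z j
      unfolding G_def Xper by (simp add: complex_eq_iff)
    show "continuous_on UNIV \<Gamma>" unfolding \<Gamma>_def[abs_def] by (intro continuous_intros L)
    show "0 < Im (\<Gamma> t)" for t by (simp add: \<Gamma>_def)
    show "Im (\<Gamma> t) < h" if "t \<le> Tc" for t unfolding Im\<Gamma> using Tc(1)[OF that] by (simp add: dist_norm norm_minus_commute)
    show "h \<le> Im (\<Gamma> t)" if "t > Tb" for t
      unfolding Im\<Gamma> using Tb[of t] that norm_triangle_ineq2[of "\<gamma> t" z0] by linarith
    show "G (\<Gamma> t) = \<Gamma> (t - 1)" if "t \<le> Tc" for t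
      using Llg[of t] that Tc(2) unfolding G_def X\<Gamma> by (simp add: \<Gamma>_def exp_add)
    show "\<exists>j'. z = \<Gamma> (s + 1) + of_real (2 * pi * of_int j')" if "z \<in> S" "G z = \<Gamma> s + of_real (2 * pi * of_int j)" for z s j
    proof -
      have XN: "X z \<in> N" using XS(1)[OF that(1)] h(2) h1(2) by blast
      have "g (X z) = \<gamma> s" using XG[OF that(1)] unfolding that(2) Xper X\<Gamma> by simp
      then have "X z = X (\<Gamma> (s + 1))" using fg[OF XN] f\<gamma> X\<Gamma> by metis
      then show ?thesis using Xinj[of z "\<Gamma> (s+1)"] that(1) unfolding S_def \<Gamma>_def by auto
    qed
  qed (use h \<theta> in auto)
  have XGn: "(g ^^ n) (X z) = X ((G ^^ n) z)" if "0 < Im z" "Im z < r" for z n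
    by (induction n) (use XG r(3)[OF that] in auto)
  have gn: "(g ^^ n) w \<in> ball z0 h" if "w \<in> ball z0 r" for n w
  proof (cases "w = z0")
    case True
    have "(g ^^ n) z0 = z0" by (induction n) (auto simp: gz)
    then show ?thesis using True h(1) by simp
  next
    case False
    define z where "z = Complex (- Im (Ln (w - z0))) (norm (w - z0))"
    have "0 < Im z" "Im z < r" using that False unfolding z_def by (auto simp: dist_norm norm_minus_commute)
    moreover have "X z = w"
    proof -
      have "exp (Re (Ln (w - z0))) = norm (w - z0)" using False by (simp add: Re_Ln)
      then have "of_real (norm (w - z0)) * exp (\<i> * of_real (Im (Ln (w - z0)))) = exp (Ln (w - z0))"
        using exp_polar[of "Ln (w - z0)"] by simp
      then show ?thesis using False unfolding X_def z_def by simp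
    qed
    ultimately show ?thesis using XGn[of z n] XS(1)[of "(G ^^ n) z"] r(3)[of z n] by metis
  qed
  have gnhol: "(g ^^ n) holomorphic_on ball z0 r" for n
  proof (induction n)
    case 0 then show ?case by (simp add: id_def)
  next
    case (Suc n)
    have "g \<circ> (g ^^ n) holomorphic_on ball z0 r"
      by (rule holomorphic_on_compose_gen[OF Suc N(3)]) (use gn h h1 in blast)
    then show ?case by (simp only: funpow.simps)
  qed
  have dgn: "((g ^^ n) has_field_derivative \<mu> ^ n) (at z0)" for n
  proof (induction n)
    case 0 then show ?case by (simp add: id_def)
  next
    case (Suc n)
    have gfix: "(g ^^ n) z0 = z0" by (induction n) (auto simp: gz)
    have "(g has_field_derivative \<mu>) (at ((g ^^ n) z0))" unfolding gfix \<mu>_def by (rule holomorphic_derivI[OF N(3,1) z0N])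
    from DERIV_chain[OF this Suc] show ?case by (simp only: funpow.simps power_Suc)
  qed
  obtain \<phi> \<sigma> where \<phi>: "\<phi> holomorphic_on ball z0 r" "strict_mono (\<sigma> :: nat \<Rightarrow> nat)"
    "\<And>x. x \<in> ball z0 r \<Longrightarrow> (\<lambda>i. (g ^^ \<sigma> i) x) \<longlonglongrightarrow> \<phi> x"
    "\<And>K. compact K \<Longrightarrow> K \<subseteq> ball z0 r \<Longrightarrow> uniform_limit K (\<lambda>i. g ^^ \<sigma> i) \<phi> sequentially"
  proof (rule Montel[of "ball z0 r" "range (\<lambda>n. g ^^ n)" "\<lambda>i. g ^^ i"])
    show "\<exists>B. \<forall>h\<in>range ((^^) g). \<forall>z\<in>K. norm (h z) \<le> B" if "compact K" "K \<subseteq> ball z0 r" for K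
    proof (intro exI[of _ "norm z0 + h"] ballI)
      fix k z assume "k \<in> range ((^^) g)" "z \<in> K"
      then have "k z \<in> ball z0 h" using gn that by blast
      then show "norm (k z) \<le> norm z0 + h" using norm_triangle_ineq2[of "k z" z0] by (simp add: dist_norm norm_minus_commute)
    qed
  qed (use gnhol in \<open>auto simp: o_def\<close>)
  have "\<exists>t'. \<forall>t\<le>t'. \<gamma> t \<in> ball z0 r" using tail_near[of "ball z0 r"] A r(1) by auto
  then obtain t2 where t2: "\<And>t. t \<le> t2 \<Longrightarrow> \<gamma> t \<in> ball z0 r" "t2 \<le> T" by (metis min.bounded_iff order_refl)
  have g\<gamma>n: "(g ^^ n) (\<gamma> t) = \<gamma> (t - real n)" if "t \<le> t2" for t n
    by (induction n) (use that t2 g\<gamma>[of "t - real _"] in \<open>auto simp: algebra_simps\<close>)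
  have lim: "(\<gamma> \<longlongrightarrow> z0) at_bot" using singleton_lands[OF A] by (simp add: lands_at_def)
  have \<phi>z: "\<phi> (\<gamma> t) - z0 = 0" if "t \<le> t2" for t
  proof -
    have "filterlim (\<lambda>i. real (\<sigma> i)) at_top sequentially"
      by (rule filterlim_compose[OF filterlim_real_sequentially filterlim_subseq[OF \<phi>(2)]])
    then have "filterlim (\<lambda>i. - real (\<sigma> i) + t) at_bot sequentially"
      by (intro filterlim_shift_at_bot filterlim_compose[OF filterlim_uminus_at_bot_at_top])
    then have "(\<lambda>i. \<gamma> (- real (\<sigma> i) + t)) \<longlonglongrightarrow> z0" by (rule filterlim_compose[OF lim])
    moreover have "(\<lambda>i. \<gamma> (- real (\<sigma> i) + t)) \<longlonglongrightarrow> \<phi> (\<gamma> t)"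
      using \<phi>(3)[OF t2(1)[OF that]] unfolding g\<gamma>n[OF that] by simp
    ultimately show ?thesis using LIMSEQ_unique by auto
  qed
  \<comment> \<open>The ray lands at \<open>z0\<close> without reaching it, so the identity theorem
    applies along the ray.\<close>
  have zlp: "z0 islimpt \<gamma> ` {..t2}"
    unfolding islimpt_approachable
  proof (intro allI impI)
    fix e :: real assume "e > 0"
    then obtain t' where "\<forall>t\<le>t'. \<gamma> t \<in> ball z0 e" using tail_near[of "ball z0 e"] A by auto
    then have "\<gamma> (min t' t2) \<in> ball z0 e" by simp
    then show "\<exists>x'\<in>\<gamma> ` {..t2}. x' \<noteq> z0 \<and> dist x' z0 < e"
      using \<gamma>nz[of "min t' t2"] by (intro bexI[of _ "\<gamma> (min t' t2)"]) (auto simp: dist_commute)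
  qed
  have \<phi>c: "\<phi> w = z0" if "w \<in> ball z0 r" for w
  proof -
    have "\<phi> w - z0 = 0"
      by (rule analytic_continuation[of "\<lambda>z. \<phi> z - z0" "ball z0 r" "\<gamma> ` {..t2}" z0 w])
        (use \<phi>(1) \<phi>z t2(1) r(1) that zlp in \<open>auto intro!: holomorphic_intros\<close>)
    then show ?thesis by simp
  qed
  have "uniform_limit (cball z0 (r/2)) (\<lambda>i. g ^^ \<sigma> i) \<phi> sequentially" by (rule \<phi>(4)) (use r(1) in auto)
  then have "eventually (\<lambda>i. \<forall>x\<in>cball z0 (r/2). dist ((g ^^ \<sigma> i) x) (\<phi> x) < r / 4) sequentially"
    by (rule uniform_limitD) (use r(1) in simp)
  then obtain i where i: "\<And>x. x \<in> cball z0 (r/2) \<Longrightarrow> dist ((g ^^ \<sigma> i) x) (\<phi> x) < r / 4"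
    unfolding eventually_sequentially by blast
  \<comment> \<open>Cauchy's estimate with values in a disc of radius \<open>r / 4\<close> on one of
    radius \<open>r / 2\<close> bounds the derivative by 1/2, while it is a power of
    \<open>\<mu>\<close> and has modulus 1.\<close>
  have "norm ((deriv ^^ 1) (g ^^ \<sigma> i) z0) \<le> fact 1 * (r / 4) / (r / 2) ^ 1"
  proof (rule Cauchy_higher_deriv_bound)
    show "(g ^^ \<sigma> i) holomorphic_on ball z0 (r/2)" using gnhol by (rule holomorphic_on_subset) (use r in auto)
    show "continuous_on (cball z0 (r/2)) (g ^^ \<sigma> i)"
      using holomorphic_on_imp_continuous_on[OF gnhol] by (rule continuous_on_subset) (use r in auto)
    show "(g ^^ \<sigma> i) w \<in> ball z0 (r / 4)" if "w \<in> ball z0 (r/2)" for w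
      using i[of w] \<phi>c[of w] that r(1) by (auto simp: dist_commute)
  qed (use r in auto)
  then show False using DERIV_imp_deriv[OF dgn[of "\<sigma> i"]] \<mu>(1) r(1) by (simp add: norm_power)
qed

lemma singleton_conclusion:
  assumes "A = {z0}"
  shows "lands_at \<gamma> z0 \<and> (repelling_fixed_point f z0 \<or> parabolic_fixed_point f z0)"
proof -
  have "f z0 = z0" using fA[of z0] assms by auto
  moreover have "norm (deriv f z0) > 1 \<or> deriv f z0 = 1"
    using singleton_not_attracting[OF assms] singleton_indifferent[OF assms] by linarith
  ultimately show ?thesis using singleton_lands[OF assms]
    by (auto simp: repelling_fixed_point_def parabolic_fixed_point_def intro: exI[of _ "1::nat"])
qed

end

section \<open>Local dynamics at a fixed point\<close>

text \<open>The set \<open>W\<close> is the union of the attracting petals, described in the Fatou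
  coordinate \<open>u\<close>: near \<open>p\<close> the map increases \<open>Re u\<close> by more
  than 1/2. Hence a right half-plane in \<open>u\<close> is invariant, and an orbit converging to
  \<open>p\<close> must enter it.\<close>

lemma invariant_petal:
  fixes G :: "complex \<Rightarrow> complex"
  assumes U: "open U" "connected U" "p \<in> U" and G: "G holomorphic_on U" "G p = p" "deriv G p = 1"
    and nid: "\<not> (\<forall>z\<in>U. G z = z)"
  obtains W where "open W" "W \<subseteq> U" "G ` W \<subseteq> W"
    "\<And>w :: nat \<Rightarrow> complex. (\<And>n. w (Suc n) = G (w n)) \<Longrightarrow> w \<longlonglongrightarrow> p \<Longrightarrow> (\<And>n. w n \<noteq> p) \<Longrightarrow> \<exists>n. w n \<in> W"
proof -
  have hol: "(\<lambda>z. G z - z) holomorphic_on U" by (intro holomorphic_intros G)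
  have nc: "\<not> (\<lambda>z. G z - z) constant_on U"
  proof
    assume "(\<lambda>z. G z - z) constant_on U"
    then obtain c where c: "\<And>z. z \<in> U \<Longrightarrow> G z - z = c" unfolding constant_on_def by blast
    then have "c = 0" using U(3) G(2) by force
    then show False using c nid by auto
  qed
  obtain k r n where nr: "0 < n" "0 < r" "ball p r \<subseteq> U" and k: "k holomorphic_on ball p r"
      "\<And>w. w \<in> ball p r \<Longrightarrow> G w - w = (w - p) ^ n * k w" "\<And>w. w \<in> ball p r \<Longrightarrow> k w \<noteq> 0"
    by (rule holomorphic_factor_zero_nonconstant[OF hol U(1,2,3) _ nc]) (use G(2) in auto)
  have kc: "isCont k p" using holomorphic_on_imp_continuous_on[OF k(1)] nr(2) by (simp add: continuous_on_eq_continuous_at)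
  \<comment> \<open>Multiplier 1 makes the zero of \<open>G z - z\<close> at \<open>p\<close> at
    least double, so there is at least one petal.\<close>
  have n1: "n \<noteq> 1"
  proof
    assume n: "n = 1"
    have "((\<lambda>w. G w - w) has_field_derivative deriv G p - 1) (at p)"
      using holomorphic_derivI[OF G(1) U(1,3)] by (auto intro!: derivative_eq_intros)
    then have "((\<lambda>w. ((G w - w) - (G p - p)) / (w - p)) \<longlongrightarrow> 0) (at p)" using G(3) by (simp add: has_field_derivative_iff)
    moreover have "eventually (\<lambda>w. ((G w - w) - (G p - p)) / (w - p) = k w) (at p)"
      unfolding eventually_at using nr(2) k(2) G(2) n by (intro exI[of _ r]) (auto simp: dist_commute)
    ultimately have "(k \<longlongrightarrow> 0) (at p)" using tendsto_cong by fast
    moreover have "(k \<longlongrightarrow> k p) (at p)" using kc by (simp add: isCont_def)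
    ultimately show False using tendsto_unique[OF _ \<open>(k \<longlongrightarrow> 0) (at p)\<close>] k(3)[of p] nr(2) by force
  qed
  obtain m where m: "n = Suc m" "m > 0" using nr(1) n1 by (cases n) auto
  define a where "a = k p"
  have a: "a \<noteq> 0" unfolding a_def using k(3)[of p] nr(2) by auto
  define e where "e z = (z - p) ^ m * k z" for z
  have Ge: "G z - p = (z - p) * (1 + e z)" if "z \<in> ball p r" for z
    using k(2)[OF that] unfolding m e_def by (simp add: algebra_simps)
  \<comment> \<open>The leading term of the Fatou coordinate, with the constant chosen so that
    \<open>u (G z) - u z\<close> tends to 1.\<close>
  define u where "u z = - 1 / (of_nat m * a * (z - p) ^ m)" for z
  have e0: "(e \<longlongrightarrow> 0) (at p)"
  proof -
    have "(e \<longlongrightarrow> (p - p) ^ m * k p) (at p)" unfolding e_def[abs_def]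
      using kc by (intro tendsto_intros) (simp add: isCont_def)
    then show ?thesis using m by (simp add: power_0_left)
  qed
  have ev_r: "eventually (\<lambda>z. z \<in> ball p r \<and> z \<noteq> p) (at p)"
    unfolding eventually_at using nr(2) by (intro exI[of _ r]) (auto simp: dist_commute)
  have "filterlim e (at 0) (at p)"
    unfolding filterlim_at using e0 ev_r by (auto elim!: eventually_mono simp: e_def k(3))
  \<comment> \<open>By \<open>Ge\<close> the map multiplies \<open>u\<close> by the inverse of
    \<open>(1 + e z) ^ m\<close>, so the increment of \<open>u\<close> is governed by the derivative
    of this power at 0.\<close>
  moreover have "((\<lambda>x. (inverse ((1 + x) ^ m) - 1) / x) \<longlongrightarrow> - of_nat m) (at (0::complex))"
  proof -
    have "((\<lambda>x::complex. inverse ((1 + x) ^ m)) has_field_derivative - of_nat m) (at 0)"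
      by (auto intro!: derivative_eq_intros)
    then show ?thesis by (simp add: has_field_derivative_iff)
  qed
  ultimately have q: "((\<lambda>z. (inverse ((1 + e z) ^ m) - 1) / e z) \<longlongrightarrow> - of_nat m) (at p)"
    using filterlim_compose by blast
  have "((\<lambda>z. - 1 / (of_nat m * a) * k z * ((inverse ((1 + e z) ^ m) - 1) / e z)) \<longlongrightarrow> - 1 / (of_nat m * a) * k p * - of_nat m) (at p)"
    using kc by (intro tendsto_intros q) (simp add: isCont_def)
  moreover have "- 1 / (of_nat m * a) * k p * - of_nat m = 1" using a m unfolding a_def by simp
  moreover have "eventually (\<lambda>z. - 1 / (of_nat m * a) * k z * ((inverse ((1 + e z) ^ m) - 1) / e z) = u (G z) - u z) (at p)"
    using ev_r
  proof eventually_elim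
    case (elim z)
    define P where "P = (z - p) ^ m"
    define Q where "Q = (1 + e z) ^ m"
    have uG: "u (G z) = - 1 / (of_nat m * a * (P * Q))"
      unfolding u_def Ge[OF conjunct1[OF elim]] P_def Q_def power_mult_distrib ..
    have ez: "e z = P * k z" "k z \<noteq> 0" using elim k(3)[of z] by (auto simp: e_def P_def)
    have "- 1 / (of_nat m * a) * k z * ((inverse Q - 1) / e z) = - 1 / (of_nat m * a) * ((inverse Q - 1) / P)"
      unfolding ez(1) using ez(2) by simp
    also have "\<dots> = - 1 / (of_nat m * a * (P * Q)) - (- 1 / (of_nat m * a * P))"
      by (simp add: divide_inverse algebra_simps)
    finally show ?case unfolding uG unfolding u_def P_def Q_def .
  qed
  ultimately have "((\<lambda>z. u (G z) - u z) \<longlongrightarrow> 1) (at p)" using tendsto_cong by force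
  then have "((\<lambda>z. Re (u (G z) - u z)) \<longlongrightarrow> Re 1) (at p)" by (rule tendsto_Re)
  then have "eventually (\<lambda>z. Re (u (G z) - u z) > 1/2) (at p)" by (rule order_tendstoD) simp
  moreover have "eventually (\<lambda>z. norm (e z) < 1) (at p)"
    using tendsto_norm[OF e0] by (rule order_tendstoD) simp
  ultimately have "eventually (\<lambda>z. z \<in> ball p r \<and> Re (u (G z)) > Re (u z) + 1/2 \<and> G z \<noteq> p) (at p)"
    using ev_r
  proof eventually_elim
    case (elim z)
    have "1 + e z \<noteq> 0" using elim(2) by (metis add.inverse_inverse add_eq_0_iff less_irrefl norm_minus_cancel norm_one)
    then show ?case using elim Ge[of z] by auto
  qed
  then obtain \<rho> where \<rho>: "\<rho> > 0" "\<And>z. z \<noteq> p \<Longrightarrow> dist z p < \<rho> \<Longrightarrow> z \<in> ball p r \<and> Re (u (G z)) > Re (u z) + 1/2 \<and> G z \<noteq> p"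
    unfolding eventually_at by auto
  \<comment> \<open>The modulus of \<open>u\<close> on the circle of radius \<open>\<rho>\<close>.
    Outside this circle it is smaller, so \<open>Re u > M\<close> keeps \<open>z\<close> within
    distance \<open>\<rho>\<close> of \<open>p\<close>.\<close>
  define M where "M = 1 / (real m * norm a * \<rho> ^ m)"
  define W where "W = {z \<in> - {p}. M < Re (u z)}"
  have near: "dist z p < \<rho>" if "z \<in> W" for z
  proof (rule ccontr)
    assume "\<not> ?thesis"
    then have "\<rho> ^ m \<le> norm (z - p) ^ m" using \<rho>(1) by (intro power_mono) (auto simp: dist_norm)
    then have "real m * norm a * \<rho> ^ m \<le> real m * norm a * norm (z - p) ^ m" by (intro mult_left_mono) auto
    moreover have "0 < real m * norm a * \<rho> ^ m" using m a \<rho>(1) by simp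
    ultimately have "1 / (real m * norm a * norm (z - p) ^ m) \<le> M" unfolding M_def by (intro frac_le) auto
    then have "norm (u z) \<le> M" unfolding u_def by (simp add: norm_divide norm_mult norm_power)
    then show False using that complex_Re_le_cmod[of "u z"] unfolding W_def by auto
  qed
  have up: "dist z p < \<rho> \<Longrightarrow> z \<noteq> p \<Longrightarrow> Re (u (G z)) > Re (u z) + 1/2" for z using \<rho>(2) by blast
  show thesis
  proof
    have "continuous_on (- {p}) (\<lambda>z. Re (u z))" unfolding u_def by (intro continuous_intros) (use a m in auto)
    then have "open (- {p} \<inter> (\<lambda>z. Re (u z)) -` {M<..})" by (rule continuous_open_preimage) auto
    then show "open W" unfolding W_def by (simp add: vimage_def Int_def)
    show "W \<subseteq> U" using near \<rho>(2) nr(3) unfolding W_def by blast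
    show "G ` W \<subseteq> W"
    proof clarify
      fix z assume z: "z \<in> W"
      then have "z \<noteq> p" "M < Re (u z)" unfolding W_def by auto
      then show "G z \<in> W" using \<rho>(2)[of z] near[OF z] unfolding W_def by auto
    qed
    fix w :: "nat \<Rightarrow> complex" assume w: "\<And>n. w (Suc n) = G (w n)" "w \<longlonglongrightarrow> p" "\<And>n. w n \<noteq> p"
    obtain N where N: "\<And>n. n \<ge> N \<Longrightarrow> dist (w n) p < \<rho>" using w(2) \<rho>(1) unfolding lim_sequentially by blast
    have inc: "Re (u (w (N + n))) \<ge> Re (u (w N)) + real n / 2" for n
    proof (induction n)
      case (Suc n)
      have "Re (u (w (Suc (N + n)))) > Re (u (w (N + n))) + 1/2" unfolding w(1) using up N w(3) by simp
      then show ?case using Suc by (simp add: add_divide_distrib)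
    qed simp
    obtain n :: nat where "real n > 2 * (M - Re (u (w N)))" using reals_Archimedean2 by blast
    then have "M < Re (u (w (N + n)))" using inc[of n] by (simp add: field_simps)
    then show "\<exists>n. w n \<in> W" using w(3) unfolding W_def by blast
  qed
qed

text \<open>An attracting point has an invariant disc and a parabolic one its petals. At a repelling
  point no orbit converges to \<open>p\<close> without reaching it, so the empty set will
  do.\<close>

lemma invariant_set_at_fixed_point:
  fixes G :: "complex \<Rightarrow> complex"
  assumes U: "open U" "connected U" "p \<in> U" and G: "G holomorphic_on U" "G p = p"
    and nid: "\<not> (\<forall>z\<in>U. G z = z)" and d: "norm (deriv G p) = 1 \<Longrightarrow> deriv G p = 1"
  obtains W where "open W" "W \<subseteq> U" "G ` W \<subseteq> W"
    "\<And>w :: nat \<Rightarrow> complex. (\<And>n. w (Suc n) = G (w n)) \<Longrightarrow> w \<longlonglongrightarrow> p \<Longrightarrow> (\<And>n. w n \<noteq> p) \<Longrightarrow> \<exists>n. w n \<in> W"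
proof -
  have "(G has_field_derivative deriv G p) (at p)" using holomorphic_derivI[OF G(1) U(1,3)] .
  then have "((\<lambda>z. (G z - G p) / (z - p)) \<longlongrightarrow> deriv G p) (at p)" by (simp add: has_field_derivative_iff)
  then have lim: "((\<lambda>z. norm ((G z - G p) / (z - p))) \<longlongrightarrow> norm (deriv G p)) (at p)" by (rule tendsto_norm)
  consider "norm (deriv G p) < 1" | "norm (deriv G p) > 1" | "deriv G p = 1" using d by linarith
  then show thesis
  proof cases
    case 1
    then have "eventually (\<lambda>z. norm ((G z - G p) / (z - p)) < 1) (at p)" using order_tendstoD(2)[OF lim] by blast
    then obtain e where e: "e > 0" "\<And>z. z \<noteq> p \<Longrightarrow> dist z p < e \<Longrightarrow> norm ((G z - G p) / (z - p)) < 1"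
      unfolding eventually_at by auto
    obtain e' where e': "e' > 0" "ball p e' \<subseteq> U" using U open_contains_ball by blast
    define r where "r = min e e'"
    have step: "dist (G z) p \<le> dist z p" if "dist z p < r" for z
    proof (cases "z = p")
      case False
      then have "norm (G z - p) / norm (z - p) < 1" using e(2)[OF False] that G(2) by (simp add: r_def norm_divide)
      then show ?thesis using False by (simp add: dist_norm field_simps)
    qed (simp add: G(2))
    show thesis
    proof (rule that[of "ball p r"])
      show "G ` ball p r \<subseteq> ball p r"
      proof clarify
        fix z assume "z \<in> ball p r"
        then show "G z \<in> ball p r" using step[of z] by (simp add: dist_commute)
      qed
      show "\<exists>n. w n \<in> ball p r" if "w \<longlonglongrightarrow> p" for w :: "nat \<Rightarrow> complex"
        using that e(1) e'(1) unfolding lim_sequentially r_def by (metis dist_commute mem_ball min_less_iff_conj order_refl)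
    qed (use e' in \<open>auto simp: r_def\<close>)
  next
    case 2
    then have "eventually (\<lambda>z. norm ((G z - G p) / (z - p)) > 1) (at p)" using order_tendstoD(1)[OF lim] by blast
    then obtain e where e: "e > 0" "\<And>z. z \<noteq> p \<Longrightarrow> dist z p < e \<Longrightarrow> norm ((G z - G p) / (z - p)) > 1"
      unfolding eventually_at by auto
    have step: "dist (G z) p \<ge> dist z p" if "dist z p < e" "z \<noteq> p" for z
    proof -
      have "norm (G z - p) / norm (z - p) > 1" using e(2)[OF that(2,1)] G(2) by (simp add: norm_divide)
      then show ?thesis using that by (simp add: dist_norm field_simps)
    qed
    have False if w: "\<And>n. w (Suc n) = G (w n)" "w \<longlonglongrightarrow> p" "\<And>n. w n \<noteq> p" for w :: "nat \<Rightarrow> complex"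
    proof -
      obtain N where N: "\<And>n. n \<ge> N \<Longrightarrow> dist (w n) p < e" using w(2) e(1) unfolding lim_sequentially by blast
      have inc: "dist (w (N + n)) p \<ge> dist (w N) p" for n
      proof (induction n)
        case (Suc n)
        then show ?case using step[of "w (N + n)"] N[of "N + n"] w(1)[of "N + n"] w(3) by fastforce
      qed simp
      have "dist (w N) p > 0" using w(3) by simp
      then obtain M where "\<And>n. n \<ge> M \<Longrightarrow> dist (w n) p < dist (w N) p" using w(2) unfolding lim_sequentially by blast
      then show False using inc[of M] by (metis le_add2 not_le)
    qed
    then show thesis using that[of "{}"] by (metis empty_subsetI image_empty open_empty)
  next
    case 3
    then show thesis using invariant_petal[OF U G _ nid] that by metis
  qed
qed

section \<open>The exterior of a continuum\<close>

text \<open>Inversion at \<open>a\<close> carries infinity to 0. A loop \<open>g\<close> in the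
  inverted exterior does not wind about points of the complement, because its winding number about
  \<open>1 / (z - a)\<close> is continuous and integral on the connected filled set, and vanishes
  near \<open>z = a\<close>.\<close>

lemma simply_connected_inverted_outside:
  fixes A :: "complex set"
  assumes A: "compact A" "connected A" "a \<in> A"
  defines "\<Omega> \<equiv> insert 0 ((\<lambda>z. 1 / (z - a)) ` outside A)"
  shows "open \<Omega>" "simply_connected \<Omega>"
proof -
  have oo: "open (outside A)" using A by (simp add: compact_imp_closed open_outside)
  have na: "z \<noteq> a" if "z \<in> outside A" for z using that A(3) outside_no_overlap by blast
  obtain R where R: "R > 0" "A \<subseteq> ball a R" using bounded_subset_ballD[OF compact_imp_bounded[OF A(1)]] by blast
  have out: "z \<in> outside A" if "R \<le> dist a z" for z
    using outside_subset_convex[of "ball a R" A] R that by auto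
  have inj: "inj_on (\<lambda>z. 1 / (z - a)) (outside A)" using na by (auto simp: inj_on_def)
  have hol: "(\<lambda>z. 1 / (z - a)) holomorphic_on outside A" using na by (auto intro!: holomorphic_intros)
  let ?\<Omega>0 = "(\<lambda>z. 1 / (z - a)) ` outside A"
  have o0: "open ?\<Omega>0" by (rule open_mapping_thm3[OF hol oo inj])
  have near: "w \<in> ?\<Omega>0" if "w \<noteq> 0" "norm w \<le> 1 / R" for w
  proof -
    have "a + 1 / w \<in> outside A" using that R(1) by (intro out) (simp add: dist_norm norm_divide field_simps)
    moreover have "w = 1 / (a + 1 / w - a)" by simp
    ultimately show ?thesis by (rule rev_image_eqI)
  qed
  have \<Omega>: "\<Omega> = ball 0 (1 / R) \<union> ?\<Omega>0" using near R(1) unfolding \<Omega>_def by force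
  show op: "open \<Omega>" unfolding \<Omega> using o0 by auto
  have "connected ?\<Omega>0"
    using connected_continuous_image[OF holomorphic_on_imp_continuous_on[OF hol] connected_outside[OF compact_imp_bounded[OF A(1)]]] by simp
  moreover have "ball 0 (1 / R) \<inter> ?\<Omega>0 \<noteq> {}"
  proof -
    have "of_real (1 / (2 * R)) \<in> ?\<Omega>0" using R(1) by (intro near) (auto simp: norm_divide intro!: frac_le)
    moreover have "of_real (1 / (2 * R)) \<in> ball (0::complex) (1 / R)" using R(1) by (simp add: norm_divide field_simps)
    ultimately show ?thesis by blast
  qed
  ultimately have con: "connected \<Omega>" unfolding \<Omega> by (intro connected_Un) auto
  show "simply_connected \<Omega>"
    unfolding simply_connected_eq_winding_number_zero[OF op]
  proof (intro conjI con allI impI)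
    fix g z assume g: "path g \<and> path_image g \<subseteq> \<Omega> \<and> pathfinish g = pathstart g \<and> z \<notin> \<Omega>"
    define H where "H = - outside A"
    have H: "H = A \<union> inside A" unfolding H_def union_with_inside[symmetric] by simp
    have Hc: "connected H" unfolding H using A by (intro connected_with_inside) (auto simp: compact_imp_closed)
    have aH: "a \<in> H" using A(3) H by auto
    have H\<Omega>: "1 / (z - a) \<notin> \<Omega>" if "z \<in> H" "z \<noteq> a" for z
    proof
      assume "1 / (z - a) \<in> \<Omega>"
      then obtain z' where "z' \<in> outside A" "1 / (z - a) = 1 / (z' - a)" using \<open>z \<noteq> a\<close> unfolding \<Omega>_def by auto
      then show False using that unfolding H_def by auto
    qed
    obtain B0 where B0: "\<And>w. norm w \<ge> B0 \<Longrightarrow> winding_number g w = 0"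
      using winding_number_zero_at_infinity[of g] g by auto
    define B where "B = max B0 1"
    have B: "B > 0" "\<And>w. norm w \<ge> B \<Longrightarrow> winding_number g w = 0" using B0 unfolding B_def by auto
    \<comment> \<open>The value 0 at \<open>a\<close> is the continuous extension, since
      \<open>1 / (z - a)\<close> tends to infinity there.\<close>
    define n where "n z = (if z = a then 0 else winding_number g (1 / (z - a)))" for z
    have "n constant_on H"
    proof (rule continuous_discrete_range_constant[OF Hc])
      show "continuous_on H n" unfolding continuous_on_eq_continuous_within
      proof
        fix x assume x: "x \<in> H"
        show "continuous (at x within H) n"
        proof (cases "x = a")
          case True
          have "eventually (\<lambda>z. n z = 0) (nhds a)" unfolding eventually_nhds_metric
          proof (intro exI[of _ "1 / B"] conjI allI impI)
            fix z assume "dist z a < 1 / B"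
            then show "n z = 0" unfolding n_def using B(1)
              by (auto simp: dist_norm norm_divide field_simps intro!: B(2))
          qed (use B in simp)
          then have "isCont n a" using isCont_cong[of n "\<lambda>_. 0" a] by simp
          then show ?thesis using True continuous_at_imp_continuous_at_within by blast
        next
          case False
          have "1 / (x - a) \<notin> path_image g" using H\<Omega>[OF x False] g by blast
          then have c: "isCont (winding_number g) (1 / (x - a))" using continuous_at_winding_number g by blast
          have "isCont (\<lambda>z. 1 / (z - a)) x" using False by (intro continuous_intros) auto
          then have "isCont (\<lambda>z. winding_number g (1 / (z - a))) x" by (rule isCont_o2[where f="\<lambda>z. 1 / (z - a)"]) (rule c)
          moreover have "eventually (\<lambda>z. n z = winding_number g (1 / (z - a))) (nhds x)"
            using t1_space_nhds[OF False] by (rule eventually_mono) (simp add: n_def)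
          ultimately have "isCont n x" by (subst isCont_cong)
          then show ?thesis using continuous_at_imp_continuous_at_within by blast
        qed
      qed
      fix x assume x: "x \<in> H"
      have int: "n y \<in> \<int>" if "y \<in> H" for y
        unfolding n_def using integer_winding_number[of g "1 / (y - a)"] g H\<Omega>[OF that] by auto
      have "1 \<le> norm (n y - n x)" if "y \<in> H" "n y \<noteq> n x" for y
      proof -
        have "n y - n x \<in> \<int>" using int that x by auto
        then obtain k :: int where "n y - n x = of_int k" by (rule Ints_cases)
        then show ?thesis using that(2) by (cases "k = 0") auto
      qed
      then show "\<exists>e>0. \<forall>y. y \<in> H \<and> n y \<noteq> n x \<longrightarrow> e \<le> norm (n y - n x)" by (intro exI[of _ 1]) auto
    qed
    then have n0: "n y = 0" if "y \<in> H" for y using aH that unfolding constant_on_def n_def by force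
    have z0: "z \<noteq> 0" using g \<Omega>_def by auto
    have "a + 1 / z \<in> H"
    proof (rule ccontr)
      assume "a + 1 / z \<notin> H"
      then have "1 / (a + 1 / z - a) \<in> ?\<Omega>0" unfolding H_def by blast
      then show False using g unfolding \<Omega>_def by simp
    qed
    then show "winding_number g z = 0" using n0[of "a + 1 / z"] z0 unfolding n_def by simp
  qed
qed

text \<open>The Riemann map of the inverted exterior, normalized at 0; the second point
  \<open>b\<close> makes this domain a proper subset of the plane. A Riemann map need not extend to
  the boundary, so the last three conclusions record only what always holds: \<open>A\<close>
  corresponds to the unit circle, and infinity to the puncture.\<close>

lemma exterior_disc:
  fixes A :: "complex set"
  assumes A: "compact A" "connected A" "a \<in> A" "b \<in> A" "a \<noteq> b"
  obtains P Q where "P holomorphic_on outside A" "Q holomorphic_on ball 0 1 - {0}"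
    "\<And>z. z \<in> outside A \<Longrightarrow> P z \<in> ball 0 1 - {0} \<and> Q (P z) = z"
    "\<And>w. w \<in> ball 0 1 - {0} \<Longrightarrow> Q w \<in> outside A \<and> P (Q w) = w"
    "\<And>V. open V \<Longrightarrow> A \<subseteq> V \<Longrightarrow> \<exists>\<rho><1. \<forall>w. \<rho> < norm w \<and> norm w < 1 \<longrightarrow> Q w \<in> V"
    "\<And>\<rho>. \<rho> < 1 \<Longrightarrow> \<exists>V. open V \<and> A \<subseteq> V \<and> (\<forall>z\<in>V \<inter> outside A. norm (P z) > \<rho>)"
    "\<And>e. e > 0 \<Longrightarrow> \<exists>B. \<forall>z\<in>outside A. norm z > B \<longrightarrow> norm (P z) < e"
proof -
  define \<Omega> where "\<Omega> = insert 0 ((\<lambda>z. 1 / (z - a)) ` outside A)"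
  have \<Omega>: "open \<Omega>" "simply_connected \<Omega>" using simply_connected_inverted_outside[OF A(1-3)] unfolding \<Omega>_def by auto
  have na: "z \<noteq> a" if "z \<in> outside A" for z using that A(3) outside_no_overlap by blast
  have in\<Omega>: "1 / (z - a) \<in> \<Omega> \<longleftrightarrow> z \<in> outside A" if "z \<noteq> a" for z
  proof
    assume "1 / (z - a) \<in> \<Omega>"
    then obtain z' where "z' \<in> outside A" "1 / (z - a) = 1 / (z' - a)" using \<open>z \<noteq> a\<close> unfolding \<Omega>_def by auto
    then show "z \<in> outside A" by auto
  qed (auto simp: \<Omega>_def)
  have "b \<notin> outside A" using A(4) outside_no_overlap by blast
  then have "\<Omega> \<noteq> UNIV" using in\<Omega>[of b] A(5) by auto
  then obtain p1 q1 where p1: "p1 holomorphic_on \<Omega>" "q1 holomorphic_on ball 0 1"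
      "\<And>z. z \<in> \<Omega> \<Longrightarrow> p1 z \<in> ball 0 1 \<and> q1 (p1 z) = z" "\<And>w. w \<in> ball 0 1 \<Longrightarrow> q1 w \<in> \<Omega> \<and> p1 (q1 w) = w"
    using Riemann_mapping_theorem[of \<Omega>] \<Omega> unfolding \<Omega>_def by blast
  have 0: "0 \<in> \<Omega>" unfolding \<Omega>_def by simp
  \<comment> \<open>An automorphism of the disc moves the image of 0 back to 0.\<close>
  obtain f g where fg: "f (p1 0) = 0" "f holomorphic_on ball 0 1" "f ` ball 0 1 \<subseteq> ball 0 1"
      "g holomorphic_on ball 0 1" "g ` ball 0 1 \<subseteq> ball 0 1"
      "\<And>z. z \<in> ball 0 1 \<Longrightarrow> f (g z) = z" "\<And>z. z \<in> ball 0 1 \<Longrightarrow> g (f z) = z"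
    using ball_biholomorphism_exists[of "p1 0"] p1(3)[OF 0] by metis
  define p where "p = f \<circ> p1"
  define q where "q = q1 \<circ> g"
  have pq: "p holomorphic_on \<Omega>" "q holomorphic_on ball 0 1" "p 0 = 0" "q 0 = 0"
      "\<And>z. z \<in> \<Omega> \<Longrightarrow> p z \<in> ball 0 1 \<and> q (p z) = z" "\<And>w. w \<in> ball 0 1 \<Longrightarrow> q w \<in> \<Omega> \<and> p (q w) = w"
  proof -
    show "p holomorphic_on \<Omega>" unfolding p_def by (rule holomorphic_on_compose_gen[OF p1(1) fg(2)]) (use p1(3) in auto)
    show "q holomorphic_on ball 0 1" unfolding q_def by (rule holomorphic_on_compose_gen[OF fg(4) p1(2) fg(5)])
    show p0: "p 0 = 0" unfolding p_def using fg by simp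
    show *: "p z \<in> ball 0 1 \<and> q (p z) = z" if "z \<in> \<Omega>" for z
      using p1(3)[OF that] fg(3) fg(7)[of "p1 z"] unfolding p_def q_def by (auto simp: image_subset_iff)
    show "q w \<in> \<Omega> \<and> p (q w) = w" if "w \<in> ball 0 1" for w
      using p1(4)[of "g w"] fg(5) fg(6)[OF that] that unfolding p_def q_def by (auto simp: image_subset_iff)
    show "q 0 = 0" using *[OF 0] p0 by metis
  qed
  have qnz: "q w \<noteq> 0" if "w \<in> ball 0 1 - {0}" for w using pq(3) pq(6)[of w] that by auto
  have pnz: "p z \<noteq> 0" if "z \<in> \<Omega>" "z \<noteq> 0" for z using pq(4) pq(5)[of z] that by auto
  define P where "P z = p (1 / (z - a))" for z
  define Q where "Q w = a + 1 / q w" for w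
  have PP: "P z \<in> ball 0 1 - {0} \<and> Q (P z) = z" if "z \<in> outside A" for z
    using pq(5)[of "1 / (z - a)"] pnz[of "1 / (z - a)"] in\<Omega>[OF na[OF that]] that na[OF that]
    unfolding P_def Q_def by auto
  have QQ: "Q w \<in> outside A \<and> P (Q w) = w" if "w \<in> ball 0 1 - {0}" for w
  proof -
    have "1 / (Q w - a) = q w" "Q w \<noteq> a" unfolding Q_def using qnz[OF that] by auto
    then show ?thesis using pq(6)[of w] in\<Omega>[of "Q w"] that unfolding P_def by auto
  qed
  have holP: "P holomorphic_on outside A"
  proof -
    have "(p \<circ> (\<lambda>z. 1 / (z - a))) holomorphic_on outside A"
      by (rule holomorphic_on_compose_gen[OF _ pq(1)]) (use na in\<Omega> in \<open>auto intro!: holomorphic_intros\<close>)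
    then show ?thesis by (simp add: P_def[abs_def] o_def)
  qed
  have holQ: "Q holomorphic_on ball 0 1 - {0}" unfolding Q_def[abs_def]
    by (intro holomorphic_intros holomorphic_on_subset[OF pq(2)]) (use qnz in auto)
  have n1: "\<exists>\<rho><1. \<forall>w. \<rho> < norm w \<and> norm w < 1 \<longrightarrow> Q w \<in> V" if V: "open V" "A \<subseteq> V" for V
  proof (rule ccontr)
    assume "\<not> ?thesis"
    then have no: "\<And>\<rho>. \<rho> < 1 \<Longrightarrow> \<exists>w. \<rho> < norm w \<and> norm w < 1 \<and> Q w \<notin> V" by blast
    have "1 - 1 / real (Suc (Suc n)) < 1" for n by simp
    then have "\<exists>w. 1 - 1 / real (Suc (Suc n)) < norm w \<and> norm w < 1 \<and> Q w \<notin> V" for n using no by blast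
    then obtain w where w: "\<And>n. 1 - 1 / real (Suc (Suc n)) < norm (w n)" "\<And>n. norm (w n) < 1" "\<And>n. Q (w n) \<notin> V" by metis
    have "1 - 1 / real (Suc (Suc n)) > 0" for n by simp
    then have wb: "w n \<in> ball 0 1 - {0}" for n using w(1,2)[of n] by (auto; smt (verit) norm_zero)
    obtain d where d: "d > 0" "ball a d \<subseteq> V" using V A(3) open_contains_ball by blast
    have "norm (q (w n)) \<le> 1 / d" for n
    proof -
      have "Q (w n) \<notin> ball a d" using w(3)[of n] d(2) by blast
      then have "d \<le> norm (1 / q (w n))" unfolding Q_def by (simp add: dist_norm)
      then show ?thesis using qnz[OF wb[of n]] d(1) by (simp add: norm_divide field_simps)
    qed
    then obtain u r where u: "strict_mono (r :: nat \<Rightarrow> nat)" "((\<lambda>n. q (w n)) \<circ> r) \<longlonglongrightarrow> u"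
      using compact_cball[of "0::complex" "1/d", unfolded compact_def, rule_format, of "\<lambda>n. q (w n)"] by auto
    have u2: "(\<lambda>n. q (w (r n))) \<longlonglongrightarrow> u" using u(2) by (simp add: o_def)
    have "u \<in> \<Omega>"
    proof (cases "u = 0")
      case False
      then have lim: "(\<lambda>n. Q (w (r n))) \<longlonglongrightarrow> a + 1 / u" unfolding Q_def by (intro tendsto_intros u2)
      have "closed (- V \<inter> - inside A)" using V(1) open_inside[OF compact_imp_closed[OF A(1)]] by (intro closed_Int) (auto simp: closed_def)
      moreover have "Q (w (r n)) \<in> - V \<inter> - inside A" for n
        using w(3)[of "r n"] QQ[OF wb, of "r n"] by (auto simp: inside_def outside_def)
      ultimately have "a + 1 / u \<in> - V \<inter> - inside A" by (rule closed_sequentially[OF _ _ lim])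
      then have "a + 1 / u \<in> outside A" using V(2) inside_Un_outside[of A] by blast
      then have "1 / (a + 1 / u - a) \<in> \<Omega>" using in\<Omega>[of "a + 1/u"] False by simp
      then show ?thesis by simp
    qed (use 0 in simp)
    then have "isCont p u" using holomorphic_on_imp_continuous_on[OF pq(1)] \<Omega>(1) by (simp add: continuous_on_eq_continuous_at)
    then have "(\<lambda>n. p (q (w (r n)))) \<longlonglongrightarrow> p u" using isCont_tendsto_compose[OF _ u2] by blast
    then have "(\<lambda>n. w (r n)) \<longlonglongrightarrow> p u" using pq(6) wb by simp
    then have n1: "(\<lambda>n. norm (w (r n))) \<longlonglongrightarrow> norm (p u)" by (rule tendsto_norm)
    have "(\<lambda>n. 1 - 1 / real (Suc (Suc n))) \<longlonglongrightarrow> 1 - 0"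
      by (intro tendsto_intros LIMSEQ_Suc[OF LIMSEQ_Suc[OF lim_inverse_n']])
    then have n2: "(\<lambda>n. 1 - 1 / real (Suc (Suc (r n)))) \<longlonglongrightarrow> 1"
      using LIMSEQ_subseq_LIMSEQ[OF _ u(1), of "\<lambda>n. 1 - 1 / real (Suc (Suc n))" 1] by (simp add: o_def)
    have "1 \<le> norm (p u)" by (rule LIMSEQ_le[OF n2 n1]) (use w(1) in \<open>auto intro: less_imp_le\<close>)
    then show False using pq(5)[OF \<open>u \<in> \<Omega>\<close>] by simp
  qed
  have n2: "\<exists>V. open V \<and> A \<subseteq> V \<and> (\<forall>z\<in>V \<inter> outside A. norm (P z) > \<rho>)" if "\<rho> < 1" for \<rho>
  proof -
    have "continuous_on (cball 0 \<rho>) q"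
      using holomorphic_on_imp_continuous_on[OF pq(2)] by (rule continuous_on_subset) (use that in auto)
    then have K: "compact (q ` cball 0 \<rho>)" by (rule compact_continuous_image) auto
    define V where "V = insert a {z. z \<noteq> a \<and> 1 / (z - a) \<notin> q ` cball 0 \<rho>}"
    obtain B where B: "B > 0" "\<And>x. x \<in> q ` cball 0 \<rho> \<Longrightarrow> norm x \<le> B"
      using compact_imp_bounded[OF K] bounded_pos by metis
    have "V = ball a (1 / (B + 1)) \<union> {z \<in> - {a}. (\<lambda>z. 1 / (z - a)) z \<in> - q ` cball 0 \<rho>}"
    proof -
      have "1 / (z - a) \<notin> q ` cball 0 \<rho>" if "z \<noteq> a" "dist a z < 1 / (B + 1)" for z
      proof
        assume "1 / (z - a) \<in> q ` cball 0 \<rho>"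
        then have "norm (1 / (z - a)) \<le> B" by (rule B(2))
        then have "1 \<le> B * norm (z - a)" using that(1) by (simp add: norm_divide field_simps)
        moreover have "norm (z - a) * (B + 1) < 1" using that(2) B(1) by (simp add: dist_norm norm_minus_commute field_simps)
        ultimately show False using norm_ge_zero[of "z - a"] by (simp add: algebra_simps)
      qed
      then show ?thesis unfolding V_def using B(1) by (fastforce simp: ball_def)
    qed
    moreover have "open {z \<in> - {a}. (\<lambda>z. 1 / (z - a)) z \<in> - q ` cball 0 \<rho>}"
    proof -
      have "open (- {a} \<inter> (\<lambda>z. 1 / (z - a)) -` (- q ` cball 0 \<rho>))"
        using compact_imp_closed[OF K] by (intro continuous_open_preimage continuous_intros) auto
      then show ?thesis by (simp add: Int_def vimage_def)
    qed
    ultimately have "open V" by auto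
    moreover have "A \<subseteq> V"
    proof
      fix z assume z: "z \<in> A"
      have "1 / (z - a) \<notin> q ` cball 0 \<rho>" if "z \<noteq> a"
      proof
        assume "1 / (z - a) \<in> q ` cball 0 \<rho>"
        then have "1 / (z - a) \<in> \<Omega>" using pq(6) that \<open>\<rho> < 1\<close> by auto
        then show False using in\<Omega>[OF that] z outside_no_overlap by blast
      qed
      then show "z \<in> V" unfolding V_def by auto
    qed
    moreover have "norm (P z) > \<rho>" if "z \<in> V \<inter> outside A" for z
    proof (rule ccontr)
      assume "\<not> ?thesis"
      then have "q (P z) \<in> q ` cball 0 \<rho>" by auto
      moreover have "q (P z) = 1 / (z - a)" unfolding P_def using pq(5) in\<Omega>[of z] na[of z] that by auto
      ultimately show False using that na[of z] unfolding V_def by auto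
    qed
    ultimately show ?thesis by blast
  qed
  have n3: "\<exists>B. \<forall>z\<in>outside A. norm z > B \<longrightarrow> norm (P z) < e" if "e > 0" for e
  proof -
    have "isCont p 0" using holomorphic_on_imp_continuous_on[OF pq(1)] \<Omega>(1) 0 by (simp add: continuous_on_eq_continuous_at)
    then obtain d where d: "d > 0" "\<And>u. dist u 0 < d \<Longrightarrow> dist (p u) (p 0) < e"
      using \<open>e > 0\<close> unfolding continuous_at_eps_delta by blast
    have "norm (P z) < e" if z: "norm z > norm a + 1 / d" for z
    proof -
      have "norm (z - a) > 1 / d" using z norm_triangle_ineq2[of z a] by linarith
      moreover have "0 < 1 / d" using d(1) by simp
      ultimately have "1 / norm (z - a) < 1 / (1 / d)" by (intro divide_strict_left_mono mult_pos_pos) auto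
      then have "norm (1 / (z - a)) < d" by (simp add: norm_divide)
      then show ?thesis using d(2)[of "1 / (z - a)"] pq(3) unfolding P_def by simp
    qed
    then show ?thesis by blast
  qed
  show thesis by (rule that[OF holP holQ PP QQ n1 n2 n3])
qed

text \<open>The universal covering of the exterior of \<open>A\<close>, namely \<open>Q\<close>
  after \<open>exp (\<i> * z)\<close>. Its deck transformations are the translations by multiples of
  \<open>2 * pi\<close>; small heights correspond to neighbourhoods of \<open>A\<close>, great
  heights to infinity.\<close>

lemma exterior_halfplane:
  fixes A :: "complex set"
  assumes A: "compact A" "connected A" "a \<in> A" "b \<in> A" "a \<noteq> b"
  obtains X where "X holomorphic_on {z. 0 < Im z}" "\<And>z. 0 < Im z \<Longrightarrow> X z \<in> outside A"
    "\<And>z j. X (z + of_real (2 * pi * of_int j)) = X z"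
    "\<And>z z'. 0 < Im z \<Longrightarrow> 0 < Im z' \<Longrightarrow> X z = X z' \<Longrightarrow> \<exists>j. z = z' + of_real (2 * pi * of_int j)"
    "\<And>\<gamma> :: real \<Rightarrow> complex. continuous_on UNIV \<gamma> \<Longrightarrow> (\<And>t. \<gamma> t \<in> outside A) \<Longrightarrow>
       \<exists>\<Gamma>. continuous_on UNIV \<Gamma> \<and> (\<forall>t. 0 < Im (\<Gamma> t) \<and> X (\<Gamma> t) = \<gamma> t)"
    "\<And>S k. open S \<Longrightarrow> convex S \<Longrightarrow> k holomorphic_on S \<Longrightarrow> k ` S \<subseteq> outside A \<Longrightarrow>
       \<exists>G. G holomorphic_on S \<and> (\<forall>z\<in>S. 0 < Im (G z) \<and> X (G z) = k z)"
    "\<And>V. open V \<Longrightarrow> A \<subseteq> V \<Longrightarrow> \<exists>h>0. \<forall>z. 0 < Im z \<and> Im z < h \<longrightarrow> X z \<in> V"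
    "\<And>h. h > 0 \<Longrightarrow> \<exists>V. open V \<and> A \<subseteq> V \<and> (\<forall>z. 0 < Im z \<and> X z \<in> V \<longrightarrow> Im z < h)"
    "\<And>M. \<exists>B. \<forall>z. 0 < Im z \<and> norm (X z) > B \<longrightarrow> Im z > M"
proof -
  obtain P Q where P: "P holomorphic_on outside A" and Q: "Q holomorphic_on ball 0 1 - {0}"
    and PP: "\<And>z. z \<in> outside A \<Longrightarrow> P z \<in> ball 0 1 - {0} \<and> Q (P z) = z"
    and QQ: "\<And>w. w \<in> ball 0 1 - {0} \<Longrightarrow> Q w \<in> outside A \<and> P (Q w) = w"
    and n1: "\<And>V. open V \<Longrightarrow> A \<subseteq> V \<Longrightarrow> \<exists>\<rho><1. \<forall>w. \<rho> < norm w \<and> norm w < 1 \<longrightarrow> Q w \<in> V"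
    and n2: "\<And>\<rho>. \<rho> < 1 \<Longrightarrow> \<exists>V. open V \<and> A \<subseteq> V \<and> (\<forall>z\<in>V \<inter> outside A. norm (P z) > \<rho>)"
    and n3: "\<And>e. e > 0 \<Longrightarrow> \<exists>B. \<forall>z\<in>outside A. norm z > B \<longrightarrow> norm (P z) < e"
    using exterior_disc[OF A] by blast
  define X where "X z = Q (exp (\<i> * z))" for z
  have ne: "norm (exp (\<i> * z)) = exp (- Im z)" for z by (simp add: norm_exp_eq_Re)
  have eb: "exp (\<i> * z) \<in> ball 0 1 - {0}" if "0 < Im z" for z using that by (simp add: ne)
  have PX: "P (X z) = exp (\<i> * z)" "X z \<in> outside A" if "0 < Im z" for z unfolding X_def using QQ[OF eb[OF that]] by auto
  have ex: "exp (\<i> * (- \<i> * l)) = exp l" for l :: complex by (simp add: algebra_simps)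
  have lift: "0 < Im (- \<i> * l) \<and> X (- \<i> * l) = w" if "w \<in> outside A" "P w = exp l" for w l
  proof -
    have "exp (Re l) < 1" using PP[OF that(1)] that(2) by (simp add: norm_exp_eq_Re)
    then show ?thesis unfolding X_def ex using PP[OF that(1)] that(2) by simp
  qed
  have "(Q \<circ> (\<lambda>z. exp (\<i> * z))) holomorphic_on {z. 0 < Im z}"
    by (rule holomorphic_on_compose_gen[OF _ Q]) (use eb in \<open>auto intro!: holomorphic_intros\<close>)
  then have hX: "X holomorphic_on {z. 0 < Im z}" by (simp add: X_def[abs_def] o_def)
  have per: "X (z + of_real (2 * pi * of_int j)) = X z" for z j
  proof -
    have "exp (\<i> * (z + of_real (2 * pi * of_int j))) = exp (\<i> * z)"
      unfolding exp_eq by (intro exI[of _ j]) (simp add: algebra_simps)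
    then show ?thesis by (simp add: X_def)
  qed
  have inj: "\<exists>j. z = z' + of_real (2 * pi * of_int j)" if "0 < Im z" "0 < Im z'" "X z = X z'" for z z'
  proof -
    have "exp (\<i> * z) = exp (\<i> * z')" using PX(1)[OF that(1)] PX(1)[OF that(2)] that(3) by simp
    then obtain j :: int where "\<i> * z = \<i> * z' + (of_int (2 * j) * of_real pi) * \<i>" unfolding exp_eq by auto
    then have "\<i> * z = \<i> * (z' + of_real (2 * pi * of_int j))" by (simp add: algebra_simps)
    then have "z = z' + of_real (2 * pi * of_int j)" by (metis complex_i_not_zero mult_cancel_left)
    then show ?thesis by blast
  qed
  have liftc: "\<exists>\<Gamma>. continuous_on UNIV \<Gamma> \<and> (\<forall>t. 0 < Im (\<Gamma> t) \<and> X (\<Gamma> t) = \<gamma> t)"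
    if \<gamma>: "continuous_on UNIV \<gamma>" "\<And>t. \<gamma> t \<in> outside A" for \<gamma> :: "real \<Rightarrow> complex"
  proof -
    have "continuous_on UNIV (\<lambda>t. P (\<gamma> t))"
      by (rule continuous_on_compose2[OF holomorphic_on_imp_continuous_on[OF P] \<gamma>(1)]) (use \<gamma> in auto)
    moreover have "P (\<gamma> t) \<noteq> 0" for t using PP[OF \<gamma>(2)] by auto
    ultimately obtain l where l: "continuous_on UNIV l" "\<And>t. P (\<gamma> t) = exp (l t)"
      using continuous_logarithm_on_contractible[of UNIV "\<lambda>t. P (\<gamma> t)"] convex_imp_contractible[OF convex_UNIV] by auto
    then show ?thesis using lift \<gamma>(2) by (intro exI[of _ "\<lambda>t. - \<i> * l t"]) (auto intro!: continuous_intros)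
  qed
  have lifth: "\<exists>G. G holomorphic_on S \<and> (\<forall>z\<in>S. 0 < Im (G z) \<and> X (G z) = k z)"
    if S: "open S" "convex S" "k holomorphic_on S" "k ` S \<subseteq> outside A" for S k
  proof -
    have "(P \<circ> k) holomorphic_on S" by (rule holomorphic_on_compose_gen[OF S(3) P S(4)])
    moreover have "(P \<circ> k) z \<noteq> 0" if "z \<in> S" for z using PP[of "k z"] S(4) that by auto
    ultimately obtain l where "l holomorphic_on S" "\<And>z. z \<in> S \<Longrightarrow> (P \<circ> k) z = exp (l z)"
      using simply_connected_imp_holomorphic_log[of "P \<circ> k" S] convex_imp_simply_connected[OF S(2)]
        open_imp_locally_path_connected[OF S(1)] by blast
    then show ?thesis using lift S(4) by (intro exI[of _ "\<lambda>z. - \<i> * l z"]) (auto intro!: holomorphic_intros)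
  qed
  have m1: "\<exists>h>0. \<forall>z. 0 < Im z \<and> Im z < h \<longrightarrow> X z \<in> V" if V: "open V" "A \<subseteq> V" for V
  proof -
    obtain \<rho> where \<rho>: "\<rho> < 1" "\<And>w. \<rho> < norm w \<Longrightarrow> norm w < 1 \<Longrightarrow> Q w \<in> V" using n1[OF V] by blast
    define \<rho>' where "\<rho>' = max \<rho> (1/2)"
    have \<rho>': "0 < \<rho>'" "\<rho>' < 1" "\<rho> \<le> \<rho>'" using \<rho>(1) unfolding \<rho>'_def by auto
    have "X z \<in> V" if "0 < Im z" "Im z < - ln \<rho>'" for z
    proof -
      have "exp (ln \<rho>') < exp (- Im z)" using that by simp
      then show ?thesis unfolding X_def using that \<rho>' by (intro \<rho>(2)) (auto simp: ne)
    qed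
    then show ?thesis using \<rho>' by (intro exI[of _ "- ln \<rho>'"]) auto
  qed
  have m2: "\<exists>V. open V \<and> A \<subseteq> V \<and> (\<forall>z. 0 < Im z \<and> X z \<in> V \<longrightarrow> Im z < h)" if h: "h > 0" for h
  proof -
    obtain V where V: "open V" "A \<subseteq> V" "\<And>z. z \<in> V \<inter> outside A \<Longrightarrow> norm (P z) > exp (- h)"
      using n2[of "exp (- h)"] h by auto
    have "Im z < h" if "0 < Im z" "X z \<in> V" for z
      using V(3)[of "X z"] PX[OF that(1)] that(2) by (simp add: ne)
    then show ?thesis using V by blast
  qed
  have m3: "\<exists>B. \<forall>z. 0 < Im z \<and> norm (X z) > B \<longrightarrow> Im z > M" for M
  proof -
    obtain B where B: "\<And>z. z \<in> outside A \<Longrightarrow> norm z > B \<Longrightarrow> norm (P z) < exp (- M)"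
      using n3[of "exp (- M)"] by auto
    have "Im z > M" if "0 < Im z" "norm (X z) > B" for z
      using B[of "X z"] PX[OF that(1)] that(2) by (simp add: ne)
    then show ?thesis by blast
  qed
  show thesis by (rule that[OF hX PX(2) per inj liftc lifth m1 m2 m3])
qed

section \<open>Reflection in the boundary of a strip\<close>

text \<open>The maximum principle for \<open>Im G - K * Im\<close>; periodicity makes up for the noncompactness of the strip.\<close>

lemma positive_harmonic_strip_bound:
  fixes G :: "complex \<Rightarrow> complex"
  assumes h: "h > 0" and G: "G holomorphic_on {z. 0 < Im z \<and> Im z < h}"
    and pos: "\<And>z. 0 < Im z \<Longrightarrow> Im z < h \<Longrightarrow> 0 < Im (G z)"
    and per: "\<And>z. 0 < Im z \<Longrightarrow> Im z < h \<Longrightarrow> Im (G (z + of_real (2 * pi))) = Im (G z)"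
    and lim: "\<And>e. e > 0 \<Longrightarrow> \<exists>\<eta>>0. \<forall>z. 0 < Im z \<and> Im z < \<eta> \<and> Im z < h \<longrightarrow> Im (G z) < e"
  obtains C where "C \<ge> 0" "\<And>z. 0 < Im z \<Longrightarrow> Im z < h / 2 \<Longrightarrow> Im (G z) \<le> C * Im z"
proof -
  define S where "S = {z. 0 < Im z \<and> Im z < h}"
  have perj: "Im (G (z + of_real (2 * pi * of_nat n))) = Im (G z)" if "z \<in> S" for z n
  proof (induction n)
    case (Suc n)
    have "z + of_real (2 * pi * of_nat (Suc n)) = (z + of_real (2 * pi * of_nat n)) + of_real (2 * pi)" by (simp add: algebra_simps)
    moreover have "Im (G ((z + of_real (2 * pi * of_nat n)) + of_real (2 * pi))) = Im (G (z + of_real (2 * pi * of_nat n)))"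
      by (rule per) (use that in \<open>auto simp: S_def\<close>)
    ultimately show ?case using Suc by metis
  qed simp
  have red: "\<exists>z'. Im z' = Im z \<and> 0 \<le> Re z' \<and> Re z' \<le> 2 * pi \<and> Im (G z') = Im (G z)" if z: "z \<in> S" for z
  proof -
    define m where "m = \<lfloor>Re z / (2 * pi)\<rfloor>"
    define z' where "z' = z + of_real (2 * pi * of_int (- m))"
    have "of_int m \<le> Re z / (2 * pi)" "Re z / (2 * pi) < of_int m + 1" unfolding m_def by linarith+
    then have b: "0 \<le> Re z'" "Re z' \<le> 2 * pi" unfolding z'_def by (auto simp: field_simps)
    have "Im (G z') = Im (G z)"
    proof (cases "m \<le> 0")
      case True then show ?thesis using perj[OF z, of "nat (- m)"] unfolding z'_def by simp
    next
      case False
      have "z' \<in> S" using z unfolding S_def z'_def by simp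
      then show ?thesis using perj[of z' "nat m"] False unfolding z'_def by simp
    qed
    then show ?thesis using b unfolding z'_def by (intro exI[of _ "z + of_real (2 * pi * of_int (- m))"]) auto
  qed
  have oS: "open S" "connected S"
  proof -
    have S: "S = {z. Im z > 0} \<inter> {z. Im z < h}" unfolding S_def by auto
    show "open S" unfolding S by (intro open_Int open_halfspace_Im_gt open_halfspace_Im_lt)
    show "connected S" unfolding S by (intro convex_connected convex_Int convex_halfspace_Im_gt convex_halfspace_Im_lt)
  qed
  have cG: "continuous_on S (\<lambda>z. Im (G z))"
    using G unfolding S_def by (intro continuous_intros holomorphic_on_imp_continuous_on)
  have maxbox: "\<exists>w. 0 \<le> Re w \<and> Re w \<le> 2 * pi \<and> y1 \<le> Im w \<and> Im w \<le> y2 \<and> (\<forall>z. y1 \<le> Im z \<and> Im z \<le> y2 \<longrightarrow> Im (G z) - K * Im z \<le> Im (G w) - K * Im w)"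
    if y: "0 < y1" "y1 \<le> y2" "y2 < h" for y1 y2 K
  proof -
    let ?B = "cbox (Complex 0 y1) (Complex (2 * pi) y2)"
    have BS: "?B \<subseteq> S" using y unfolding S_def by (auto simp: in_cbox_complex_iff)
    have "\<exists>w\<in>?B. \<forall>z\<in>?B. Im (G z) - K * Im z \<le> Im (G w) - K * Im w"
      by (intro continuous_attains_sup continuous_intros continuous_on_subset[OF cG BS] compact_cbox)
        (use y in \<open>auto simp: box_ne_empty Basis_complex_def\<close>)
    then obtain w where w: "w \<in> ?B" "\<And>z. z \<in> ?B \<Longrightarrow> Im (G z) - K * Im z \<le> Im (G w) - K * Im w" by blast
    have "Im (G z) - K * Im z \<le> Im (G w) - K * Im w" if z: "y1 \<le> Im z" "Im z \<le> y2" for z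
    proof -
      have "z \<in> S" using z y unfolding S_def by auto
      then obtain z' where z': "Im z' = Im z" "0 \<le> Re z'" "Re z' \<le> 2 * pi" "Im (G z') = Im (G z)" using red by blast
      then have "z' \<in> ?B" using z by (auto simp: in_cbox_complex_iff)
      then show ?thesis using w(2) z' by metis
    qed
    then show ?thesis using w(1) by (intro exI[of _ w]) (auto simp: in_cbox_complex_iff)
  qed
  obtain w0 where w0: "\<And>z. Im z = h / 2 \<Longrightarrow> Im (G z) - 0 * Im z \<le> Im (G w0) - 0 * Im w0" "Im w0 = h / 2"
    using maxbox[of "h/2" "h/2" 0] h by force
  \<comment> \<open>The slope at which \<open>Im G - K * Im\<close> is nonpositive at height
    \<open>h / 2\<close>, with equality at \<open>w0\<close>.\<close>
  define K where "K = Im (G w0) / (h / 2)"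
  have K0: "K \<ge> 0" unfolding K_def using pos[of w0] w0(2) h by simp
  have "Im (G z) \<le> K * Im z" if z: "0 < Im z" "Im z < h / 2" for z
  proof (rule ccontr)
    assume "\<not> ?thesis"
    then have gt: "Im (G z) - K * Im z > 0" by simp
    define d where "d = Im (G z) - K * Im z"
    obtain \<eta> where \<eta>: "\<eta> > 0" "\<And>z. 0 < Im z \<Longrightarrow> Im z < \<eta> \<Longrightarrow> Im z < h \<Longrightarrow> Im (G z) < d"
      using lim[of d] gt unfolding d_def by auto
    define y1 where "y1 = min (Im z) \<eta> / 2"
    have y1: "0 < y1" "y1 < Im z" "y1 < \<eta>" using z \<eta>(1) unfolding y1_def by auto
    obtain w where w: "y1 \<le> Im w" "Im w \<le> h / 2" "\<And>z. y1 \<le> Im z \<Longrightarrow> Im z \<le> h / 2 \<Longrightarrow> Im (G z) - K * Im z \<le> Im (G w) - K * Im w"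
      using maxbox[of y1 "h/2" K] y1 z h by auto
    have dw: "d \<le> Im (G w) - K * Im w" using w(3)[of z] y1 z unfolding d_def by auto
    have "Im w \<noteq> h / 2"
    proof
      assume wh: "Im w = h / 2"
      then have "Im (G w) \<le> Im (G w0)" using w0(1)[of w] by simp
      moreover have "K * Im w = Im (G w0)" unfolding K_def wh using h by simp
      ultimately show False using dw gt unfolding d_def by simp
    qed
    then have w2: "Im w < h / 2" using w(2) by simp
    define T where "T = {z. 0 < Im z} \<inter> {z. Im z < h / 2}"
    have T: "open T" "connected T" unfolding T_def
      by (intro open_Int open_halfspace_Im_gt open_halfspace_Im_lt convex_connected convex_Int convex_halfspace_Im_gt convex_halfspace_Im_lt)+
    have TS: "T \<subseteq> S" unfolding T_def S_def using h by auto
    \<comment> \<open>The modulus of \<open>E\<close> is the exponential of the harmonic function in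
      question, so that the maximum modulus principle applies.\<close>
    define E where "E u = exp (- \<i> * (G u - of_real K * u))" for u
    have nE: "norm (E u) = exp (Im (G u) - K * Im u)" for u unfolding E_def by (simp add: norm_exp_eq_Re)
    have low: "Im (G u) - K * Im u < d" if "0 < Im u" "Im u \<le> y1" for u
    proof -
      have "Im (G u) < d" using \<eta>(2)[of u] that y1 z h by auto
      moreover have "0 \<le> K * Im u" using K0 that by simp
      ultimately show ?thesis by linarith
    qed
    have "E constant_on T"
    proof (rule maximum_modulus_principle[OF _ T T(1) order_refl, of E w])
      show "E holomorphic_on T" unfolding E_def using G TS unfolding S_def
        by (intro holomorphic_intros holomorphic_on_subset[OF G]) auto
      show "w \<in> T" using w w2 y1 unfolding T_def by auto
      show "norm (E u) \<le> norm (E w)" if "u \<in> T" for u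
      proof (cases "Im u \<le> y1")
        case True then show ?thesis using low[of u] that dw unfolding nE T_def by simp
      next
        case False then show ?thesis using w(3)[of u] that unfolding nE T_def by simp
      qed
    qed
    moreover have "Complex 0 y1 \<in> T" "w \<in> T" using w w2 y1 z unfolding T_def by auto
    ultimately have "E (Complex 0 y1) = E w" unfolding constant_on_def by metis
    then have "norm (E (Complex 0 y1)) = norm (E w)" by simp
    then show False using low[of "Complex 0 y1"] y1 dw unfolding nE by simp
  qed
  then show thesis using that K0 by blast
qed

lemma strip_convex: "convex {z. a < Im z \<and> Im z < b}" "open {z. a < Im z \<and> Im z < b}"
proof -
  have S: "{z. a < Im z \<and> Im z < b} = {z. Im z > a} \<inter> {z. Im z < b}" by auto
  show "convex {z. a < Im z \<and> Im z < b}" unfolding S by (intro convex_Int convex_halfspace_Im_gt convex_halfspace_Im_lt)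
  show "open {z. a < Im z \<and> Im z < b}" unfolding S by (intro open_Int open_halfspace_Im_gt open_halfspace_Im_lt)
qed

text \<open>Schwarz reflection needs continuity up to the real axis, but only \<open>Im G\<close> is
  known to tend to 0 there. The linear bound on \<open>Im G\<close> yields a bound on the derivative
  by Cauchy's estimate, so \<open>G\<close> is Lipschitz and extends to the closure.\<close>

lemma strip_reflection:
  fixes G :: "complex \<Rightarrow> complex" and m :: int
  assumes h: "h > 0" and G: "G holomorphic_on {z. 0 < Im z \<and> Im z < h}"
    and pos: "\<And>z. 0 < Im z \<Longrightarrow> Im z < h \<Longrightarrow> 0 < Im (G z)"
    and per: "\<And>z. 0 < Im z \<Longrightarrow> Im z < h \<Longrightarrow> G (z + of_real (2 * pi)) = G z + of_real (2 * pi * of_int m)"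
    and lim: "\<And>e. e > 0 \<Longrightarrow> \<exists>\<eta>>0. \<forall>z. 0 < Im z \<and> Im z < \<eta> \<and> Im z < h \<longrightarrow> Im (G z) < e"
  obtains h' F C L where "0 < h'" "h' \<le> h" "F holomorphic_on {z. - h' < Im z \<and> Im z < h'}"
    "\<And>z. 0 < Im z \<Longrightarrow> Im z < h' \<Longrightarrow> F z = G z"
    "\<And>z. Im z = 0 \<Longrightarrow> Im (F z) = 0"
    "\<And>z. - h' < Im z \<Longrightarrow> Im z < 0 \<Longrightarrow> Im (F z) < 0"
    "\<And>z. 0 < Im z \<Longrightarrow> Im z < h' \<Longrightarrow> Im (F z) \<le> C * Im z"
    "\<And>z. - h' < Im z \<Longrightarrow> Im z < h' \<Longrightarrow> F (z + of_real (2 * pi)) = F z + of_real (2 * pi * of_int m)"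
    "\<And>z w. 0 \<le> Im z \<Longrightarrow> Im z < h' \<Longrightarrow> 0 \<le> Im w \<Longrightarrow> Im w < h' \<Longrightarrow> norm (F z - F w) \<le> L * norm (z - w)"
proof -
  \<comment> \<open>Below \<open>h / 4\<close> the disc of radius half the height stays in the lower
    half of the strip, where the linear bound holds.\<close>
  define h' where "h' = h / 4"
  have h': "0 < h'" "h' \<le> h" using h unfolding h'_def by auto
  have per': "Im (G (z + of_real (2 * pi))) = Im (G z)" if "0 < Im z" "Im z < h" for z
    unfolding per[OF that] by simp
  obtain C where C: "C \<ge> 0" "\<And>z. 0 < Im z \<Longrightarrow> Im z < h / 2 \<Longrightarrow> Im (G z) \<le> C * Im z"
    using positive_harmonic_strip_bound[OF h G pos per' lim] by blast
  let ?S = "{z. 0 < Im z \<and> Im z < h}"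
  let ?T = "{z. 0 < Im z \<and> Im z < h'}"
  note T = strip_convex[of 0 h']
  define L where "L = 2 * (exp (2 * C) + 1)"
  have dG: "norm (deriv G z) \<le> L" if z: "z \<in> ?T" for z
  proof -
    define y where "y = Im z"
    have y: "y > 0" "y < h / 4" using z unfolding y_def h'_def by auto
    \<comment> \<open>The real part of \<open>G\<close> is not under control, but the modulus of
      \<open>\<phi>\<close> depends on \<open>Im G\<close> alone: it is at most
      \<open>exp (2 * C)\<close> on the disc of radius \<open>y / 2\<close> and at least 1 at
      \<open>z\<close>, as \<open>Im G > 0\<close>. Dividing by \<open>y\<close> makes the estimate
      uniform in the height.\<close>
    define \<phi> where "\<phi> u = exp (- \<i> * G u / of_real y)" for u
    have cb: "cball z (y / 2) \<subseteq> {z. 0 < Im z \<and> Im z < h / 2} \<inter> {u. Im u \<le> 2 * y}"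
    proof
      fix u assume "u \<in> cball z (y / 2)"
      then have "\<bar>Im z - Im u\<bar> \<le> y / 2" using abs_Im_le_cmod[of "z - u"] by (simp add: dist_norm)
      then have "Im u \<ge> y / 2" "Im u \<le> 3 / 2 * y" unfolding y_def by linarith+
      then show "u \<in> {z. 0 < Im z \<and> Im z < h / 2} \<inter> {u. Im u \<le> 2 * y}" using y by simp
    qed
    have sub: "cball z (y / 2) \<subseteq> ?S" using cb h by auto
    have hol: "\<phi> holomorphic_on cball z (y / 2)" unfolding \<phi>_def
      using y by (intro holomorphic_intros holomorphic_on_subset[OF G sub]) auto
    have n\<phi>: "norm (\<phi> u) = exp (Im (G u) / y)" for u unfolding \<phi>_def by (simp add: norm_exp_eq_Re)
    have "norm ((deriv ^^ 1) \<phi> z) \<le> fact 1 * (exp (2 * C) + 1) / (y / 2) ^ 1"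
    proof (rule Cauchy_higher_deriv_bound)
      show "\<phi> holomorphic_on ball z (y / 2)" using hol ball_subset_cball by (rule holomorphic_on_subset)
      show "continuous_on (cball z (y / 2)) \<phi>" using hol by (rule holomorphic_on_imp_continuous_on)
      fix u assume "u \<in> ball z (y / 2)"
      then have u: "u \<in> cball z (y / 2)" by simp
      have "Im (G u) \<le> C * Im u" using C(2)[of u] cb u by blast
      also have "\<dots> \<le> C * (2 * y)" using C(1) cb u by (intro mult_left_mono) auto
      finally have "Im (G u) / y \<le> 2 * C" using y by (simp add: field_simps)
      then have "norm (\<phi> u) \<le> exp (2 * C)" unfolding n\<phi> by simp
      then show "\<phi> u \<in> ball 0 (exp (2 * C) + 1)" by simp
    qed (use y in auto)
    then have d1: "norm (deriv \<phi> z) \<le> L / y" unfolding L_def by (simp add: field_simps)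
    have zS: "z \<in> ?S" using z h' by auto
    have "(G has_field_derivative deriv G z) (at z)" using holomorphic_derivI[OF G strip_convex(2) zS] .
    then have "(\<phi> has_field_derivative \<phi> z * (- \<i> * deriv G z / of_real y)) (at z)"
      unfolding \<phi>_def[abs_def] using y by (auto intro!: derivative_eq_intros)
    then have "deriv \<phi> z = \<phi> z * (- \<i> * deriv G z / of_real y)" by (rule DERIV_imp_deriv)
    then have "norm (\<phi> z) * (norm (deriv G z) / y) \<le> L / y" using d1 y by (simp add: norm_mult norm_divide)
    moreover have "1 \<le> norm (\<phi> z)" unfolding n\<phi> using pos[of z] zS y by simp
    then have "1 * (norm (deriv G z) / y) \<le> norm (\<phi> z) * (norm (deriv G z) / y)" using y by (intro mult_right_mono) auto
    ultimately show ?thesis using y by (simp add: field_simps)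
  qed
  have lip: "norm (G z - G w) \<le> L * norm (z - w)" if "z \<in> ?T" "w \<in> ?T" for z w
  proof (rule field_differentiable_bound[OF T(1) _ _ that])
    fix u assume u: "u \<in> ?T"
    show "(G has_field_derivative deriv G u) (at u within ?T)"
      using holomorphic_derivI[OF G strip_convex(2), of u] u h' has_field_derivative_at_within by auto
  qed (rule dG)
  have "L \<ge> 0" unfolding L_def by (simp add: add_nonneg_nonneg)
  have "uniformly_continuous_on ?T G"
    by (rule lipschitz_on_uniformly_continuous[OF lipschitz_onI[of ?T G L]])
      (use lip \<open>L \<ge> 0\<close> in \<open>simp_all only: dist_norm\<close>)
  then obtain G1 where G1: "uniformly_continuous_on (closure ?T) G1" "\<And>x. x \<in> ?T \<Longrightarrow> G x = G1 x"
    by (rule uniformly_continuous_on_extension_on_closure) blast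
  \<comment> \<open>Points of the open strip that approach \<open>u\<close> from above. They commute
    with horizontal translation, so periodicity and the Lipschitz bound pass to the limit.\<close>
  define s where "s u n = u + \<i> * of_real ((h' - Im u) / real (n + 2))" for u n
  have Ims: "Im (s u n) = Im u + (h' - Im u) / real (n + 2)" for u n unfolding s_def by simp
  have st: "s u n \<in> ?T" if "0 \<le> Im u" "Im u < h'" for u n
  proof -
    have e: "0 < (h' - Im u) / real (n + 2)" using that by simp
    have "(h' - Im u) / real (n + 2) < (h' - Im u) / 1" using that by (intro divide_strict_left_mono) auto
    then have "(h' - Im u) / real (n + 2) < h' - Im u" unfolding div_by_1 .
    then have "0 < Im u + (h' - Im u) / real (n + 2) \<and> Im u + (h' - Im u) / real (n + 2) < h'" using e that by linarith
    then show ?thesis unfolding mem_Collect_eq Ims .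
  qed
  have sl: "s u \<longlonglongrightarrow> u" for u
  proof -
    have "(\<lambda>n. (h' - Im u) / real (n + 2)) \<longlonglongrightarrow> 0" by real_asymp
    then have "s u \<longlonglongrightarrow> u + \<i> * of_real 0" unfolding s_def by (intro tendsto_intros)
    then show ?thesis by simp
  qed
  have cl: "z \<in> closure ?T" if z: "0 \<le> Im z" "Im z < h'" for z
    unfolding closure_sequential using st[OF z] sl by blast
  have c1: "continuous_on {z. 0 \<le> Im z \<and> Im z < h'} G1"
    using uniformly_continuous_imp_continuous[OF G1(1)] by (rule continuous_on_subset) (use cl in auto)
  have sG: "(\<lambda>n. G (s u n)) \<longlonglongrightarrow> G1 u" if u: "0 \<le> Im u" "Im u < h'" for u
  proof -
    have "(\<lambda>n. G1 (s u n)) \<longlonglongrightarrow> G1 u"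
      by (rule continuous_on_tendsto_compose[OF c1 sl]) (use u st[OF u] in \<open>auto intro!: always_eventually simp: less_imp_le\<close>)
    then show ?thesis using G1(2)[OF st[OF u]] by simp
  qed
  have re1: "Im (G1 z) = 0" if z: "Im z = 0" for z
  proof -
    have z': "0 \<le> Im z" "Im z < h'" using z h' by auto
    have sT: "0 < Im (s z n)" "Im (s z n) < h / 4" for n using st[OF z', of n] unfolding h'_def by auto
    have "(\<lambda>n. Im (G (s z n))) \<longlonglongrightarrow> 0"
    proof (rule tendsto_sandwich[of "\<lambda>_. 0" _ _ "\<lambda>n. C * Im (s z n)"])
      show "eventually (\<lambda>n. 0 \<le> Im (G (s z n))) sequentially"
      proof (intro always_eventually allI)
        fix n show "0 \<le> Im (G (s z n))" using pos[of "s z n"] sT[of n] h by linarith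
      qed
      have "Im (G (s z n)) \<le> C * Im (s z n)" for n using C(2)[of "s z n"] sT[of n] by linarith
      then show "eventually (\<lambda>n. Im (G (s z n)) \<le> C * Im (s z n)) sequentially" by (intro always_eventually) auto
      have "(\<lambda>n. C * Im (s z n)) \<longlonglongrightarrow> C * Im z" by (intro tendsto_intros sl)
      then show "(\<lambda>n. C * Im (s z n)) \<longlonglongrightarrow> 0" using z by simp
    qed auto
    then show ?thesis using tendsto_Im[OF sG[OF z']] LIMSEQ_unique by blast
  qed
  let ?R = "{z. - h' < Im z \<and> Im z < h'}"
  define F where "F z = (if 0 \<le> Im z then G1 z else cnj (G1 (cnj z)))" for z
  have GT: "G holomorphic_on ?T" using G by (rule holomorphic_on_subset) (use h' in auto)
  have "F holomorphic_on ?R" unfolding F_def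
  proof (rule Schwarz_reflection)
    show "open ?R" by (rule strip_convex)
    show "cnj ` ?R \<subseteq> ?R" by auto
    show "G1 holomorphic_on ?R \<inter> {z. 0 < Im z}"
      by (rule holomorphic_transform[OF holomorphic_on_subset[OF GT]]) (use G1(2) h' in auto)
    show "continuous_on (?R \<inter> {z. 0 \<le> Im z}) G1" using c1 by (rule continuous_on_subset) auto
    show "G1 z \<in> \<real>" if "z \<in> ?R" "z \<in> \<real>" for z using re1[of z] that by (simp add: complex_is_Real_iff)
  qed
  have FG: "F z = G z" if "0 < Im z" "Im z < h'" for z using G1(2)[of z] that by (simp add: F_def)
  have Fpos: "F (z + of_real (2 * pi)) = F z + of_real (2 * pi * of_int m)" if z: "0 \<le> Im z" "Im z < h'" for z
  proof (cases "Im z = 0")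
    case False
    then show ?thesis using FG[of z] FG[of "z + of_real (2 * pi)"] per[of z] z h' by auto
  next
    case True
    have z2: "Im (z + of_real (2 * pi)) = 0" using True by simp
    have z': "0 \<le> Im z" "Im z < h'" using True h' by auto
    have "s (z + of_real (2 * pi)) n = s z n + of_real (2 * pi)" for n by (simp add: s_def)
    then have "G (s (z + of_real (2 * pi)) n) = G (s z n) + of_real (2 * pi * of_int m)" for n
      using per[of "s z n"] st[OF z', of n] h' by simp
    then have "(\<lambda>n. G (s z n) + of_real (2 * pi * of_int m)) \<longlonglongrightarrow> G1 (z + of_real (2 * pi))"
      using sG[of "z + of_real (2 * pi)"] z' by simp
    moreover have "(\<lambda>n. G (s z n) + of_real (2 * pi * of_int m)) \<longlonglongrightarrow> G1 z + of_real (2 * pi * of_int m)"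
      by (intro tendsto_intros sG z')
    ultimately show ?thesis using LIMSEQ_unique True by (fastforce simp: F_def)
  qed
  have Fcnj: "F (cnj z) = cnj (F z)" for z
  proof (cases "Im z = 0")
    case True
    then have "cnj z = z" by (simp add: complex_eq_iff)
    moreover have "cnj (F z) = F z" using re1[OF True] True by (simp add: F_def complex_eq_iff)
    ultimately show ?thesis by metis
  qed (auto simp: F_def)
  have lip0: "norm (F z - F w) \<le> L * norm (z - w)" if z: "0 \<le> Im z" "Im z < h'" "0 \<le> Im w" "Im w < h'" for z w
  proof -
    have "(\<lambda>n. norm (G (s z n) - G (s w n))) \<longlonglongrightarrow> norm (G1 z - G1 w)" by (intro tendsto_intros sG z)
    then have "(\<lambda>n. norm (G (s z n) - G (s w n))) \<longlonglongrightarrow> norm (F z - F w)" using z by (simp add: F_def)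
    moreover have "(\<lambda>n. L * norm (s z n - s w n)) \<longlonglongrightarrow> L * norm (z - w)" by (intro tendsto_intros sl)
    ultimately show ?thesis
      by (rule LIMSEQ_le) (use lip[OF st[OF z(1,2)] st[OF z(3,4)]] in blast)
  qed
  show thesis
  proof (rule that[of h' F C L, OF h' \<open>F holomorphic_on ?R\<close> FG])
    show "Im (F z) = 0" if "Im z = 0" for z using re1[OF that] that by (simp add: F_def)
    show "Im (F z) < 0" if "- h' < Im z" "Im z < 0" for z
      using pos[of "cnj z"] FG[of "cnj z"] that h' arg_cong[OF Fcnj[of z], of Im] by auto
    show "Im (F z) \<le> C * Im z" if "0 < Im z" "Im z < h'" for z
      using C(2)[of z] FG[OF that] that h unfolding h'_def by simp
    show "F (z + of_real (2 * pi)) = F z + of_real (2 * pi * of_int m)" if "- h' < Im z" "Im z < h'" for z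
    proof (cases "0 \<le> Im z")
      case True then show ?thesis using Fpos that by simp
    next
      case False
      then have "F (cnj (z + of_real (2 * pi))) = F (cnj z) + of_real (2 * pi * of_int m)"
        using Fpos[of "cnj z"] that by simp
      then have "cnj (F (z + of_real (2 * pi))) = cnj (F z + of_real (2 * pi * of_int m))" unfolding Fcnj by simp
      then show ?thesis by (metis complex_cnj_cancel_iff)
    qed
  qed (use lip0 in auto)
qed

section \<open>Reflected maps of a strip\<close>

text \<open>
  A lift of a map defined near the boundary circle of a disc, after reflection: the strip is
  \<open>{- h < Im z < h}\<close>, the circle is the real axis modulo \<open>2 * pi\<close>.
\<close>

locale strip_map =
  fixes F :: "complex \<Rightarrow> complex" and h C L :: real and m :: int
  assumes h: "h > 0" and hol: "F holomorphic_on {z. - h < Im z \<and> Im z < h}"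
    and pos: "0 < Im z \<Longrightarrow> Im z < h \<Longrightarrow> 0 < Im (F z)"
    and zero: "Im z = 0 \<Longrightarrow> Im (F z) = 0"
    and neg: "- h < Im z \<Longrightarrow> Im z < 0 \<Longrightarrow> Im (F z) < 0"
    and bound: "0 < Im z \<Longrightarrow> Im z < h \<Longrightarrow> Im (F z) \<le> C * Im z"
    and per: "- h < Im z \<Longrightarrow> Im z < h \<Longrightarrow> F (z + of_real (2 * pi)) = F z + of_real (2 * pi * of_int m)"
    and lip: "0 \<le> Im z \<Longrightarrow> Im z < h \<Longrightarrow> 0 \<le> Im w \<Longrightarrow> Im w < h \<Longrightarrow> norm (F z - F w) \<le> L * norm (z - w)"
    and inj: "0 < Im z \<Longrightarrow> Im z < h \<Longrightarrow> 0 < Im z' \<Longrightarrow> Im z' < h \<Longrightarrow> F z = F z' + of_real (2 * pi * of_int j) \<Longrightarrow>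
      \<exists>j'. z = z' + of_real (2 * pi * of_int j')"
begin

definition R :: "complex set" where "R = {z. - h < Im z \<and> Im z < h}"

lemma R: "open R" "convex R" "connected R" "F holomorphic_on R" "of_real x \<in> R"
  using strip_convex[of "-h" h] hol h by (auto simp: R_def convex_connected)

lemma contF: "z \<in> R \<Longrightarrow> isCont F z"
  using holomorphic_on_imp_continuous_on[OF R(4)] R(1) by (simp add: continuous_on_eq_continuous_at)

lemma nonconst: assumes "open U" "U \<noteq> {}" "U \<subseteq> R" shows "\<not> F constant_on U"
proof
  assume "F constant_on U"
  then obtain c where c: "\<And>z. z \<in> U \<Longrightarrow> F z = c" unfolding constant_on_def by blast
  have e: "F z = c" if "z \<in> R" for z
    using analytic_continuation_open[OF assms(1) R(1) assms(2) R(3) assms(3) R(4), of "\<lambda>_. c" z] c that by auto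
  have i: "\<i> * of_real (h / 2) \<in> R" "0 \<in> R" using h by (auto simp: R_def)
  have "Im (F (\<i> * of_real (h / 2))) > 0" using h by (intro pos) auto
  then show False using e[OF i(1)] e[OF i(2)] zero[of 0] by simp
qed

text \<open>Injectivity above the real axis passes to the axis itself. Small discs about
  \<open>x\<close> and \<open>x'\<close> have open images, which overlap modulo the period at a
  point above the axis. Its preimages lie above the axis and are translates of one another, so
  \<open>x\<close> is close to a translate of \<open>x'\<close>.\<close>

lemma real_injective:
  assumes "F (of_real x) = F (of_real x') + of_real (2 * pi * of_int j)"
  shows "\<exists>j'. x = x' + 2 * pi * of_int j'"
proof (rule ccontr)
  assume no: "\<nexists>j'. x = x' + 2 * pi * of_int j'"
  have "closed (range (\<lambda>j::int. x' + 2 * pi * of_int j))"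
  proof -
    have "range (\<lambda>j::int. x' + 2 * pi * of_int j) = (\<lambda>y. x' + 2 * pi * y) ` \<int>" by (auto simp: Ints_def)
    moreover have "closed ((+) x' ` (*) (2 * pi) ` \<int>)"
      by (intro closed_translation closed_injective_linear_image closed_Ints) (auto simp: bounded_linear_mult_right linear_linear inj_on_def)
    ultimately show ?thesis by (simp add: image_image)
  qed
  moreover have "x \<notin> range (\<lambda>j::int. x' + 2 * pi * of_int j)" using no by auto
  ultimately obtain e0 where e0: "e0 > 0" "ball x e0 \<inter> range (\<lambda>j::int. x' + 2 * pi * of_int j) = {}"
    by (metis open_Compl open_contains_ball ComplI disjoint_eq_subset_Compl)
  define e where "e = min (e0 / 2) h"
  have e: "e > 0" "e \<le> h" "2 * e \<le> e0" using e0(1) h unfolding e_def by auto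
  have bR: "ball (of_real y) e \<subseteq> R" for y :: real
  proof
    fix z assume "z \<in> ball (of_real y :: complex) e"
    then have "\<bar>Im (of_real y - z)\<bar> < e" using abs_Im_le_cmod[of "of_real y - z"] by (simp add: dist_norm)
    then show "z \<in> R" using e(2) unfolding R_def by (auto simp: abs_less_iff)
  qed
  have op: "open (F ` ball (of_real y) e)" for y :: real
    by (rule open_mapping_thm[of F R "ball (of_real y) e"]) (use R bR e(1) nonconst[OF open_ball, of "of_real y" e] nonconst[of R] in auto)
  have "open (F ` ball (of_real x) e \<inter> ((\<lambda>w. w + of_real (2 * pi * of_int j)) ` F ` ball (of_real x') e))"
    using op[of x] open_translation[OF op[of x'], of "of_real (2 * pi * of_int j)"] by (auto simp: add.commute)
  moreover have "F (of_real x) \<in> F ` ball (of_real x) e \<inter> ((\<lambda>w. w + of_real (2 * pi * of_int j)) ` F ` ball (of_real x') e)"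
  proof
    show "F (of_real x) \<in> F ` ball (of_real x) e" using e(1) by (intro imageI) simp
    show "F (of_real x) \<in> (\<lambda>w. w + of_real (2 * pi * of_int j)) ` F ` ball (of_real x') e"
      unfolding assms using e(1) by (intro imageI) simp
  qed
  ultimately obtain d where d: "d > 0" "ball (F (of_real x)) d \<subseteq> F ` ball (of_real x) e \<inter> ((\<lambda>w. w + of_real (2 * pi * of_int j)) ` F ` ball (of_real x') e)"
    using open_contains_ball by metis
  \<comment> \<open>A common value just above the real axis; by the signs of \<open>Im F\<close> its
    preimages are in the upper half of the strip.\<close>
  define v where "v = F (of_real x) + \<i> * of_real (d / 2)"
  have "v \<in> ball (F (of_real x)) d" using d(1) unfolding v_def by (simp add: dist_norm norm_mult)
  then obtain z z' where z: "z \<in> ball (of_real x) e" "v = F z" and z': "z' \<in> ball (of_real x') e" "v = F z' + of_real (2 * pi * of_int j)"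
    using d(2) by blast
  have Imv: "Im v > 0" using zero[of "of_real x"] d(1) unfolding v_def by simp
  have up: "0 < Im z \<and> Im z < h" if "z \<in> R" "Im (F z) > 0" for z
    using that neg[of z] zero[of z] unfolding R_def by (cases "Im z" "0::real" rule: linorder_cases) auto
  have zR: "z \<in> R" "z' \<in> R" using bR z(1) z'(1) by blast+
  have "Im (F z) > 0" "Im (F z') > 0" using Imv z(2) arg_cong[OF z'(2), of Im] by auto
  then have "0 < Im z \<and> Im z < h" "0 < Im z' \<and> Im z' < h" using up zR by blast+
  then obtain j' where j': "z = z' + of_real (2 * pi * of_int j')" using inj[of z z' j] z z' by auto
  have "\<bar>Re z - x\<bar> < e" using z(1) abs_Re_le_cmod[of "of_real x - z"] by (simp add: dist_norm abs_minus_commute)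
  moreover have "\<bar>Re z' - x'\<bar> < e" using z'(1) abs_Re_le_cmod[of "of_real x' - z'"] by (simp add: dist_norm abs_minus_commute)
  moreover have "Re z = Re z' + 2 * pi * of_int j'" unfolding j' by simp
  ultimately have "\<bar>x - (x' + 2 * pi * of_int j')\<bar> < e0" using e(3) by linarith
  then have "x' + 2 * pi * of_int j' \<in> ball x e0" by (simp add: dist_real_def)
  then show False using e0(2) by blast
qed

definition r :: "real \<Rightarrow> real" where "r x = Re (F (of_real x))"

lemma F_real: "F (of_real x) = of_real (r x)"
  using zero[of "of_real x"] by (simp add: r_def complex_eq_iff)

text \<open>The sign of the derivative is read off by approaching the real axis vertically: the
  upper side is mapped to the upper side, so these difference quotients have positive real
  part.\<close>

lemma r_deriv: "(r has_real_derivative Re (deriv F (of_real x))) (at x)" "0 \<le> Re (deriv F (of_real x))" "Im (deriv F (of_real x)) = 0"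
proof -
  have d: "(F has_field_derivative deriv F (of_real x)) (at (of_real x))" using holomorphic_derivI[OF R(4,1,5)] .
  have d1: "((\<lambda>y. F (of_real y)) has_vector_derivative deriv F (of_real x)) (at x)"
  proof -
    have "((F \<circ> of_real) has_vector_derivative (1 * deriv F (of_real x))) (at x)"
      by (rule field_vector_diff_chain_at) (use d in \<open>auto intro!: derivative_eq_intros\<close>)
    then show ?thesis by (simp add: o_def)
  qed
  have "((\<lambda>y. Re (F (of_real y))) has_vector_derivative Re (deriv F (of_real x))) (at x)"
    using bounded_linear.has_vector_derivative[OF bounded_linear_Re d1] .
  then show "(r has_real_derivative Re (deriv F (of_real x))) (at x)"
    by (simp add: r_def[abs_def] has_real_derivative_iff_has_vector_derivative)
  have "((\<lambda>y. Im (F (of_real y))) has_vector_derivative Im (deriv F (of_real x))) (at x)"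
    using bounded_linear.has_vector_derivative[OF bounded_linear_Im d1] .
  moreover have "(\<lambda>y. Im (F (of_real y))) = (\<lambda>_. 0)" using zero by auto
  ultimately show "Im (deriv F (of_real x)) = 0"
    using vector_derivative_unique_at has_vector_derivative_const by metis
  obtain y :: "nat \<Rightarrow> real" where y: "\<And>n. 0 < y n" "\<And>n. y n < h" "y \<longlonglongrightarrow> 0"
  proof
    show "(\<lambda>n. h / real (n + 2)) \<longlonglongrightarrow> 0" by real_asymp
    show "0 < h / real (n + 2)" for n using h by simp
    have "h / real (n + 2) < h / 1" for n using h by (intro divide_strict_left_mono) auto
    then show "h / real (n + 2) < h" for n unfolding div_by_1 .
  qed
  have yn: "y n \<noteq> 0" for n using y(1)[of n] by simp
  have "(\<lambda>n. \<i> * of_real (y n)) \<longlonglongrightarrow> \<i> * of_real 0" by (intro tendsto_intros y)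
  then have fl: "filterlim (\<lambda>n. \<i> * of_real (y n)) (at 0) sequentially"
    unfolding filterlim_at using yn by simp
  have "((\<lambda>w. (F (of_real x + w) - F (of_real x)) / w) \<longlongrightarrow> deriv F (of_real x)) (at 0)"
    using d by (simp add: DERIV_def)
  then have "(\<lambda>n. (F (of_real x + \<i> * of_real (y n)) - F (of_real x)) / (\<i> * of_real (y n))) \<longlonglongrightarrow> deriv F (of_real x)"
    by (rule filterlim_compose[OF _ fl])
  then have "(\<lambda>n. Re ((F (of_real x + \<i> * of_real (y n)) - F (of_real x)) / (\<i> * of_real (y n)))) \<longlonglongrightarrow> Re (deriv F (of_real x))"
    by (rule tendsto_Re)
  moreover have nn: "Re ((F (of_real x + \<i> * of_real y) - F (of_real x)) / (\<i> * of_real y)) \<ge> 0" if "0 < y" "y < h" for y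
  proof -
    have "Im (F (of_real x + \<i> * of_real y)) > 0" using that by (intro pos) auto
    moreover have "Re (w / (\<i> * of_real y)) = Im w / y" for w using that(1) by (simp add: Re_divide power2_eq_square)
    ultimately show ?thesis using that(1) zero[of "of_real x"] by simp
  qed
  ultimately show "0 \<le> Re (deriv F (of_real x))"
    using nn[OF y(1,2)] LIMSEQ_le_const by blast
qed

lemma r_strict_mono: "x < y \<Longrightarrow> r x < r y"
proof -
  assume xy: "x < y"
  have "r x \<le> r y" using r_deriv xy by (intro DERIV_nonneg_imp_nondecreasing[of x y r]) auto
  moreover have "r x \<noteq> r y"
  proof
    assume e: "r x = r y"
    \<comment> \<open>If \<open>r\<close> took equal values at both ends it would be constant
      between them; \<open>w\<close> is a second point at distance less than one period from
      \<open>x\<close>, which \<open>real_injective\<close> excludes.\<close>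
    define w where "w = min ((x + y) / 2) (x + pi)"
    have w: "x < w" "w \<le> y" "w < x + 2 * pi" using xy pi_gt_zero unfolding w_def by (auto simp: min_def field_simps; linarith)+
    have "r x \<le> r w" "r w \<le> r y"
      using r_deriv w by (auto intro!: DERIV_nonneg_imp_nondecreasing[of _ _ r])
    then have "F (of_real w) = F (of_real x) + of_real (2 * pi * of_int 0)" using e by (simp add: F_real)
    then obtain j' where "w = x + 2 * pi * of_int j'" using real_injective by blast
    then have "0 < 2 * pi * of_int j'" "2 * pi * of_int j' < 2 * pi * 1" using w by auto
    then have "0 < j'" "j' < 1" by (auto simp: zero_less_mult_iff)
    then show False by simp
  qed
  ultimately show ?thesis by simp
qed

lemma r_cont: "isCont r x" using r_deriv(1) by (rule DERIV_isCont)

lemma r_per: "r (x + 2 * pi) = r x + 2 * pi * of_int m"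
proof -
  have "F (of_real (x + 2 * pi)) = F (of_real x) + of_real (2 * pi * of_int m)"
    using per[of "of_real x"] h by simp
  then show ?thesis unfolding r_def by simp
qed

text \<open>Monotonicity gives \<open>m \<ge> 1\<close>. If \<open>m \<ge> 2\<close>, then by the
  intermediate value theorem \<open>r\<close> would pass through \<open>r 0 + 2 * pi\<close>
  strictly inside the first period, against injectivity on the circle.\<close>

lemma degree_one: "m = 1"
proof -
  have "r 0 < r (0 + 2 * pi)" by (rule r_strict_mono) simp
  then have "0 < 2 * pi * of_int m" unfolding r_per by simp
  then have m1: "m \<ge> 1" by (simp add: zero_less_mult_iff)
  have "\<not> m \<ge> 2"
  proof
    assume m2: "m \<ge> 2"
    then have gt: "2 * pi * 1 < 2 * pi * of_int m" by (intro mult_strict_left_mono) auto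
    obtain x where x: "0 \<le> x" "x \<le> 0 + 2 * pi" "r x = r 0 + 2 * pi"
      using IVT[of r 0 "r 0 + 2 * pi" "0 + 2 * pi"] r_per[of 0] gt r_cont by auto
    have "F (of_real x) = F (of_real 0) + of_real (2 * pi * of_int 1)" using x(3) unfolding F_real by simp
    then obtain j where j: "x = 0 + 2 * pi * of_int j" using real_injective by blast
    have "x \<noteq> 0" using x(3) by auto
    moreover have "x \<noteq> 2 * pi" using x(3) r_per[of 0] gt by auto
    ultimately have "0 < 2 * pi * of_int j" "2 * pi * of_int j < 2 * pi * 1" using x(1,2) unfolding j by linarith+
    then have "0 < j" "j < 1" by (auto simp: zero_less_mult_iff)
    then show False by simp
  qed
  then show ?thesis using m1 by simp
qed

lemma per_int: "z \<in> R \<Longrightarrow> F (z + of_real (2 * pi * of_int j)) = F z + of_real (2 * pi * of_int j)"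
proof -
  have nat: "F (z + of_real (2 * pi * of_nat n)) = F z + of_real (2 * pi * of_nat n)" if "z \<in> R" for z n
  proof (induction n)
    case (Suc n)
    have "z + of_real (2 * pi * of_nat (Suc n)) = (z + of_real (2 * pi * of_nat n)) + of_real (2 * pi)" by (simp add: algebra_simps)
    moreover have "F ((z + of_real (2 * pi * of_nat n)) + of_real (2 * pi)) = F (z + of_real (2 * pi * of_nat n)) + of_real (2 * pi)"
      using per[of "z + of_real (2 * pi * of_nat n)"] that unfolding R_def degree_one by simp
    ultimately show ?case using Suc by (simp add: algebra_simps)
  qed simp
  assume z: "z \<in> R"
  show ?thesis
  proof (cases "j \<ge> 0")
    case True then show ?thesis using nat[OF z, of "nat j"] by simp
  next
    case False
    have "z + of_real (2 * pi * of_int j) \<in> R" using z by (simp add: R_def)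
    from nat[OF this, of "nat (- j)"] False show ?thesis by (simp add: algebra_simps)
  qed
qed

lemma r_per_int: "r (x + 2 * pi * of_int j) = r x + 2 * pi * of_int j"
  using arg_cong[OF per_int[OF R(5)[of x], of j], of Re] by (simp add: r_def)

section \<open>Orbits that stay near the real axis\<close>

definition S :: "complex set" where "S = {z. 0 < Im z \<and> Im z < h}"

text \<open>The neighbourhood is uniform in \<open>n\<close>, so that on a component of
  \<open>stable\<close> all iterates are defined and holomorphic together, as Montel's theorem
  requires.\<close>

definition stable :: "complex set" where
  "stable = {z. \<exists>U. open U \<and> z \<in> U \<and> (\<forall>w\<in>U. \<forall>n. (F ^^ n) w \<in> S)}"

lemma S: "open S" "S \<subseteq> R" using strip_convex[of 0 h] h by (auto simp: S_def R_def)

lemma open_stable: "open stable"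
proof -
  have "stable = \<Union>{U. open U \<and> (\<forall>w\<in>U. \<forall>n. (F ^^ n) w \<in> S)}" unfolding stable_def by auto
  then show ?thesis by auto
qed

lemma stable_iterate: "z \<in> stable \<Longrightarrow> (F ^^ n) z \<in> S"
  unfolding stable_def by auto

lemma stable_back: assumes z: "z \<in> S" "F z \<in> stable" shows "z \<in> stable"
proof -
  obtain U where U: "open U" "F z \<in> U" "\<And>w n. w \<in> U \<Longrightarrow> (F ^^ n) w \<in> S" using z(2) unfolding stable_def by blast
  have "continuous_on S F" using holomorphic_on_imp_continuous_on[OF R(4)] S(2) continuous_on_subset by blast
  then have "open (S \<inter> F -` U)" using S(1) U(1) by (rule continuous_open_preimage)
  moreover have "(F ^^ n) w \<in> S" if "w \<in> S \<inter> F -` U" for w n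
    using that U(3)[of "F w"] by (cases n) (auto simp: funpow_swap1)
  ultimately show ?thesis using z(1) U(2) unfolding stable_def by blast
qed

lemma iterate_per:
  assumes "\<And>n. (F ^^ n) z \<in> R"
  shows "(F ^^ n) (z + of_real (2 * pi * of_int j)) = (F ^^ n) z + of_real (2 * pi * of_int j)"
  by (induction n) (use per_int[OF assms] in auto)

lemma stable_shift: assumes z: "z \<in> stable" shows "z + of_real (2 * pi * of_int j) \<in> stable"
proof -
  obtain U where U: "open U" "z \<in> U" "\<And>w n. w \<in> U \<Longrightarrow> (F ^^ n) w \<in> S" using z unfolding stable_def by blast
  let ?V = "(\<lambda>w. of_real (2 * pi * of_int j) + w) ` U"
  have "open ?V" by (rule open_translation[OF U(1)])
  moreover have "z + of_real (2 * pi * of_int j) \<in> ?V" using U(2) by (auto simp: add.commute)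
  moreover have "(F ^^ n) w \<in> S" if w: "w \<in> ?V" for w n
  proof -
    obtain v where v: "v \<in> U" "w = v + of_real (2 * pi * of_int j)" using w by (auto simp: add.commute)
    have "(F ^^ n) w = (F ^^ n) v + of_real (2 * pi * of_int j)"
      unfolding v(2) by (rule iterate_per) (use U(3)[OF v(1)] S(2) in blast)
    then show ?thesis using U(3)[OF v(1), of n] by (simp add: S_def)
  qed
  ultimately show ?thesis unfolding stable_def by blast
qed

text \<open>By \<open>r_deriv\<close> the multiplier at a real fixed point is real and nonnegative,
  so modulus 1 means multiplier 1 and rotations cannot occur. The upper part of the invariant set
  stays above the axis and is therefore stable.\<close>

lemma fixed_point_basin:
  assumes p: "r p = p" and nid: "\<not> (\<forall>z\<in>R. F z = z)"
  obtains W where "open W" "W \<inter> {z. 0 < Im z} \<subseteq> stable"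
    "\<And>w :: nat \<Rightarrow> complex. (\<And>n. w (Suc n) = F (w n)) \<Longrightarrow> w \<longlonglongrightarrow> of_real p \<Longrightarrow> (\<And>n. w n \<noteq> of_real p) \<Longrightarrow> \<exists>n. w n \<in> W"
proof -
  have d: "deriv F (of_real p) = 1" if "norm (deriv F (of_real p)) = 1"
  proof -
    have e: "deriv F (of_real p) = of_real (Re (deriv F (of_real p)))" using r_deriv(3) by (simp add: complex_eq_iff)
    then have "\<bar>Re (deriv F (of_real p))\<bar> = 1" using that by (metis norm_of_real)
    then show ?thesis using e r_deriv(2)[of p] by simp
  qed
  obtain W where W: "open W" "W \<subseteq> R" "F ` W \<subseteq> W"
    "\<And>w :: nat \<Rightarrow> complex. (\<And>n. w (Suc n) = F (w n)) \<Longrightarrow> w \<longlonglongrightarrow> of_real p \<Longrightarrow> (\<And>n. w n \<noteq> of_real p) \<Longrightarrow> \<exists>n. w n \<in> W"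
    using invariant_set_at_fixed_point[OF R(1,3,5,4) _ nid d] F_real[of p] p by metis
  have "W \<inter> {z. 0 < Im z} \<subseteq> stable"
  proof
    fix z assume z: "z \<in> W \<inter> {z. 0 < Im z}"
    have it: "(F ^^ n) w \<in> W \<inter> {z. 0 < Im z}" if "w \<in> W \<inter> {z. 0 < Im z}" for w n
    proof (induction n)
      case 0 then show ?case using that by simp
    next
      case (Suc n)
      then show ?case using W(2,3) pos[of "(F ^^ n) w"] unfolding R_def by auto
    qed
    have "W \<inter> {z. 0 < Im z} \<subseteq> S" using W(2) unfolding S_def R_def by auto
    moreover have "open (W \<inter> {z. 0 < Im z})" using W(1) open_halfspace_Im_gt by (intro open_Int) auto
    ultimately show "z \<in> stable" unfolding stable_def using z it by blast
  qed
  then show thesis using that[OF W(1) _ W(4)] by blast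
qed

text \<open>The orbit is strictly monotone and cannot pass a translate of the fixed point
  \<open>p\<close>. Strictness is what keeps it off its limit, as \<open>fixed_point_basin\<close>
  demands.\<close>

lemma real_orbit_converges:
  assumes x: "r x \<noteq> x" and p: "r p = p"
  obtains q where "r q = q" "(\<lambda>k. (r ^^ k) x) \<longlonglongrightarrow> q" "\<And>k. (r ^^ k) x \<noteq> q"
proof -
  let ?x = "\<lambda>k. (r ^^ k) x"
  have pj: "r (p + 2 * pi * of_int j) = p + 2 * pi * of_int j" for j using r_per_int p by simp
  have fixq: "r q = q" if "?x \<longlonglongrightarrow> q" for q
  proof -
    have "(\<lambda>k. r (?x k)) \<longlonglongrightarrow> r q" using isCont_tendsto_compose[OF r_cont that] .
    moreover have "(\<lambda>k. r (?x k)) \<longlonglongrightarrow> q" using LIMSEQ_Suc[OF that] by simp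
    ultimately show ?thesis using LIMSEQ_unique by blast
  qed
  consider "x < r x" | "r x < x" using x by linarith
  then show thesis
  proof cases
    case 1
    define j where "j = \<lceil>(x - p) / (2 * pi)\<rceil>"
    have "(x - p) / (2 * pi) \<le> of_int j" unfolding j_def by linarith
    then have "x \<le> p + 2 * pi * of_int j" by (simp add: field_simps)
    then have xp: "x < p + 2 * pi * of_int j" using x pj[of j] by (cases "x = p + 2 * pi * of_int j") auto
    have le: "?x k < p + 2 * pi * of_int j" for k by (induction k) (use xp r_strict_mono pj[of j] in fastforce)+
    have inc: "?x k < ?x (Suc k)" for k by (induction k) (use 1 r_strict_mono in auto)
    have "incseq ?x" by (rule incseq_SucI) (use inc less_imp_le in blast)
    then obtain q where q: "?x \<longlonglongrightarrow> q" "\<And>k. ?x k \<le> q"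
      using incseq_convergent[of ?x "p + 2 * pi * of_int j"] le less_imp_le by metis
    have "?x k \<noteq> q" for k using inc[of k] q(2)[of "Suc k"] by linarith
    then show thesis using that[of q] fixq q(1) by blast
  next
    case 2
    define j where "j = \<lfloor>(x - p) / (2 * pi)\<rfloor>"
    have "of_int j \<le> (x - p) / (2 * pi)" unfolding j_def by linarith
    then have "p + 2 * pi * of_int j \<le> x" by (simp add: field_simps)
    then have xp: "p + 2 * pi * of_int j < x" using x pj[of j] by (cases "x = p + 2 * pi * of_int j") auto
    have ge: "p + 2 * pi * of_int j < ?x k" for k by (induction k) (use xp r_strict_mono pj[of j] in fastforce)+
    have dec: "?x (Suc k) < ?x k" for k by (induction k) (use 2 r_strict_mono in auto)
    have "decseq ?x" by (rule decseq_SucI) (use dec less_imp_le in blast)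
    then obtain q where q: "?x \<longlonglongrightarrow> q" "\<And>k. q \<le> ?x k"
      using decseq_convergent[of ?x "p + 2 * pi * of_int j"] ge less_imp_le by metis
    have "?x k \<noteq> q" for k using dec[of k] q(2)[of "Suc k"] by linarith
    then show thesis using that[of q] fixq q(1) by blast
  qed
qed

text \<open>If the orbit, modulo translation, accumulates at a real point that is not fixed, it
  shadows the orbit of that point into the basin of a fixed point. Otherwise it accumulates at real
  fixed points only; these are isolated and the steps become small, so it converges to one of them
  and enters its basin directly.\<close>

lemma orbit_enters_stable:
  fixes z :: "nat \<Rightarrow> complex"
  assumes zS: "\<And>n. z n \<in> S" and zF: "\<And>n. z (Suc n) = F (z n)" and z0: "(\<lambda>n. Im (z n)) \<longlonglongrightarrow> 0"
    and p0: "r p0 = p0" and nid: "\<not> (\<forall>z\<in>R. F z = z)"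
  shows "\<exists>n. z n \<in> stable"
proof -
  define sh where "sh j = complex_of_real (2 * pi * of_int j)" for j :: int
  have Fsh: "F (w + sh j) = F w + sh j" if "w \<in> R" for w j using per_int[OF that] by (simp add: sh_def)
  have zk: "(F ^^ k) (z n + sh j) = z (n + k) + sh j" for k n j
    by (induction k) (use Fsh zS S(2) zF in auto)
  have Imsh: "Im (w + sh j) = Im w" for w j by (simp add: sh_def)
  have unsh: "z n \<in> stable" if "z n + sh j \<in> stable" for n j
    using stable_shift[OF that, of "- j"] by (simp add: sh_def)
  have red: "\<exists>j. 0 \<le> Re (w + sh j) \<and> Re (w + sh j) \<le> 2 * pi" for w
  proof -
    define m where "m = \<lfloor>Re w / (2 * pi)\<rfloor>"
    have "of_int m \<le> Re w / (2 * pi)" "Re w / (2 * pi) < of_int m + 1" unfolding m_def by linarith+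
    then show ?thesis by (intro exI[of _ "- m"]) (auto simp: sh_def field_simps)
  qed
  show ?thesis
  proof (cases "\<exists>x. r x \<noteq> x \<and> (\<forall>e>0. \<exists>n j. dist (z n + sh j) (of_real x) < e)")
    case True
    then obtain x where x: "r x \<noteq> x" "\<And>e. e > 0 \<Longrightarrow> \<exists>n j. dist (z n + sh j) (of_real x) < e" by blast
    obtain q where q: "r q = q" "(\<lambda>k. (r ^^ k) x) \<longlonglongrightarrow> q" "\<And>k. (r ^^ k) x \<noteq> q" using real_orbit_converges[OF x(1) p0] by blast
    obtain W where W: "open W" "W \<inter> {z. 0 < Im z} \<subseteq> stable"
      "\<And>w :: nat \<Rightarrow> complex. (\<And>n. w (Suc n) = F (w n)) \<Longrightarrow> w \<longlonglongrightarrow> of_real q \<Longrightarrow> (\<And>n. w n \<noteq> of_real q) \<Longrightarrow> \<exists>n. w n \<in> W"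
      using fixed_point_basin[OF q(1) nid] by blast
    have Fr: "(F ^^ k) (of_real x) = of_real ((r ^^ k) x)" for k by (induction k) (auto simp: F_real)
    obtain k where k: "complex_of_real ((r ^^ k) x) \<in> W"
      using W(3)[of "\<lambda>k. of_real ((r ^^ k) x)"] q(3) tendsto_of_real[OF q(2), where 'a=complex] by (auto simp: F_real)
    have "isCont (F ^^ k) (of_real x)" for k
    proof (induction k)
      case (Suc k)
      have "isCont F ((F ^^ k) (of_real x))" unfolding Fr by (rule contF[OF R(5)])
      then have "isCont (F \<circ> (F ^^ k)) (of_real x)" by (rule continuous_at_compose[OF Suc])
      then show ?case by (simp only: funpow.simps)
    qed (simp add: id_def)
    then have "((F ^^ k) \<longlongrightarrow> (F ^^ k) (of_real x)) (nhds (of_real x))" by (simp add: isCont_def tendsto_at_iff_tendsto_nhds)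
    then have "eventually (\<lambda>w. (F ^^ k) w \<in> W) (nhds (of_real x))" using topological_tendstoD W(1) k Fr by metis
    then obtain e where e: "e > 0" "\<And>w. dist w (of_real x) < e \<Longrightarrow> (F ^^ k) w \<in> W" unfolding eventually_nhds_metric by blast
    obtain n j where "dist (z n + sh j) (of_real x) < e" using x(2)[OF e(1)] by blast
    then have "z (n + k) + sh j \<in> W" using e(2) zk by metis
    moreover have "0 < Im (z (n + k) + sh j)" using zS[of "n + k"] unfolding Imsh S_def by simp
    ultimately show ?thesis using W(2) unsh[of "n + k" j] by blast
  next
    case False
    then have nf: "\<And>x. r x \<noteq> x \<Longrightarrow> \<exists>e>0. \<forall>n j. e \<le> dist (z n + sh j) (of_real x)" by (meson not_less)
    have limit_real: "r (Re y) = Re y" "Im y = 0" if s: "strict_mono \<sigma>" "(\<lambda>i. z (\<sigma> i) + sh (J i)) \<longlonglongrightarrow> y" for \<sigma> :: "nat \<Rightarrow> nat" and J y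
    proof -
      have "(\<lambda>i. Im (z (\<sigma> i) + sh (J i))) \<longlonglongrightarrow> 0" unfolding Imsh
        using LIMSEQ_subseq_LIMSEQ[OF z0 s(1)] by (simp add: o_def)
      then show im: "Im y = 0" using tendsto_Im[OF s(2)] LIMSEQ_unique by blast
      show "r (Re y) = Re y"
      proof (rule ccontr)
        assume "r (Re y) \<noteq> Re y"
        then obtain e where e: "e > 0" "\<And>n j. e \<le> dist (z n + sh j) (of_real (Re y))" using nf by blast
        have "of_real (Re y) = y" using im by (simp add: complex_eq_iff)
        then obtain N where "\<And>i. i \<ge> N \<Longrightarrow> dist (z (\<sigma> i) + sh (J i)) (of_real (Re y)) < e"
          using s(2) e(1) unfolding lim_sequentially by metis
        then show False using e(2) by (meson not_less order_refl)
      qed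
    qed
    \<comment> \<open>All accumulation points are real and fixed in this case, so every compact set
      without real fixed points is eventually avoided by all translates.\<close>
    have cpt: "\<exists>N. \<forall>n\<ge>N. \<forall>j. z n + sh j \<notin> K" if K: "compact K" "\<And>x. of_real x \<in> K \<Longrightarrow> r x \<noteq> x" for K
    proof (rule ccontr)
      assume "\<not> ?thesis"
      then have "\<forall>N. \<exists>n. N < n \<and> (\<exists>j. z n + sh j \<in> K)" by (meson Suc_le_eq less_imp_le)
      then have "infinite {n. \<exists>j. z n + sh j \<in> K}" unfolding infinite_nat_iff_unbounded by auto
      then obtain \<sigma> :: "nat \<Rightarrow> nat" where \<sigma>: "strict_mono \<sigma>" "\<And>i. \<sigma> i \<in> {n. \<exists>j. z n + sh j \<in> K}"
        using infinite_enumerate by blast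
      then have "\<forall>i. \<exists>j. z (\<sigma> i) + sh j \<in> K" by blast
      then obtain J where J: "\<And>i. z (\<sigma> i) + sh (J i) \<in> K" by metis
      obtain y \<rho> where y: "y \<in> K" "strict_mono \<rho>" "((\<lambda>i. z (\<sigma> i) + sh (J i)) \<circ> \<rho>) \<longlonglongrightarrow> y"
        using K(1)[unfolded compact_def, rule_format, of "\<lambda>i. z (\<sigma> i) + sh (J i)"] J by blast
      have "strict_mono (\<sigma> \<circ> \<rho>)" using \<sigma>(1) y(2) by (rule strict_mono_o)
      then have "r (Re y) = Re y" "Im y = 0" using limit_real[of "\<sigma> \<circ> \<rho>" "J \<circ> \<rho>" y] y(3) by (auto simp: o_def)
      moreover have "of_real (Re y) = y" using \<open>Im y = 0\<close> by (simp add: complex_eq_iff)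
      ultimately show False using K(2)[of "Re y"] y(1) by metis
    qed
    obtain M0 where M0: "\<And>n. n \<ge> M0 \<Longrightarrow> Im (z n) < h / 2"
      using order_tendstoD(2)[OF z0, of "h/2"] h unfolding eventually_sequentially by auto
    let ?B = "cbox (Complex 0 0) (Complex (2 * pi) (h / 2))"
    have BR: "?B \<subseteq> R" using h unfolding R_def by (auto simp: in_cbox_complex_iff)
    have inB: "\<exists>j. z n + sh j \<in> ?B" if "n \<ge> M0" for n
    proof -
      obtain j where "0 \<le> Re (z n + sh j)" "Re (z n + sh j) \<le> 2 * pi" using red by blast
      then have "z n + sh j \<in> ?B" using M0[OF that] zS[of n] Imsh[of "z n" j] unfolding S_def by (auto simp: in_cbox_complex_iff)
      then show ?thesis by blast
    qed
    have "\<forall>i. \<exists>j. z (i + M0) + sh j \<in> ?B" using inB by auto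
    then obtain J where J: "\<And>i. z (i + M0) + sh (J i) \<in> ?B" by metis
    obtain y \<rho> where y: "y \<in> ?B" "strict_mono \<rho>" "((\<lambda>i. z (i + M0) + sh (J i)) \<circ> \<rho>) \<longlonglongrightarrow> y"
      using compact_cbox[of "Complex 0 0" "Complex (2 * pi) (h / 2)", unfolded compact_def, rule_format, of "\<lambda>i. z (i + M0) + sh (J i)"] J by blast
    define p where "p = Re y"
    have "strict_mono (\<lambda>i. \<rho> i + M0)" using y(2) by (simp add: strict_mono_def)
    then have p: "r p = p" "Im y = 0" using limit_real[of "\<lambda>i. \<rho> i + M0" "J \<circ> \<rho>" y] y(3) by (auto simp: o_def p_def)
    have yp: "y = of_real p" using p(2) by (simp add: complex_eq_iff p_def)
    obtain \<beta> where "\<beta> \<in> R" "F \<beta> \<noteq> \<beta>" using nid by blast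
    then obtain \<eta>0 where \<eta>0: "\<eta>0 > 0" "ball (of_real p) \<eta>0 \<subseteq> R" "\<And>w. w \<in> ball (of_real p) \<eta>0 - {of_real p} \<Longrightarrow> F w - w \<noteq> 0"
    proof -
      have "(\<lambda>w. F w - w) holomorphic_on R" by (intro holomorphic_intros R)
      then show thesis
        by (rule isolated_zeros[of "\<lambda>w. F w - w" R "of_real p" \<beta>])
          (use R F_real[of p] p(1) \<open>\<beta> \<in> R\<close> \<open>F \<beta> \<noteq> \<beta>\<close> that in auto)
    qed
    \<comment> \<open>The closed annulus between radii \<open>\<eta>\<close> and
      \<open>2 * \<eta>\<close> lies within the isolating radius. Since it is eventually avoided and
      the steps are eventually shorter than \<open>\<eta>\<close>, the orbit cannot leave the inner
      disc.\<close>
    define \<eta> where "\<eta> = \<eta>0 / 3"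
    have \<eta>: "\<eta> > 0" "2 * \<eta> < \<eta>0" using \<eta>0(1) unfolding \<eta>_def by auto
    have isol: "r x \<noteq> x" if "x \<noteq> p" "dist (of_real p :: complex) (of_real x) < \<eta>0" for x
      using \<eta>0(3)[of "of_real x"] that F_real[of x] by auto
    have ann: "\<exists>N. \<forall>n\<ge>N. \<forall>j. \<not> (e \<le> dist (of_real p) (z n + sh j) \<and> dist (of_real p) (z n + sh j) \<le> 2 * \<eta>)" if "e > 0" for e
    proof -
      have "compact (cball (of_real p) (2 * \<eta>) - ball (of_real p :: complex) e)" by (intro compact_diff) auto
      moreover have "r x \<noteq> x" if "of_real x \<in> cball (of_real p) (2 * \<eta>) - ball (of_real p :: complex) e" for x
        by (rule isol) (use that \<open>e > 0\<close> \<eta>(2) in auto)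
      ultimately obtain N where "\<forall>n\<ge>N. \<forall>j. z n + sh j \<notin> cball (of_real p) (2 * \<eta>) - ball (of_real p) e" using cpt by blast
      then have "\<not> (e \<le> dist (of_real p) (z n + sh j) \<and> dist (of_real p) (z n + sh j) \<le> 2 * \<eta>)" if "n \<ge> N" for n j
        using that by (metis DiffI mem_ball mem_cball not_le)
      then show ?thesis by blast
    qed
    obtain N1 where N1: "\<And>n j. n \<ge> N1 \<Longrightarrow> \<eta> \<le> dist (of_real p) (z n + sh j) \<Longrightarrow> dist (of_real p) (z n + sh j) \<le> 2 * \<eta> \<Longrightarrow> False"
      using ann[OF \<eta>(1)] by blast
    \<comment> \<open>Points that are moved by at least \<open>\<eta>\<close> form a compact set in
      the box without real fixed points, so the orbit eventually moves by less than
      \<open>\<eta>\<close>.\<close>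
    obtain N2 where N2: "\<And>n. n \<ge> N2 \<Longrightarrow> dist (z (Suc n)) (z n) < \<eta>"
    proof -
      let ?K = "?B \<inter> {w. \<eta> \<le> norm (F w - w)}"
      have "closed (?B \<inter> {w. \<eta> \<le> norm (F w - w)})"
      proof -
        have "continuous_on ?B (\<lambda>w. norm (F w - w))"
          by (intro continuous_intros continuous_on_subset[OF holomorphic_on_imp_continuous_on[OF R(4)] BR])
        then have "closed (?B \<inter> (\<lambda>w. norm (F w - w)) -` {\<eta>..})" by (rule continuous_closed_preimage) auto
        then show ?thesis by (simp add: vimage_def Int_def)
      qed
      then have "compact ?K" by (simp add: compact_eq_bounded_closed bounded_Int)
      moreover have "r x \<noteq> x" if "of_real x \<in> ?K" for x using that \<eta>(1) F_real[of x] by auto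
      ultimately obtain N where N: "\<forall>n\<ge>N. \<forall>j. z n + sh j \<notin> ?K" using cpt by blast
      have "dist (z (Suc n)) (z n) < \<eta>" if n: "n \<ge> max N M0" for n
      proof -
        obtain j where j: "z n + sh j \<in> ?B" using inB n by auto
        then have "norm (F (z n + sh j) - (z n + sh j)) < \<eta>"
          using N[rule_format, of n j] n by (simp only: max.bounded_iff Int_iff mem_Collect_eq not_le simp_thms)
        then show ?thesis using Fsh[of "z n" j] zS[of n] S(2) zF[of n] by (auto simp: dist_norm)
      qed
      then show thesis using that by blast
    qed
    obtain i0 where i0: "\<And>i. i \<ge> i0 \<Longrightarrow> dist (z (\<rho> i + M0) + sh (J (\<rho> i))) y < \<eta>"
      using y(3) \<eta>(1) unfolding lim_sequentially o_def by blast
    define i where "i = max i0 (max N1 N2)"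
    define n0 where "n0 = \<rho> i + M0"
    define j where "j = J (\<rho> i)"
    have n0: "n0 \<ge> N1" "n0 \<ge> N2" using seq_suble[OF y(2), of i] unfolding n0_def i_def by linarith+
    define w where "w n = z (n0 + n) + sh j" for n
    have w\<eta>: "dist (of_real p) (w n) < \<eta>" for n
    proof (induction n)
      case 0
      then show ?case using i0[of i] yp unfolding w_def n0_def j_def i_def by (simp add: dist_commute)
    next
      case (Suc n)
      have "dist (w (Suc n)) (w n) < \<eta>" using N2[of "n0 + n"] n0 unfolding w_def by simp
      then have "dist (of_real p) (w (Suc n)) < 2 * \<eta>" using Suc dist_triangle[of "of_real p" "w (Suc n)" "w n"] by (simp add: dist_commute)
      then show ?case using N1[of "n0 + Suc n" j] n0 unfolding w_def by force
    qed
    have "w \<longlonglongrightarrow> of_real p" unfolding lim_sequentially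
    proof (intro allI impI)
      fix e :: real assume "e > 0"
      then obtain N where N: "\<And>n j. n \<ge> N \<Longrightarrow> \<not> (e \<le> dist (of_real p) (z n + sh j) \<and> dist (of_real p) (z n + sh j) \<le> 2 * \<eta>)"
        using ann by blast
      have "dist (w n) (of_real p) < e" if "n \<ge> N" for n
        using N[of "n0 + n" j] that w\<eta>[of n] \<eta>(1) unfolding w_def by (simp add: dist_commute)
      then show "\<exists>N. \<forall>n\<ge>N. dist (w n) (of_real p) < e" by blast
    qed
    moreover have "w (Suc n) = F (w n)" for n using Fsh[of "z (n0 + n)" j] zS[of "n0 + n"] S(2) zF[of "n0 + n"] unfolding w_def by auto
    moreover have Imw: "Im (w n) > 0" for n using zS[of "n0 + n"] unfolding w_def Imsh S_def by simp
    then have "w n \<noteq> of_real p" for n by (metis Im_complex_of_real less_irrefl)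
    ultimately obtain n where "w n \<in> stable" using fixed_point_basin[OF p(1) nid] Imw by (metis IntI mem_Collect_eq subsetD)
    then show ?thesis using unsh unfolding w_def by blast
  qed
qed

end

section \<open>Stability along the lifted ray\<close>

context strip_map
begin

text \<open>With a real fixed point every backward orbit along the curve enters
  \<open>stable\<close>, which pulls back along \<open>F\<close>. Without one,
  \<open>r x - x\<close> has constant sign and is bounded away from 0 by periodicity, so near the
  axis \<open>F\<close> drifts in one direction and \<open>no_spiral\<close> gives an invariant
  supply of low points.\<close>

lemma curve_stable:
  fixes \<Gamma> :: "real \<Rightarrow> complex"
  assumes \<Gamma>c: "continuous_on UNIV \<Gamma>" and \<Gamma>0: "\<And>t. 0 < Im (\<Gamma> t)"
    and low: "\<And>t. t \<le> Tc \<Longrightarrow> Im (\<Gamma> t) < h" and high: "\<And>t. t > Tb \<Longrightarrow> h \<le> Im (\<Gamma> t)"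
    and F\<Gamma>: "\<And>t. t \<le> Tc \<Longrightarrow> F (\<Gamma> t) = \<Gamma> (t - 1)"
    and bck: "\<And>z s j. z \<in> S \<Longrightarrow> F z = \<Gamma> s + of_real (2 * pi * of_int j) \<Longrightarrow> \<exists>j'. z = \<Gamma> (s + 1) + of_real (2 * pi * of_int j')"
    and lim0: "\<And>e. e > 0 \<Longrightarrow> \<exists>T'. \<forall>t\<le>T'. Im (\<Gamma> t) < e"
    and nid: "\<not> (\<forall>z\<in>R. F z = z)"
  obtains W u0 where "open W" "connected W" "\<And>n w. w \<in> W \<Longrightarrow> (F ^^ n) w \<in> S" "u0 + 1 \<le> Tc" "\<Gamma> ` {u0..u0+1} \<subseteq> W"
proof (cases "\<exists>p. r p = p")
  case True
  then obtain p where p: "r p = p" by blast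
  have \<Gamma>S: "\<Gamma> t \<in> S" if "t \<le> Tc" for t using \<Gamma>0 low[OF that] by (simp add: S_def)
  have st: "\<Gamma> t \<in> stable" if t: "t \<le> Tc" for t
  proof -
    have "\<exists>n. \<Gamma> (t - real n) \<in> stable"
    proof (rule orbit_enters_stable[OF _ _ _ p nid])
      show "\<Gamma> (t - real n) \<in> S" for n using \<Gamma>S t by simp
      show "\<Gamma> (t - real (Suc n)) = F (\<Gamma> (t - real n))" for n using F\<Gamma>[of "t - real n"] t by (simp add: algebra_simps)
      show "(\<lambda>n. Im (\<Gamma> (t - real n))) \<longlonglongrightarrow> 0" unfolding lim_sequentially
      proof (intro allI impI)
        fix e :: real assume "e > 0"
        then obtain T' where T': "\<And>t. t \<le> T' \<Longrightarrow> Im (\<Gamma> t) < e" using lim0 by blast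
        have "dist (Im (\<Gamma> (t - real n))) 0 < e" if "n \<ge> nat \<lceil>t - T'\<rceil>" for n
        proof -
          have "t - real n \<le> T'" using that by linarith
          then show ?thesis using T' \<Gamma>0[of "t - real n"] by (simp add: dist_real_def)
        qed
        then show "\<exists>N. \<forall>n\<ge>N. dist (Im (\<Gamma> (t - real n))) 0 < e" by blast
      qed
    qed
    then obtain n where n: "\<Gamma> (t - real n) \<in> stable" by blast
    have "\<Gamma> (t - real (n - k)) \<in> stable" if "k \<le> n" for k using that
    proof (induction k)
      case (Suc k)
      have "t - real (n - Suc k) - 1 = t - real (n - k)" using Suc by (simp add: of_nat_diff)
      moreover have "\<Gamma> (t - real (n - k)) \<in> stable" using Suc by simp
      moreover have "F (\<Gamma> (t - real (n - Suc k))) = \<Gamma> (t - real (n - Suc k) - 1)" using F\<Gamma>[of "t - real (n - Suc k)"] t by simp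
      ultimately have "F (\<Gamma> (t - real (n - Suc k))) \<in> stable" by metis
      moreover have "\<Gamma> (t - real (n - Suc k)) \<in> S" using \<Gamma>S t by simp
      ultimately show ?case using stable_back by blast
    qed (use n in simp)
    from this[of n] show ?thesis by simp
  qed
  \<comment> \<open>The whole tail of the curve is connected and stable, hence in a single
    component.\<close>
  define W where "W = connected_component_set stable (\<Gamma> Tc)"
  have "\<Gamma> ` {..Tc} \<subseteq> W" unfolding W_def
  proof (rule connected_component_maximal)
    show "connected (\<Gamma> ` {..Tc})" by (intro connected_continuous_image continuous_on_subset[OF \<Gamma>c]) auto
  qed (use st in auto)
  moreover have "W \<subseteq> stable" unfolding W_def by (rule connected_component_subset)
  moreover have "\<Gamma> ` {Tc-1..Tc-1+1} \<subseteq> \<Gamma> ` {..Tc}" by auto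
  moreover have "open W" "connected W" unfolding W_def using open_stable by (auto intro: open_connected_component)
  ultimately show thesis using stable_iterate by (intro that[of W "Tc - 1"]) auto
next
  case False
  then have nf: "r x - x \<noteq> 0" for x by auto
  define d where "d x = r x - x" for x
  have dc: "continuous_on A d" for A unfolding d_def using r_cont by (intro continuous_intros continuous_at_imp_continuous_on) auto
  have "\<exists>x\<in>{0..2*pi}. \<forall>y\<in>{0..2*pi}. \<bar>d x\<bar> \<le> \<bar>d y\<bar>"
    by (rule continuous_attains_inf) (auto intro!: continuous_on_rabs dc)
  then obtain xm where xm: "\<And>x. x \<in> {0..2*pi} \<Longrightarrow> \<bar>d xm\<bar> \<le> \<bar>d x\<bar>" by blast
  have "\<exists>x\<in>{0..2*pi}. \<forall>y\<in>{0..2*pi}. \<bar>d y\<bar> \<le> \<bar>d x\<bar>"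
    by (rule continuous_attains_sup) (auto intro!: continuous_on_rabs dc)
  then obtain xM where xM: "\<And>x. x \<in> {0..2*pi} \<Longrightarrow> \<bar>d x\<bar> \<le> \<bar>d xM\<bar>" by blast
  define \<delta> where "\<delta> = \<bar>d xm\<bar> / 2"
  define D where "D = \<bar>d xM\<bar> + \<delta>"
  have \<delta>: "\<delta> > 0" using nf[of xm] unfolding \<delta>_def d_def by simp
  have dper: "d (x + 2 * pi * of_int j) = d x" for x j using r_per_int unfolding d_def by simp
  have db: "2 * \<delta> \<le> \<bar>d x\<bar>" "\<bar>d x\<bar> \<le> D - \<delta>" for x
  proof -
    define j where "j = \<lfloor>x / (2 * pi)\<rfloor>"
    have "of_int j \<le> x / (2 * pi)" "x / (2 * pi) < of_int j + 1" unfolding j_def by linarith+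
    then have "x + 2 * pi * of_int (- j) \<in> {0..2*pi}" by (auto simp: field_simps)
    from xm[OF this] xM[OF this] dper[of x "- j"] show "2 * \<delta> \<le> \<bar>d x\<bar>" "\<bar>d x\<bar> \<le> D - \<delta>" unfolding \<delta>_def D_def by auto
  qed
  \<comment> \<open>At heights below \<open>h2\<close> the Lipschitz bound keeps the horizontal
    displacement within \<open>\<delta>\<close> of its value on the axis, which is at least
    \<open>2 * \<delta>\<close> in modulus.\<close>
  define h2 where "h2 = min h (\<delta> / (\<bar>L\<bar> + 1))"
  have h2: "0 < h2" "h2 \<le> h" using h \<delta> unfolding h2_def by auto
  have near: "\<bar>Re (F z) - Re z - d (Re z)\<bar> \<le> \<delta>" if z: "0 < Im z" "Im z < h2" for z
  proof -
    have "norm (F z - F (of_real (Re z))) \<le> L * norm (z - of_real (Re z))" using z h h2 by (intro lip) auto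
    also have "norm (z - of_real (Re z)) = Im z" using z by (simp add: norm_complex_def)
    also have "L * Im z \<le> (\<bar>L\<bar> + 1) * (\<delta> / (\<bar>L\<bar> + 1))" using z unfolding h2_def by (intro mult_mono) auto
    also have "\<dots> = \<delta>" by simp
    finally show ?thesis using abs_Re_le_cmod[of "F z - F (of_real (Re z))"] by (simp add: d_def r_def)
  qed
  have sgn: "(\<forall>x. d x < 0) \<or> (\<forall>x. d x > 0)"
  proof (rule ccontr)
    assume "\<not> ?thesis"
    then obtain a b where "d a \<ge> 0" "d b \<le> 0" by (auto simp: not_less)
    then have "d a > 0" "d b < 0" using nf[of a] nf[of b] unfolding d_def by auto
    moreover have "connected (d ` UNIV)" by (rule connected_continuous_image[OF dc]) simp
    ultimately have "0 \<in> range d" unfolding connected_iff_interval by (metis less_imp_le rangeI)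
    then show False using nf unfolding d_def by auto
  qed
  let ?S2 = "{z. 0 < Im z \<and> Im z < h2}"
  obtain Tc2' where "\<forall>t\<le>Tc2'. Im (\<Gamma> t) < h2" using lim0[OF h2(1)] by blast
  then obtain Tc2 where Tc2: "\<And>t. t \<le> Tc2 \<Longrightarrow> Im (\<Gamma> t) < h2" "Tc2 \<le> Tc" by (metis min.bounded_iff order_refl)
  obtain \<rho> where \<rho>: "0 < \<rho>" "\<rho> \<le> h2" "\<And>z n. 0 < Im z \<Longrightarrow> Im z < \<rho> \<Longrightarrow> (F ^^ n) z \<in> ?S2"
  proof (rule no_spiral[of h2 \<delta> F C D \<Gamma> Tc2 Tb])
    show "continuous_on ?S2 F"
      using holomorphic_on_imp_continuous_on[OF R(4)] by (rule continuous_on_subset) (use h2 in \<open>auto simp: R_def\<close>)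
    show "0 < Im (F z) \<and> Im (F z) \<le> C * Im z" if "z \<in> ?S2" for z using that pos bound h2 by auto
    show "(\<forall>z\<in>?S2. Re z - D \<le> Re (F z) \<and> Re (F z) \<le> Re z - \<delta>) \<or> (\<forall>z\<in>?S2. Re z + \<delta> \<le> Re (F z) \<and> Re (F z) \<le> Re z + D)"
      using sgn
    proof
      assume "\<forall>x. d x < 0"
      then have "Re z - D \<le> Re (F z) \<and> Re (F z) \<le> Re z - \<delta>" if "z \<in> ?S2" for z
        using near[of z] db[of "Re z"] that unfolding mem_Collect_eq by (smt (verit))
      then show ?thesis by blast
    next
      assume "\<forall>x. d x > 0"
      then have "Re z + \<delta> \<le> Re (F z) \<and> Re (F z) \<le> Re z + D" if "z \<in> ?S2" for z
        using near[of z] db[of "Re z"] that unfolding mem_Collect_eq by (smt (verit))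
      then show ?thesis by blast
    qed
    show "F (z + of_real (2 * pi * of_int j)) = F z + of_real (2 * pi * of_int j)" if "z \<in> ?S2" for z j
      using that h2 by (intro per_int) (auto simp: R_def)
    show "h2 \<le> Im (\<Gamma> t)" if "t > Tb" for t using high[OF that] h2(2) by linarith
    show "\<exists>j'. z = \<Gamma> (s + 1) + of_real (2 * pi * of_int j')" if "z \<in> ?S2" "F z = \<Gamma> s + of_real (2 * pi * of_int j)" for z s j
      using bck[of z s j] that h2 by (auto simp: S_def)
  qed (use h2 \<delta> \<Gamma>c \<Gamma>0 Tc2 F\<Gamma> in auto)
  obtain T' where T': "\<And>t. t \<le> T' \<Longrightarrow> Im (\<Gamma> t) < \<rho>" using lim0[OF \<rho>(1)] by blast
  define u0 where "u0 = min T' Tc - 1"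
  show thesis
  proof (rule that[of "{z. 0 < Im z \<and> Im z < \<rho>}" u0])
    show "(F ^^ n) w \<in> S" if "w \<in> {z. 0 < Im z \<and> Im z < \<rho>}" for n w using \<rho>(3)[of w n] that h2(2) by (auto simp: S_def)
    show "\<Gamma> ` {u0..u0+1} \<subseteq> {z. 0 < Im z \<and> Im z < \<rho>}" using T' \<Gamma>0 by (auto simp: u0_def)
  qed (use strip_convex[of 0 \<rho>] in \<open>auto simp: u0_def convex_connected\<close>)
qed

end

section \<open>Landing\<close>

lemma continuous_integer_constant:
  fixes q :: "'a::topological_space \<Rightarrow> complex"
  assumes S: "connected S" "continuous_on S q" and int: "\<And>z. z \<in> S \<Longrightarrow> q z \<in> \<int>"
  obtains m :: int where "\<And>z. z \<in> S \<Longrightarrow> q z = of_int m"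
proof (cases "S = {}")
  case False
  then obtain a where a: "a \<in> S" by blast
  have "q constant_on S"
  proof (rule continuous_discrete_range_constant[OF S])
    fix x assume x: "x \<in> S"
    have "1 \<le> norm (q y - q x)" if "y \<in> S" "q y \<noteq> q x" for y
    proof -
      have "q y - q x \<in> \<int>" using int that x by auto
      then obtain k :: int where "q y - q x = of_int k" by (rule Ints_cases)
      then show ?thesis using that(2) by (cases "k = 0") auto
    qed
    then show "\<exists>e>0. \<forall>y. y \<in> S \<and> q y \<noteq> q x \<longrightarrow> e \<le> norm (q y - q x)" by (intro exI[of _ 1]) auto
  qed
  moreover obtain m :: int where "q a = of_int m" using int[OF a] by (rule Ints_cases)
  ultimately show thesis using that[of m] a unfolding constant_on_def by metis
qed (use that in auto)

context ray_inverse
begin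

lemma ray_outside: "\<gamma> t \<in> outside A"
proof -
  have sub: "\<gamma> ` {t..} \<subseteq> connected_component_set (- A) (\<gamma> t)"
    by (rule connected_component_maximal)
      (auto intro!: connected_continuous_image continuous_on_subset[OF \<gamma>c] simp: ray_notin_A)
  have "\<not> bounded (\<gamma> ` {t..})"
  proof
    assume "bounded (\<gamma> ` {t..})"
    then obtain B where B: "\<And>s. s \<ge> t \<Longrightarrow> norm (\<gamma> s) \<le> B" unfolding bounded_iff by auto
    obtain t0 where "\<And>s. s \<ge> t0 \<Longrightarrow> norm (\<gamma> s) > B" using ray_bounded_below by blast
    then have "norm (\<gamma> (max t t0)) > B" by simp
    then show False using B[of "max t t0"] by simp
  qed
  then have "\<not> bounded (connected_component_set (- A) (\<gamma> t))" using sub bounded_subset by blast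
  then show ?thesis using ray_notin_A by (simp add: outside_def)
qed

lemma accumulation_singleton: "\<exists>z0. A = {z0}"
proof (rule ccontr)
  assume ns: "\<nexists>z0. A = {z0}"
  obtain a where a: "a \<in> A" using A_nonempty by blast
  obtain b where b: "b \<in> A" "a \<noteq> b" using ns a by (metis insertI1 singletonD subsetI subset_antisym insert_subset empty_subsetI)
  obtain X where X: "X holomorphic_on {z. 0 < Im z}" and Xout: "\<And>z. 0 < Im z \<Longrightarrow> X z \<in> outside A"
    and Xper: "\<And>z j. X (z + of_real (2 * pi * of_int j)) = X z"
    and Xinj: "\<And>z z'. 0 < Im z \<Longrightarrow> 0 < Im z' \<Longrightarrow> X z = X z' \<Longrightarrow> \<exists>j. z = z' + of_real (2 * pi * of_int j)"
    and Xlc: "\<And>\<gamma> :: real \<Rightarrow> complex. continuous_on UNIV \<gamma> \<Longrightarrow> (\<And>t. \<gamma> t \<in> outside A) \<Longrightarrow>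
       \<exists>\<Gamma>. continuous_on UNIV \<Gamma> \<and> (\<forall>t. 0 < Im (\<Gamma> t) \<and> X (\<Gamma> t) = \<gamma> t)"
    and Xlh: "\<And>S k. open S \<Longrightarrow> convex S \<Longrightarrow> k holomorphic_on S \<Longrightarrow> k ` S \<subseteq> outside A \<Longrightarrow>
       \<exists>G. G holomorphic_on S \<and> (\<forall>z\<in>S. 0 < Im (G z) \<and> X (G z) = k z)"
    and Xn1: "\<And>V. open V \<Longrightarrow> A \<subseteq> V \<Longrightarrow> \<exists>h>0. \<forall>z. 0 < Im z \<and> Im z < h \<longrightarrow> X z \<in> V"
    and Xn2: "\<And>h. h > 0 \<Longrightarrow> \<exists>V. open V \<and> A \<subseteq> V \<and> (\<forall>z. 0 < Im z \<and> X z \<in> V \<longrightarrow> Im z < h)"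
    and Xn3: "\<And>M. \<exists>B. \<forall>z. 0 < Im z \<and> norm (X z) > B \<longrightarrow> Im z > M"
    using exterior_halfplane[OF A_compact A_connected a b] by blast
  obtain B where B: "A \<subseteq> ball 0 B" using bounded_subset_ballD[OF compact_imp_bounded[OF A_compact]] by blast
  obtain h0 where h0: "h0 > 0" "\<And>z. 0 < Im z \<Longrightarrow> Im z < h0 \<Longrightarrow> X z \<in> N \<inter> ball 0 B"
  proof -
    have "open (N \<inter> ball 0 B)" "A \<subseteq> N \<inter> ball 0 B" using N B by auto
    then show thesis using Xn1 that by metis
  qed
  obtain \<Gamma> where \<Gamma>: "continuous_on UNIV \<Gamma>" "\<And>t. 0 < Im (\<Gamma> t)" "\<And>t. X (\<Gamma> t) = \<gamma> t"
    using Xlc[OF \<gamma>c ray_outside] by blast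
  have lim0: "\<exists>T'. \<forall>t\<le>T'. Im (\<Gamma> t) < e" if "e > 0" for e
  proof -
    obtain V where V: "open V" "A \<subseteq> V" "\<And>z. 0 < Im z \<Longrightarrow> X z \<in> V \<Longrightarrow> Im z < e" using Xn2[OF \<open>e > 0\<close>] by blast
    then show ?thesis using tail_near[OF V(1,2)] \<Gamma> by metis
  qed
  obtain T1' where "\<forall>t\<le>T1'. Im (\<Gamma> t) < h0" using lim0[OF h0(1)] by blast
  then obtain T1 where T1: "\<And>t. t \<le> T1 \<Longrightarrow> Im (\<Gamma> t) < h0" "T1 \<le> T" by (metis min.bounded_iff order_refl)
  let ?S = "{z. 0 < Im z \<and> Im z < h0}"
  note S = strip_convex[of 0 h0]
  define k where "k z = g (X z)" for z
  have XS: "X holomorphic_on ?S" using X by (rule holomorphic_on_subset) auto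
  have "(g \<circ> X) holomorphic_on ?S" by (rule holomorphic_on_compose_gen[OF XS N(3)]) (use h0 in auto)
  then have kh: "k holomorphic_on ?S" by (simp add: k_def[abs_def] o_def)
  have gnA: "g z \<notin> A" if "z \<in> N" "z \<notin> A" for z using fA[of "g z"] fg[OF that(1)] that(2) by auto
  have \<Gamma>S: "\<Gamma> t \<in> ?S" if "t \<le> T1" for t using T1(1)[OF that] \<Gamma>(2) by auto
  have k\<Gamma>: "k (\<Gamma> t) = \<gamma> (t - 1)" if "t \<le> T1" for t using \<Gamma>(3) g\<gamma>[of t] that T1(2) by (simp add: k_def)
  \<comment> \<open>The image is connected, avoids \<open>A\<close> because \<open>f\<close> maps
    \<open>A\<close> into itself, and contains a point of the ray; so it lies in the unbounded
    component.\<close>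
  have kout: "k ` ?S \<subseteq> outside A"
  proof -
    have "k ` ?S \<subseteq> connected_component_set (- A) (\<gamma> (T1 - 1))"
    proof (rule connected_component_maximal)
      show "\<gamma> (T1 - 1) \<in> k ` ?S" using \<Gamma>S[of T1] k\<Gamma>[of T1] by force
      show "connected (k ` ?S)"
        by (intro connected_continuous_image holomorphic_on_imp_continuous_on[OF kh] convex_connected S)
      show "k ` ?S \<subseteq> - A"
      proof clarify
        fix z assume z: "0 < Im z" "Im z < h0" "k z \<in> A"
        then show False using gnA[of "X z"] h0(2)[of z] Xout[of z] outside_no_overlap[of A] unfolding k_def by blast
      qed
    qed
    then show ?thesis using outside_same_component[OF _ ray_outside[of "T1 - 1"]] by auto
  qed
  obtain G0 where G0: "G0 holomorphic_on ?S" "\<And>z. z \<in> ?S \<Longrightarrow> 0 < Im (G0 z) \<and> X (G0 z) = k z"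
    using Xlh[OF S(2,1) kh kout] by blast
  obtain j1 where j1: "G0 (\<Gamma> T1) = \<Gamma> (T1 - 1) + of_real (2 * pi * of_int j1)"
    using Xinj[of "G0 (\<Gamma> T1)" "\<Gamma> (T1 - 1)"] G0(2)[OF \<Gamma>S[of T1]] k\<Gamma>[of T1] \<Gamma> by auto
  \<comment> \<open>A deck transformation adjusts the lift so that it shifts the lifted ray
    backwards by one unit of time.\<close>
  define G where "G z = G0 z + of_real (2 * pi * of_int (- j1))" for z
  have G: "G holomorphic_on ?S" unfolding G_def by (intro holomorphic_intros G0)
  have GX: "0 < Im (G z)" "X (G z) = g (X z)" if "z \<in> ?S" for z
    using G0(2)[OF that] Xper[of "G0 z" "- j1"] unfolding G_def k_def by auto
  have G\<Gamma>: "G (\<Gamma> t) = \<Gamma> (t - 1)" if t: "t \<le> T1" for t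
  proof -
    have "\<i> * G (\<Gamma> t) = \<i> * \<Gamma> (t - 1)"
    proof (rule lift_unique[where f=exp and T="{..T1}" and a=T1 and ?g1.0="\<lambda>t. \<i> * G (\<Gamma> t)" and ?g2.0="\<lambda>t. \<i> * \<Gamma> (t - 1)"])
      show "continuous_on {..T1} (\<lambda>t. \<i> * G (\<Gamma> t))"
        by (intro continuous_intros continuous_on_compose2[OF holomorphic_on_imp_continuous_on[OF G]] continuous_on_subset[OF \<Gamma>(1)])
          (use \<Gamma>S in auto)
      show "continuous_on {..T1} (\<lambda>t. \<i> * \<Gamma> (t - 1))" by (intro continuous_intros continuous_on_compose2[OF \<Gamma>(1)]) auto
      show "exp (\<i> * G (\<Gamma> x)) = exp (\<i> * \<Gamma> (x - 1))" if "x \<in> {..T1}" for x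
      proof -
        have "X (G (\<Gamma> x)) = X (\<Gamma> (x - 1))" using GX(2)[OF \<Gamma>S] k\<Gamma>[of x] that \<Gamma>(3) by (simp add: k_def)
        then obtain j :: int where "G (\<Gamma> x) = \<Gamma> (x - 1) + of_real (2 * pi * of_int j)"
          using Xinj[of "G (\<Gamma> x)" "\<Gamma> (x - 1)"] GX(1)[OF \<Gamma>S, of x] \<Gamma>(2) \<open>x \<in> {..T1}\<close> by auto
        then show ?thesis unfolding exp_eq by (intro exI[of _ j]) (simp add: algebra_simps)
      qed
      show "deriv exp (\<i> * G (\<Gamma> x)) \<noteq> 0" for x using DERIV_imp_deriv[OF DERIV_exp, of "\<i> * G (\<Gamma> x)"] by simp
      show "\<i> * G (\<Gamma> T1) = \<i> * \<Gamma> (T1 - 1)" unfolding G_def j1 by simp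
    qed (use t in \<open>auto intro: holomorphic_intros\<close>)
    then show ?thesis by simp
  qed
  have Ssh: "z + of_real (2 * pi) \<in> ?S" if "z \<in> ?S" for z using that by simp
  \<comment> \<open>The degree of \<open>G\<close> on the circle, at this stage an arbitrary
    integer; it is shown to be 1 only after reflection.\<close>
  have "\<exists>m::int. \<forall>z\<in>?S. (G (z + of_real (2 * pi)) - G z) / of_real (2 * pi) = of_int m"
  proof (rule continuous_integer_constant[of ?S "\<lambda>z. (G (z + of_real (2 * pi)) - G z) / of_real (2 * pi)"])
    show "connected ?S" by (rule convex_connected[OF S(1)])
    have c: "continuous_on ?S G" by (rule holomorphic_on_imp_continuous_on[OF G])
    show "continuous_on ?S (\<lambda>z. (G (z + of_real (2 * pi)) - G z) / of_real (2 * pi))"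
      by (intro continuous_intros continuous_on_compose2[OF c] c) (use Ssh in auto)
    show "(G (z + of_real (2 * pi)) - G z) / of_real (2 * pi) \<in> \<int>" if z: "z \<in> ?S" for z
    proof -
      have "X (G (z + of_real (2 * pi))) = X (G z)" using GX(2)[OF Ssh[OF z]] GX(2)[OF z] Xper[of z 1] by simp
      then obtain j :: int where "G (z + of_real (2 * pi)) = G z + of_real (2 * pi * of_int j)"
        using Xinj[OF GX(1)[OF Ssh[OF z]] GX(1)[OF z]] by blast
      then have "(G (z + of_real (2 * pi)) - G z) / of_real (2 * pi) = of_int j" by (simp add: field_simps)
      then show ?thesis by simp
    qed
  qed blast
  then obtain m :: int where m: "\<And>z. z \<in> ?S \<Longrightarrow> (G (z + of_real (2 * pi)) - G z) / of_real (2 * pi) = of_int m" by blast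
  have Gper: "G (z + of_real (2 * pi)) = G z + of_real (2 * pi * of_int m)" if "0 < Im z" "Im z < h0" for z
    using m[of z] that by (simp add: field_simps)
  have Glim: "\<exists>\<eta>>0. \<forall>z. 0 < Im z \<and> Im z < \<eta> \<and> Im z < h0 \<longrightarrow> Im (G z) < e" if "e > 0" for e
  proof -
    obtain V where V: "open V" "A \<subseteq> V" "\<And>z. 0 < Im z \<Longrightarrow> X z \<in> V \<Longrightarrow> Im z < e" using Xn2[OF \<open>e > 0\<close>] by blast
    have "open (N \<inter> g -` V)" using holomorphic_on_imp_continuous_on[OF N(3)] N(1) V(1) by (rule continuous_open_preimage)
    moreover have "A \<subseteq> N \<inter> g -` V" using gA N(2) V(2) by auto
    ultimately obtain \<eta> where \<eta>: "\<eta> > 0" "\<And>z. 0 < Im z \<Longrightarrow> Im z < \<eta> \<Longrightarrow> X z \<in> N \<inter> g -` V"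
      using Xn1 by metis
    have "Im (G z) < e" if "0 < Im z" "Im z < \<eta>" "Im z < h0" for z
      using V(3)[of "G z"] GX[of z] \<eta>(2)[of z] that by auto
    then show ?thesis using \<eta>(1) by blast
  qed
  obtain h' F C L where F: "0 < h'" "h' \<le> h0" "F holomorphic_on {z. - h' < Im z \<and> Im z < h'}"
    "\<And>z. 0 < Im z \<Longrightarrow> Im z < h' \<Longrightarrow> F z = G z"
    "\<And>z. Im z = 0 \<Longrightarrow> Im (F z) = 0"
    "\<And>z. - h' < Im z \<Longrightarrow> Im z < 0 \<Longrightarrow> Im (F z) < 0"
    "\<And>z. 0 < Im z \<Longrightarrow> Im z < h' \<Longrightarrow> Im (F z) \<le> C * Im z"
    "\<And>z. - h' < Im z \<Longrightarrow> Im z < h' \<Longrightarrow> F (z + of_real (2 * pi)) = F z + of_real (2 * pi * of_int m)"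
    "\<And>z w. 0 \<le> Im z \<Longrightarrow> Im z < h' \<Longrightarrow> 0 \<le> Im w \<Longrightarrow> Im w < h' \<Longrightarrow> norm (F z - F w) \<le> L * norm (z - w)"
    by (rule strip_reflection[OF h0(1) G _ Gper Glim]) (use GX in auto)
  have FX: "X (F z) = g (X z)" "X z \<in> N" "0 < Im (F z)" if "0 < Im z" "Im z < h'" for z
    using F(2) F(4)[OF that] GX[of z] h0(2)[of z] that by auto
  have Xeq: "X z = f w" if "0 < Im z" "Im z < h'" "X (F z) = w" for z w
    using FX[OF that(1,2)] fg that(3) by metis
  interpret strip_map F h' C L m
  proof
    show "\<exists>j'. z = z' + of_real (2 * pi * of_int j')"
      if "0 < Im z" "Im z < h'" "0 < Im z'" "Im z' < h'" "F z = F z' + of_real (2 * pi * of_int j)" for z z' j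
    proof -
      have "X (F z) = X (F z')" unfolding that(5) by (rule Xper)
      then have "X z = X z'" using Xeq[of z] Xeq[of z'] that by metis
      then show ?thesis using Xinj that by blast
    qed
  qed (use F FX in auto)
  obtain T2' where "\<forall>t\<le>T2'. Im (\<Gamma> t) < h'" using lim0[OF F(1)] by blast
  then obtain T2 where T2: "\<And>t. t \<le> T2 \<Longrightarrow> Im (\<Gamma> t) < h'" "T2 \<le> T1" by (metis min.bounded_iff order_refl)
  have F\<Gamma>: "F (\<Gamma> t) = \<Gamma> (t - 1)" if "t \<le> T2" for t
    using F(4)[of "\<Gamma> t"] G\<Gamma>[of t] T2 \<Gamma>(2) that by auto
  obtain B' where B': "\<And>z. 0 < Im z \<Longrightarrow> norm (X z) > B' \<Longrightarrow> Im z > h'" using Xn3 by blast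
  obtain Tb where Tb: "\<And>t. t \<ge> Tb \<Longrightarrow> norm (\<gamma> t) > B'" using ray_bounded_below by blast
  \<comment> \<open>If \<open>F\<close> were the identity, the ray would return to the same point at
    every integer time instead of escaping.\<close>
  have nid: "\<not> (\<forall>z\<in>R. F z = z)"
  proof
    assume id: "\<forall>z\<in>R. F z = z"
    have "\<Gamma> (T2 - 1) = \<Gamma> T2" using id F\<Gamma>[of T2] T2(1)[of T2] \<Gamma>(2)[of T2] F(1) by (auto simp: R_def)
    then have "\<gamma> (T2 - 1) = \<gamma> T2" using \<Gamma>(3) by metis
    then have fx: "f (\<gamma> T2) = \<gamma> T2" using f\<gamma>[of "T2 - 1"] by simp
    have "(f ^^ n) (\<gamma> T2) = \<gamma> T2" for n by (induction n) (auto simp: fx)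
    then have "\<gamma> (T2 + real n) = \<gamma> T2" for n unfolding iterate_ray .
    moreover obtain t0 where "\<And>t. t \<ge> t0 \<Longrightarrow> norm (\<gamma> t) > norm (\<gamma> T2)" using ray_bounded_below by blast
    moreover have "T2 + real (nat \<lceil>t0 - T2\<rceil>) \<ge> t0" by linarith
    ultimately show False by (metis less_irrefl)
  qed
  obtain W u0 where W: "open W" "connected W" "\<And>n w. w \<in> W \<Longrightarrow> (F ^^ n) w \<in> S" "u0 + 1 \<le> T2" "\<Gamma> ` {u0..u0+1} \<subseteq> W"
  proof (rule curve_stable[of \<Gamma> T2 Tb, OF \<Gamma>(1,2) T2(1) _ F\<Gamma> _ lim0 nid])
    show "h' \<le> Im (\<Gamma> t)" if "t > Tb" for t using B'[of "\<Gamma> t"] Tb[of t] that \<Gamma> by auto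
    show "\<exists>j'. z = \<Gamma> (s + 1) + of_real (2 * pi * of_int j')" if "z \<in> S" "F z = \<Gamma> s + of_real (2 * pi * of_int j)" for z s j
    proof -
      have z: "0 < Im z" "Im z < h'" using that(1) by (auto simp: S_def)
      have "X (F z) = \<gamma> s" unfolding that(2) Xper \<Gamma>(3) ..
      then have "X z = X (\<Gamma> (s + 1))" using Xeq[OF z] f\<gamma> \<Gamma>(3) by metis
      then show ?thesis using Xinj[OF z(1) \<Gamma>(2)] by blast
    qed
  qed auto
  have Fnh: "(F ^^ n) holomorphic_on W" for n
  proof (induction n)
    case 0 then show ?case by (simp add: id_def)
  next
    case (Suc n)
    have "F \<circ> (F ^^ n) holomorphic_on W"
      by (rule holomorphic_on_compose_gen[OF Suc R(4)]) (use W(3) S(2) in blast)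
    then show ?case by (simp only: funpow.simps)
  qed
  have Sb: "0 < Im w \<and> Im w < h'" if "w \<in> S" for w using that by (simp add: S_def)
  have F\<Gamma>n: "(F ^^ n) (\<Gamma> t) = \<Gamma> (t - real n)" if "t \<le> T2" for t n
    by (induction n) (use that F\<Gamma>[of "t - real _"] in \<open>auto simp: algebra_simps\<close>)
  have "\<exists>z0. A = {z0}"
  proof (rule stable_imp_singleton[OF W(1,2), of "\<lambda>n. X \<circ> (F ^^ n)" B "\<lambda>u. \<Gamma> (u0 + u)" u0])
    show "X \<circ> (F ^^ n) holomorphic_on W" for n
      by (rule holomorphic_on_compose_gen[OF Fnh X]) (use W(3) Sb in blast)
    show "norm ((X \<circ> F ^^ n) z) \<le> B" "(X \<circ> F ^^ n) z \<notin> A" if "z \<in> W" for n z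
    proof -
      have "X ((F ^^ n) z) \<notin> A" using Xout[of "(F ^^ n) z"] Sb[OF W(3)[OF that, of n]] outside_no_overlap[of A] by blast
      then show "norm ((X \<circ> F ^^ n) z) \<le> B" "(X \<circ> F ^^ n) z \<notin> A"
        using h0(2)[of "(F ^^ n) z"] Sb[OF W(3)[OF that, of n]] F(2) by auto
    qed
    show "continuous_on {0..1} (\<lambda>u. \<Gamma> (u0 + u))" by (intro continuous_on_compose2[OF \<Gamma>(1)] continuous_intros) auto
    show "(\<lambda>u. \<Gamma> (u0 + u)) ` {0..1} \<subseteq> W" using W(5) by auto
    show "(X \<circ> F ^^ n) (\<Gamma> (u0 + u)) = \<gamma> (u0 + u - real n)" if "u \<in> {0..1}" for n u
      using F\<Gamma>n[of "u0 + u" n] that W(4) \<Gamma>(3) by simp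
  qed
  then show False using ns by blast
qed

theorem ray_lands: "\<exists>z0. lands_at \<gamma> z0 \<and> (repelling_fixed_point f z0 \<or> parabolic_fixed_point f z0)"
  using accumulation_singleton singleton_conclusion by blast

end

section \<open>Hulls and branches on compact sets\<close>

text \<open>For compact \<open>X\<close> this is the polynomially convex hull, that is,
  \<open>X\<close> with the bounded components of its complement filled in.\<close>

definition phull :: "complex set \<Rightarrow> complex set" where "phull X = - outside X"

lemma phull_eq: "phull X = X \<union> inside X"
  unfolding phull_def by (rule union_with_inside[symmetric])

lemma compact_phull: assumes "compact X" shows "compact (phull X)"
proof -
  have "bounded (X \<union> inside X)" using compact_imp_bounded[OF assms] bounded_inside[OF compact_imp_bounded[OF assms]] by simp
  moreover have "closed (phull X)" unfolding phull_def using open_outside[OF compact_imp_closed[OF assms]] by auto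
  ultimately show ?thesis by (simp add: phull_eq compact_eq_bounded_closed)
qed

lemma connected_unbounded_outside:
  assumes "connected U" "\<not> bounded U" "U \<inter> X = {}" "z \<in> U" shows "z \<in> outside X"
proof -
  have "U \<subseteq> connected_component_set (- X) z"
    by (rule connected_component_maximal) (use assms in auto)
  then have "\<not> bounded (connected_component_set (- X) z)" using assms(2) bounded_subset by blast
  then show ?thesis using assms by (auto simp: outside_def)
qed

lemma outside_unbounded_connected:
  assumes "z \<in> outside X"
  obtains U where "connected U" "\<not> bounded U" "z \<in> U" "U \<subseteq> outside X"
proof (rule that[of "connected_component_set (- X) z"])
  show "\<not> bounded (connected_component_set (- X) z)" "z \<in> connected_component_set (- X) z"
    using assms by (auto simp: outside_def)
  show "connected_component_set (- X) z \<subseteq> outside X"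
    using outside_same_component[OF _ assms] by auto
qed auto

lemma phull_mono: assumes "X \<subseteq> phull Y" shows "phull X \<subseteq> phull Y"
proof -
  have "outside Y \<subseteq> outside X"
  proof
    fix z assume "z \<in> outside Y"
    then obtain U where "connected U" "\<not> bounded U" "z \<in> U" "U \<subseteq> outside Y" by (rule outside_unbounded_connected)
    then show "z \<in> outside X" using connected_unbounded_outside[of U X z] assms unfolding phull_def by blast
  qed
  then show ?thesis unfolding phull_def by blast
qed

text \<open>By the open mapping theorem the part of \<open>f\<close> phull
  X\<open>in the unbounded component of the complement of\<close>f \<open>X\<close> is open as well
  as closed there. If it were nonempty it would be the whole component, which is unbounded.\<close>

lemma image_phull:
  assumes f: "f holomorphic_on UNIV" "\<not> f constant_on UNIV" and X: "compact X"
  shows "f ` phull X \<subseteq> phull (f ` X)"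
proof (rule ccontr)
  assume no: "\<not> ?thesis"
  let ?V = "outside (f ` X)"
  have fc: "continuous_on B f" for B using holomorphic_on_imp_continuous_on[OF f(1)] continuous_on_subset by blast
  have cfX: "compact (f ` X)" using X fc compact_continuous_image by blast
  have cH: "compact (f ` phull X)" using compact_phull[OF X] fc compact_continuous_image by blast
  have V: "open ?V" "connected ?V" "\<not> bounded ?V"
    using open_outside[OF compact_imp_closed[OF cfX]] connected_outside[OF compact_imp_bounded[OF cfX]]
      unbounded_outside[OF compact_imp_bounded[OF cfX]] by auto
  have e: "f ` phull X \<inter> ?V = f ` inside X \<inter> ?V" using outside_no_overlap[of "f ` X"] unfolding phull_eq by blast
  have "open (f ` inside X)"
    using f(2) open_inside[OF compact_imp_closed[OF X]]
    by (intro open_mapping_thm[OF f(1)]) auto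
  then have "openin (top_of_set ?V) (f ` phull X \<inter> ?V)" unfolding e by (metis Int_commute openin_open_Int)
  moreover have "closedin (top_of_set ?V) (f ` phull X \<inter> ?V)"
    using compact_imp_closed[OF cH] by (metis Int_commute closedin_closed_Int)
  moreover have "f ` phull X \<inter> ?V \<noteq> {}" using no unfolding phull_def by auto
  ultimately have "f ` phull X \<inter> ?V = ?V" using V(2) unfolding connected_clopen by blast
  then show False using V(3) compact_imp_bounded[OF cH] bounded_subset by blast
qed

lemma maximum_modulus_phull:
  assumes "k holomorphic_on UNIV" "compact X" "\<And>z. z \<in> X \<Longrightarrow> norm (k z) \<le> \<beta>" "z \<in> phull X"
  shows "norm (k z) \<le> \<beta>"
proof (cases "z \<in> X")
  case False
  then have z: "z \<in> inside X" using assms(4) by (simp add: phull_eq)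
  show ?thesis
  proof (rule maximum_modulus_frontier[of k "inside X"])
    show "k holomorphic_on interior (inside X)" by (rule holomorphic_on_subset[OF assms(1)]) auto
    show "continuous_on (closure (inside X)) k"
      using holomorphic_on_imp_continuous_on[OF assms(1)] by (rule continuous_on_subset) auto
    show "bounded (inside X)" using bounded_inside compact_imp_bounded assms(2) by blast
    show "norm (k w) \<le> \<beta>" if "w \<in> frontier (inside X)" for w
      using assms(3) that frontier_inside_subset[OF compact_imp_closed[OF assms(2)]] by blast
  qed (rule z)
qed (use assms in auto)

text \<open>Join \<open>S\<close> to infinity by a closed connected set \<open>X\<close> off
  \<open>P\<close>. The component of the complement of \<open>X\<close> that contains
  \<open>P\<close> has a connected unbounded complement and is therefore simply connected.\<close>

lemma simply_connected_nbhd: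
  fixes P S :: "complex set"
  assumes P: "compact P" "connected P" "P \<noteq> {}" and S: "compact S" "S \<subseteq> outside P"
  obtains V where "open V" "simply_connected V" "P \<subseteq> V" "V \<inter> S = {}"
proof -
  let ?\<Omega> = "outside P"
  have \<Omega>: "open ?\<Omega>" "connected ?\<Omega>"
    using open_outside[OF compact_imp_closed[OF P(1)]] connected_outside[OF compact_imp_bounded[OF P(1)]] by auto
  then have pc: "path_connected ?\<Omega>" by (rule connected_open_path_connected)
  obtain \<rho> where \<rho>: "\<rho> > 0" "P \<subseteq> ball 0 \<rho>" using bounded_subset_ballD[OF compact_imp_bounded[OF P(1)]] by blast
  define z1 where "z1 = complex_of_real \<rho>"
  have out: "- ball 0 \<rho> \<subseteq> ?\<Omega>" using \<rho> by (intro outside_subset_convex) auto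
  have z1: "z1 \<in> - ball 0 \<rho>" using \<rho>(1) unfolding z1_def by simp
  have "\<exists>r>0. cball s r \<subseteq> ?\<Omega>" if "s \<in> S" for s using S(2) \<Omega>(1) that open_contains_cball by blast
  then obtain r where r: "\<And>s. s \<in> S \<Longrightarrow> r s > 0 \<and> cball s (r s) \<subseteq> ?\<Omega>" by metis
  have "S \<subseteq> (\<Union>s\<in>S. ball s (r s))" using r by auto
  then obtain D where D: "D \<subseteq> S" "finite D" "S \<subseteq> (\<Union>s\<in>D. ball s (r s))"
    using compactE_image[OF S(1), of S "\<lambda>s. ball s (r s)"] by auto
  have "\<exists>g. path g \<and> path_image g \<subseteq> ?\<Omega> \<and> pathstart g = s \<and> pathfinish g = z1" if "s \<in> D" for s
    using pc S(2) D(1) that out z1 unfolding path_connected_def by blast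
  then obtain g where g: "\<And>s. s \<in> D \<Longrightarrow> path (g s) \<and> path_image (g s) \<subseteq> ?\<Omega> \<and> pathstart (g s) = s \<and> pathfinish (g s) = z1" by metis
  \<comment> \<open>The exterior of a large disc together with finitely many discs that cover
    \<open>S\<close>, each attached to the exterior by a path.\<close>
  define X where "X = - ball 0 \<rho> \<union> (\<Union>s\<in>D. cball s (r s) \<union> path_image (g s))"
  have clX: "closed X" unfolding X_def using D(2) g
    by (intro closed_Un closed_UN) (auto simp: closed_path_image closed_def[symmetric])
  have XP: "X \<inter> P = {}"
  proof -
    have "X \<subseteq> ?\<Omega>" unfolding X_def using out r g D(1) by blast
    then show ?thesis using outside_no_overlap[of P] by blast
  qed
  have conX: "connected X"
  proof -
    have c1: "connected (- ball 0 \<rho> :: complex set)" by (rule connected_complement_bounded_convex) auto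
    have "connected (- ball 0 \<rho> \<union> (cball s (r s) \<union> path_image (g s)))" if s: "s \<in> D" for s
    proof (intro connected_Un c1)
      show "connected (path_image (g s))" using g[OF s] connected_path_image by blast
      have "s \<in> cball s (r s) \<inter> path_image (g s)" using g[OF s] r[of s] D(1) s pathstart_in_path_image by force
      then show "cball s (r s) \<inter> path_image (g s) \<noteq> {}" by blast
      have "z1 \<in> path_image (g s)" using g[OF s] pathfinish_in_path_image by metis
      then show "- ball 0 \<rho> \<inter> (cball s (r s) \<union> path_image (g s)) \<noteq> {}" using z1 by blast
    qed (auto intro: convex_connected)
    then have "connected (\<Union>(insert (- ball 0 \<rho>) ((\<lambda>s. - ball 0 \<rho> \<union> (cball s (r s) \<union> path_image (g s))) ` D)))"
      using c1 z1 by (intro connected_Union) auto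
    moreover have "\<Union>(insert (- ball 0 \<rho>) ((\<lambda>s. - ball 0 \<rho> \<union> (cball s (r s) \<union> path_image (g s))) ` D)) = X"
      unfolding X_def by auto
    ultimately show ?thesis by simp
  qed
  obtain p where p: "p \<in> P" using P(3) by blast
  define V where "V = connected_component_set (- X) p"
  have PV: "P \<subseteq> V" unfolding V_def using XP p P(2) by (intro connected_component_maximal) auto
  have oV: "open V" unfolding V_def using clX by (intro open_connected_component) auto
  have VX: "V \<subseteq> - X" unfolding V_def by (rule connected_component_subset)
  have "V \<in> components (- X)" unfolding V_def using XP p by (intro componentsI) auto
  then have "connected (- V)" using component_complement_connected[OF conX] by blast
  moreover have "- V \<noteq> {}" "\<not> bounded (- V)"
  proof -
    have "- ball 0 \<rho> \<subseteq> - V" using VX unfolding X_def by blast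
    moreover have "\<not> bounded (- ball 0 \<rho> :: complex set)" by (rule cobounded_imp_unbounded) simp
    ultimately show "\<not> bounded (- V)" using bounded_subset by blast
    then show "- V \<noteq> {}" by auto
  qed
  ultimately have "\<And>C. C \<in> components (- V) \<Longrightarrow> \<not> bounded C" by (metis components_eq_sing_iff singletonD)
  then have "simply_connected V" unfolding simply_connected_eq_unbounded_complement_components[OF oV]
    by (auto simp: V_def)
  moreover have "V \<inter> S = {}" using VX D(3) unfolding X_def by (auto simp: subset_iff) (meson less_imp_le)
  ultimately show thesis using that oV PV by blast
qed

text \<open>It is not enough that \<open>P\<close> avoids the singular values: it must not surround
  any, so that a simply connected neighbourhood off them exists.\<close>

lemma branch_on_compact:
  assumes hol: "f holomorphic_on UNIV" and bs: "bounded (singular_values f)"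
    and P: "compact P" "connected P" "p \<in> P" "singular_values f \<subseteq> outside P" and z0: "f z0 = p"
  obtains V g where "open V" "P \<subseteq> V" "V \<inter> singular_values f = {}" "g holomorphic_on V" "\<And>z. z \<in> V \<Longrightarrow> f (g z) = z" "g p = z0"
proof -
  have "compact (singular_values f)" using bs by (simp add: compact_eq_bounded_closed)
  then obtain V where V: "open V" "simply_connected V" "P \<subseteq> V" "V \<inter> singular_values f = {}"
    using simply_connected_nbhd[OF P(1,2) _ _ P(4)] P(3) by blast
  obtain g where "g holomorphic_on V" "g p = z0" "\<And>u. u \<in> V \<Longrightarrow> f (g u) = u"
  proof (rule entire_lift_holomorphic[OF hol V(2,1), of "\<lambda>u. u" p z0])
    show "(\<lambda>u. u) holomorphic_on V" by (rule holomorphic_on_ident)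
  qed (use V(3,4) P(3) z0 in auto)
  then show thesis using that V by blast
qed

lemma branch_unique:
  assumes hol: "f holomorphic_on UNIV" and T: "connected T" "a \<in> T" "T \<inter> singular_values f = {}"
    and g: "continuous_on T g1" "continuous_on T g2" "\<And>z. z \<in> T \<Longrightarrow> f (g1 z) = z" "\<And>z. z \<in> T \<Longrightarrow> f (g2 z) = z"
    and a: "g1 a = g2 a" and z: "z \<in> T"
  shows "g1 z = g2 z"
proof (rule lift_unique[where f=f and T=T and a=a and ?g1.0=g1 and ?g2.0=g2])
  show "deriv f (g1 x) \<noteq> 0" if "x \<in> T" for x
    using deriv_nonzero_off_singular[of f "g1 x"] g(3)[OF that] T(3) that by auto
qed (use assms in auto)

lemma branch_along_ray:
  assumes hol: "f holomorphic_on UNIV" and c: "continuous_on UNIV \<gamma>" and f\<gamma>: "\<And>t. f (\<gamma> t) = \<gamma> (t + 1 :: real)"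
    and I: "connected I" "a \<in> I" and V: "\<gamma> ` I \<subseteq> V" "V \<inter> singular_values f = {}"
    and g: "continuous_on V g" "\<And>z. z \<in> V \<Longrightarrow> f (g z) = z"
    and a: "g (\<gamma> a) = \<gamma> (a - 1)" and t: "t \<in> I"
  shows "g (\<gamma> t) = \<gamma> (t - 1)"
proof (rule lift_unique[where f=f and T=I and a=a and ?g1.0="\<lambda>t. g (\<gamma> t)" and ?g2.0="\<lambda>t. \<gamma> (t - 1)"])
  show "continuous_on I (\<lambda>t. g (\<gamma> t))"
    by (rule continuous_on_compose2[OF g(1) continuous_on_subset[OF c]]) (use V in auto)
  show "continuous_on I (\<lambda>t. \<gamma> (t - 1))" by (intro continuous_on_compose2[OF c] continuous_intros) auto
  show "f (g (\<gamma> x)) = f (\<gamma> (x - 1))" if "x \<in> I" for x using g(2)[of "\<gamma> x"] V that f\<gamma>[of "x - 1"] by auto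
  show "deriv f (g (\<gamma> x)) \<noteq> 0" if "x \<in> I" for x
    using deriv_nonzero_off_singular[of f "g (\<gamma> x)"] g(2)[of "\<gamma> x"] V that by auto
qed (use assms in auto)

section \<open>Growth of iterates near the Julia set\<close>

lemma normal_family_of_bounded_subsequence:
  fixes h :: "nat \<Rightarrow> complex \<Rightarrow> complex" and r1 :: "nat \<Rightarrow> nat"
  assumes U: "open U" and r1: "strict_mono r1" and hol: "\<And>i. h (r1 i) holomorphic_on U"
    and bd: "\<And>K. compact K \<Longrightarrow> K \<subseteq> U \<Longrightarrow> \<exists>B. \<forall>i. \<forall>z\<in>K. norm (h (r1 i) z) \<le> B"
  shows "\<exists>r :: nat \<Rightarrow> nat. strict_mono r \<and> (\<exists>g. g holomorphic_on U \<and>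
    (\<forall>K. compact K \<and> K \<subseteq> U \<longrightarrow> uniform_limit K (\<lambda>n. h (r n)) g sequentially))"
proof -
  obtain g r2 where g: "g holomorphic_on U" "strict_mono (r2 :: nat \<Rightarrow> nat)"
    "\<And>K. compact K \<Longrightarrow> K \<subseteq> U \<Longrightarrow> uniform_limit K (\<lambda>i. h (r1 (r2 i))) g sequentially"
  proof (rule Montel[of U "range (\<lambda>i. h (r1 i))" "\<lambda>i. h (r1 i)"])
    show "\<exists>B. \<forall>k\<in>range (\<lambda>i. h (r1 i)). \<forall>z\<in>K. norm (k z) \<le> B" if "compact K" "K \<subseteq> U" for K
      using bd[OF that] by blast
  qed (use U hol in \<open>auto simp: o_def\<close>)
  have "strict_mono (\<lambda>n. r1 (r2 n))" using strict_mono_o[OF r1 g(2)] by (simp add: o_def)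
  then show ?thesis using g by (intro exI[of _ "\<lambda>n. r1 (r2 n)"]) auto
qed

text \<open>Montel's theorem with omitted values that vary with the function but stay bounded and
  separated. An affine change \<open>\<phi> i\<close> makes them 0 and 1, and the bounds on
  \<open>p\<close> and \<open>q\<close> carry convergence back to \<open>h i\<close>.\<close>

lemma normal_family_omitting:
  assumes U: "open U" "connected U" "s \<in> U" and hol: "\<And>h. h \<in> \<F> \<Longrightarrow> h holomorphic_on U"
    and om: "\<And>h. h \<in> \<F> \<Longrightarrow> \<exists>p q. norm p \<le> M \<and> norm q \<le> M \<and> norm (p - q) \<ge> 1 \<and> (\<forall>z\<in>U. h z \<noteq> p \<and> h z \<noteq> q)"
  shows "normal_family_on U \<F>"
  unfolding normal_family_on_def
proof (intro allI impI)
  fix h :: "nat \<Rightarrow> complex \<Rightarrow> complex"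
  assume h: "range h \<subseteq> \<F>"
  have "\<exists>p q. norm p \<le> M \<and> norm q \<le> M \<and> norm (p - q) \<ge> 1 \<and> (\<forall>z\<in>U. h i z \<noteq> p \<and> h i z \<noteq> q)" for i
    using om h by blast
  then obtain p q where pq: "\<And>i. norm (p i) \<le> M" "\<And>i. norm (q i) \<le> M" "\<And>i. norm (p i - q i) \<ge> 1"
    "\<And>i z. z \<in> U \<Longrightarrow> h i z \<noteq> p i" "\<And>i z. z \<in> U \<Longrightarrow> h i z \<noteq> q i" by metis
  have hh: "h i holomorphic_on U" for i using hol h by blast
  have ne: "q i - p i \<noteq> 0" for i using pq(3)[of i] by auto
  have M: "M \<ge> 0" using pq(1)[of 0] norm_ge_zero order_trans by blast
  have d2: "norm (q i - p i) \<le> 2 * M" "norm (q i - p i) \<ge> 1" for i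
    using norm_triangle_ineq4[of "q i" "p i"] pq(1,2)[of i] pq(3)[of i] by (auto simp: norm_minus_commute)
  define \<phi> where "\<phi> i z = (h i z - p i) / (q i - p i)" for i z
  have h\<phi>: "h i z = p i + (q i - p i) * \<phi> i z" for i z using ne[of i] by (simp add: \<phi>_def)
  have \<phi>: "\<phi> i holomorphic_on U" "\<And>z. z \<in> U \<Longrightarrow> \<phi> i z \<noteq> 0" "\<And>z. z \<in> U \<Longrightarrow> \<phi> i z \<noteq> 1" for i
    unfolding \<phi>_def using hh pq(4,5)[of _ i] ne[of i] by (auto intro!: holomorphic_intros simp: divide_eq_1_iff)
  have hb: "norm (h i z) \<le> M + 2 * M * B" if "norm (\<phi> i z) \<le> B" for i z B
  proof -
    have "norm (h i z) \<le> norm (p i) + norm (q i - p i) * norm (\<phi> i z)" unfolding h\<phi> by (metis norm_mult norm_triangle_ineq)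
    also have "\<dots> \<le> M + 2 * M * B" using pq(1)[of i] d2(1)[of i] that M by (intro add_mono mult_mono) auto
    finally show ?thesis .
  qed
  let ?G = "\<lambda>r. \<exists>g. g holomorphic_on U \<and> (\<forall>K. compact K \<and> K \<subseteq> U \<longrightarrow> uniform_limit K (\<lambda>n. h (r n)) g sequentially)"
  let ?I = "\<lambda>r. \<forall>K. compact K \<and> K \<subseteq> U \<longrightarrow> (\<forall>R. \<forall>\<^sub>F n in sequentially. \<forall>z\<in>K. R < norm (h (r n) z))"
  show "\<exists>r :: nat \<Rightarrow> nat. strict_mono r \<and> (?G r \<or> ?I r)"
  proof (cases "infinite {i. norm (\<phi> i s) \<le> 1}")
    case True
    then obtain r1 :: "nat \<Rightarrow> nat" where r1: "strict_mono r1" "\<And>i. r1 i \<in> {i. norm (\<phi> i s) \<le> 1}"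
      using infinite_enumerate by blast
    have "\<exists>B. \<forall>i. \<forall>z\<in>K. norm (h (r1 i) z) \<le> B" if K: "compact K" "K \<subseteq> U" for K
    proof -
      obtain B where B: "\<And>k z. k \<in> range (\<lambda>i. \<phi> (r1 i)) \<Longrightarrow> z \<in> K \<Longrightarrow> norm (k z) \<le> B"
        by (rule GPicard3[OF U, of "range (\<lambda>i. \<phi> (r1 i))" "range (\<lambda>i. \<phi> (r1 i))" K]) (use \<phi> r1(2) K in auto)
      then show ?thesis using hb by (intro exI[of _ "M + 2 * M * B"]) auto
    qed
    from normal_family_of_bounded_subsequence[OF U(1) r1(1) hh this] show ?thesis by blast
  next
    case False
    then obtain N where N: "\<And>i. i \<ge> N \<Longrightarrow> norm (\<phi> i s) > 1"
      unfolding infinite_nat_iff_unbounded_le by (metis mem_Collect_eq not_le)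
    \<comment> \<open>If \<open>\<phi> i s\<close> is eventually large, the inverses also omit 0 and
      1 and are bounded at \<open>s\<close>, so they form a family of the first kind.\<close>
    define \<psi> where "\<psi> i z = inverse (\<phi> (i + N) z)" for i z
    have \<psi>: "\<psi> i holomorphic_on U" "\<And>z. z \<in> U \<Longrightarrow> \<psi> i z \<noteq> 0" "\<And>z. z \<in> U \<Longrightarrow> \<psi> i z \<noteq> 1" "norm (\<psi> i s) \<le> 1" for i
      unfolding \<psi>_def using \<phi>(1)[of "i + N"] \<phi>(2)[of _ "i + N"] \<phi>(3)[of _ "i + N"] N[of "i + N"]
      by (auto intro!: holomorphic_intros simp: norm_inverse inverse_eq_1_iff inverse_le_1_iff)
    obtain \<psi>0 r where \<psi>0: "\<psi>0 holomorphic_on U" "strict_mono (r :: nat \<Rightarrow> nat)"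
      "\<And>K. compact K \<Longrightarrow> K \<subseteq> U \<Longrightarrow> uniform_limit K (\<lambda>i. \<psi> (r i)) \<psi>0 sequentially"
    proof (rule Montel[of U "range \<psi>" \<psi>])
      show "\<exists>B. \<forall>k\<in>range \<psi>. \<forall>z\<in>K. norm (k z) \<le> B" if K: "compact K" "K \<subseteq> U" for K
        by (rule GPicard3[OF U, of "range \<psi>" "range \<psi>" K]) (use \<psi> K in blast)+
    qed (use U \<psi> in \<open>auto simp: o_def\<close>)
    define r1 where "r1 i = r i + N" for i
    have r1: "strict_mono r1" using \<psi>0(2) by (simp add: r1_def strict_mono_def)
    have \<phi>\<psi>: "\<phi> (r1 i) z = inverse (\<psi> (r i) z)" for i z by (simp add: \<psi>_def r1_def)
    \<comment> \<open>By Hurwitz the limit of the inverses is identically 0, which is locally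
      uniform convergence of \<open>h\<close> to infinity, or has no zeros, which bounds
      \<open>h\<close> on compact sets.\<close>
    show ?thesis
    proof (cases "\<forall>z\<in>U. \<psi>0 z = 0")
      case True
      have "?I r1"
      proof (intro allI impI)
        fix K R assume K: "compact K \<and> K \<subseteq> U"
        define e where "e = 1 / (\<bar>R\<bar> + M + 1)"
        have e: "e > 0" unfolding e_def using M by simp
        then have "\<forall>\<^sub>F i in sequentially. \<forall>z\<in>K. dist (\<psi> (r i) z) (\<psi>0 z) < e"
          using \<psi>0(3) K uniform_limitD by blast
        then show "\<forall>\<^sub>F n in sequentially. \<forall>z\<in>K. R < norm (h (r1 n) z)"
        proof eventually_elim
          case (elim i)
          show ?case
          proof
            fix z assume z: "z \<in> K"
            then have "norm (\<psi> (r i) z) < e" "\<psi> (r i) z \<noteq> 0" using elim True K \<psi>(2) by force+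
            then have "1 / e < norm (\<phi> (r1 i) z)" unfolding \<phi>\<psi> norm_inverse using e by (simp add: field_simps)
            then have big: "\<bar>R\<bar> + M + 1 < norm (\<phi> (r1 i) z)" unfolding e_def by simp
            have "1 * norm (\<phi> (r1 i) z) \<le> norm (q (r1 i) - p (r1 i)) * norm (\<phi> (r1 i) z)"
              using d2(2) by (intro mult_right_mono) auto
            also have "\<dots> = norm (h (r1 i) z - p (r1 i))" unfolding h\<phi> by (simp add: norm_mult)
            also have "\<dots> \<le> norm (h (r1 i) z) + M" using norm_triangle_ineq4[of "h (r1 i) z" "p (r1 i)"] pq(1)[of "r1 i"] by linarith
            finally show "R < norm (h (r1 i) z)" using big by linarith
          qed
        qed
      qed
      then show ?thesis using r1 by blast
    next
      case False
      have nz: "\<psi>0 z \<noteq> 0" if z: "z \<in> U" for z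
      proof (cases "\<psi>0 constant_on U")
        case True
        then show ?thesis using False z unfolding constant_on_def by metis
      next
        case nc: False
        show ?thesis by (rule Hurwitz_no_zeros[OF U(1,2) _ \<psi>0(1) \<psi>0(3) nc _ z]) (use \<psi> in auto)
      qed
      have "\<exists>B. \<forall>i. \<forall>z\<in>K. norm (h (r1 i) z) \<le> B" if K: "compact K" "K \<subseteq> U" for K
      proof (cases "K = {}")
        case ne: False
        have "continuous_on K (\<lambda>z. norm (\<psi>0 z))"
          by (intro continuous_intros continuous_on_subset[OF holomorphic_on_imp_continuous_on[OF \<psi>0(1)] K(2)])
        then obtain z0 where z0: "z0 \<in> K" "\<And>z. z \<in> K \<Longrightarrow> norm (\<psi>0 z0) \<le> norm (\<psi>0 z)"
          using continuous_attains_inf[OF K(1) ne] by blast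
        define d where "d = norm (\<psi>0 z0) / 2"
        have d: "d > 0" using nz[of z0] z0(1) K(2) unfolding d_def by auto
        then have "\<forall>\<^sub>F i in sequentially. \<forall>z\<in>K. dist (\<psi> (r i) z) (\<psi>0 z) < d"
          using uniform_limitD[OF \<psi>0(3)[OF K]] by blast
        then obtain i0 where i0: "\<And>i z. i \<ge> i0 \<Longrightarrow> z \<in> K \<Longrightarrow> dist (\<psi> (r i) z) (\<psi>0 z) < d"
          unfolding eventually_sequentially by blast
        have late: "norm (h (r1 i) z) \<le> M + 2 * M * (1 / d)" if "i \<ge> i0" "z \<in> K" for i z
        proof (rule hb)
          have "norm (\<psi>0 z) - norm (\<psi> (r i) z) < d" using i0[OF that] norm_triangle_ineq2[of "\<psi>0 z" "\<psi> (r i) z"]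
            by (simp add: dist_norm norm_minus_commute)
          then have "d < norm (\<psi> (r i) z)" using z0(2)[OF that(2)] unfolding d_def by simp
          then have "inverse (norm (\<psi> (r i) z)) \<le> inverse d" using d by (intro le_imp_inverse_le) auto
          then show "norm (\<phi> (r1 i) z) \<le> 1 / d" unfolding \<phi>\<psi> norm_inverse by (simp add: inverse_eq_divide)
        qed
        have "\<exists>B. \<forall>z\<in>K. norm (h (r1 i) z) \<le> B" for i
          using compact_imp_bounded[OF compact_continuous_image[OF continuous_on_subset[OF holomorphic_on_imp_continuous_on[OF hh] K(2)] K(1)]]
          unfolding bounded_iff by auto
        then obtain B where B: "\<And>i z. z \<in> K \<Longrightarrow> norm (h (r1 i) z) \<le> B i" by metis
        define B0 where "B0 = Max (insert (M + 2 * M * (1 / d)) (B ` {..<i0}))"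
        have "norm (h (r1 i) z) \<le> B0" if "z \<in> K" for i z
        proof (cases "i \<ge> i0")
          case True
          have "M + 2 * M * (1 / d) \<le> B0" unfolding B0_def by (intro Max_ge) auto
          then show ?thesis using late[OF True that] by linarith
        next
          case False
          then have "B i \<le> B0" unfolding B0_def by (intro Max_ge) auto
          then show ?thesis using B[OF that, of i] by linarith
        qed
        then show ?thesis by blast
      qed auto
      from normal_family_of_bounded_subsequence[OF U(1) r1 hh this] show ?thesis by blast
    qed
  qed
qed

lemma outside_norm:
  fixes X :: "complex set"
  assumes X: "compact X" and p: "p \<in> outside X" "norm p \<le> r"
  obtains q where "q \<in> outside X" "norm q = r"
proof -
  have "connected (norm ` outside X)"
    by (intro connected_continuous_image continuous_intros connected_outside compact_imp_bounded[OF X]) auto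
  moreover have "norm p \<in> norm ` outside X" using p by blast
  moreover obtain q where q: "q \<in> outside X" "norm q > r"
    using unbounded_outside[OF compact_imp_bounded[OF X]] unfolding bounded_iff by (metis not_le)
  ultimately have "r \<in> norm ` outside X" using p(2) unfolding connected_iff_interval by (metis image_eqI less_imp_le)
  then show thesis using that by blast
qed

section \<open>Growth of iterates and components of slow sets\<close>

context bounded_singular
begin

lemma not_constant_on_open: assumes "open U" "U \<noteq> {}" shows "\<not> f constant_on U"
proof
  assume "f constant_on U"
  then obtain c where c: "\<And>z. z \<in> U \<Longrightarrow> f z = c" unfolding constant_on_def by blast
  have "f z = c" for z
    using analytic_continuation_open[of U UNIV f "\<lambda>_. c" z] assms hol c by auto
  then have "\<forall>z. f z = poly [:c:] z" by simp
  then show False using trans by blast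
qed

lemma iterate_hol: "(f ^^ n) holomorphic_on UNIV"
proof (induction n)
  case (Suc n)
  have "f \<circ> (f ^^ n) holomorphic_on UNIV" by (rule holomorphic_on_compose_gen[OF Suc hol]) auto
  then show ?case by (simp only: funpow.simps)
qed (simp add: id_def)

lemma iterate_cont: "continuous_on A (f ^^ n)"
  using holomorphic_on_imp_continuous_on[OF iterate_hol] continuous_on_subset by blast

lemma iterate_open: "open U \<Longrightarrow> open ((f ^^ n) ` U)"
proof (induction n)
  case (Suc n)
  have "open (f ` ((f ^^ n) ` U))"
  proof (cases "U = {}")
    case False
    show ?thesis
      by (rule open_mapping_thm[OF hol open_UNIV connected_UNIV]) (use Suc not_constant_on_open[of UNIV] in auto)
  qed auto
  then show ?case by (simp add: image_comp)
qed simp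

lemma iterate_not_constant: assumes "open U" "U \<noteq> {}" shows "\<not> (f ^^ n) constant_on U"
proof
  assume "(f ^^ n) constant_on U"
  then obtain c where "\<And>z. z \<in> U \<Longrightarrow> (f ^^ n) z = c" unfolding constant_on_def by blast
  then have "(f ^^ n) ` U = {c}" using assms(2) by auto
  then show False using iterate_open[OF assms(1), of n] not_open_singleton by metis
qed

lemma finite_preimages: assumes "bounded B" shows "finite {z \<in> B. f z = c}"
proof (rule ccontr)
  assume inf: "infinite {z \<in> B. f z = c}"
  have "bounded {z \<in> B. f z = c}" using assms by (rule bounded_subset) auto
  then obtain \<xi> where \<xi>: "\<xi> islimpt {z \<in> B. f z = c}"
    using Bolzano_Weierstrass_imp_closed inf bounded_infinite_imp_islimpt by blast
  have "f w - c = 0" for w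
    by (rule analytic_continuation[of "\<lambda>z. f z - c" UNIV "{z \<in> B. f z = c}" \<xi> w])
      (use hol \<xi> in \<open>auto intro!: holomorphic_intros connected_UNIV\<close>)
  then show False using not_constant_on_open[of UNIV] unfolding constant_on_def by auto
qed

text \<open>At a boundary point of a component some tract map sends a whole vertical strip
  injectively into the component. The strip contains infinitely many translates by
  \<open>2 * pi * \<i>\<close>, all preimages of one value; a bounded component has room for
  finitely many only.\<close>

lemma slow_component_unbounded_1:
  assumes R': "R' > R0" and U: "U \<in> components {z. norm (f z) < R'}" shows "\<not> bounded U"
proof
  assume bU: "bounded U"
  let ?O = "{z. norm (f z) < R'}"
  have fcont: "continuous_on UNIV f" using iterate_cont[of UNIV 1] by simp
  have oO: "open ?O" using fcont by (intro open_Collect_less continuous_intros) auto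
  have oU: "open U" using open_components[OF oO U] .
  have Une: "U \<noteq> {}" using in_components_nonempty[OF U] .
  have "U \<noteq> UNIV" using bU not_bounded_UNIV by metis
  then obtain z where z: "z \<in> frontier U" using frontier_eq_empty Une by blast
  have zU: "z \<in> closure U" "z \<notin> U" using z oU by (auto simp: frontier_def interior_open)
  have "U \<subseteq> ?O" using in_components_subset[OF U] .
  then have "U \<subseteq> {z. norm (f z) \<le> R'}" by auto
  moreover have "closed {z. norm (f z) \<le> R'}" using fcont by (intro closed_Collect_le continuous_intros) auto
  ultimately have "norm (f z) \<le> R'" using zU(1) closure_minimal by blast
  moreover have "\<not> norm (f z) < R'"
  proof
    assume "norm (f z) < R'"
    then obtain e where e: "e > 0" "ball z e \<subseteq> ?O" using oO open_contains_ball by blast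
    have "ball z e \<inter> U \<noteq> {}" using zU(1) e(1) unfolding closure_approachable by (metis IntI dist_commute empty_iff mem_ball)
    then have "ball z e \<subseteq> U" using components_maximal[OF U _ e(2)] by (simp add: Int_commute)
    then show False using zU(2) centre_in_ball[of z e] e(1) by blast
  qed
  ultimately have fz: "norm (f z) = R'" by simp
  have nz: "f z \<noteq> 0" using fz R' R0_pos by auto
  define \<zeta>0 where "\<zeta>0 = Ln (f z)"
  have \<zeta>0: "\<zeta>0 \<in> H" "f z = exp \<zeta>0" unfolding \<zeta>0_def H_def using nz fz R' R0_pos by auto
  obtain h where h: "tract_map h" "h \<zeta>0 = z" using tract_map_exists[OF \<zeta>0] by blast
  have hh: "h holomorphic_on H" "\<And>\<zeta>. \<zeta> \<in> H \<Longrightarrow> f (h \<zeta>) = exp \<zeta>" using h(1) by (auto simp: tract_map_def)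
  have "open (h ` H)" by (rule open_mapping_thm3[OF hh(1) H_props(1) tract_map_inj[OF h(1)]])
  moreover have "z \<in> h ` H" using h(2) \<zeta>0(1) by blast
  ultimately have "h ` H \<inter> U \<noteq> {}" using zU(1) closure_iff_nhds_not_empty[of z U] by (metis IntI Int_commute open_Int_closure_eq_empty emptyE)
  then obtain \<zeta> where \<zeta>: "\<zeta> \<in> H" "h \<zeta> \<in> U" by blast
  define B where "B = {\<zeta>. ln R0 < Re \<zeta>} \<inter> {\<zeta>. Re \<zeta> < ln R'}"
  have R'pos: "R' > 0" using R' R0_pos by linarith
  have BH: "B \<subseteq> H" unfolding B_def H_def by auto
  have Re_less: "norm (exp \<eta>) < R' \<longleftrightarrow> Re \<eta> < ln R'" for \<eta> :: complex
    using exp_less_cancel_iff[of "Re \<eta>" "ln R'"] R'pos by (simp add: norm_exp_eq_Re)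
  have "norm (f (h \<zeta>)) < R'" using \<zeta>(2) in_components_subset[OF U] by auto
  then have "norm (exp \<zeta>) < R'" using hh(2)[OF \<zeta>(1)] by simp
  then have \<zeta>B: "\<zeta> \<in> B" using \<zeta>(1) Re_less unfolding B_def H_def by auto
  have "h ` B \<subseteq> U"
  proof (rule components_maximal[OF U])
    have "connected B" unfolding B_def
      by (intro convex_connected convex_Int convex_halfspace_Re_gt convex_halfspace_Re_lt)
    then show "connected (h ` B)"
      using connected_continuous_image continuous_on_subset[OF holomorphic_on_imp_continuous_on[OF hh(1)] BH] by blast
    show "h ` B \<subseteq> ?O" using hh(2) BH Re_less unfolding B_def by auto
    show "U \<inter> h ` B \<noteq> {}" using \<zeta>(2) \<zeta>B by blast
  qed
  define \<eta> where "\<eta> k = \<zeta> + of_real (2 * pi * of_nat k) * \<i>" for k :: nat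
  have \<eta>: "\<eta> k \<in> B" "exp (\<eta> k) = exp \<zeta>" for k
  proof -
    show "\<eta> k \<in> B" using \<zeta>B by (simp add: \<eta>_def B_def)
    show "exp (\<eta> k) = exp \<zeta>" unfolding \<eta>_def exp_eq by (intro exI[of _ "int k"]) (simp add: mult_ac)
  qed
  have "inj (\<lambda>k. h (\<eta> k))"
  proof (rule injI)
    fix k l assume "h (\<eta> k) = h (\<eta> l)"
    then have "\<eta> k = \<eta> l" using tract_map_inj[OF h(1)] \<eta>(1) BH unfolding inj_on_def by blast
    then show "k = l" by (simp add: \<eta>_def)
  qed
  then have "infinite (range (\<lambda>k. h (\<eta> k)))" by (rule range_inj_infinite)
  moreover have "range (\<lambda>k. h (\<eta> k)) \<subseteq> {z \<in> U. f z = exp \<zeta>}"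
    using \<open>h ` B \<subseteq> U\<close> \<eta> hh(2) BH by fastforce
  ultimately show False using finite_preimages[OF bU, of "exp \<zeta>"] finite_subset by blast
qed

text \<open>If \<open>W\<close> is bounded, its image under \<open>f ^^ k\<close> is both open and
  closed in a component for \<open>f\<close> itself. The image would then be this component and
  bounded, contrary to \<open>slow_component_unbounded_1\<close>.\<close>

lemma slow_component_unbounded:
  assumes R': "R' > R0" and W: "W \<in> components {z. norm ((f ^^ Suc k) z) < R'}" shows "\<not> bounded W"
proof
  assume bW: "bounded W"
  let ?Ok = "{z. norm ((f ^^ Suc k) z) < R'}"
  let ?O = "{z. norm (f z) < R'}"
  have "open ?Ok" by (intro open_Collect_less continuous_intros iterate_cont)
  then have oW: "open W" using open_components W by blast
  have Wne: "W \<noteq> {}" "connected W" "W \<subseteq> ?Ok" using in_components_nonempty[OF W] in_components_connected[OF W] in_components_subset[OF W] by auto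
  have "(f ^^ k) ` W \<subseteq> ?O" using Wne(3) by auto
  moreover have cW: "connected ((f ^^ k) ` W)" using connected_continuous_image[OF iterate_cont Wne(2)] .
  ultimately obtain U where U: "U \<in> components ?O" "(f ^^ k) ` W \<subseteq> U"
    using exists_component_superset[of "(f ^^ k) ` W" ?O] Wne(1) by (metis empty_iff image_eqI ex_in_conv subset_empty)
  have "closedin (top_of_set ?Ok) W" using closedin_component[OF W] .
  then obtain Z where Z: "closed Z" "W = ?Ok \<inter> Z" unfolding closedin_closed by blast
  then have "closure W \<subseteq> Z" by (intro closure_minimal) auto
  then have Wcl: "W = ?Ok \<inter> closure W" using Z(2) closure_subset[of W] by blast
  have e: "(f ^^ k) ` W = U \<inter> (f ^^ k) ` closure W"
  proof
    show "(f ^^ k) ` W \<subseteq> U \<inter> (f ^^ k) ` closure W" using U(2) closure_subset by blast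
    show "U \<inter> (f ^^ k) ` closure W \<subseteq> (f ^^ k) ` W"
    proof
      fix v assume v: "v \<in> U \<inter> (f ^^ k) ` closure W"
      then obtain w where w: "w \<in> closure W" "v = (f ^^ k) w" by blast
      have "w \<in> ?Ok" using v in_components_subset[OF U(1)] w by auto
      then show "v \<in> (f ^^ k) ` W" using Wcl w by blast
    qed
  qed
  have "compact (closure W)" using bW by (simp add: compact_closure)
  then have cc: "compact ((f ^^ k) ` closure W)" using compact_continuous_image iterate_cont by blast
  have "closedin (top_of_set U) ((f ^^ k) ` W)" unfolding e using compact_imp_closed[OF cc] by (metis closedin_closed_Int)
  moreover have "openin (top_of_set U) ((f ^^ k) ` W)" using iterate_open[OF oW, of k] U(2) by (metis openin_open_eq[of U] openin_subtopology_Int2 openin_open Int_absorb1)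
  ultimately have "(f ^^ k) ` W = U" using in_components_connected[OF U(1)] Wne(1) unfolding connected_clopen by blast
  moreover have "bounded ((f ^^ k) ` W)" using compact_imp_bounded[OF cc] bounded_subset closure_subset by (metis image_mono)
  ultimately show False using slow_component_unbounded_1[OF R' U(1)] by simp
qed

text \<open>Cauchy's estimates on the given circles remove all coefficients of order at least
  2.\<close>

lemma affine_growth_contradiction:
  assumes "\<And>A. \<exists>r\<ge>A. \<forall>z. norm z \<le> r \<longrightarrow> norm (f z) \<le> K * r" shows False
proof -
  have z: "(deriv ^^ n) f 0 = 0" if n: "n \<ge> 2" for n
  proof (rule ccontr)
    assume nz: "(deriv ^^ n) f 0 \<noteq> 0"
    define d where "d = norm ((deriv ^^ n) f 0)"
    have d: "d > 0" using nz by (simp add: d_def)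
    define A where "A = max 1 (fact n * (\<bar>K\<bar> + 1) / d + 1)"
    obtain r where r: "r \<ge> A" "\<And>z. norm z \<le> r \<Longrightarrow> norm (f z) \<le> K * r" using assms by blast
    have r1: "r \<ge> 1" "r > 0" using r(1) unfolding A_def by auto
    have "d \<le> fact n * (K * r + r) / r ^ n" unfolding d_def
    proof (rule Cauchy_higher_deriv_bound)
      show "f holomorphic_on ball 0 r" using hol by (rule holomorphic_on_subset) auto
      show "continuous_on (cball 0 r) f" using iterate_cont[of "cball 0 r" 1] by simp
      show "f w \<in> ball 0 (K * r + r)" if "w \<in> ball 0 r" for w using r(2)[of w] that r1 by auto
    qed (use r1 n in auto)
    also have "\<dots> \<le> fact n * ((\<bar>K\<bar> + 1) * r) / r ^ n"
      using r1 by (intro divide_right_mono mult_left_mono) (auto simp: algebra_simps mult_right_mono)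
    also have "\<dots> \<le> fact n * ((\<bar>K\<bar> + 1) * r) / r ^ 2"
      using r1 n by (intro divide_left_mono power_increasing mult_pos_pos) auto
    also have "\<dots> = fact n * (\<bar>K\<bar> + 1) / r" using r1 by (simp add: power2_eq_square)
    finally have "d * r \<le> fact n * (\<bar>K\<bar> + 1)" using r1 by (simp add: field_simps)
    moreover have "fact n * (\<bar>K\<bar> + 1) / d < r" using r(1) unfolding A_def by linarith
    then have "fact n * (\<bar>K\<bar> + 1) < d * r" using d by (simp add: field_simps)
    ultimately show False by linarith
  qed
  define a where "a = f 0"
  define b where "b = deriv f 0"
  have "f w = a + b * w" for w
  proof -
    have "(\<lambda>n. (deriv ^^ n) f 0 / (fact n) * (w - 0) ^ n) sums f w"
      by (rule holomorphic_power_series[of f 0 "norm w + 1"]) (use hol in \<open>auto intro: holomorphic_on_subset simp: add_pos_nonneg\<close>)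
    moreover have "(\<lambda>n. (deriv ^^ n) f 0 / (fact n) * (w - 0) ^ n) sums (\<Sum>n\<in>{..<2}. (deriv ^^ n) f 0 / (fact n) * (w - 0) ^ n)"
      by (rule sums_finite) (use z in auto)
    ultimately have "f w = (\<Sum>n\<in>{..<2}. (deriv ^^ n) f 0 / (fact n) * (w - 0) ^ n)" using sums_unique2 by blast
    then show ?thesis by (simp add: numeral_2_eq_2 a_def b_def)
  qed
  then have "\<forall>w. f w = poly [:a, b:] w" by (simp add: mult.commute)
  then have "\<exists>p. \<forall>w. f w = poly p w" by (rule exI)
  then show False by (rule notE[OF trans])
qed

text \<open>If the hull misses a point of a large disc, the exterior of the image contains points of
  norm \<open>2 * R2\<close> and \<open>4 * R2\<close>, two well separated values that
  \<open>f\<close> omits on the disc. Schottky's theorem then bounds \<open>f\<close> linearly on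
  half the disc; for arbitrarily large radii \<open>f\<close> would be affine.\<close>

lemma disc_in_phull_image:
  obtains RH where "\<And>R2. R2 \<ge> RH \<Longrightarrow> cball 0 R2 \<subseteq> phull (f ` cball 0 R2)"
proof (rule ccontr)
  assume "\<not> thesis"
  then have no: "\<And>RH. \<exists>R2\<ge>RH. \<not> cball 0 R2 \<subseteq> phull (f ` cball 0 R2)" using that by blast
  \<comment> \<open>Schottky's constant for functions that omit 0 and 1, have modulus at most 2 at
    the centre, and are considered on the disc of radius 1/2.\<close>
  define Q where "Q = exp (pi * exp (pi * (2 + 2 * 2 + 12 * (1/2) / (1 - 1/2))))"
  show False
  proof (rule affine_growth_contradiction)
    fix A :: real
    obtain R2 where R2: "R2 \<ge> max (2 * A) R0" "\<not> cball 0 R2 \<subseteq> phull (f ` cball 0 R2)" using no by blast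
    have Rp: "R2 > 0" "R2 \<ge> R0" using R2(1) R0_pos by auto
    obtain p where p: "norm p \<le> R2" "p \<in> outside (f ` cball 0 R2)" using R2(2) unfolding phull_def by auto
    have cX: "compact (f ` cball 0 R2)" using iterate_cont[of "cball 0 R2" 1] by (intro compact_continuous_image) auto
    obtain p1 where p1: "p1 \<in> outside (f ` cball 0 R2)" "norm p1 = 2 * R2"
      using outside_norm[OF cX p(2), of "2 * R2"] p(1) Rp by auto
    obtain p2 where p2: "p2 \<in> outside (f ` cball 0 R2)" "norm p2 = 4 * R2"
      using outside_norm[OF cX p(2), of "4 * R2"] p(1) Rp by auto
    have om: "f z \<noteq> p1" "f z \<noteq> p2" if "norm z \<le> R2" for z
    proof -
      have "f z \<notin> outside (f ` cball 0 R2)" using that outside_no_overlap[of "f ` cball 0 R2"] unfolding disjoint_iff by auto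
      then show "f z \<noteq> p1" "f z \<noteq> p2" using p1(1) p2(1) by auto
    qed
    have d: "norm (p2 - p1) \<ge> 2 * R2" "norm (p2 - p1) \<le> 6 * R2"
      using norm_triangle_ineq2[of p2 p1] norm_triangle_ineq4[of p2 p1] p1(2) p2(2) by auto
    define g where "g w = (f (of_real R2 * w) - p1) / (p2 - p1)" for w
    have ne: "p2 - p1 \<noteq> 0" using d Rp by auto
    have nR: "norm (of_real R2 * w) \<le> R2" if "norm w \<le> 1" for w :: complex
      using that Rp by (simp add: norm_mult)
    have gb: "norm (g w) \<le> Q" if "norm w \<le> 1/2" for w unfolding Q_def
    proof (rule Schottky[where f=g and r=2 and t="1/2"])
      have "(f \<circ> (\<lambda>w. of_real R2 * w)) holomorphic_on cball 0 1"
        by (rule holomorphic_on_compose_gen[OF _ hol]) (auto intro!: holomorphic_intros)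
      then show "g holomorphic_on cball 0 1" unfolding g_def o_def by (intro holomorphic_intros) (use ne in auto)
      have "norm (f 0 - p1) \<le> 2 * (2 * R2)" using norm_triangle_ineq4[of "f 0" p1] f0 p1(2) Rp by linarith
      also have "\<dots> \<le> 2 * norm (p2 - p1)" using d by simp
      finally show "norm (g 0) \<le> 2" using ne by (simp add: g_def norm_divide field_simps)
      show "\<not> (g z = 0 \<or> g z = 1)" if "z \<in> cball 0 1" for z
        using om[OF nR[of z]] that ne by (auto simp: g_def divide_eq_1_iff)
    qed (use that in auto)
    define r where "r = R2 / 2"
    have "norm (f z) \<le> (4 + 12 * Q) * r" if z: "norm z \<le> r" for z
    proof -
      define w where "w = z / of_real R2"
      have w: "norm w \<le> 1/2" "of_real R2 * w = z" using z Rp by (auto simp: w_def r_def norm_divide field_simps)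
      have "f z = p1 + (p2 - p1) * g w" using ne by (simp add: g_def w)
      then have "norm (f z) \<le> norm p1 + norm (p2 - p1) * norm (g w)" by (metis norm_mult norm_triangle_ineq)
      also have "\<dots> \<le> 2 * R2 + 6 * R2 * Q" using gb[OF w(1)] d p1(2) Rp by (intro add_mono mult_mono) auto
      finally show ?thesis by (simp add: r_def algebra_simps)
    qed
    moreover have "r \<ge> A" using R2(1) unfolding r_def by simp
    ultimately show "\<exists>r\<ge>A. \<forall>z. norm z \<le> r \<longrightarrow> norm (f z) \<le> (4 + 12 * Q) * r" by blast
  qed
qed

text \<open>The hull is used because the images themselves may miss points of the disc; for the hull
  the property persists under further iteration, and the maximum principle sees no
  difference.\<close>

definition covers :: "complex \<Rightarrow> real \<Rightarrow> nat \<Rightarrow> real \<Rightarrow> bool" where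
  "covers s e j R2 \<longleftrightarrow> cball 0 R2 \<subseteq> phull ((f ^^ j) ` cball s e)"

lemma compact_iterate_image: "compact X \<Longrightarrow> compact ((f ^^ j) ` X)"
  using compact_continuous_image iterate_cont by blast

lemma covers_Suc:
  assumes H: "cball 0 R2 \<subseteq> phull (f ` cball 0 R2)" and c: "covers s e j R2"
  shows "covers s e (Suc j) R2"
proof -
  have "f ` cball 0 R2 \<subseteq> f ` phull ((f ^^ j) ` cball s e)" using c unfolding covers_def by blast
  also have "\<dots> \<subseteq> phull (f ` (f ^^ j) ` cball s e)"
    by (rule image_phull[OF hol not_constant_on_open[OF open_UNIV UNIV_not_empty] compact_iterate_image]) simp
  finally have "phull (f ` cball 0 R2) \<subseteq> phull (f ` (f ^^ j) ` cball s e)" by (rule phull_mono)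
  then show ?thesis using H unfolding covers_def by (simp add: image_comp)
qed

lemma covers_mono:
  assumes H: "cball 0 R2 \<subseteq> phull (f ` cball 0 R2)" and c: "covers s e j R2" and "j \<le> j'"
  shows "covers s e j' R2"
  using assms(3) by (induction rule: dec_induct) (use c covers_Suc[OF H] in auto)

text \<open>If no iterate covers, each omits on the disc about \<open>s\<close> two values that are
  bounded and separated, of norms at most \<open>R2\<close> and equal to \<open>R2 + 1\<close>. Then
  the iterates are normal at \<open>s\<close>.\<close>

lemma covers_exists:
  assumes s: "s \<in> julia_set f" and e: "e > 0" and R2: "R2 \<ge> 0"
  shows "\<exists>j. covers s e j R2"
proof (rule ccontr)
  assume no: "\<nexists>j. covers s e j R2"
  have "normal_family_on (ball s e) (range (\<lambda>n. f ^^ n))"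
  proof (rule normal_family_omitting[of "ball s e" s _ "R2 + 1"])
    show "h holomorphic_on ball s e" if "h \<in> range (\<lambda>n. f ^^ n)" for h
      using that holomorphic_on_subset[OF iterate_hol] by auto
    fix h assume "h \<in> range (\<lambda>n. f ^^ n)"
    then obtain j where j: "h = f ^^ j" by blast
    let ?X = "(f ^^ j) ` cball s e"
    have X: "compact ?X" using compact_iterate_image by simp
    obtain p where p: "norm p \<le> R2" "p \<in> outside ?X" using no[unfolded covers_def phull_def] by (meson ComplI mem_cball_0 subsetI)
    obtain q where q: "q \<in> outside ?X" "norm q = R2 + 1" using outside_norm[OF X p(2), of "R2 + 1"] p(1) by auto
    have "norm (p - q) \<ge> 1" using norm_triangle_ineq2[of q p] p q by (simp add: norm_minus_commute)
    moreover have "h z \<noteq> p \<and> h z \<noteq> q" if "z \<in> ball s e" for z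
    proof -
      have "h z \<in> ?X" unfolding j using that by auto
      then have "h z \<notin> outside ?X" using outside_no_overlap[of ?X] by blast
      then show ?thesis using p q by auto
    qed
    ultimately show "\<exists>p q. norm p \<le> R2 + 1 \<and> norm q \<le> R2 + 1 \<and> 1 \<le> norm (p - q) \<and> (\<forall>z\<in>ball s e. h z \<noteq> p \<and> h z \<noteq> q)"
      using p(1) q(2) by (intro exI[of _ p] exI[of _ q]) auto
  qed (use e in auto)
  then have "s \<in> fatou_set f" unfolding fatou_set_def using e by (intro CollectI exI[of _ "ball s e"]) auto
  then show False using s unfolding julia_set_def by blast
qed

text \<open>Compactness of the singular set makes the number of steps uniform. The first conclusion
  is the maximum principle on the hull that contains the disc of radius \<open>R2\<close>. For the
  second, the slow component of 0 is unbounded, so it must leave the hull and meets the image of the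
  small disc.\<close>

lemma growth_near_julia:
  assumes J: "singular_values f \<subseteq> julia_set f" and H: "cball 0 R2 \<subseteq> phull (f ` cball 0 R2)" and R2: "R2 \<ge> 0" and e: "e > 0"
  obtains m where
    "\<And>s k \<beta> z. s \<in> singular_values f \<Longrightarrow> k holomorphic_on UNIV \<Longrightarrow> (\<And>w. w \<in> ball s e \<Longrightarrow> norm (k ((f ^^ Suc m) w)) \<le> \<beta>) \<Longrightarrow>
       z \<in> cball 0 R2 \<Longrightarrow> norm (k z) \<le> \<beta>"
    "\<And>s R'. s \<in> singular_values f \<Longrightarrow> R' > R0 \<Longrightarrow> \<exists>z\<in>ball s e. norm ((f ^^ Suc m) z) < R'"
proof -
  have S: "compact (singular_values f)"
    using sing bounded_subset[OF bounded_ball] by (auto simp: compact_eq_bounded_closed)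
  have "\<exists>j. covers s (e/2) j R2" if "s \<in> singular_values f" for s using covers_exists J that e R2 by auto
  then obtain j where j: "\<And>s. s \<in> singular_values f \<Longrightarrow> covers s (e/2) (j s) R2" by metis
  have "singular_values f \<subseteq> (\<Union>s\<in>singular_values f. ball s (e/2))" using e by auto
  then obtain D where D: "D \<subseteq> singular_values f" "finite D" "singular_values f \<subseteq> (\<Union>s\<in>D. ball s (e/2))"
    using compactE_image[OF S, of "singular_values f" "\<lambda>s. ball s (e/2)"] by auto
  define m where "m = Max (insert 0 (j ` D))"
  have jm: "covers c (e/2) m R2" if "c \<in> D" for c
    by (rule covers_mono[OF H j]) (use that D in \<open>auto simp: m_def\<close>)
  have near: "\<exists>c\<in>D. cball c (e/2) \<subseteq> ball s e" if s: "s \<in> singular_values f" for s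
  proof -
    obtain c where c: "c \<in> D" "s \<in> ball c (e/2)" using D(3) s by blast
    have "cball c (e/2) \<subseteq> ball s e"
    proof
      fix w assume "w \<in> cball c (e/2)"
      then show "w \<in> ball s e" using c(2) dist_triangle[of s w c] by (simp add: dist_commute)
    qed
    then show ?thesis using c by blast
  qed
  show thesis
  proof (rule that[of m])
    fix s z :: complex and k \<beta>
    assume s: "s \<in> singular_values f" and k: "k holomorphic_on UNIV" "\<And>w. w \<in> ball s e \<Longrightarrow> norm (k ((f ^^ Suc m) w)) \<le> \<beta>"
      and z: "z \<in> cball 0 R2"
    obtain c where c: "c \<in> D" "cball c (e/2) \<subseteq> ball s e" using near[OF s] by blast
    have "z \<in> phull ((f ^^ Suc m) ` cball c (e/2))" using covers_Suc[OF H jm[OF c(1)]] z unfolding covers_def by blast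
    then show "norm (k z) \<le> \<beta>"
      by (rule maximum_modulus_phull[OF k(1) compact_iterate_image, rotated 2]) (use k(2) c(2) in auto)
  next
    fix s R' assume s: "s \<in> singular_values f" and R': "R' > R0"
    obtain c where c: "c \<in> D" "cball c (e/2) \<subseteq> ball s e" using near[OF s] by blast
    let ?X = "(f ^^ m) ` cball c (e/2)"
    let ?O = "{z. norm (f z) < R'}"
    have "0 \<in> ?O" using f0 R' by simp
    then obtain U where U: "U \<in> components ?O" "0 \<in> U" by (metis UnionE Union_components)
    have "0 \<in> phull ?X" using jm[OF c(1)] R2 unfolding covers_def by auto
    then have "U \<inter> ?X \<noteq> {}"
      using connected_unbounded_outside[OF in_components_connected[OF U(1)] slow_component_unbounded_1[OF R' U(1)] _ U(2)]
      unfolding phull_def by blast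
    then obtain z where "z \<in> cball c (e/2)" "(f ^^ m) z \<in> ?O" using in_components_subset[OF U(1)] by blast
    then show "\<exists>z\<in>ball s e. norm ((f ^^ Suc m) z) < R'" using c(2) by auto
  qed
qed

text \<open>The disc lies in the hull of its own image, so by the maximum principle the supremum of
  \<open>f ^^ n\<close> over the disc does not decrease with \<open>n\<close>.\<close>

lemma iterate_bound_mono:
  assumes H: "cball 0 R2 \<subseteq> phull (f ` cball 0 R2)" and b: "\<And>z. z \<in> cball 0 R2 \<Longrightarrow> norm ((f ^^ n) z) \<le> \<beta>" and jn: "j \<le> n"
    and z: "z \<in> cball 0 R2"
  shows "norm ((f ^^ j) z) \<le> \<beta>"
proof -
  have "\<forall>z\<in>cball 0 R2. norm ((f ^^ j) z) \<le> \<beta>" using jn b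
  proof (induction n arbitrary: j)
    case (Suc n)
    have n: "norm ((f ^^ n) z) \<le> \<beta>" if z: "z \<in> cball 0 R2" for z
    proof (rule maximum_modulus_phull[OF iterate_hol])
      show "compact (f ` cball 0 R2)" using compact_iterate_image[of "cball 0 R2" 1] by simp
      show "norm ((f ^^ n) w) \<le> \<beta>" if "w \<in> f ` cball 0 R2" for w
        using that Suc.prems(2) by (auto simp: funpow_swap1)
      show "z \<in> phull (f ` cball 0 R2)" using H z by blast
    qed
    show ?case
    proof (cases "j = Suc n")
      case True then show ?thesis using Suc.prems(2) by blast
    next
      case False
      then show ?thesis using Suc.IH[of j] Suc.prems(1) n by auto
    qed
  qed auto
  then show ?thesis using z by blast
qed

text \<open>Iterate until the far end of the arc reaches the unit interval of time. On slow points
  and on ray points alike the iterate is bounded by the maximum \<open>M\<close> of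
  \<open>f ^^ (n - m)\<close> on the disc of radius \<open>R3\<close>. If \<open>P\<close>
  surrounded the ball, growth would carry the bound \<open>M\<close> to the disc of radius
  \<open>R3 + 1\<close>, where the maximum would be attained in the interior.\<close>

lemma ray_arc_not_surrounding:
  fixes \<gamma> :: "real \<Rightarrow> complex" and m :: nat
  assumes f\<gamma>: "\<And>t. f (\<gamma> t) = \<gamma> (t + 1)" and H: "cball 0 R3 \<subseteq> phull (f ` cball 0 R3)" and R3: "R3 \<ge> 0"
    and \<gamma>0: "\<And>v. 0 \<le> v \<Longrightarrow> v \<le> 1 \<Longrightarrow> norm (\<gamma> v) \<le> R3"
    and grow: "\<And>k \<beta> z. k holomorphic_on UNIV \<Longrightarrow> (\<And>w. w \<in> ball s e \<Longrightarrow> norm (k ((f ^^ m) w)) \<le> \<beta>) \<Longrightarrow>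
       z \<in> cball 0 (R3 + 1) \<Longrightarrow> norm (k z) \<le> \<beta>"
    and P: "compact P" "P \<subseteq> \<gamma> ` {t'..t} \<union> {z. norm ((f ^^ m) z) \<le> R3}" and t: "t' \<le> t" "t \<le> - real m - 2"
  shows "\<not> ball s e \<subseteq> phull P"
proof
  assume sub: "ball s e \<subseteq> phull P"
  have it: "(f ^^ n) (\<gamma> t) = \<gamma> (t + real n)" for n t by (induction n) (auto simp: f\<gamma> add_ac)
  \<comment> \<open>The time \<open>t'\<close> is moved into the unit interval. The margin
    \<open>- real m - 2\<close> on \<open>t\<close> ensures that all other points of the arc need at
    most \<open>n - m\<close> further steps from that interval.\<close>
  define n where "n = nat \<lceil>- t'\<rceil>"
  have n: "0 \<le> t' + real n" "t' + real n \<le> 1" "real n \<ge> - t'" using t unfolding n_def by linarith+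
  have nm: "m \<le> n" using n(3) t by linarith
  let ?k = "f ^^ (n - m)"
  obtain z1 where z1: "z1 \<in> cball 0 R3" "\<And>z. z \<in> cball 0 R3 \<Longrightarrow> norm (?k z) \<le> norm (?k z1)"
  proof -
    have "\<exists>x\<in>cball 0 R3. \<forall>y\<in>cball 0 R3. norm (?k y) \<le> norm (?k x)"
      by (rule continuous_attains_sup) (use R3 in \<open>auto intro!: continuous_intros iterate_cont\<close>)
    then show thesis using that by blast
  qed
  define M where "M = norm (?k z1)"
  have kn: "(f ^^ n) z = ?k ((f ^^ m) z)" for z using nm by (metis comp_apply funpow_add le_add_diff_inverse2)
  have "norm ((f ^^ n) z) \<le> M" if z: "z \<in> P" for z
  proof (cases "norm ((f ^^ m) z) \<le> R3")
    case True then show ?thesis using z1(2)[of "(f ^^ m) z"] kn M_def by simp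
  next
    case False
    then obtain u where u: "z = \<gamma> u" "t' \<le> u" "u \<le> t" using z P(2) by auto
    define x where "x = u + real n"
    have x: "0 \<le> x" "x \<le> real n - real m - 2 + 1 + 1" using n u t unfolding x_def by linarith+
    define j where "j = nat \<lfloor>x\<rfloor>"
    define v where "v = x - real j"
    have v: "0 \<le> v" "v \<le> 1" "j \<le> n - m" using x nm unfolding v_def j_def by linarith+
    have "(f ^^ n) z = (f ^^ j) (\<gamma> v)" unfolding it u v_def x_def by simp
    then show ?thesis using iterate_bound_mono[OF H, of "n - m" M j "\<gamma> v"] z1(2) v \<gamma>0 unfolding M_def by auto
  qed
  then have "norm ((f ^^ n) w) \<le> M" if "w \<in> ball s e" for w
    using maximum_modulus_phull[OF iterate_hol P(1)] sub that by blast
  then have b: "norm (?k z) \<le> M" if "z \<in> cball 0 (R3 + 1)" for z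
    using grow[of ?k M z] iterate_hol that unfolding kn by blast
  have "?k constant_on UNIV"
  proof (rule maximum_modulus_principle[OF iterate_hol open_UNIV connected_UNIV, of "ball 0 (R3 + 1)" z1])
    show "norm (?k z) \<le> norm (?k z1)" if "z \<in> ball 0 (R3 + 1)" for z using b[of z] that unfolding M_def by auto
  qed (use z1(1) in auto)
  then show False using iterate_not_constant[OF open_UNIV] by blast
qed

end

lemma ball_in_phull:
  assumes "ball s e \<inter> P = {}" "s \<in> phull P" "e > 0" shows "ball s e \<subseteq> phull P"
proof
  fix w assume w: "w \<in> ball s e"
  show "w \<in> phull P"
  proof (rule ccontr)
    assume "w \<notin> phull P"
    then have wo: "w \<in> outside P" by (simp add: phull_def)
    have "connected_component (- P) w s" unfolding connected_component_def
      using assms w by (intro exI[of _ "ball s e"]) auto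
    then show False using outside_same_component[OF _ wo] assms(2) by (simp add: phull_def)
  qed
qed

section \<open>Boundedness of the ray\<close>

text \<open>
  \<open>meets\<close> and \<open>unb\<close> join every singular value to infinity within \<open>{z. norm ((f ^^ q) z) < R'}\<close>, up to an
  \<open>\<epsilon>\<close>-ball. The hypothesis on the Julia set enters through \<open>meets\<close> and \<open>nosur\<close> only.
\<close>

locale ray_setup = bounded_singular f R0 for f R0 +
  fixes \<gamma> :: "real \<Rightarrow> complex" and \<epsilon> R3 :: real and q :: nat and T1 :: real
  assumes \<gamma>c: "continuous_on UNIV \<gamma>" and f\<gamma>: "f (\<gamma> t) = \<gamma> (t + 1)" and eps: "\<epsilon> > 0"
    and far: "t \<le> T1 \<Longrightarrow> s \<in> singular_values f \<Longrightarrow> 4 * \<epsilon> \<le> dist s (\<gamma> t)" and R3: "R0 < R3"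
    and meets: "s \<in> singular_values f \<Longrightarrow> R' > R0 \<Longrightarrow> \<exists>z\<in>ball s \<epsilon>. norm ((f ^^ q) z) < R'"
    and unb: "R' > R0 \<Longrightarrow> W \<in> components {z. norm ((f ^^ q) z) < R'} \<Longrightarrow> \<not> bounded W"
    and nosur: "t \<le> T1 \<Longrightarrow> t' \<le> t \<Longrightarrow> compact P \<Longrightarrow> P \<subseteq> \<gamma> ` {t'..t} \<union> {z. norm ((f ^^ q) z) \<le> R3} \<Longrightarrow>
      (\<forall>s\<in>singular_values f. P \<inter> ball s \<epsilon> = {}) \<Longrightarrow> singular_values f \<subseteq> outside P"
begin

abbreviation "SV \<equiv> singular_values f"
abbreviation "FF \<equiv> f ^^ q"

lemma bounded_SV: "bounded SV" using sing bounded_subset bounded_ball by blast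

lemma compact_SV: "compact SV" using bounded_SV by (simp add: compact_eq_bounded_closed)

lemma ray_compact: "compact (\<gamma> ` {a..b})" and ray_connected: "connected (\<gamma> ` {a..b})"
  by (auto intro!: compact_continuous_image connected_continuous_image continuous_on_subset[OF \<gamma>c])

text \<open>The predecessors of two passages of the ray near \<open>x\<close> belong to the same
  inverse branch on the disc.\<close>

definition "agree x \<delta> u v \<longleftrightarrow> (\<exists>g. continuous_on (cball x \<delta>) g \<and> (\<forall>z\<in>cball x \<delta>. f (g z) = z) \<and>
  g (\<gamma> u) = \<gamma> (u - 1) \<and> g (\<gamma> v) = \<gamma> (v - 1))"

lemma branch_at_ray:
  assumes P: "compact P" "connected P" "SV \<subseteq> outside P" "\<gamma> u \<in> P"
  obtains g where "continuous_on P g" "\<And>z. z \<in> P \<Longrightarrow> f (g z) = z" "g (\<gamma> u) = \<gamma> (u - 1)" "P \<inter> SV = {}"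
proof -
  have "f (\<gamma> (u - 1)) = \<gamma> u" using f\<gamma>[of "u - 1"] by simp
  from branch_on_compact[OF hol bounded_SV P(1,2,4,3) this] obtain V g where "P \<subseteq> V" "V \<inter> SV = {}" "g holomorphic_on V"
    "\<And>z. z \<in> V \<Longrightarrow> f (g z) = z" "g (\<gamma> u) = \<gamma> (u - 1)" by metis
  moreover from this have "continuous_on P g" using holomorphic_on_imp_continuous_on continuous_on_subset by metis
  ultimately show thesis by (intro that[of g]) auto
qed

lemma loop_agree:
  assumes P: "compact P" "connected P" "SV \<subseteq> outside P" "\<gamma> ` {min u v..max u v} \<subseteq> P" "cball x \<delta> \<subseteq> P"
  shows "agree x \<delta> u v"
proof -
  have "\<gamma> u \<in> P" using P(4) by auto
  from branch_at_ray[OF P(1,2,3) this] obtain g where g: "continuous_on P g" "\<And>z. z \<in> P \<Longrightarrow> f (g z) = z" "g (\<gamma> u) = \<gamma> (u - 1)" "P \<inter> SV = {}"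
    by metis
  have "g (\<gamma> v) = \<gamma> (v - 1)"
    by (rule branch_along_ray[OF hol \<gamma>c f\<gamma> connected_Icc _ P(4) g(4,1,2,3)]) auto
  then show ?thesis using g P(5) continuous_on_subset[OF g(1) P(5)] unfolding agree_def by (intro exI[of _ g]) auto
qed

text \<open>All branches that agree at \<open>\<gamma> u\<close> are the same on the disc, hence
  bounded there, whereas the predecessors \<open>\<gamma> (s l - 1)\<close> are unbounded.\<close>

lemma agree_contradiction:
  assumes inf: "filterlim (\<lambda>k. norm (\<gamma> (s k - 1))) at_top sequentially" and I: "infinite (I :: nat set)"
    and x: "cball x \<delta> \<inter> SV = {}" "\<gamma> u \<in> cball x \<delta>"
    and ag: "\<And>l. l \<in> I \<Longrightarrow> \<gamma> (s l) \<in> cball x \<delta> \<and> agree x \<delta> u (s l)"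
  shows False
proof -
  obtain l0 where "l0 \<in> I" using infinite_imp_nonempty[OF I] by blast
  then obtain b where b: "continuous_on (cball x \<delta>) b" "\<forall>z\<in>cball x \<delta>. f (b z) = z" "b (\<gamma> u) = \<gamma> (u - 1)"
    using ag unfolding agree_def by metis
  have "bounded (b ` cball x \<delta>)" by (rule compact_imp_bounded[OF compact_continuous_image[OF b(1) compact_cball]])
  then obtain B where B: "\<And>z. z \<in> cball x \<delta> \<Longrightarrow> norm (b z) \<le> B" unfolding bounded_iff by blast
  have "\<forall>\<^sub>F k in sequentially. B < norm (\<gamma> (s k - 1))" using inf unfolding filterlim_at_top_dense by simp
  then obtain N where N: "\<forall>k\<ge>N. B < norm (\<gamma> (s k - 1))" unfolding eventually_sequentially by (elim exE)
  obtain l where l: "l \<in> I" "l \<ge> N" using I infinite_nat_iff_unbounded_le[of I] by metis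
  obtain g where g: "continuous_on (cball x \<delta>) g" "\<forall>z\<in>cball x \<delta>. f (g z) = z" "g (\<gamma> u) = \<gamma> (u - 1)" "g (\<gamma> (s l)) = \<gamma> (s l - 1)"
    using ag[OF l(1)] unfolding agree_def by metis
  have m: "\<gamma> (s l) \<in> cball x \<delta>" using ag[OF l(1)] by blast
  have "b (\<gamma> (s l)) = g (\<gamma> (s l))"
    by (rule branch_unique[OF hol connected_cball x(2,1) b(1) g(1)]) (use b g m in auto)
  then show False using N l(2) B[OF m] g(4) by fastforce
qed

lemma limit_far:
  assumes "\<And>k. s k \<le> T1" "(\<lambda>k. \<gamma> (s k)) \<longlonglongrightarrow> x" "w \<in> SV" shows "4 * \<epsilon> \<le> dist w x"
proof -
  have "(\<lambda>k. dist w (\<gamma> (s k))) \<longlonglongrightarrow> dist w x" by (intro tendsto_intros assms)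
  then show ?thesis by (rule LIMSEQ_le_const) (use far assms in auto)
qed

text \<open>If \<open>x\<close> were slow, a small slow disc around it would close up every ray arc
  between two passages to a set of the kind treated by \<open>nosur\<close>. It surrounds no
  singular value, so the branches agree.\<close>

lemma no_escape_slow:
  assumes s: "\<And>k. s k \<le> T1" and x: "(\<lambda>k. \<gamma> (s k)) \<longlonglongrightarrow> x"
    and inf: "filterlim (\<lambda>k. norm (\<gamma> (s k - 1))) at_top sequentially"
  shows "R3 \<le> norm (FF x)"
proof (rule ccontr)
  assume "\<not> ?thesis"
  then have "x \<in> {z. norm (FF z) < R3}" by simp
  moreover have "open {z. norm (FF z) < R3}" by (intro open_Collect_less continuous_intros iterate_cont)
  ultimately obtain e where e: "e > 0" "cball x e \<subseteq> {z. norm (FF z) < R3}" using open_contains_cball by blast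
  define \<delta> where "\<delta> = min e \<epsilon>"
  have \<delta>: "\<delta> > 0" "cball x \<delta> \<subseteq> {z. norm (FF z) \<le> R3}" "\<delta> \<le> \<epsilon>" using e eps unfolding \<delta>_def by fastforce+
  obtain K where K: "\<And>k. k \<ge> K \<Longrightarrow> \<gamma> (s k) \<in> cball x \<delta>"
    using x \<delta>(1) unfolding lim_sequentially by (metis dist_commute less_imp_le mem_cball)
  have avoid: "cball x \<delta> \<inter> ball w \<epsilon> = {}" if w: "w \<in> SV" for w
  proof (intro equals0I)
    fix z assume "z \<in> cball x \<delta> \<inter> ball w \<epsilon>"
    then show False using limit_far[OF s x w] dist_triangle[of w x z] \<delta>(3) eps by (simp add: dist_commute)
  qed
  show False
  proof (rule agree_contradiction[OF inf infinite_Ici[of K] _ K[OF order_refl]])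
    show "cball x \<delta> \<inter> SV = {}" using avoid eps by fastforce
    fix l assume "l \<in> {K..}"
    then have l: "l \<ge> K" by simp
    define a where "a = min (s K) (s l)"
    define b where "b = max (s K) (s l)"
    have ab: "a \<le> b" "b \<le> T1" "s K \<in> {a..b}" using s unfolding a_def b_def by auto
    define P where "P = \<gamma> ` {a..b} \<union> cball x \<delta>"
    have cP: "compact P" unfolding P_def by (intro compact_Un ray_compact compact_cball)
    have "\<gamma> (s K) \<in> \<gamma> ` {a..b} \<inter> cball x \<delta>" using ab K by auto
    then have "connected P" unfolding P_def by (intro connected_Un ray_connected) auto
    moreover have "SV \<subseteq> outside P"
    proof (rule nosur[OF ab(2,1) cP])
      show "P \<subseteq> \<gamma> ` {a..b} \<union> {z. norm (FF z) \<le> R3}" using \<delta>(2) unfolding P_def by blast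
      show "\<forall>w\<in>SV. P \<inter> ball w \<epsilon> = {}"
      proof (intro ballI equals0I)
        fix w z assume w: "w \<in> SV" and z: "z \<in> P \<inter> ball w \<epsilon>"
        then have "\<exists>u\<in>{a..b}. z = \<gamma> u" using avoid unfolding P_def by blast
        then obtain u where u: "u \<le> T1" "z = \<gamma> u" using ab(2) by (meson atLeastAtMost_iff order_trans)
        show False using far[OF u(1) w] z u(2) eps by auto
      qed
    qed
    ultimately show "\<gamma> (s l) \<in> cball x \<delta> \<and> agree x \<delta> (s K) (s l)"
      using K[OF l] cP by (intro conjI loop_agree[of P]) (auto simp: P_def a_def b_def)
  qed
qed

text \<open>The critical points of \<open>FF\<close> are countable, so some level in the interval
  avoids their values. At a regular level the slow set is locally connected at its boundary, which
  gives finiteness and accessibility of components.\<close>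

lemma regular_level:
  obtains R' where "R0 < R'" "R' < R3" "\<And>z. norm (FF z) = R' \<Longrightarrow> deriv FF z \<noteq> 0"
proof -
  have dh: "deriv FF holomorphic_on UNIV" by (intro holomorphic_deriv iterate_hol open_UNIV)
  have nz: "\<exists>z. deriv FF z \<noteq> 0"
  proof (rule ccontr)
    assume "\<not> ?thesis"
    then have "\<And>z. deriv FF z = 0" by blast
    then have "(FF has_field_derivative 0) (at z)" for z using holomorphic_derivI[OF iterate_hol[of q] open_UNIV, of z] by simp
    then have "FF constant_on UNIV" unfolding constant_on_def using has_field_derivative_zero_constant[of UNIV FF] by auto
    then show False using iterate_not_constant[OF open_UNIV] by blast
  qed
  have "countable {z. deriv FF z = 0}"
  proof (cases "deriv FF constant_on UNIV")
    case True
    then have "{z. deriv FF z = 0} = {}" using nz unfolding constant_on_def by auto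
    then show ?thesis by (simp only: countable_empty)
  next
    case False
    then show ?thesis using holomorphic_countable_zeros[OF dh open_UNIV connected_UNIV _ False] by (simp add: closed_imp_fsigma_in)
  qed
  then have "countable ((\<lambda>z. norm (FF z)) ` {z. deriv FF z = 0})" by (rule countable_image)
  then have "\<not> {R0<..<R3} \<subseteq> (\<lambda>z. norm (FF z)) ` {z. deriv FF z = 0}"
    using uncountable_open_interval[of R0 R3] R3 countable_subset by blast
  then obtain R' where "R' \<in> {R0<..<R3}" "R' \<notin> (\<lambda>z. norm (FF z)) ` {z. deriv FF z = 0}" by blast
  then show thesis using that[of R'] by auto
qed

end

section \<open>Components of a slow set at a regular level\<close>

locale ray_fast = ray_setup +
  fixes R' :: real
  assumes R': "R0 < R'" "R' < R3" and reg: "norm ((f ^^ q) z) = R' \<Longrightarrow> deriv (f ^^ q) z \<noteq> 0"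
begin

definition "slow = {z. norm (FF z) < R'}"
definition "enl r = {z. \<exists>s\<in>SV. dist s z \<le> r}"
text \<open>The points whose distance from the singular set is exactly
  \<open>2 * \<epsilon>\<close>: a compact shell that separates singular values from the far
  plane.\<close>

definition "Q = {z \<in> enl (2 * \<epsilon>). \<forall>s\<in>SV. 2 * \<epsilon> \<le> dist s z}"
text \<open>Only components that reach the shell are kept, because compactness of the shell makes
  them finitely many.\<close>

definition "\<A> = {C \<in> components (slow - enl \<epsilon>). C \<inter> Q \<noteq> {}}"
text \<open>Every singular value is joined to infinity within \<open>K\<close>, so a compact set disjoint from \<open>K\<close> surrounds none.\<close>

definition "K = enl (2 * \<epsilon>) \<union> \<Union>\<A>"

lemma compact_enl: "compact (enl r)"
proof -
  have "enl r = (\<Union>x\<in>SV. \<Union>y\<in>cball 0 r. {x + y})"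
  proof (intro equalityI subsetI)
    fix z assume "z \<in> enl r"
    then obtain s where "s \<in> SV" "dist s z \<le> r" by (auto simp: enl_def)
    then show "z \<in> (\<Union>x\<in>SV. \<Union>y\<in>cball 0 r. {x + y})" by (intro UN_I[of s] UN_I[of "z - s"]) (auto simp: dist_norm norm_minus_commute)
  next
    fix z assume "z \<in> (\<Union>x\<in>SV. \<Union>y\<in>cball 0 r. {x + y})"
    then obtain x y where "x \<in> SV" "norm y \<le> r" "z = x + y" by auto
    then show "z \<in> enl r" unfolding enl_def by (intro CollectI bexI[of _ x]) (auto simp: dist_norm)
  qed
  then show ?thesis using compact_sums'[OF compact_SV compact_cball[of 0 r]] by simp
qed

lemma closed_enl: "closed (enl r)" using compact_enl compact_imp_closed by blast

lemma slow: "open slow" "open (slow - enl r)"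
proof -
  show "open slow" unfolding slow_def by (intro open_Collect_less continuous_intros iterate_cont)
  then show "open (slow - enl r)" using closed_enl by (intro open_Diff)
qed

lemma compact_Q: "compact Q"
proof -
  have "Q = enl (2 * \<epsilon>) \<inter> (\<Inter>s\<in>SV. {z. 2 * \<epsilon> \<le> dist s z})" by (auto simp: Q_def)
  moreover have "closed (\<Inter>s\<in>SV. {z. 2 * \<epsilon> \<le> dist s z})"
    by (intro closed_INT ballI closed_Collect_le continuous_intros)
  ultimately show ?thesis using compact_enl compact_Int_closed by metis
qed

text \<open>At a boundary point \<open>FF\<close> is a local homeomorphism by regularity. It carries
  the slow set near \<open>y\<close> to the intersection of two discs, which is convex.\<close>

lemma local_connected:
  assumes y: "norm (FF y) \<le> R'" and N: "open N" "y \<in> N"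
  obtains D where "open D" "y \<in> D" "D \<subseteq> N" "connected (D \<inter> slow)"
    "norm (FF y) = R' \<Longrightarrow> \<exists>c. path c \<and> c 0 = y \<and> (\<forall>t\<in>{0<..1}. c t \<in> D \<inter> slow)"
proof (cases "norm (FF y) = R'")
  case False
  then have "y \<in> N \<inter> slow" using y N by (simp add: slow_def)
  moreover have "open (N \<inter> slow)" using N slow by blast
  ultimately obtain e where e: "e > 0" "ball y e \<subseteq> N \<inter> slow" using open_contains_ball by blast
  then have "ball y e \<inter> slow = ball y e" by blast
  then show thesis using that[of "ball y e"] e False by auto
next
  case True
  have R'pos: "R' > 0" using R'(1) R0_pos by linarith
  have holN: "FF holomorphic_on N" using iterate_hol by (rule holomorphic_on_subset) auto
  obtain r where r: "r > 0" "ball y r \<subseteq> N" "open (FF ` ball y r)" "inj_on FF (ball y r)"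
    using has_complex_derivative_locally_invertible[OF holN N(2,1) reg[OF True]] by metis
  have holr: "FF holomorphic_on ball y r" using iterate_hol by (rule holomorphic_on_subset) auto
  obtain g where g: "g holomorphic_on FF ` ball y r" "\<And>z. z \<in> ball y r \<Longrightarrow> g (FF z) = z"
    using holomorphic_has_inverse[OF holr open_ball r(4)] by metis
  have "FF y \<in> FF ` ball y r" using r(1) by auto
  then obtain \<rho>0 where \<rho>0: "\<rho>0 > 0" "ball (FF y) \<rho>0 \<subseteq> FF ` ball y r" using r(3) open_contains_ball by blast
  define \<rho> where "\<rho> = min \<rho>0 R'"
  have \<rho>: "\<rho> > 0" "\<rho> \<le> R'" "ball (FF y) \<rho> \<subseteq> FF ` ball y r" using \<rho>0 R'pos unfolding \<rho>_def by auto
  have gc: "continuous_on (ball (FF y) \<rho>) g" using holomorphic_on_imp_continuous_on[OF g(1)] \<rho>(3) continuous_on_subset by blast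
  have Fg: "FF (g w) = w" "g w \<in> ball y r" if "w \<in> ball (FF y) \<rho>" for w using \<rho>(3) g(2) that by auto
  define D where "D = ball y r \<inter> FF -` ball (FF y) \<rho>"
  have oD: "open D" unfolding D_def by (rule continuous_open_preimage[OF iterate_cont]) auto
  have gD: "g w \<in> D" if "w \<in> ball (FF y) \<rho>" for w unfolding D_def using Fg[OF that] that by simp
  have "D \<inter> slow = g ` (ball (FF y) \<rho> \<inter> ball 0 R')"
  proof (intro equalityI subsetI)
    fix z assume "z \<in> D \<inter> slow"
    then have "z \<in> ball y r" "FF z \<in> ball (FF y) \<rho> \<inter> ball 0 R'" by (auto simp: D_def slow_def)
    then show "z \<in> g ` (ball (FF y) \<rho> \<inter> ball 0 R')" using g(2)[of z] by (metis image_eqI)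
  next
    fix z assume "z \<in> g ` (ball (FF y) \<rho> \<inter> ball 0 R')"
    then obtain w where w: "w \<in> ball (FF y) \<rho>" "w \<in> ball 0 R'" "z = g w" by blast
    then show "z \<in> D \<inter> slow" using gD[OF w(1)] Fg(1)[OF w(1)] by (simp add: slow_def)
  qed
  then have cD: "connected (D \<inter> slow)"
    by (simp only:) (intro connected_continuous_image continuous_on_subset[OF gc] convex_connected convex_Int; auto)
  \<comment> \<open>The access path is the lift of the radial segment from \<open>FF y\<close>
    towards 0, whose length \<open>\<rho> / 2\<close> keeps it in the disc of the local
    inverse.\<close>
  define u where "u t = t * (\<rho> / (2 * R'))" for t :: real
  define c where "c t = g ((1 - of_real (u t)) * FF y)" for t :: real
  have u: "u t * R' = t * (\<rho> / 2)" "u 0 = 0" for t using R'pos by (auto simp: u_def)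
  have cb: "(1 - of_real (u t)) * FF y \<in> ball (FF y) \<rho>" "norm ((1 - of_real (u t)) * FF y) = R' - t * (\<rho> / 2)"
    if t: "t \<in> {0..1}" for t
  proof -
    have b0: "0 \<le> u t" using t \<rho> R'pos by (auto simp: u_def)
    have tr: "t * (\<rho> / 2) \<le> 1 * (\<rho> / 2)" using t \<rho> by (intro mult_right_mono) auto
    then have "u t * R' \<le> 1 * R'" unfolding u(1) using \<rho> by linarith
    then have b1: "u t \<le> 1" using R'pos by simp
    have "norm (1 - of_real (u t) :: complex) = 1 - u t"
      using b1 norm_of_real[of "1 - u t", where 'a=complex] by simp
    then have "norm ((1 - of_real (u t)) * FF y) = (1 - u t) * R'" using True by (simp add: norm_mult)
    then show "norm ((1 - of_real (u t)) * FF y) = R' - t * (\<rho> / 2)" using u(1)[of t] by (simp add: algebra_simps)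
    have "dist (FF y) ((1 - of_real (u t)) * FF y) = norm (of_real (u t) * FF y)"
      by (simp add: dist_norm algebra_simps)
    also have "\<dots> = t * (\<rho> / 2)" using b0 True u(1)[of t] by (simp add: norm_mult)
    finally show "(1 - of_real (u t)) * FF y \<in> ball (FF y) \<rho>" using \<rho>(1) tr by (simp only: mem_ball)
  qed
  have uc: "continuous_on A u" for A unfolding u_def[abs_def] by (intro continuous_intros)
  have "path c" unfolding path_def c_def by (intro continuous_on_compose2[OF gc] continuous_intros uc) (use cb in auto)
  moreover have "c 0 = y" using g(2)[of y] r(1) by (simp add: c_def u)
  moreover have "c t \<in> D \<inter> slow" if t: "t \<in> {0<..1}" for t
  proof -
    have t': "t \<in> {0..1}" using t by auto
    show ?thesis using gD[OF cb(1)[OF t']] Fg(1)[OF cb(1)[OF t']] cb(2)[OF t'] t \<rho>(1) unfolding c_def slow_def by auto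
  qed
  ultimately have "\<exists>c. path c \<and> c 0 = y \<and> (\<forall>t\<in>{0<..1}. c t \<in> D \<inter> slow)" by blast
  moreover have "y \<in> D" "D \<subseteq> N" using r(1,2) \<rho>(1) by (auto simp: D_def)
  ultimately show thesis using that[of D] oD cD by blast
qed

lemma Q_disjoint: "y \<in> Q \<Longrightarrow> y \<notin> enl \<epsilon>"
  using eps by (force simp: Q_def enl_def)

lemma component_A:
  assumes C: "C \<in> \<A>"
  shows "open C" "connected C" "C \<subseteq> slow" "C \<inter> enl \<epsilon> = {}" "C \<noteq> {}"
  using C open_components[OF slow(2)] in_components_connected in_components_subset[of C "slow - enl \<epsilon>"] in_components_nonempty
  unfolding \<A>_def by blast+

text \<open>Each point of the shell has a neighbourhood that meets at most one of the components, by
  \<open>local_connected\<close>, or none if the point is not in the closure of the slow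
  set.\<close>

lemma finite_A: "finite \<A>"
proof -
  have "\<exists>D. open D \<and> y \<in> D \<and> finite {C \<in> \<A>. C \<inter> D \<noteq> {}}" if y: "y \<in> Q" for y
  proof (cases "norm (FF y) \<le> R'")
    case True
    have "open (- enl \<epsilon>)" "y \<in> - enl \<epsilon>" using closed_enl Q_disjoint[OF y] by auto
    then obtain D where D: "open D" "y \<in> D" "D \<subseteq> - enl \<epsilon>" "connected (D \<inter> slow)"
      by (rule local_connected[OF True]) (rule that)
    have un: "C = C'" if "C \<in> \<A>" "C' \<in> \<A>" "C \<inter> D \<noteq> {}" "C' \<inter> D \<noteq> {}" for C C'
      using joinable_components_eq[of "D \<inter> slow" "slow - enl \<epsilon>" C C'] D(3,4) that
        component_A(3)[OF that(1)] component_A(3)[OF that(2)] unfolding \<A>_def by blast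
    have "finite {C \<in> \<A>. C \<inter> D \<noteq> {}}"
    proof (cases "\<exists>C0\<in>\<A>. C0 \<inter> D \<noteq> {}")
      case True
      then obtain C0 where "C0 \<in> \<A>" "C0 \<inter> D \<noteq> {}" by blast
      then have "{C \<in> \<A>. C \<inter> D \<noteq> {}} \<subseteq> {C0}" using un by blast
      then show ?thesis by (rule finite_subset) simp
    next
      case False
      then have "{C \<in> \<A>. C \<inter> D \<noteq> {}} = {}" by blast
      then show ?thesis by (simp only: finite.emptyI)
    qed
    then show ?thesis using D by blast
  next
    case False
    define D where "D = {z. R' < norm (FF z)}"
    have "open D" unfolding D_def by (intro open_Collect_less continuous_intros iterate_cont)
    moreover have "C \<inter> D = {}" if "C \<in> \<A>" for C using component_A(3)[OF that] by (auto simp: D_def slow_def)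
    then have "{C \<in> \<A>. C \<inter> D \<noteq> {}} = {}" by blast
    then have "finite {C \<in> \<A>. C \<inter> D \<noteq> {}}" by (simp only: finite.emptyI)
    ultimately show ?thesis using False by (intro exI[of _ D]) (simp add: D_def)
  qed
  then have "\<forall>y\<in>Q. \<exists>D. open D \<and> y \<in> D \<and> finite {C \<in> \<A>. C \<inter> D \<noteq> {}}" by (intro ballI)
  from bchoice[OF this] obtain D where D: "\<forall>y\<in>Q. open (D y) \<and> y \<in> D y \<and> finite {C \<in> \<A>. C \<inter> D y \<noteq> {}}" by (elim exE)
  obtain Y where Y: "Y \<subseteq> Q" "finite Y" "Q \<subseteq> (\<Union>y\<in>Y. D y)"
    by (rule compactE_image[OF compact_Q, of Q D]) (use D in auto)
  have "\<A> \<subseteq> (\<Union>y\<in>Y. {C \<in> \<A>. C \<inter> D y \<noteq> {}})"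
  proof
    fix C assume C: "C \<in> \<A>"
    then obtain z where "z \<in> C" "z \<in> Q" unfolding \<A>_def by blast
    then show "C \<in> (\<Union>y\<in>Y. {C \<in> \<A>. C \<inter> D y \<noteq> {}})" using C Y(3) by blast
  qed
  moreover have "finite (\<Union>y\<in>Y. {C \<in> \<A>. C \<inter> D y \<noteq> {}})" using Y D by (intro finite_UN_I) blast+
  ultimately show ?thesis by (rule finite_subset)
qed

text \<open>Near each singular value there is a slow point, and its slow component \<open>U\<close>
  is unbounded. Outside \<open>enl (2 * \<epsilon>)\<close> the set \<open>U\<close> consists of
  components that reach the shell; one that did not could be split off from the connected set
  \<open>U\<close>. So \<open>U\<close> lies in \<open>K\<close> and leads from the singular value
  to infinity.\<close>

lemma K_surround:
  assumes PK: "P \<inter> K = {}" shows "SV \<subseteq> outside P"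
proof
  fix s assume s: "s \<in> SV"
  obtain z where z: "z \<in> ball s \<epsilon>" "z \<in> slow" using meets[OF s R'(1)] unfolding slow_def by blast
  define U where "U = connected_component_set slow z"
  have Uc: "U \<in> components slow" unfolding U_def components_def using z(2) by blast
  have U: "connected U" "\<not> bounded U" "U \<subseteq> slow" "z \<in> U"
    using in_components_connected[OF Uc] unb[OF R'(1)] Uc in_components_subset[OF Uc] z(2) unfolding slow_def U_def by auto
  have zE: "z \<in> enl \<epsilon>" unfolding enl_def using z(1) s by (intro CollectI bexI[of _ s]) auto
  have "U \<subseteq> K"
  proof
    fix u assume u: "u \<in> U"
    show "u \<in> K"
    proof (cases "u \<in> enl (2 * \<epsilon>)")
      case True then show ?thesis by (simp add: K_def)
    next
      case False
      define Y where "Y = (\<Union>w\<in>SV. ball w (2 * \<epsilon>))"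
      have YE: "Y \<subseteq> enl (2 * \<epsilon>)" "enl \<epsilon> \<subseteq> Y" using eps unfolding Y_def enl_def by (force+)
      define C where "C = connected_component_set (slow - enl \<epsilon>) u"
      have uS: "u \<in> slow - enl \<epsilon>" using u U(3) False YE by auto
      have C: "C \<in> components (slow - enl \<epsilon>)" "u \<in> C" using uS unfolding C_def components_def by auto
      have "C \<inter> Q \<noteq> {}"
      proof
        assume no: "C \<inter> Q = {}"
        have oY: "open Y" unfolding Y_def by blast
        have oC: "open C" using open_components[OF slow(2) C(1)] .
        \<comment> \<open>If \<open>C\<close> misses the shell, \<open>C\<close> and this open set
          separate \<open>U\<close>, which contains \<open>u\<close> in \<open>C\<close> and
          \<open>z\<close> close to a singular value.\<close>
        have oB: "open (Y \<union> \<Union>(components (slow - enl \<epsilon>) - {C}))" using oY open_components[OF slow(2)] by blast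
        have oX: "open (- enl (2 * \<epsilon>))" using closed_enl by auto
        have "C \<inter> Y = {}"
        proof (rule ccontr)
          assume "C \<inter> Y \<noteq> {}"
          moreover have "C \<subseteq> - enl (2 * \<epsilon>) \<union> Y" using no unfolding Q_def Y_def by (auto simp flip: not_le)
          moreover have "- enl (2 * \<epsilon>) \<inter> C \<noteq> {}" using C(2) False by blast
          ultimately show False using connectedD[OF in_components_connected[OF C(1)] oX oY] YE by blast
        qed
        moreover have "\<And>C'. C' \<in> components (slow - enl \<epsilon>) - {C} \<Longrightarrow> C' \<inter> C = {}" using components_nonoverlap C(1) by blast
        ultimately have e: "C \<inter> (Y \<union> \<Union>(components (slow - enl \<epsilon>) - {C})) \<inter> U = {}" by blast
        have "U \<subseteq> C \<union> (Y \<union> \<Union>(components (slow - enl \<epsilon>) - {C}))"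
          using U(3) YE(2) Union_components[of "slow - enl \<epsilon>"] by blast
        moreover have "C \<inter> U \<noteq> {}" "(Y \<union> \<Union>(components (slow - enl \<epsilon>) - {C})) \<inter> U \<noteq> {}" using C(2) u U(4) zE YE(2) by blast+
        ultimately show False using connectedD[OF U(1) oC oB e] by blast
      qed
      then show ?thesis using C unfolding K_def \<A>_def by blast
    qed
  qed
  moreover have "cball s (2 * \<epsilon>) \<subseteq> K" using s unfolding K_def enl_def by auto
  ultimately have "(cball s (2 * \<epsilon>) \<union> U) \<inter> P = {}" using PK by blast
  moreover have "connected (cball s (2 * \<epsilon>) \<union> U)"
  proof (rule connected_Un[OF connected_cball U(1)])
    have "z \<in> cball s (2 * \<epsilon>)" using z(1) eps by simp
    then show "cball s (2 * \<epsilon>) \<inter> U \<noteq> {}" using U(4) by blast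
  qed
  moreover have "\<not> bounded (cball s (2 * \<epsilon>) \<union> U)" using U(2) by simp
  ultimately show "s \<in> outside P" using connected_unbounded_outside[of _ P s] eps by fastforce
qed

lemma closure_A:
  assumes C: "C \<in> \<A>" and y: "y \<in> closure C"
  shows "norm (FF y) \<le> R'" "y \<notin> C \<Longrightarrow> y \<notin> enl \<epsilon> \<Longrightarrow> norm (FF y) = R'"
proof -
  have "closed {z. norm (FF z) \<le> R'}" by (intro closed_Collect_le continuous_intros iterate_cont)
  moreover have "C \<subseteq> {z. norm (FF z) \<le> R'}" using component_A(3)[OF C] by (auto simp: slow_def)
  ultimately show le: "norm (FF y) \<le> R'" using y closure_minimal by blast
  assume n: "y \<notin> C" "y \<notin> enl \<epsilon>"
  show "norm (FF y) = R'"
  proof (rule ccontr)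
    assume "\<not> ?thesis"
    then have yS: "y \<in> slow - enl \<epsilon>" using le n by (simp add: slow_def)
    then obtain C' where C': "C' \<in> components (slow - enl \<epsilon>)" "y \<in> C'" using Union_components[of "slow - enl \<epsilon>"] by blast
    then have "C' \<inter> C \<noteq> {}" using y open_components[OF slow(2) C'(1)] by (meson closure_iff_nhds_not_empty disjoint_iff subset_refl)
    then show False using C'(1,2) C n(1) components_nonoverlap[of C' "slow - enl \<epsilon>" C] unfolding \<A>_def by blast
  qed
qed

text \<open>Local connectedness of the slow set at \<open>y\<close> ensures that the local access
  path enters the given component and not another one.\<close>

lemma access:
  assumes C: "C \<in> \<A>" and y: "y \<in> closure C" "y \<notin> C" "y \<notin> enl \<epsilon>"
  obtains c where "path c" "c 0 = y" "\<And>t. t \<in> {0<..1} \<Longrightarrow> c t \<in> C"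
proof -
  have N: "open (- enl \<epsilon>)" "y \<in> - enl \<epsilon>" using closed_enl y(3) by auto
  have e: "norm (FF y) = R'" using closure_A(2)[OF C y] .
  then have le: "norm (FF y) \<le> R'" by simp
  obtain D c where D: "open D" "y \<in> D" "D \<subseteq> - enl \<epsilon>" "connected (D \<inter> slow)"
    and c: "path c" "c 0 = y" "\<forall>t\<in>{0<..1}. c t \<in> D \<inter> slow"
    using local_connected[OF le N] e by metis
  have "C \<inter> D \<noteq> {}" using y(1) D(1,2) by (meson closure_iff_nhds_not_empty inf_commute subset_refl)
  then have "C \<inter> (D \<inter> slow) \<noteq> {}" using component_A(3)[OF C] by blast
  moreover have "C \<in> components (slow - enl \<epsilon>)" using C by (simp add: \<A>_def)
  ultimately have "D \<inter> slow \<subseteq> C" using components_maximal[of C "slow - enl \<epsilon>" "D \<inter> slow"] D(3,4) by blast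
  then show thesis using that c by blast
qed

lemma arc_in_component:
  assumes C: "C \<in> \<A>" and y: "y \<in> closure C" "y \<notin> C" "y \<notin> enl \<epsilon>" and z: "z \<in> closure C" "z \<notin> C" "z \<notin> enl \<epsilon>" and yz: "y \<noteq> z"
  obtains p where "arc p" "pathstart p = y" "pathfinish p = z" "path_image p \<subseteq> insert y (insert z C)"
proof -
  obtain c where c: "path c" "c 0 = y" "\<And>t. t \<in> {0<..1} \<Longrightarrow> c t \<in> C" using access[OF C y] by metis
  obtain d where d: "path d" "d 0 = z" "\<And>t. t \<in> {0<..1} \<Longrightarrow> d t \<in> C" using access[OF C z] by metis
  have "path_connected C" using component_A(1,2)[OF C] connected_open_path_connected by blast
  moreover have "c 1 \<in> C" "d 1 \<in> C" using c(3) d(3) by auto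
  ultimately obtain g where g: "path g" "path_image g \<subseteq> C" "pathstart g = c 1" "pathfinish g = d 1"
    unfolding path_connected_def by blast
  have ic: "path_image c \<subseteq> insert y C" "path_image d \<subseteq> insert z C"
    using c(2,3) d(2,3) unfolding path_image_def by (auto simp: le_less)
  define p where "p = c +++ (g +++ reversepath d)"
  have "pathfinish c = pathstart g" "pathfinish g = pathstart (reversepath d)"
    using g by (simp_all add: pathfinish_def)
  then have p: "path p" "pathstart p = y" "pathfinish p = z"
    using c d g unfolding p_def by (simp_all add: path_join_imp) (simp_all add: pathstart_def)
  have "path_image p \<subseteq> path_image c \<union> (path_image g \<union> path_image d)"
    unfolding p_def using path_image_join_subset[of c] path_image_join_subset[of g "reversepath d"] by fastforce
  then have "path_image p \<subseteq> insert y (insert z C)" using ic g(2) by blast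
  then show thesis using path_contains_arc[OF p yz] that by (metis subset_trans)
qed

end

text \<open>The closed path made of the three sides stays in \<open>X\<close>, so it does not wind
  about a point outside \<open>X\<close>. This is the cocycle identity.\<close>

lemma winding_number_triangle:
  assumes "path p" "path q" "path r" "pathfinish p = pathstart q" "pathstart r = pathstart p" "pathfinish r = pathfinish q"
    and "path_image p \<subseteq> X" "path_image q \<subseteq> X" "path_image r \<subseteq> X" and s: "s \<in> outside X"
  shows "winding_number p s + winding_number q s = winding_number r s"
proof -
  let ?c = "p +++ q +++ reversepath r"
  have sX: "s \<notin> X" using s outside_no_overlap by blast
  have "path_image ?c \<subseteq> X"
    using path_image_join_subset[of p "q +++ reversepath r"] path_image_join_subset[of q "reversepath r"] assms(7-9)
    by (simp add: subset_iff) blast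
  then have "s \<in> outside (path_image ?c)" using s outside_mono by blast
  then have "winding_number ?c s = 0" using assms by (intro winding_number_zero_in_outside) auto
  moreover have "winding_number ?c s = winding_number p s + (winding_number q s - winding_number r s)"
  proof -
    have ni: "s \<notin> path_image p" "s \<notin> path_image q" "s \<notin> path_image r" using assms(7-9) sX by auto
    have "s \<notin> path_image (q +++ reversepath r)" using not_in_path_image_join[of s q "reversepath r"] ni by simp
    then show ?thesis using assms(1-6) ni by (simp add: winding_number_join winding_number_reversepath)
  qed
  ultimately show ?thesis by (simp add: algebra_simps)
qed

text \<open>Two arcs that meet at most in their ends form a Jordan curve. Its winding numbers are
  \<open>- 1\<close>, 0 or 1, and 0 is not taken inside the curve, so equality of the two numbers
  places \<open>s\<close> outside.\<close>

lemma winding_number_two_arcs: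
  assumes p: "arc p" "arc q" "pathstart p = a" "pathstart q = a" "pathfinish p = b" "pathfinish q = b"
    and pq: "path_image p \<inter> path_image q \<subseteq> {a, b}" and s: "s \<notin> path_image p" "s \<notin> path_image q"
  shows "winding_number p s - winding_number q s \<in> {-1, 0, 1}"
    and "winding_number p s = winding_number q s \<Longrightarrow> s \<in> outside (path_image p \<union> path_image q)"
proof -
  let ?c = "p +++ reversepath q"
  have c: "simple_path ?c" "pathfinish ?c = pathstart ?c" "path_image ?c = path_image p \<union> path_image q"
    using p pq by (auto intro!: simple_path_join_loop arc_reversepath simp: path_image_join)
  have w: "winding_number ?c s = winding_number p s - winding_number q s"
    using p s by (simp add: winding_number_join winding_number_reversepath arc_imp_path)
  have sc: "s \<notin> path_image ?c" using s c(3) by simp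
  then show "winding_number p s - winding_number q s \<in> {-1, 0, 1}"
    using simple_closed_path_winding_number_cases[OF c(1,2) sc] w by simp
  assume "winding_number p s = winding_number q s"
  then have z: "winding_number ?c s = 0" using w by simp
  have "s \<notin> inside (path_image ?c)"
  proof (rule simple_closed_path_winding_number_inside[OF c(1)])
    assume "\<And>z. z \<in> inside (path_image ?c) \<Longrightarrow> winding_number ?c z = 1"
    from this[of s] show ?thesis using z by auto
  next
    assume "\<And>z. z \<in> inside (path_image ?c) \<Longrightarrow> winding_number ?c z = - 1"
    from this[of s] show ?thesis using z by auto
  qed
  then show "s \<in> outside (path_image p \<union> path_image q)" using sc inside_Un_outside[of "path_image ?c"] unfolding c(3)[symmetric] by blast
qed

section \<open>Loops that pass through a slow component\<close>

context ray_fast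
begin

definition "barrier = \<Union>(closure ` \<A>)"
text \<open>The first meeting with the barrier after time \<open>u\<close>. As the ray comes from
  outside the barrier, it then lies on the level \<open>R'\<close>, in the boundary of the open
  component.\<close>

definition "hit u C a \<longleftrightarrow> C \<in> \<A> \<and> u \<le> a \<and> a \<le> T1 \<and> \<gamma> a \<in> closure C \<and> (\<forall>t\<in>{u..<a}. \<gamma> t \<notin> barrier) \<and> norm (FF (\<gamma> a)) = R'"
definition "strand x \<delta> u a = \<gamma> ` {u..a} \<union> cball x \<delta>"

lemma closed_barrier: "closed barrier" unfolding barrier_def using finite_A by (intro closed_Union) auto

lemma ray_avoids: assumes "t \<le> T1" shows "\<gamma> t \<notin> enl (2 * \<epsilon>)" "\<gamma> t \<notin> enl \<epsilon>"
  using far[OF assms] eps unfolding enl_def by force+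

lemma K_subset: "K \<subseteq> enl (2 * \<epsilon>) \<union> barrier" unfolding K_def barrier_def using closure_subset by blast

text \<open>Both the component and the ray keep away from the \<open>\<epsilon>\<close>-balls about
  singular values, so \<open>nosur\<close> applies.\<close>

lemma slow_loop:
  assumes P: "compact P" "P \<subseteq> \<gamma> ` {t'..t} \<union> C" "t' \<le> t" "t \<le> T1" and C: "C \<in> \<A>"
  shows "SV \<subseteq> outside P"
proof (rule nosur[OF P(4,3,1)])
  have "C \<subseteq> {z. norm (FF z) \<le> R3}" using component_A(3)[OF C] R'(2) unfolding slow_def by force
  then show "P \<subseteq> \<gamma> ` {t'..t} \<union> {z. norm (FF z) \<le> R3}" using P(2) by blast
  show "\<forall>w\<in>SV. P \<inter> ball w \<epsilon> = {}"
  proof (intro ballI equals0I)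
    fix w z assume w: "w \<in> SV" and z: "z \<in> P \<inter> ball w \<epsilon>"
    then have zE: "z \<in> enl \<epsilon>" unfolding enl_def by (intro CollectI bexI[of _ w]) auto
    then have "\<exists>u\<in>{t'..t}. z = \<gamma> u" using z P(2) component_A(4)[OF C] by blast
    then show False using ray_avoids(2) zE P(4) by force
  qed
qed

lemma hit_exists:
  assumes t: "u \<le> t" "t \<le> T1" "\<gamma> t \<in> barrier" and u: "\<gamma> u \<notin> barrier"
  obtains C a where "hit u C a"
proof -
  define Z where "Z = {u..T1} \<inter> \<gamma> -` barrier"
  have "closed (\<gamma> -` barrier)" using continuous_closed_vimage[OF closed_barrier] \<gamma>c continuous_on_eq_continuous_at by blast
  then have "compact Z" unfolding Z_def by (intro compact_Int_closed) auto
  moreover have "Z \<noteq> {}" using t unfolding Z_def by auto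
  ultimately obtain a where a: "a \<in> Z" "\<And>t. t \<in> Z \<Longrightarrow> a \<le> t" using compact_attains_inf by metis
  then have aT: "u \<le> a" "a \<le> T1" "\<gamma> a \<in> barrier" unfolding Z_def by auto
  then obtain C where C: "C \<in> \<A>" "\<gamma> a \<in> closure C" unfolding barrier_def by blast
  have before: "\<gamma> t \<notin> barrier" if "t \<in> {u..<a}" for t using a(2)[of t] that aT unfolding Z_def by force
  \<comment> \<open>An open component would have been entered before time \<open>a\<close>.\<close>
  have "\<gamma> a \<notin> C"
  proof
    assume "\<gamma> a \<in> C"
    moreover have "open (\<gamma> -` C)" using continuous_open_vimage[OF component_A(1)[OF C(1)]] \<gamma>c continuous_on_eq_continuous_at by blast
    ultimately obtain e where e: "e > 0" "ball a e \<subseteq> \<gamma> -` C" using open_contains_ball by blast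
    have ua: "u < a" using aT u by (cases "u = a") auto
    define t where "t = max u (a - e / 2)"
    have "t \<in> ball a e" "t \<in> {u..<a}" using ua e(1) unfolding t_def by (auto simp: dist_real_def max_def)
    then show False using before e(2) C(1) closure_subset unfolding barrier_def by blast
  qed
  then have "norm (FF (\<gamma> a)) = R'" using closure_A(2)[OF C] ray_avoids aT by blast
  then show thesis using that[of C a] C aT before unfolding hit_def by blast
qed

lemma hitD:
  assumes "hit u C a"
  shows "C \<in> \<A>" "u \<le> a" "a \<le> T1" "\<gamma> a \<in> closure C" "\<gamma> a \<notin> slow" "\<gamma> a \<notin> C" "\<gamma> a \<notin> \<Union>\<A>"
    and "\<gamma> ` {u..a} \<inter> K = {}" "\<gamma> ` {u..a} \<inter> barrier \<subseteq> {\<gamma> a}"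
proof -
  show h: "C \<in> \<A>" "u \<le> a" "a \<le> T1" "\<gamma> a \<in> closure C" "\<gamma> a \<notin> slow" using assms unfolding hit_def slow_def by auto
  show n: "\<gamma> a \<notin> C" "\<gamma> a \<notin> \<Union>\<A>" using h component_A(3) by blast+
  have b: "\<gamma> t \<notin> barrier \<or> t = a" if "t \<in> {u..a}" for t using assms that unfolding hit_def by force
  show "\<gamma> ` {u..a} \<inter> barrier \<subseteq> {\<gamma> a}" using b by blast
  show "\<gamma> ` {u..a} \<inter> K = {}"
  proof (intro equals0I)
    fix z assume "z \<in> \<gamma> ` {u..a} \<inter> K"
    then obtain t where t: "t \<in> {u..a}" "\<gamma> t \<in> K" by blast
    then have "\<gamma> t \<notin> enl (2 * \<epsilon>)" using ray_avoids h(3) by auto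
    then show False using t(2) b[OF t(1)] n(2) closure_subset unfolding K_def barrier_def by blast
  qed
qed

lemma strand:
  assumes "\<gamma> u \<in> cball x \<delta>" "u \<le> a"
  shows "compact (strand x \<delta> u a)" "connected (strand x \<delta> u a)" "cball x \<delta> \<subseteq> strand x \<delta> u a"
    "\<gamma> u \<in> strand x \<delta> u a" "\<gamma> a \<in> strand x \<delta> u a"
proof -
  show "compact (strand x \<delta> u a)" unfolding strand_def by (intro compact_Un ray_compact compact_cball)
  have "\<gamma> u \<in> \<gamma> ` {u..a} \<inter> cball x \<delta>" using assms by auto
  then show "connected (strand x \<delta> u a)" unfolding strand_def by (intro connected_Un ray_connected) auto
qed (use assms in \<open>auto simp: strand_def\<close>)

lemma two_strands:
  assumes "\<gamma> u \<in> cball x \<delta>" "u \<le> a" "\<gamma> v \<in> cball x \<delta>" "v \<le> b"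
  shows "compact (strand x \<delta> u a \<union> strand x \<delta> v b)" "connected (strand x \<delta> u a \<union> strand x \<delta> v b)"
proof -
  show "compact (strand x \<delta> u a \<union> strand x \<delta> v b)" using strand assms by (intro compact_Un) auto
  have "strand x \<delta> u a \<inter> strand x \<delta> v b \<noteq> {}" using assms strand(3,4) by blast
  then show "connected (strand x \<delta> u a \<union> strand x \<delta> v b)" using strand assms by (intro connected_Un)
qed

text \<open>Three sets carry branches that agree at \<open>\<gamma> a\<close>: the two strands,
  which avoid \<open>K\<close>; the ray between \<open>a\<close> and \<open>b\<close> closed up by
  \<open>\<sigma>\<close>, which is a slow loop; and the loop of \<open>n\<close> and
  \<open>\<sigma>\<close>, which is the one hypothesis. The third compares the first two at
  \<open>\<gamma> b\<close>, so the branch on the strands follows the ray at \<open>b\<close> and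
  then back to \<open>v\<close>.\<close>

lemma fast_pair:
  assumes u: "hit u C a" "\<gamma> u \<in> cball x \<delta>" and v: "hit v C b" "\<gamma> v \<in> cball x \<delta>"
    and xK: "cball x \<delta> \<inter> K = {}"
    and n: "compact n" "connected n" "\<gamma> a \<in> n" "\<gamma> b \<in> n" "n \<subseteq> strand x \<delta> u a \<union> strand x \<delta> v b"
    and \<sigma>: "compact \<sigma>" "connected \<sigma>" "\<gamma> a \<in> \<sigma>" "\<gamma> b \<in> \<sigma>" "\<sigma> \<subseteq> insert (\<gamma> a) (insert (\<gamma> b) C)"
    and out: "SV \<subseteq> outside (n \<union> \<sigma>)"
  shows "agree x \<delta> u v"
proof -
  note hu = hitD[OF u(1)] and hv = hitD[OF v(1)]
  let ?N = "strand x \<delta> u a \<union> strand x \<delta> v b"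
  note N = two_strands[OF u(2) hu(2) v(2) hv(2)]
  have "?N \<inter> K = {}" using hu(8) hv(8) xK unfolding strand_def by blast
  then have oN: "SV \<subseteq> outside ?N" by (rule K_surround)
  have uN: "\<gamma> u \<in> ?N" using strand(4)[OF u(2) hu(2)] by blast
  from branch_at_ray[OF N oN uN] obtain g where g: "continuous_on ?N g" "\<And>z. z \<in> ?N \<Longrightarrow> f (g z) = z" "g (\<gamma> u) = \<gamma> (u - 1)" "?N \<inter> SV = {}"
    by metis
  have ga: "g (\<gamma> a) = \<gamma> (a - 1)"
    by (rule branch_along_ray[OF hol \<gamma>c f\<gamma> connected_Icc[of u a] _ _ g(4,1,2,3)]) (use hu(2) in \<open>auto simp: strand_def\<close>)
  let ?I = "{min a b..max a b}"
  let ?P = "\<gamma> ` ?I \<union> \<sigma>"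
  have cP: "compact ?P" by (intro compact_Un ray_compact \<sigma>)
  have "\<gamma> ` ?I \<inter> \<sigma> \<noteq> {}" using \<sigma>(3) by (intro ex_in_conv[THEN iffD1] exI[of _ "\<gamma> a"]) auto
  then have coP: "connected ?P" using \<sigma>(2) by (intro connected_Un ray_connected)
  have oP: "SV \<subseteq> outside ?P"
    by (rule slow_loop[OF cP _ _ _ hu(1), of "min a b" "max a b"]) (use \<sigma>(5) hu(3) hv(3) in auto)
  have aP: "\<gamma> a \<in> ?P" using \<sigma>(3) by blast
  from branch_at_ray[OF cP coP oP aP] obtain h where h: "continuous_on ?P h" "\<And>z. z \<in> ?P \<Longrightarrow> f (h z) = z" "h (\<gamma> a) = \<gamma> (a - 1)" "?P \<inter> SV = {}"
    by metis
  have hb: "h (\<gamma> b) = \<gamma> (b - 1)"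
    by (rule branch_along_ray[OF hol \<gamma>c f\<gamma> connected_Icc[of "min a b" "max a b"] _ _ h(4,1,2,3)]) auto
  have cJ: "compact (n \<union> \<sigma>)" "connected (n \<union> \<sigma>)" "\<gamma> a \<in> n \<union> \<sigma>" using n \<sigma> by (auto intro!: connected_Un)
  from branch_at_ray[OF cJ(1,2) out cJ(3)] obtain j where j: "continuous_on (n \<union> \<sigma>) j" "\<And>z. z \<in> n \<union> \<sigma> \<Longrightarrow> f (j z) = z" "j (\<gamma> a) = \<gamma> (a - 1)" "(n \<union> \<sigma>) \<inter> SV = {}"
    by metis
  \<comment> \<open>Uniqueness along \<open>n\<close> links the strand branch to the loop branch,
    and uniqueness along \<open>\<sigma>\<close> links the latter to the branch that follows the ray
    from \<open>a\<close> to \<open>b\<close>.\<close>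
  have "g (\<gamma> b) = j (\<gamma> b)"
    by (rule branch_unique[OF hol n(2,3) _ continuous_on_subset[OF g(1) n(5)] continuous_on_subset[OF j(1)]])
      (use j g(2) n ga in auto)
  also have "\<dots> = h (\<gamma> b)"
    by (rule branch_unique[OF hol \<sigma>(2,3) _ continuous_on_subset[OF j(1)] continuous_on_subset[OF h(1)]])
      (use j h \<sigma> in auto)
  finally have gb: "g (\<gamma> b) = \<gamma> (b - 1)" using hb by simp
  have "g (\<gamma> v) = \<gamma> (v - 1)"
    by (rule branch_along_ray[OF hol \<gamma>c f\<gamma> connected_Icc[of v b] _ _ g(4,1,2) gb]) (use hv(2) in \<open>auto simp: strand_def\<close>)
  moreover have "cball x \<delta> \<subseteq> ?N" by (auto simp: strand_def)
  ultimately show ?thesis using g(2,3) continuous_on_subset[OF g(1)] unfolding agree_def by (intro exI[of _ g]) blast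
qed

text \<open>
  The path \<open>n\<close> leads from \<open>\<gamma> a\<close> back along the ray, through the disc, and along the ray to \<open>\<gamma> b\<close>, while \<open>\<sigma>\<close> returns
  through the slow component \<open>C\<close>: together they form a Jordan curve, unless both are constant.
\<close>

definition "crossing x \<delta> C u a v b n \<sigma> \<longleftrightarrow> path n \<and> path \<sigma> \<and> pathstart n = \<gamma> a \<and> pathfinish n = \<gamma> b \<and>
  pathstart \<sigma> = \<gamma> a \<and> pathfinish \<sigma> = \<gamma> b \<and> path_image n \<subseteq> strand x \<delta> u a \<union> strand x \<delta> v b \<and>
  path_image \<sigma> \<subseteq> insert (\<gamma> a) (insert (\<gamma> b) C) \<and>
  (\<forall>s\<in>SV. winding_number n s - winding_number \<sigma> s \<in> {-1, 0, 1} \<and>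
    (winding_number n s = winding_number \<sigma> s \<longrightarrow> s \<in> outside (path_image n \<union> path_image \<sigma>)))"

lemma strand_path:
  assumes "\<gamma> u \<in> cball x \<delta>" "u \<le> a" "\<gamma> v \<in> cball x \<delta>" "v \<le> b"
  obtains p where "path p" "pathstart p = \<gamma> a" "pathfinish p = \<gamma> b" "path_image p \<subseteq> strand x \<delta> u a \<union> strand x \<delta> v b"
proof -
  have pc: "path_connected (strand x \<delta> w c)" if "\<gamma> w \<in> cball x \<delta>" "w \<le> c" for w c
  proof -
    have "\<gamma> ` {w..c} \<inter> cball x \<delta> \<noteq> {}" using that by (intro ex_in_conv[THEN iffD1] exI[of _ "\<gamma> w"]) auto
    moreover have "path_connected (\<gamma> ` {w..c})"
      by (intro path_connected_continuous_image continuous_on_subset[OF \<gamma>c] convex_imp_path_connected) auto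
    ultimately show ?thesis unfolding strand_def by (intro path_connected_Un convex_imp_path_connected[OF convex_cball])
  qed
  have "strand x \<delta> u a \<inter> strand x \<delta> v b \<noteq> {}" using assms strand(3,4) by blast
  then have "path_connected (strand x \<delta> u a \<union> strand x \<delta> v b)" using pc assms by (intro path_connected_Un)
  then show thesis using that strand(5)[OF assms(1,2)] strand(5)[OF assms(3,4)] unfolding path_connected_def by blast
qed

lemma crossing_exists:
  assumes u: "hit u C a" "\<gamma> u \<in> cball x \<delta>" and v: "hit v C b" "\<gamma> v \<in> cball x \<delta>"
    and xK: "cball x \<delta> \<inter> (enl (2 * \<epsilon>) \<union> barrier) = {}"
  obtains n \<sigma> where "crossing x \<delta> C u a v b n \<sigma>"
proof (cases "\<gamma> a = \<gamma> b")
  case True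
  let ?n = "linepath (\<gamma> a) (\<gamma> a)"
  have "SV \<subseteq> outside {\<gamma> a}" by (rule slow_loop[OF _ _ order_refl hitD(3,1)[OF u(1)]]) auto
  then have "crossing x \<delta> C u a v b ?n ?n" using True strand(5)[OF u(2) hitD(2)[OF u(1)]] unfolding crossing_def by auto
  then show thesis by (rule that)
next
  case False
  note hu = hitD[OF u(1)] and hv = hitD[OF v(1)]
  obtain p where p: "path p" "pathstart p = \<gamma> a" "pathfinish p = \<gamma> b" "path_image p \<subseteq> strand x \<delta> u a \<union> strand x \<delta> v b"
    using strand_path[OF u(2) hu(2) v(2) hv(2)] by metis
  obtain n where n: "arc n" "path_image n \<subseteq> path_image p" "pathstart n = \<gamma> a" "pathfinish n = \<gamma> b"
    using path_contains_arc[OF p(1-3) False] by metis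
  have e: "\<gamma> a \<notin> enl \<epsilon>" "\<gamma> b \<notin> enl \<epsilon>" using ray_avoids hu(3) hv(3) by auto
  obtain \<sigma> where \<sigma>: "arc \<sigma>" "pathstart \<sigma> = \<gamma> a" "pathfinish \<sigma> = \<gamma> b" "path_image \<sigma> \<subseteq> insert (\<gamma> a) (insert (\<gamma> b) C)"
    by (rule arc_in_component[OF hu(1,4,6) e(1) hv(4,6) e(2) False])
  have CCC: "C \<subseteq> barrier" using hu(1) closure_subset unfolding barrier_def by blast
  have "path_image n \<inter> path_image \<sigma> \<subseteq> {\<gamma> a, \<gamma> b}"
    using n(2) p(4) \<sigma>(4) hu(9) hv(9) xK CCC unfolding strand_def by blast
  note w = winding_number_two_arcs[OF n(1) \<sigma>(1) n(3) \<sigma>(2) n(4) \<sigma>(3) this]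
  have N: "path_image n \<subseteq> strand x \<delta> u a \<union> strand x \<delta> v b" using n(2) p(4) by blast
  have "s \<notin> path_image n \<and> s \<notin> path_image \<sigma>" if s: "s \<in> SV" for s
  proof -
    have "s \<in> K" "s \<in> enl \<epsilon>" using s eps unfolding K_def enl_def by force+
    moreover have "(strand x \<delta> u a \<union> strand x \<delta> v b) \<inter> K = {}" using hu(8) hv(8) xK K_subset unfolding strand_def by blast
    ultimately show ?thesis using N \<sigma>(4) component_A(4)[OF hu(1)] e by blast
  qed
  then have "crossing x \<delta> C u a v b n \<sigma>" using w n \<sigma> N unfolding crossing_def by (simp add: arc_imp_path)
  then show thesis by (rule that)
qed

text \<open>The two halves of the crossing are additive separately: three strands avoid
  \<open>K\<close>, so they surround no singular value, and the three slow arcs together with the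
  ray between their ends are covered by \<open>slow_loop\<close>.\<close>

lemma crossing_triangle:
  assumes h: "hit u C a" "hit v C b" "hit w C c"
    and x: "\<gamma> u \<in> cball x \<delta>" "\<gamma> v \<in> cball x \<delta>" "\<gamma> w \<in> cball x \<delta>" and xK: "cball x \<delta> \<inter> K = {}"
    and c: "crossing x \<delta> C u a v b n1 \<sigma>1" "crossing x \<delta> C v b w c n2 \<sigma>2" "crossing x \<delta> C u a w c n3 \<sigma>3" and s: "s \<in> SV"
  shows "winding_number n1 s + winding_number n2 s = winding_number n3 s"
    and "winding_number \<sigma>1 s + winding_number \<sigma>2 s = winding_number \<sigma>3 s"
proof -
  note hh = hitD[OF h(1)] hitD[OF h(2)] hitD[OF h(3)]
  note cc = c[unfolded crossing_def]
  define N where "N = strand x \<delta> u a \<union> strand x \<delta> v b \<union> strand x \<delta> w c"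
  have "N \<inter> K = {}" using hh(8,17,26) xK unfolding N_def strand_def by blast
  then have sN: "s \<in> outside N" using K_surround s by blast
  show "winding_number n1 s + winding_number n2 s = winding_number n3 s"
    by (rule winding_number_triangle[OF _ _ _ _ _ _ _ _ _ sN]) (use cc in \<open>auto simp: N_def\<close>)
  define L where "L = path_image \<sigma>1 \<union> path_image \<sigma>2 \<union> path_image \<sigma>3"
  have "SV \<subseteq> outside L"
  proof (rule slow_loop[OF _ _ _ _ hh(1)])
    show "compact L" using cc unfolding L_def by (intro compact_Un compact_path_image) auto
    have "{\<gamma> a, \<gamma> b, \<gamma> c} \<subseteq> \<gamma> ` {min a (min b c)..max a (max b c)}"
      by (simp only: insert_subset) (intro conjI imageI empty_subsetI; simp add: min_def max_def)
    moreover have "L \<subseteq> {\<gamma> a, \<gamma> b, \<gamma> c} \<union> C" unfolding L_def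
    proof (intro Un_least)
      show "path_image \<sigma>1 \<subseteq> {\<gamma> a, \<gamma> b, \<gamma> c} \<union> C" using cc(1) by auto
      show "path_image \<sigma>2 \<subseteq> {\<gamma> a, \<gamma> b, \<gamma> c} \<union> C" using cc(2) by auto
      show "path_image \<sigma>3 \<subseteq> {\<gamma> a, \<gamma> b, \<gamma> c} \<union> C" using cc(3) by auto
    qed
    ultimately show "L \<subseteq> \<gamma> ` {min a (min b c)..max a (max b c)} \<union> C" by blast
    show "max a (max b c) \<le> T1" using hh by auto
  qed auto
  then have sL: "s \<in> outside L" using s by blast
  show "winding_number \<sigma>1 s + winding_number \<sigma>2 s = winding_number \<sigma>3 s"
    by (rule winding_number_triangle[OF _ _ _ _ _ _ _ _ _ sL]) (use cc in \<open>auto simp: L_def\<close>)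
qed

text \<open>Finitely many centres suffice because each ball of radius \<open>\<epsilon>\<close>
  about a singular value avoids the loop and hence lies on one side of it.\<close>

lemma crossing_agree:
  assumes u: "hit u C a" "\<gamma> u \<in> cball x \<delta>" and v: "hit v C b" "\<gamma> v \<in> cball x \<delta>"
    and xK: "cball x \<delta> \<inter> K = {}" and c: "crossing x \<delta> C u a v b n \<sigma>"
    and Z: "Z \<subseteq> SV" "SV \<subseteq> (\<Union>z\<in>Z. ball z \<epsilon>)" "\<And>z. z \<in> Z \<Longrightarrow> winding_number n z = winding_number \<sigma> z"
  shows "agree x \<delta> u v"
proof -
  note hu = hitD[OF u(1)] and hv = hitD[OF v(1)] and cc = c[unfolded crossing_def]
  let ?J = "path_image n \<union> path_image \<sigma>"
  have "SV \<subseteq> outside ?J"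
  proof
    fix s assume "s \<in> SV"
    then obtain z where z: "z \<in> Z" "s \<in> ball z \<epsilon>" using Z(2) by blast
    have zS: "z \<in> SV" using z(1) Z(1) by blast
    have zo: "z \<in> outside ?J" using cc Z(3)[OF z(1)] zS by blast
    have b: "ball z \<epsilon> \<subseteq> enl \<epsilon>" "ball z \<epsilon> \<subseteq> K" using zS eps unfolding K_def enl_def by force+
    have "strand x \<delta> u a \<inter> K = {}" "strand x \<delta> v b \<inter> K = {}" using hu(8) hv(8) xK unfolding strand_def by blast+
    moreover have "\<gamma> a \<notin> enl \<epsilon>" "\<gamma> b \<notin> enl \<epsilon>" using ray_avoids hu(3) hv(3) by auto
    ultimately have "ball z \<epsilon> \<inter> ?J = {}" using cc b component_A(4)[OF hu(1)] by blast
    then have "ball z \<epsilon> \<subseteq> connected_component_set (- ?J) z"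
      by (intro connected_component_maximal) (use eps in auto)
    then show "s \<in> outside ?J" using outside_same_component[OF _ zo] z(2) by auto
  qed
  moreover have "\<gamma> a \<in> path_image n" "\<gamma> b \<in> path_image n" "\<gamma> a \<in> path_image \<sigma>" "\<gamma> b \<in> path_image \<sigma>"
    using cc pathstart_in_path_image pathfinish_in_path_image by metis+
  moreover have "path n" "path \<sigma>" using cc by auto
  ultimately show ?thesis using cc
    by (intro fast_pair[OF u v xK, of "path_image n" "path_image \<sigma>"] compact_path_image connected_path_image) simp_all
qed

text \<open>By \<open>no_escape_slow\<close> the limit is off the barrier, so a small disc around it
  is fast. Infinitely many passages are of one kind: either the ray never meets the barrier before
  \<open>T1\<close>, and \<open>K_surround\<close> applies to the plain loop, or it hits the same
  component each time and winding numbers decide.\<close>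

lemma no_escape:
  assumes s: "\<And>k. s k \<le> T1" and x: "(\<lambda>k. \<gamma> (s k)) \<longlonglongrightarrow> x"
    and inf: "filterlim (\<lambda>k. norm (\<gamma> (s k - 1))) at_top sequentially"
  shows False
proof -
  have "x \<notin> barrier" using closure_A(1) no_escape_slow[OF s x inf] R'(2) unfolding barrier_def by force
  moreover have "x \<notin> enl (2 * \<epsilon>)" using limit_far[OF s x] eps unfolding enl_def by force
  ultimately have "x \<in> - (enl (2 * \<epsilon>) \<union> barrier)" by blast
  moreover have "open (- (enl (2 * \<epsilon>) \<union> barrier))" using closed_barrier closed_enl by auto
  ultimately obtain \<delta> where \<delta>: "\<delta> > 0" "cball x \<delta> \<subseteq> - (enl (2 * \<epsilon>) \<union> barrier)" using open_contains_cball by metis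
  then have xE: "cball x \<delta> \<inter> (enl (2 * \<epsilon>) \<union> barrier) = {}" by blast
  then have xK: "cball x \<delta> \<inter> K = {}" using K_subset by blast
  have "SV \<subseteq> K" using eps unfolding K_def enl_def by force
  then have xS: "cball x \<delta> \<inter> SV = {}" using xK by blast
  obtain N where N: "\<And>k. k \<ge> N \<Longrightarrow> \<gamma> (s k) \<in> cball x \<delta>"
    using x \<delta>(1) unfolding lim_sequentially by (metis dist_commute less_imp_le mem_cball)
  \<comment> \<open>Passages after which the ray avoids the barrier up to time \<open>T1\<close>;
    \<open>I1\<close> collects those with a first hit.\<close>
  define I0 where "I0 = {k. k \<ge> N \<and> (\<forall>t\<in>{s k..T1}. \<gamma> t \<notin> barrier)}"
  define I1 where "I1 = {k. k \<ge> N \<and> (\<exists>C a. hit (s k) C a)}"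
  have "{N..} \<subseteq> I0 \<union> I1"
  proof
    fix k assume "k \<in> {N..}"
    then have k: "k \<ge> N" by simp
    have "\<gamma> (s k) \<notin> barrier" using N[OF k] xE by blast
    then show "k \<in> I0 \<union> I1" using hit_exists[of "s k"] k unfolding I0_def I1_def by (auto; meson)
  qed
  then have inf01: "infinite I0 \<or> infinite I1" using infinite_Ici[of N] finite_subset finite_Un by metis
  have fin0: "finite I0"
  proof (rule ccontr)
    assume I: "infinite I0"
    then obtain k where k: "k \<in> I0" using infinite_imp_nonempty by blast
    then have xk: "\<gamma> (s k) \<in> cball x \<delta>" using N unfolding I0_def by blast
    show False
    proof (rule agree_contradiction[OF inf I xS xk])
      fix l assume l: "l \<in> I0"
      define P where "P = \<gamma> ` {min (s k) (s l)..max (s k) (s l)} \<union> cball x \<delta>"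
      have cP: "compact P" unfolding P_def by (intro compact_Un ray_compact compact_cball)
      have "\<gamma> ` {min (s k) (s l)..max (s k) (s l)} \<inter> cball x \<delta> \<noteq> {}"
        using xk by (intro ex_in_conv[THEN iffD1] exI[of _ "\<gamma> (s k)"]) auto
      then have coP: "connected P" unfolding P_def by (intro connected_Un ray_connected connected_cball)
      have "\<gamma> t \<notin> K" if t: "t \<in> {min (s k) (s l)..max (s k) (s l)}" for t
      proof -
        have "t \<in> {s k..T1} \<or> t \<in> {s l..T1}" using t s[of k] s[of l] by auto
        then have "\<gamma> t \<notin> barrier" "t \<le> T1" using k l unfolding I0_def by auto
        then show ?thesis using ray_avoids K_subset by blast
      qed
      then have "P \<inter> K = {}" using xK unfolding P_def by blast
      then have "agree x \<delta> (s k) (s l)"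
        by (intro loop_agree[OF cP coP K_surround]) (auto simp: P_def)
      moreover have "\<gamma> (s l) \<in> cball x \<delta>" using N l unfolding I0_def by blast
      ultimately show "\<gamma> (s l) \<in> cball x \<delta> \<and> agree x \<delta> (s k) (s l)" by blast
    qed
  qed
  then have I1: "infinite I1" using inf01 by blast
  have "\<forall>k\<in>I1. \<exists>p. hit (s k) (fst p) (snd p)" unfolding I1_def by auto
  from bchoice[OF this] obtain p where p: "\<forall>k\<in>I1. hit (s k) (fst (p k)) (snd (p k))" by (elim exE)
  have "(\<lambda>k. fst (p k)) ` I1 \<subseteq> \<A>" using p hitD(1) by blast
  then have "finite ((\<lambda>k. fst (p k)) ` I1)" using finite_A finite_subset by blast
  \<comment> \<open>Finiteness of \<open>\<A>\<close> allows one component \<open>C\<close> to be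
    fixed.\<close>
  from pigeonhole_infinite[OF I1 this] obtain k0 where k0: "k0 \<in> I1" "infinite {k \<in> I1. fst (p k) = fst (p k0)}" by blast
  define C where "C = fst (p k0)"
  define a where "a k = snd (p k)" for k
  define I where "I = {k \<in> I1. fst (p k) = C}"
  have I: "infinite I" "k0 \<in> I" using k0 unfolding I_def C_def by auto
  have h: "hit (s k) C (a k)" "\<gamma> (s k) \<in> cball x \<delta>" if "k \<in> I" for k
    using that p N unfolding I_def a_def I1_def by auto
  have cr: "\<exists>n \<sigma>. crossing x \<delta> C (s k) (a k) (s l) (a l) n \<sigma>" if "k \<in> I" "l \<in> I" for k l
    using crossing_exists[OF h[OF that(1)] h[OF that(2)] xE] by metis
  then have "\<forall>l\<in>I. \<exists>q. crossing x \<delta> C (s k0) (a k0) (s l) (a l) (fst q) (snd q)" using I(2) by auto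
  from bchoice[OF this] obtain q where q: "\<forall>l\<in>I. crossing x \<delta> C (s k0) (a k0) (s l) (a l) (fst (q l)) (snd (q l))" by (elim exE)
  obtain Z where Z: "Z \<subseteq> SV" "finite Z" "SV \<subseteq> (\<Union>z\<in>Z. ball z \<epsilon>)"
    by (rule compactE_image[OF compact_SV, of SV "\<lambda>z. ball z \<epsilon>"]) (use eps in auto)
  \<comment> \<open>The winding data of the crossing from the fixed passage \<open>k0\<close> to
    \<open>l\<close> at the centres in \<open>Z\<close>. It takes finitely many values, so
    infinitely many \<open>l\<close> share it with some \<open>k\<close>.\<close>
  define H where "H l = restrict (\<lambda>z. winding_number (fst (q l)) z - winding_number (snd (q l)) z) Z" for l
  have "H ` I \<subseteq> Z \<rightarrow>\<^sub>E {-1, 0, 1}" 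
  proof (rule image_subsetI)
    fix l assume "l \<in> I"
    then have "\<forall>z\<in>SV. winding_number (fst (q l)) z - winding_number (snd (q l)) z \<in> {-1, 0, 1}"
      using q unfolding crossing_def by blast
    then show "H l \<in> Z \<rightarrow>\<^sub>E {-1, 0, 1}" using Z(1) unfolding H_def by (intro restrict_PiE_iff[THEN iffD2]) blast
  qed
  moreover have "finite (Z \<rightarrow>\<^sub>E {-1, 0, 1 :: complex})" using Z(2) by (intro finite_PiE) auto
  ultimately have "finite (H ` I)" by (rule finite_subset)
  from pigeonhole_infinite[OF I(1) this] obtain k where k: "k \<in> I" "infinite {l \<in> I. H l = H k}" by blast
  show False
  proof (rule agree_contradiction[OF inf k(2) xS h(2)[OF k(1)]])
    fix l assume "l \<in> {l \<in> I. H l = H k}"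
    then have l: "l \<in> I" "H l = H k" by auto
    obtain n \<sigma> where c: "crossing x \<delta> C (s k) (a k) (s l) (a l) n \<sigma>" using cr[OF k(1) l(1)] by blast
    have "agree x \<delta> (s k) (s l)"
    proof (rule crossing_agree[OF h[OF k(1)] h[OF l(1)] xK c Z(1,3)])
      fix z assume z: "z \<in> Z"
      have zS: "z \<in> SV" using z Z(1) by blast
      \<comment> \<open>By additivity the data of the crossing from \<open>k\<close> to
        \<open>l\<close> is the difference of the data from \<open>k0\<close>, hence 0.\<close>
      note tr = crossing_triangle[OF h(1)[OF I(2)] h(1)[OF k(1)] h(1)[OF l(1)] h(2)[OF I(2)] h(2)[OF k(1)] h(2)[OF l(1)] xK
          q[rule_format, OF k(1)] c q[rule_format, OF l(1)] zS]
      have "H l z = H k z" using l(2) by simp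
      then have "winding_number (fst (q l)) z - winding_number (snd (q l)) z = winding_number (fst (q k)) z - winding_number (snd (q k)) z"
        using z by (simp add: H_def)
      then show "winding_number n z = winding_number \<sigma> z" using tr by (simp add: algebra_simps flip: tr)
    qed
    then show "\<gamma> (s l) \<in> cball x \<delta> \<and> agree x \<delta> (s k) (s l)" using h(2)[OF l(1)] by blast
  qed
qed

end

text \<open>A failure of properness would give a sequence of bounded ray points whose predecessors
  tend to infinity; a convergent subsequence contradicts \<open>no_escape\<close>.\<close>

lemma (in ray_setup) bounded_tail: "bounded (\<gamma> ` {..T1 - 1})"
proof (rule proper_imp_bounded_tail[OF \<gamma>c f\<gamma>])
  obtain R' where R': "R0 < R'" "R' < R3" "\<And>z. norm (FF z) = R' \<Longrightarrow> deriv FF z \<noteq> 0" by (rule regular_level) (rule that)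
  interpret ray_fast f R0 \<gamma> \<epsilon> R3 q T1 R' by unfold_locales (use R' in auto)
  fix x
  show "\<exists>y. \<forall>t\<le>T1 - 1. norm (\<gamma> (t + 1)) \<le> x \<longrightarrow> norm (\<gamma> t) \<le> y"
  proof (rule ccontr)
    assume no: "\<not> ?thesis"
    have "\<forall>n. \<exists>t. t \<le> T1 - 1 \<and> norm (\<gamma> (t + 1)) \<le> x \<and> real n < norm (\<gamma> t)"
    proof
      fix n
      show "\<exists>t. t \<le> T1 - 1 \<and> norm (\<gamma> (t + 1)) \<le> x \<and> real n < norm (\<gamma> t)"
        using no by (auto simp: not_le dest!: spec[of _ "real n"])
    qed
    from choice[OF this] obtain t where t: "\<And>n. t n \<le> T1 - 1" "\<And>n. norm (\<gamma> (t n + 1)) \<le> x" "\<And>n. real n < norm (\<gamma> (t n))" by blast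
    obtain z r where r: "strict_mono (r :: nat \<Rightarrow> nat)" "((\<lambda>n. \<gamma> (t n + 1)) \<circ> r) \<longlonglongrightarrow> z"
      using compact_cball[of "0::complex" x, unfolded compact_def, rule_format, of "\<lambda>n. \<gamma> (t n + 1)"] t(2) by auto
    have "filterlim (\<lambda>k. norm (\<gamma> (t (r k)))) at_top sequentially"
    proof (rule filterlim_at_top_mono[OF filterlim_real_sequentially always_eventually], rule allI)
      fix k
      have "k \<le> r k" using seq_suble[OF r(1)] .
      then show "real k \<le> norm (\<gamma> (t (r k)))" using t(3)[of "r k"] by simp
    qed
    moreover have "t (r k) + 1 \<le> T1" for k using t(1)[of "r k"] by linarith
    ultimately show False using no_escape[of "\<lambda>k. t (r k) + 1" z] r(2) by (simp add: o_def)
  qed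
qed

section \<open>The inverse branch in part (ii)\<close>

context bounded_singular
begin

context
  fixes \<gamma> :: "real \<Rightarrow> complex"
  assumes \<gamma>c: "continuous_on UNIV \<gamma>" and \<gamma>inf: "filterlim (\<lambda>t. norm (\<gamma> t)) at_top at_top" and f\<gamma>: "\<And>t. f (\<gamma> t) = \<gamma> (t + 1)"
    and J: "singular_values f \<subseteq> julia_set f" and disj: "accumulation_set \<gamma> \<inter> singular_values f = {}"
begin

text \<open>The ray is not yet known to be bounded, but ray points close to singular values are,
  since the singular set is. They would accumulate at a singular value.\<close>

lemma far_from_singular:
  obtains \<epsilon> T where "\<epsilon> > 0" "\<And>t s. t \<le> T \<Longrightarrow> s \<in> singular_values f \<Longrightarrow> \<epsilon> \<le> dist s (\<gamma> t)"
proof (rule ccontr)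
  assume no: "\<not> thesis"
  have "\<forall>n. \<exists>p. fst p \<le> - real n \<and> snd p \<in> singular_values f \<and> dist (snd p) (\<gamma> (fst p)) < 1 / real (Suc n)"
  proof
    fix n
    have "\<not> (\<forall>t s. t \<le> - real n \<longrightarrow> s \<in> singular_values f \<longrightarrow> 1 / real (Suc n) \<le> dist s (\<gamma> t))"
      using no that[of "1 / real (Suc n)" "- real n"] by auto
    then show "\<exists>p. fst p \<le> - real n \<and> snd p \<in> singular_values f \<and> dist (snd p) (\<gamma> (fst p)) < 1 / real (Suc n)" by (auto simp: not_le)
  qed
  from choice[OF this] obtain p where p: "\<And>n. fst (p n) \<le> - real n" "\<And>n. snd (p n) \<in> singular_values f"
    "\<And>n. dist (snd (p n)) (\<gamma> (fst (p n))) < 1 / real (Suc n)" by blast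
  have "filterlim (\<lambda>n. fst (p n)) at_bot sequentially"
    by (rule filterlim_at_bot_mono[OF filterlim_uminus_at_bot_at_top[THEN filterlim_compose, OF filterlim_real_sequentially]]) (use p(1) in auto)
  moreover have "norm (\<gamma> (fst (p n))) \<le> R0 + 1" for n
  proof -
    have "norm (snd (p n)) < R0" using p(2)[of n] sing by auto
    moreover have "1 / real (Suc n) \<le> 1" by simp
    ultimately show ?thesis using p(3)[of n, unfolded dist_norm] norm_triangle_sub[of "\<gamma> (fst (p n))" "snd (p n)"]
      unfolding norm_minus_commute[of "\<gamma> (fst (p n))"] by linarith
  qed
  ultimately obtain z r where z: "z \<in> accumulation_set \<gamma>" "strict_mono r" "(\<lambda>n. \<gamma> (fst (p (r n)))) \<longlonglongrightarrow> z"
    using accumulation_subsequence[of "\<lambda>n. fst (p n)" \<gamma> "R0 + 1"] by metis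
  have "(\<lambda>n. dist (snd (p n)) (\<gamma> (fst (p n)))) \<longlonglongrightarrow> 0"
    by (rule tendsto_sandwich[OF _ _ tendsto_const LIMSEQ_inverse_real_of_nat])
      (use p(3) in \<open>auto intro!: always_eventually less_imp_le simp: inverse_eq_divide\<close>)
  then have "((\<lambda>n. dist (snd (p n)) (\<gamma> (fst (p n)))) \<circ> r) \<longlonglongrightarrow> 0" by (rule LIMSEQ_subseq_LIMSEQ[OF _ z(2)])
  then have "(\<lambda>n. snd (p (r n)) - \<gamma> (fst (p (r n)))) \<longlonglongrightarrow> 0" by (simp add: o_def dist_norm tendsto_norm_zero_iff)
  from tendsto_add[OF this z(3)] have lim: "(\<lambda>n. snd (p (r n))) \<longlonglongrightarrow> z" by simp
  have "closed (singular_values f)" unfolding singular_values_def by (rule closed_closure)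
  then have "z \<in> singular_values f" using closed_sequentially[OF _ _ lim] p(2) by blast
  then show False using z(1) disj by blast
qed

text \<open>Once the tail is bounded, \<open>A\<close> is compact and invariant, so all iterates are
  bounded on its hull. If a singular value were in the hull, growth near the Julia set would bound
  all iterates on a disc that contains \<open>\<gamma> 0\<close>, although the ray escapes.\<close>

lemma tail_bounded_unsurrounding:
  obtains T where "bounded (\<gamma> ` {..T})" "singular_values f \<subseteq> outside (accumulation_set \<gamma>)"
proof -
  obtain \<epsilon>0 T0 where e0: "\<epsilon>0 > 0" "\<And>t s. t \<le> T0 \<Longrightarrow> s \<in> singular_values f \<Longrightarrow> \<epsilon>0 \<le> dist s (\<gamma> t)"
    by (rule far_from_singular) (rule that)
  define \<epsilon> where "\<epsilon> = \<epsilon>0 / 4"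
  have eps: "\<epsilon> > 0" and far: "\<And>t s. t \<le> T0 \<Longrightarrow> s \<in> singular_values f \<Longrightarrow> 4 * \<epsilon> \<le> dist s (\<gamma> t)" using e0 by (auto simp: \<epsilon>_def)
  obtain RH where RH: "\<And>R2. R2 \<ge> RH \<Longrightarrow> cball 0 R2 \<subseteq> phull (f ` cball 0 R2)" by (rule disc_in_phull_image) (rule that)
  have "compact (\<gamma> ` {0..1})" by (intro compact_continuous_image continuous_on_subset[OF \<gamma>c]) auto
  then have "bounded (\<gamma> ` {0..1})" by (rule compact_imp_bounded)
  then obtain M where M: "\<And>v. v \<in> {0..1} \<Longrightarrow> norm (\<gamma> v) \<le> M" unfolding bounded_iff by blast
  \<comment> \<open>Large enough for the covering property of discs, to leave a gap of slow levels
    above \<open>R0\<close>, and to contain one unit of the ray.\<close>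
  define R3 where "R3 = Max {RH, R0 + 1, M}"
  have R3m: "R3 \<ge> RH" "R3 \<ge> R0 + 1" "R3 \<ge> M" unfolding R3_def by auto
  have R3': "R3 \<ge> 0" "R0 < R3" using R3m(2) R0_pos by linarith+
  have H: "cball 0 R3 \<subseteq> phull (f ` cball 0 R3)" "cball 0 (R3 + 1) \<subseteq> phull (f ` cball 0 (R3 + 1))" using RH R3m(1) by auto
  have R30: "R3 + 1 \<ge> 0" using R3' by simp
  obtain m where grow: "\<And>s k \<beta> z. s \<in> singular_values f \<Longrightarrow> k holomorphic_on UNIV \<Longrightarrow> (\<And>w. w \<in> ball s \<epsilon> \<Longrightarrow> norm (k ((f ^^ Suc m) w)) \<le> \<beta>) \<Longrightarrow>
       z \<in> cball 0 (R3 + 1) \<Longrightarrow> norm (k z) \<le> \<beta>"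
    and meets: "\<And>s R'. s \<in> singular_values f \<Longrightarrow> R' > R0 \<Longrightarrow> \<exists>z\<in>ball s \<epsilon>. norm ((f ^^ Suc m) z) < R'"
  proof (rule growth_near_julia[OF J H(2) R30 eps])
    fix m
    assume a: "\<And>s k \<beta> z. s \<in> singular_values f \<Longrightarrow> k holomorphic_on UNIV \<Longrightarrow>
        (\<And>w. w \<in> ball s \<epsilon> \<Longrightarrow> norm (k ((f ^^ Suc m) w)) \<le> \<beta>) \<Longrightarrow> z \<in> cball 0 (R3 + 1) \<Longrightarrow> norm (k z) \<le> \<beta>"
      and b: "\<And>s R'. s \<in> singular_values f \<Longrightarrow> R' > R0 \<Longrightarrow> \<exists>z\<in>ball s \<epsilon>. norm ((f ^^ Suc m) z) < R'"
    show thesis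
    proof (rule that[of m])
      fix s :: complex and k \<beta> and z :: complex
      assume "s \<in> singular_values f" "k holomorphic_on UNIV" "\<And>w. w \<in> ball s \<epsilon> \<Longrightarrow> norm (k ((f ^^ Suc m) w)) \<le> \<beta>" "z \<in> cball 0 (R3 + 1)"
      then show "norm (k z) \<le> \<beta>" by (rule a)
    qed (rule b)
  qed
  \<comment> \<open>Early enough for the distance to the singular set and for the time margin in
    \<open>ray_arc_not_surrounding\<close>, with \<open>Suc m\<close> steps.\<close>
  define T1 where "T1 = min T0 (- real (Suc m) - 2)"
  have T1: "T1 \<le> T0" "T1 \<le> - real (Suc m) - 2" unfolding T1_def by auto
  interpret ray_setup f R0 \<gamma> \<epsilon> R3 "Suc m" T1
  proof unfold_locales
    show "4 * \<epsilon> \<le> dist s (\<gamma> t)" if "t \<le> T1" "s \<in> singular_values f" for t s using far that T1(1) by auto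
    show "\<not> bounded W" if "R0 < R'" "W \<in> components {z. norm ((f ^^ Suc m) z) < R'}" for R' W
      by (rule slow_component_unbounded[OF that])
    show "singular_values f \<subseteq> outside P" if t: "t \<le> T1" "t' \<le> t" and P: "compact P" "P \<subseteq> \<gamma> ` {t'..t} \<union> {z. norm ((f ^^ Suc m) z) \<le> R3}"
      "\<forall>s\<in>singular_values f. P \<inter> ball s \<epsilon> = {}" for t t' P
    proof (rule ccontr)
      assume "\<not> ?thesis"
      then obtain s where s: "s \<in> singular_values f" "s \<in> phull P" unfolding phull_def by blast
      have "ball s \<epsilon> \<inter> P = {}" using P(3) s(1) by blast
      from ball_in_phull[OF this s(2) eps] have "ball s \<epsilon> \<subseteq> phull P" .
      moreover have "\<not> ball s \<epsilon> \<subseteq> phull P"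
      proof (rule ray_arc_not_surrounding[where \<gamma>=\<gamma> and m="Suc m" and t=t and t'=t', OF _ H(1) R3'(1) _ _ P(1,2) t(2)])
        show "f (\<gamma> v) = \<gamma> (v + 1)" for v by (rule f\<gamma>)
        show "norm (k z) \<le> \<beta>" if "k holomorphic_on UNIV" "\<And>w. w \<in> ball s \<epsilon> \<Longrightarrow> norm (k ((f ^^ Suc m) w)) \<le> \<beta>" "z \<in> cball 0 (R3 + 1)" for k \<beta> z
          using that by (rule grow[OF s(1)])
        show "norm (\<gamma> v) \<le> R3" if "0 \<le> v" "v \<le> 1" for v using M[of v] that R3m(3) by simp
        show "t \<le> - real (Suc m) - 2" using t(1) T1(2) by linarith
      qed
      ultimately show False by blast
    qed
  qed (use \<gamma>c f\<gamma> eps R3' meets in auto)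
  have b: "bounded (\<gamma> ` {..T1 - 1})" by (rule bounded_tail)
  define A where "A = accumulation_set \<gamma>"
  have cA: "compact A" unfolding A_def by (rule accumulation_compact_connected[OF \<gamma>c b])
  have fcont: "continuous_on UNIV f" using holomorphic_on_imp_continuous_on[OF hol] .
  have fA: "f ` A \<subseteq> A" unfolding A_def by (rule accumulation_invariant(1)[where \<gamma>=\<gamma>, OF fcont]) (rule f\<gamma>)
  have "singular_values f \<subseteq> outside A"
  proof (rule ccontr)
    assume "\<not> ?thesis"
    then obtain s where s: "s \<in> singular_values f" "s \<in> phull A" unfolding phull_def by blast
    have "4 * \<epsilon> \<le> dist s z" if z: "z \<in> A" for z
    proof -
      obtain t where t: "filterlim t at_bot sequentially" "(\<lambda>n. \<gamma> (t n)) \<longlonglongrightarrow> z"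
        using z by (auto simp: A_def accumulation_set_def)
      have "\<forall>\<^sub>F n in sequentially. t n \<le> T1" using t(1) unfolding filterlim_at_bot by blast
      then have "\<forall>\<^sub>F n in sequentially. 4 * \<epsilon> \<le> dist s (\<gamma> (t n))" by eventually_elim (rule far[OF _ s(1)], use T1(1) in simp)
      moreover have "(\<lambda>n. dist s (\<gamma> (t n))) \<longlonglongrightarrow> dist s z" by (intro tendsto_intros t)
      ultimately show ?thesis by (intro tendsto_lowerbound[of _ _ sequentially]) auto
    qed
    then have "ball s \<epsilon> \<inter> A = {}" using eps by force
    from ball_in_phull[OF this s(2) eps] have sub: "ball s \<epsilon> \<subseteq> phull A" .
    obtain B where B: "\<And>z. z \<in> A \<Longrightarrow> norm z \<le> B" using compact_imp_bounded[OF cA] unfolding bounded_iff by blast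
    have it: "(f ^^ n) z \<in> A" if "z \<in> A" for n z using that fA by (induction n) auto
    have g0: "norm ((f ^^ n) z) \<le> B" if z: "z \<in> cball 0 (R3 + 1)" for n z
    proof (rule grow[OF s(1) iterate_hol _ z])
      fix w assume w: "w \<in> ball s \<epsilon>"
      have "norm ((f ^^ (n + Suc m)) w) \<le> B"
        by (rule maximum_modulus_phull[OF iterate_hol cA B[OF it]]) (use sub w in auto)
      then show "norm ((f ^^ n) ((f ^^ Suc m) w)) \<le> B" unfolding funpow_add o_apply .
    qed
    have "\<gamma> 0 \<in> cball 0 (R3 + 1)" using M[of 0] R3m(3) by simp
    moreover have "(f ^^ n) (\<gamma> 0) = \<gamma> (real n)" for n by (induction n) (auto simp: f\<gamma> add.commute)
    ultimately have "norm (\<gamma> (real n)) \<le> B" for n using g0[of "\<gamma> 0" n] by simp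
    moreover have "\<forall>\<^sub>F n in sequentially. B < norm (\<gamma> (real n))"
      using filterlim_compose[OF \<gamma>inf filterlim_real_sequentially] unfolding filterlim_at_top_dense by blast
    ultimately show False by (auto simp: eventually_sequentially not_less[symmetric])
  qed
  then show thesis using that b unfolding A_def by blast
qed

text \<open>Since \<open>A\<close> surrounds no singular value, a single branch exists on a simply
  connected neighbourhood. Normalized at one ray point it follows the ray, and passing to the limit
  shows that it preserves \<open>A\<close>.\<close>

lemma ray_inverse_exists: obtains N g T where "ray_inverse f \<gamma> (accumulation_set \<gamma>) N g T"
proof -
  define A where "A = accumulation_set \<gamma>"
  obtain T0 where "bounded (\<gamma> ` {..T0})" "singular_values f \<subseteq> outside (accumulation_set \<gamma>)"
    by (rule tail_bounded_unsurrounding) (rule that)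
  note T0 = this[folded A_def]
  have cA: "compact A" "connected A" "A \<noteq> {}" unfolding A_def by (rule accumulation_compact_connected[OF \<gamma>c T0(1)])+
  have cS: "compact (singular_values f)" using sing bounded_subset[OF bounded_ball] by (auto simp: compact_eq_bounded_closed singular_values_def)
  obtain V where V: "open V" "simply_connected V" "A \<subseteq> V" "V \<inter> singular_values f = {}"
    by (rule simply_connected_nbhd[OF cA cS T0(2)]) (rule that)
  obtain T2 where T2: "\<And>t. t \<le> T2 \<Longrightarrow> \<gamma> t \<in> V" using tail_near_accumulation[OF T0(1) V(1)] V(3) unfolding A_def by metis
  define T where "T = min T0 T2"
  have \<gamma>V: "\<gamma> ` {..T} \<subseteq> V" using T2 unfolding T_def by auto
  have bT: "bounded (\<gamma> ` {..T})" using T0(1) by (rule bounded_subset) (auto simp: T_def)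
  obtain g where g: "g holomorphic_on V" "g (\<gamma> T) = \<gamma> (T - 1)" "\<And>u. u \<in> V \<Longrightarrow> f (g u) = u"
  proof (rule entire_lift_holomorphic[OF hol V(2,1) holomorphic_on_ident])
    show "\<gamma> T = f (\<gamma> (T - 1))" using f\<gamma>[of "T - 1"] by simp
  qed (use V(4) \<gamma>V in auto)
  have gc: "continuous_on V g" using holomorphic_on_imp_continuous_on[OF g(1)] .
  have con: "connected {..T}" by auto
  have g\<gamma>: "g (\<gamma> t) = \<gamma> (t - 1)" if "t \<le> T" for t
    by (rule branch_along_ray[OF hol \<gamma>c f\<gamma> con _ \<gamma>V V(4) gc g(3,2)]) (use that in auto)
  have "g ` A \<subseteq> A"
  proof clarify
    fix z assume z: "z \<in> A"
    then obtain t where t: "filterlim t at_bot sequentially" "(\<lambda>n. \<gamma> (t n)) \<longlonglongrightarrow> z" by (auto simp: A_def accumulation_set_def)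
    have "isCont g z" using gc V(3) z by (auto simp: continuous_on_eq_continuous_at[OF V(1)])
    then have lim: "(\<lambda>n. g (\<gamma> (t n))) \<longlonglongrightarrow> g z" using isCont_tendsto_compose t(2) by blast
    have "\<forall>\<^sub>F n in sequentially. t n \<le> T" using t(1) unfolding filterlim_at_bot by blast
    then have ev: "\<forall>\<^sub>F n in sequentially. g (\<gamma> (t n)) = \<gamma> (t n + - 1)" by eventually_elim (simp add: g\<gamma>)
    have "(\<lambda>n. \<gamma> (t n + - 1)) \<longlonglongrightarrow> g z" by (rule tendsto_cong[OF ev, THEN iffD1, OF lim])
    then show "g z \<in> A" using filterlim_shift_at_bot[OF t(1), of "- 1"] unfolding A_def accumulation_set_def by blast
  qed
  then have "ray_inverse f \<gamma> A V g T"
    by unfold_locales (use hol trans \<gamma>c \<gamma>inf f\<gamma> bT V g g\<gamma> \<gamma>V in \<open>auto simp: A_def\<close>)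
  then show thesis using that unfolding A_def by blast
qed

end

end

theorem theorem4:
  fixes f :: "complex \<Rightarrow> complex"
  assumes "f \<in> eremenko_lyubich_class"
  shows "(\<forall>\<gamma>. fixed_ray f \<gamma> \<longrightarrow>
            (\<exists>g. homeomorphism (closure (range \<gamma>)) (closure (range \<gamma>)) f g) \<longrightarrow>
            (\<forall>z \<in> accumulation_set \<gamma>. \<not> critical_point f z) \<longrightarrow>
            (\<exists>z\<^sub>0. lands_at \<gamma> z\<^sub>0 \<and> (repelling_fixed_point f z\<^sub>0 \<or> parabolic_fixed_point f z\<^sub>0)))
       \<and> (singular_values f \<subseteq> julia_set f \<longrightarrow>
           (\<forall>\<gamma>. fixed_ray f \<gamma> \<longrightarrow>
              accumulation_set \<gamma> \<inter> singular_values f = {} \<longrightarrow>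
              (\<exists>z\<^sub>0. lands_at \<gamma> z\<^sub>0 \<and> (repelling_fixed_point f z\<^sub>0 \<or> parabolic_fixed_point f z\<^sub>0))))"
proof (intro conjI allI impI)
  fix \<gamma>
  assume r: "fixed_ray f \<gamma>" and h: "\<exists>g. homeomorphism (closure (range \<gamma>)) (closure (range \<gamma>)) f g"
    and c: "\<forall>z \<in> accumulation_set \<gamma>. \<not> critical_point f z"
  from h obtain G where "homeomorphism (closure (range \<gamma>)) (closure (range \<gamma>)) f G" by blast
  from homeomorphism_ray_inverse[OF assms r this c] obtain N g T where "ray_inverse f \<gamma> (accumulation_set \<gamma>) N g T" by metis
  then show "\<exists>z\<^sub>0. lands_at \<gamma> z\<^sub>0 \<and> (repelling_fixed_point f z\<^sub>0 \<or> parabolic_fixed_point f z\<^sub>0)" by (rule ray_inverse.ray_lands)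
next
  fix \<gamma>
  assume J: "singular_values f \<subseteq> julia_set f" and r: "fixed_ray f \<gamma>" and d: "accumulation_set \<gamma> \<inter> singular_values f = {}"
  have f: "f holomorphic_on UNIV" "\<nexists>p. \<forall>z. f z = poly p z" "bounded (singular_values f)"
    using assms by (auto simp: eremenko_lyubich_class_def transcendental_entire_def)
  obtain B where B: "\<And>z. z \<in> singular_values f \<Longrightarrow> norm z \<le> B" using f(3) unfolding bounded_iff by blast
  define R0 where "R0 = max B (norm (f 0)) + 1"
  have R0: "singular_values f \<subseteq> ball 0 R0" "norm (f 0) < R0" using B unfolding R0_def by (auto simp: less_add_one max_def dest!: B)
  interpret bounded_singular f R0 by unfold_locales (use f R0 in auto)
  have \<gamma>: "continuous_on UNIV \<gamma>" "filterlim (\<lambda>t. norm (\<gamma> t)) at_top at_top" "\<And>t. f (\<gamma> t) = \<gamma> (t + 1)"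
    using r by (auto simp: fixed_ray_def)
  from ray_inverse_exists[OF \<gamma> J d] obtain N g T where "ray_inverse f \<gamma> (accumulation_set \<gamma>) N g T" by metis
  then show "\<exists>z\<^sub>0. lands_at \<gamma> z\<^sub>0 \<and> (repelling_fixed_point f z\<^sub>0 \<or> parabolic_fixed_point f z\<^sub>0)" by (rule ray_inverse.ray_lands)
qed

end
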